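(* Let $L$ be a homogeneous centered Lévy basis on $\mathcal B_b(\mathbb R^d)$ and let $g\in L^1(\mathbb R^d,ds)\cap\mathcal L_{\Phi_1}$ have non-vanishing Fourier transform. Let $\mu$ be a finite measure on $\mathcal B(\mathbb R^d)$ equivalent to Lebesgue measure. Put $X_u=\int_{\mathbb R^d}g(u-s)L(ds)$, $u\in\mathbb R^d$ (taken in a measurable modification), and $\mu(X;A)=\int_AX_u\,\mu(du)$, $A\in\mathcal B(\mathbb R^d)$. Then for every $m\in\{0,1,2,\dots\}$ the following are equivalent: (i) the law of the field $(\mu(X;A))_{A\in\mathcal B(\mathbb R^d)}$ belongs to $\mathbb L_m(\mathbb R^{\mathcal B(\mathbb R^d)})$; (ii) $\mathcal L(X)\in\mathbb L_m(\mathbb R^{\mathbb R^d})$; (iii) $\mathcal L(L)\in\mathbb L_m(\mathbb R^{\mathcal B_b(\mathbb R^d)})$.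
   Context: $\mathcal B_b(\mathbb R^d)$: bounded Borel sets. Lévy basis: independently scattered, a.s. countably additive family $\{L(A)\}_{A\in\mathcal B_b(\mathbb R^d)}$ of ID random variables with $\log\mathbb Ee^{i\theta L(A)}=\int_A\psi(\theta,s)c(ds)$, $\psi(\theta,s)=i\gamma(s)\theta-\frac12b^2(s)\theta^2+\int[e^{i\theta x}-1-i\theta\tau_1(x)]\rho(s,dx)$, $\tau_1(x)=x/(1\vee|x|)$; homogeneous: $\gamma,b,\rho$ constant in $s$ and $c$ proportional to Lebesgue measure; centered: $\mathbb EL(A)=0$. $\mathcal L_{\Phi_1}=\{f:\int\Phi_1(|f(s)|,s)c(ds)<\infty\}$ with $\Phi_1(r,s)=\sup_{|c|\le1}|\gamma(s)cr+\int[\tau_1(xcr)-cr\tau_1(x)]\rho(s,dx)|+b^2(s)r^2+\int[|xr|\mathbf 1_{\{|xr|>1\}}+|xr|^2\mathbf 1_{\{|xr|\le1\}}]\rho(s,dx)$ (integrable functions with finite first moment of the integral). Urbanik classes: $\mu\in\mathbb L_0(\mathbb R^k)$ (selfdecomposable) if for all $q>1$ there is ID $\mu_q$ with $\hat\mu(\theta)=\hat\mu(q^{-1}\theta)\hat\mu_q(\theta)$; $\mathbb L_m$ additionally requires $\mu_q\in\mathbb L_{m-1}$; a field's law is in $\mathbb L_m(\mathbb R^I)$ iff all its finite-dimensional distributions are. *)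

theory Defs
  imports "HOL-Probability.Probability"
begin

definition tau1 :: "real \<Rightarrow> real" where
  "tau1 x = x / max 1 \<bar>x\<bar>"

definition levy_measure :: "real measure \<Rightarrow> bool" where
  "levy_measure \<rho> \<longleftrightarrow> sets \<rho> = sets borel \<and> emeasure \<rho> {0} = 0 \<and>
     (\<integral>\<^sup>+ x. ennreal (min 1 (x\<^sup>2)) \<partial>\<rho>) < \<infinity>"

definition lk_exponent :: "real \<Rightarrow> real \<Rightarrow> real measure \<Rightarrow> real \<Rightarrow> complex" where
  "lk_exponent \<gamma> b \<rho> \<theta> =
     \<i> * complex_of_real (\<gamma> * \<theta>) - complex_of_real (b\<^sup>2 * \<theta>\<^sup>2 / 2)
     + (CLINT x|\<rho>. iexp (\<theta> * x) - 1 - \<i> * complex_of_real (\<theta> * tau1 x))"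

text \<open>The function Phi_1(r) (homogeneous case, independent of s).\<close>
definition Phi1 :: "real \<Rightarrow> real \<Rightarrow> real measure \<Rightarrow> real \<Rightarrow> ennreal" where
  "Phi1 \<gamma> b \<rho> r =
     (SUP c\<in>{-1..1::real}. ennreal \<bar>\<gamma> * c * r + (LINT x|\<rho>. tau1 (x * c * r) - c * r * tau1 x)\<bar>)
     + ennreal (b\<^sup>2 * r\<^sup>2)
     + (\<integral>\<^sup>+ x. ennreal (if \<bar>x * r\<bar> > 1 then \<bar>x * r\<bar> else (x * r)\<^sup>2) \<partial>\<rho>)"

definition in_L_Phi1 :: "real \<Rightarrow> real \<Rightarrow> real measure \<Rightarrow> ('d::euclidean_space \<Rightarrow> real) \<Rightarrow> bool" where
  "in_L_Phi1 \<gamma> b \<rho> f \<longleftrightarrow> f \<in> borel_measurable lborel \<and>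
     (\<integral>\<^sup>+ s. Phi1 \<gamma> b \<rho> \<bar>f s\<bar> \<partial>lborel) < \<infinity>"

definition bdd_borel :: "'d::euclidean_space set set" where
  "bdd_borel = {A. A \<in> sets borel \<and> bounded A}"

text \<open>Homogeneous Levy basis with triple (gamma,b,rho): the control measure c is
  proportional to Lebesgue measure; the proportionality constant is absorbed into the triple.\<close>
definition homogeneous_levy_basis ::
  "'a measure \<Rightarrow> ('d::euclidean_space set \<Rightarrow> 'a \<Rightarrow> real) \<Rightarrow> real \<Rightarrow> real \<Rightarrow> real measure \<Rightarrow> bool" where
  "homogeneous_levy_basis M L \<gamma> b \<rho> \<longleftrightarrow>
     levy_measure \<rho> \<and>
     (\<forall>A\<in>bdd_borel. L A \<in> borel_measurable M) \<and>
     (\<forall>F. finite F \<and> F \<subseteq> bdd_borel \<and> disjoint F \<longrightarrow> prob_space.indep_vars M (\<lambda>_. borel) L F) \<and>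
     (\<forall>A :: nat \<Rightarrow> 'd set. range A \<subseteq> bdd_borel \<and> disjoint_family A \<and> bounded (\<Union>n. A n) \<longrightarrow>
        (AE \<omega> in M. (\<lambda>n. L (A n) \<omega>) sums L (\<Union>n. A n) \<omega>)) \<and>
     (\<forall>A\<in>bdd_borel. \<forall>\<theta>. char (distr M borel (L A)) \<theta> =
        exp (complex_of_real (measure lborel A) * lk_exponent \<gamma> b \<rho> \<theta>))"

definition centered :: "'a measure \<Rightarrow> ('d::euclidean_space set \<Rightarrow> 'a \<Rightarrow> real) \<Rightarrow> bool" where
  "centered M L \<longleftrightarrow> (\<forall>A\<in>bdd_borel. integrable M (L A) \<and> (\<integral>\<omega>. L A \<omega> \<partial>M) = 0)"

section \<open>Stochastic integral w.r.t. a Levy basis (Rajput-Rosinski)\<close>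

definition conv_in_prob :: "'a measure \<Rightarrow> (nat \<Rightarrow> 'a \<Rightarrow> real) \<Rightarrow> ('a \<Rightarrow> real) \<Rightarrow> bool" where
  "conv_in_prob M Y Z \<longleftrightarrow> Z \<in> borel_measurable M \<and>
     (\<forall>\<epsilon>>0. (\<lambda>k. measure M {\<omega>\<in>space M. \<bar>Y k \<omega> - Z \<omega>\<bar> > \<epsilon>}) \<longlonglongrightarrow> 0)"

definition levy_integral ::
  "'a measure \<Rightarrow> ('d::euclidean_space set \<Rightarrow> 'a \<Rightarrow> real) \<Rightarrow> ('d \<Rightarrow> real) \<Rightarrow> ('a \<Rightarrow> real) \<Rightarrow> bool" where
  "levy_integral M L f Z \<longleftrightarrow>
     (\<exists>(n :: nat \<Rightarrow> nat) (a :: nat \<Rightarrow> nat \<Rightarrow> real) (S :: nat \<Rightarrow> nat \<Rightarrow> 'd set).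
        (\<forall>k j. S k j \<in> bdd_borel) \<and>
        (AE s in lborel. (\<lambda>k. \<Sum>j<n k. a k j * indicator (S k j) s) \<longlonglongrightarrow> f s) \<and>
        (\<forall>B\<in>sets borel. \<exists>W. conv_in_prob M (\<lambda>k \<omega>. \<Sum>j<n k. a k j * L (B \<inter> S k j) \<omega>) W) \<and>
        conv_in_prob M (\<lambda>k \<omega>. \<Sum>j<n k. a k j * L (S k j) \<omega>) Z)"

definition fd_char :: "'i set \<Rightarrow> ('i \<Rightarrow> real) measure \<Rightarrow> ('i \<Rightarrow> real) \<Rightarrow> complex" where
  "fd_char J \<nu> \<theta> = (CLINT x|\<nu>. iexp (\<Sum>j\<in>J. \<theta> j * x j))"

definition fd_prob :: "'i set \<Rightarrow> ('i \<Rightarrow> real) measure \<Rightarrow> bool" where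
  "fd_prob J \<nu> \<longleftrightarrow> prob_space \<nu> \<and> sets \<nu> = sets (PiM J (\<lambda>_. borel))"

definition fd_inf_div :: "'i set \<Rightarrow> ('i \<Rightarrow> real) measure \<Rightarrow> bool" where
  "fd_inf_div J \<nu> \<longleftrightarrow> fd_prob J \<nu> \<and>
     (\<forall>n::nat. n > 0 \<longrightarrow> (\<exists>\<eta>. fd_prob J \<eta> \<and> (\<forall>\<theta>. fd_char J \<nu> \<theta> = fd_char J \<eta> \<theta> ^ n)))"

definition fd_factor :: "'i set \<Rightarrow> ('i \<Rightarrow> real) measure \<Rightarrow> real \<Rightarrow> ('i \<Rightarrow> real) measure \<Rightarrow> bool" where
  "fd_factor J \<nu> q \<eta> \<longleftrightarrow>
     (\<forall>\<theta>. fd_char J \<nu> \<theta> = fd_char J \<nu> (\<lambda>j. \<theta> j / q) * fd_char J \<eta> \<theta>)"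

fun urbanik :: "nat \<Rightarrow> 'i set \<Rightarrow> ('i \<Rightarrow> real) measure \<Rightarrow> bool" where
  "urbanik 0 J \<nu> \<longleftrightarrow> fd_prob J \<nu> \<and>
     (\<forall>q>1. \<exists>\<eta>. fd_inf_div J \<eta> \<and> fd_factor J \<nu> q \<eta>)"
| "urbanik (Suc m) J \<nu> \<longleftrightarrow> urbanik 0 J \<nu> \<and>
     (\<forall>q>1. \<exists>\<eta>. urbanik m J \<eta> \<and> fd_factor J \<nu> q \<eta>)"

definition field_in_urbanik :: "nat \<Rightarrow> 'a measure \<Rightarrow> 'i set \<Rightarrow> ('i \<Rightarrow> 'a \<Rightarrow> real) \<Rightarrow> bool" where
  "field_in_urbanik m M I Y \<longleftrightarrow>
     (\<forall>J. finite J \<and> J \<subseteq> I \<longrightarrow>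
        urbanik m J (distr M (PiM J (\<lambda>_. borel)) (\<lambda>\<omega>. \<lambda>j\<in>J. Y j \<omega>)))"

definition fourier :: "('d::euclidean_space \<Rightarrow> real) \<Rightarrow> 'd \<Rightarrow> complex" where
  "fourier g \<theta> = (CLINT s|lborel. complex_of_real (g s) * iexp (\<theta> \<bullet> s))"

end

theory Submission
  imports Defs
begin

text \<open>
  All three fields consist of integrals of kernels against \<open>L\<close>: indicators of bounded sets for \<open>L\<close>, the
  translates \<open>g (u - \<cdot>)\<close> for \<open>X\<close>, and the averages of these over \<open>A\<close> for \<open>\<mu>(X; A)\<close>. The joint characteristic
  function of finitely many such integrals is the exponential of the integral, over space, of the
  Levy--Khintchine exponent composed with the combination of the kernels. Hence every one of the three
  conditions follows from a condition on the Levy measure \<open>\<rho>\<close> alone: \<open>\<rho>\<close> dominates its image under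
  division by \<open>q\<close>, for every \<open>q > 1\<close>, and (recursively) so do the differences.

  Conversely, this condition is necessary as soon as the span of the kernels contains functions that are close,
  relative to the volume of a ball, to the indicator of the ball: the cofactor of the corresponding
  one-dimensional law, suitably rooted, then has an exponent close to the difference of the exponents of \<open>L\<close>
  at \<open>\<theta>\<close> and at \<open>\<theta> / q\<close>, and a continuity argument shows that the difference of the Levy measures is nonnegative.
  For \<open>X\<close> such functions are averages of translates of \<open>g\<close> over large balls, which look like the integral of \<open>g\<close>
  times the indicator of the ball; only the value of the Fourier transform at 0, the integral of \<open>g\<close>, matters.
  For \<open>\<mu>(X; A)\<close> the density of Lebesgue measure with respect to \<open>\<mu>\<close> turns averages against \<open>\<mu>\<close>
  into averages against Lebesgue measure.
\<close>

section \<open>Exponents and modulars of kernels\<close>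

text \<open>The first-moment modular \<open>Phi1\<close> gives every law involved a mean, so jumps
  can be compensated by their full size; for a centered basis no drift then remains, and the kernels
  form a space governed by one convex modular, where Jensen's inequality and continuity of
  translations do the work of L^p arguments. Two obstacles shape the proof.
  \<open>levy_integral\<close> is a limit in probability of simple integrals whose kernels converge
  almost everywhere, without any domination, so the exponent of the limit has to be identified by a
  gliding hump. And Urbanik classes ask for cofactors that are actual laws, so laws with a
  prescribed exponent must be built, from Gaussian and compensated Poisson pieces. For necessity,
  infinite divisibility of the cofactor permits roots of order much larger than the volume of the
  ball; only then does the characteristic function minus 1, rescaled, have the difference of
  exponents as its limit. Second differences in t turn that limit into one of Fourier transforms of
  finite measures, to which Levy's continuity theorem applies. Balls must grow because the error of
  averaging translates sits near the boundary.\<close>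

lemma norm_integral_le:
  fixes f :: "'x \<Rightarrow> 'y::{banach, second_countable_topology}"
  assumes "integrable M f" "integrable M g" "\<And>x. norm (f x) \<le> g x"
  shows "norm (integral\<^sup>L M f) \<le> integral\<^sup>L M g"
  by (rule order_trans[OF integral_norm_bound]) (intro integral_mono integrable_norm assms)

text \<open>A convex function comparable with min(|y|, y^2); convexity is needed for Jensen's inequality
  in the space of kernels.\<close>

definition kf :: "real \<Rightarrow> real" where
  "kf y = y\<^sup>2 / (1 + \<bar>y\<bar>)"

lemma kf_nonneg [simp]: "0 \<le> kf y"
  by (simp add: kf_def)

lemma kf_0 [simp]: "kf 0 = 0"
  by (simp add: kf_def)

lemma kf_minus [simp]: "kf (- y) = kf y"
  by (simp add: kf_def)

lemma kf_pos: "y \<noteq> 0 \<Longrightarrow> 0 < kf y"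
  by (simp add: kf_def add_pos_nonneg)

text \<open>Polynomial division. In this form convexity is visible for nonnegative y: an affine
  function plus \<open>inverse\<close> of an affine one.\<close>

lemma kf_alt: "kf y = \<bar>y\<bar> - 1 + inverse (1 + \<bar>y\<bar>)"
proof -
  have "1 + \<bar>y\<bar> \<noteq> 0" by linarith
  then show ?thesis
    by (simp add: kf_def field_simps power2_eq_square)
qed

lemma kf_le_abs: "kf y \<le> \<bar>y\<bar>"
  unfolding kf_def by (simp add: field_simps power2_eq_square)

lemma kf_le_sq: "kf y \<le> y\<^sup>2"
  unfolding kf_def by (simp add: field_simps mult_nonneg_nonneg)

lemma sq_le_kf: "\<bar>y\<bar> \<le> 1 \<Longrightarrow> y\<^sup>2 \<le> 2 * kf y"
proof -
  assume "\<bar>y\<bar> \<le> 1"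
  then have "y\<^sup>2 * (1 + \<bar>y\<bar>) \<le> y\<^sup>2 * 2" by (intro mult_left_mono) auto
  then show "y\<^sup>2 \<le> 2 * kf y" by (simp add: kf_def field_simps)
qed

lemma abs_le_kf_of_ge_1: "1 \<le> \<bar>y\<bar> \<Longrightarrow> \<bar>y\<bar> \<le> 2 * kf y"
proof -
  assume "1 \<le> \<bar>y\<bar>"
  then have "\<bar>y\<bar> * (1 + \<bar>y\<bar>) \<le> \<bar>y\<bar> * (2 * \<bar>y\<bar>)" by (intro mult_left_mono) auto
  then show "\<bar>y\<bar> \<le> 2 * kf y" by (simp add: kf_def field_simps power2_eq_square)
qed

lemma min_le_kf: "min \<bar>y\<bar> (y\<^sup>2) \<le> 2 * kf y"
  using sq_le_kf[of y] abs_le_kf_of_ge_1[of y] by linarith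

lemma abs_le_kf: "\<bar>y\<bar> \<le> 1 + 2 * kf y"
  using abs_le_kf_of_ge_1[of y] kf_nonneg[of y] by linarith

lemma kf_mono: "\<bar>x\<bar> \<le> \<bar>y\<bar> \<Longrightarrow> kf x \<le> kf y"
proof -
  assume *: "\<bar>x\<bar> \<le> \<bar>y\<bar>"
  have "\<bar>x\<bar> * \<bar>x\<bar> * (1 + \<bar>y\<bar>) \<le> \<bar>y\<bar> * \<bar>y\<bar> * (1 + \<bar>x\<bar>)"
  proof -
    have "\<bar>x\<bar> * \<bar>x\<bar> \<le> \<bar>y\<bar> * \<bar>y\<bar>" using * by (intro mult_mono) auto
    moreover have "\<bar>x\<bar> * \<bar>y\<bar> * \<bar>x\<bar> \<le> \<bar>x\<bar> * \<bar>y\<bar> * \<bar>y\<bar>" using * by (intro mult_left_mono) auto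
    ultimately show ?thesis by (simp add: algebra_simps)
  qed
  then show ?thesis by (simp add: kf_def field_simps power2_eq_square)
qed

text \<open>The denominators satisfy \<open>\<bar>c\<bar> * (1 + \<bar>y\<bar>) \<le> 1 + \<bar>c *
  y\<bar>\<close>. Linear decay in \<open>c\<close> is all that holds uniformly in \<open>y\<close>,
  since \<open>kf\<close> grows linearly at infinity; it is what converts a uniform bound plus an
  L^1 bound into a modular bound.\<close>

lemma kf_scale_le_1:
  assumes "\<bar>c\<bar> \<le> 1" shows "kf (c * y) \<le> \<bar>c\<bar> * kf y"
proof -
  have "\<bar>c\<bar> * (1 + \<bar>y\<bar>) \<le> 1 + \<bar>c * y\<bar>"
    using assms by (simp add: abs_mult algebra_simps)
  then have "\<bar>c\<bar> / (1 + \<bar>c * y\<bar>) \<le> 1 / (1 + \<bar>y\<bar>)"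
    by (simp add: field_simps)
  then have "(\<bar>c\<bar> * y\<^sup>2) * (\<bar>c\<bar> / (1 + \<bar>c * y\<bar>)) \<le> (\<bar>c\<bar> * y\<^sup>2) * (1 / (1 + \<bar>y\<bar>))"
    by (intro mult_left_mono) auto
  then show ?thesis by (simp add: kf_def power_mult_distrib power2_eq_square mult_ac)
qed

lemma kf_scale: "kf (c * y) \<le> max 1 (c\<^sup>2) * kf y"
proof (cases "\<bar>c\<bar> \<le> 1")
  case True
  then have "kf (c * y) \<le> \<bar>c\<bar> * kf y" by (rule kf_scale_le_1)
  also have "\<dots> \<le> max 1 (c\<^sup>2) * kf y" using True by (intro mult_right_mono) auto
  finally show ?thesis .
next
  case False
  then have "\<bar>y\<bar> \<le> \<bar>c * y\<bar>" by (simp add: abs_mult mult_le_cancel_right1)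
  then have "c\<^sup>2 * y\<^sup>2 / (1 + \<bar>c * y\<bar>) \<le> c\<^sup>2 * y\<^sup>2 / (1 + \<bar>y\<bar>)"
    by (intro divide_left_mono) (auto intro!: mult_pos_pos)
  then have "kf (c * y) \<le> c\<^sup>2 * kf y" by (simp add: kf_def power_mult_distrib)
  also have "\<dots> \<le> max 1 (c\<^sup>2) * kf y" by (intro mult_right_mono) auto
  finally show ?thesis .
qed

lemma convex_on_kf: "convex_on UNIV kf"
proof (rule convex_onI)
  fix t x y :: real assume t: "0 < t" "t < 1"
  have inv: "convex_on {0<..} (inverse :: real \<Rightarrow> real)"
    by (rule convex_on_inverse) auto
  have c: "inverse ((1 - t) *\<^sub>R (1 + \<bar>x\<bar>) + t *\<^sub>R (1 + \<bar>y\<bar>)) \<le>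
      (1 - t) * inverse (1 + \<bar>x\<bar>) + t * inverse (1 + \<bar>y\<bar>)"
    using t by (intro convex_onD[OF inv]) (auto intro: add_pos_nonneg)
  have eq: "(1 - t) *\<^sub>R (1 + \<bar>x\<bar>) + t *\<^sub>R (1 + \<bar>y\<bar>) = 1 + \<bar>(1 - t) * \<bar>x\<bar> + t * \<bar>y\<bar>\<bar>"
    using t by (simp add: algebra_simps) (smt (verit) abs_ge_zero mult_nonneg_nonneg mult_left_le_one_le)
  \<comment> \<open>Monotonicity in the absolute value reduces to nonnegative arguments, where
    \<open>kf_alt\<close> applies.\<close>
  have "kf ((1 - t) *\<^sub>R x + t *\<^sub>R y) \<le> kf ((1 - t) * \<bar>x\<bar> + t * \<bar>y\<bar>)"
  proof (rule kf_mono)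
    have "\<bar>(1 - t) *\<^sub>R x + t *\<^sub>R y\<bar> \<le> \<bar>(1 - t) * x\<bar> + \<bar>t * y\<bar>" by simp
    also have "\<dots> = (1 - t) * \<bar>x\<bar> + t * \<bar>y\<bar>" using t by (simp add: abs_mult)
    finally show "\<bar>(1 - t) *\<^sub>R x + t *\<^sub>R y\<bar> \<le> \<bar>(1 - t) * \<bar>x\<bar> + t * \<bar>y\<bar>\<bar>" by linarith
  qed
  also have "\<dots> \<le> (1 - t) * kf x + t * kf y"
  proof -
    have "\<bar>(1 - t) * \<bar>x\<bar> + t * \<bar>y\<bar>\<bar> = (1 - t) * \<bar>x\<bar> + t * \<bar>y\<bar>" using t by simp
    then show ?thesis using c unfolding eq kf_alt by (simp add: algebra_simps)
  qed
  finally show "kf ((1 - t) *\<^sub>R x + t *\<^sub>R y) \<le> (1 - t) * kf x + t * kf y" .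
qed simp

lemma kf_add: "kf (x + y) \<le> 2 * (kf x + kf y)"
proof -
  \<comment> \<open>Convexity at the midpoint of 2x and 2y; each doubling costs a factor 4, half of
    which survives.\<close>
  have "kf ((1 - 1/2) *\<^sub>R (2 * x) + (1/2) *\<^sub>R (2 * y)) \<le> (1 - 1/2) * kf (2 * x) + (1/2) * kf (2 * y)"
    by (rule convex_onD[OF convex_on_kf]) auto
  then show ?thesis using kf_scale[of 2 x] kf_scale[of 2 y] by simp
qed

lemma kf_measurable [measurable]: "kf \<in> borel_measurable borel"
  unfolding kf_def by measurable

text \<open>The Levy--Khintchine integrand compensated by the whole jump instead of its truncation
  \<open>tau1\<close>. Finite first moments make this possible, and it removes the drift of a
  centered law.\<close>

definition ek :: "real \<Rightarrow> complex" where
  "ek y = iexp y - 1 - \<i> * of_real y"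

lemma ek_0 [simp]: "ek 0 = 0"
  by (simp add: ek_def)

lemma ek_measurable [measurable]: "ek \<in> borel_measurable borel"
  unfolding ek_def by measurable

lemma norm_ek_le: "norm (ek y) \<le> 4 * kf y"
proof -
  have "norm (ek y) \<le> y\<^sup>2 / 2"
    using iexp_approx1[of y 1] by (simp add: ek_def algebra_simps power2_eq_square)
  moreover have "norm (ek y) \<le> 2 * \<bar>y\<bar>"
    using iexp_approx2[of y 1] by (simp add: ek_def algebra_simps)
  ultimately show ?thesis using min_le_kf[of y] zero_le_power2[of y] by linarith
qed

lemma norm_iexp_diff_1: "norm (iexp x - 1) \<le> min \<bar>x\<bar> 2"
  using iexp_approx1[of x 0] iexp_approx2[of x 0] by (simp add: algebra_simps)

text \<open>Young's inequality with weight \<open>e\<close>: for small \<open>y\<close> the squares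
  of \<open>y\<close> and of \<open>min \<bar>x\<bar> 2\<close> are both controlled by
  \<open>kf\<close>, and \<open>e\<close> shifts the cost from \<open>x\<close> to \<open>y\<close>.
  For large \<open>y\<close> the factor \<open>min \<bar>x\<bar> 2\<close> is simply bounded by
  2.\<close>

lemma abs_times_min_le:
  assumes "0 < e" "e \<le> 1"
  shows "\<bar>y\<bar> * min \<bar>x\<bar> 2 \<le> 4 * e * kf x + (5 / e) * kf y"
proof (cases "\<bar>y\<bar> \<le> 1")
  case False
  then have "\<bar>y\<bar> \<le> 2 * kf y" using abs_le_kf_of_ge_1[of y] by linarith
  moreover have "\<bar>y\<bar> * min \<bar>x\<bar> 2 \<le> \<bar>y\<bar> * 2" by (intro mult_left_mono) auto
  ultimately have "\<bar>y\<bar> * min \<bar>x\<bar> 2 \<le> 4 * kf y" by linarith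
  moreover have "4 * kf y \<le> (5/e) * kf y" using assms
    by (intro mult_right_mono) (auto simp: field_simps)
  moreover have "0 \<le> 4 * e * kf x" using assms by simp
  ultimately show ?thesis by linarith
next
  case True
  have y: "y\<^sup>2 \<le> 2 * kf y" using sq_le_kf True by blast
  have x: "(min \<bar>x\<bar> 2)\<^sup>2 \<le> 8 * kf x"
  proof (cases "\<bar>x\<bar> \<le> 1")
    case True
    then have "x\<^sup>2 \<le> 2 * kf x" using sq_le_kf by blast
    then show ?thesis using True kf_nonneg[of x] by (simp add: min_def del: kf_nonneg)
  next
    case False
    then have "1 / 2 \<le> kf x" using kf_mono[of 1 x] by (simp add: kf_def)
    moreover have "(min \<bar>x\<bar> 2)\<^sup>2 \<le> 2\<^sup>2" by (intro power_mono) auto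
    ultimately show ?thesis by simp
  qed
  define u where "u = min \<bar>x\<bar> 2"
  have "0 \<le> (e * u - \<bar>y\<bar>)\<^sup>2" by simp
  then have "2 * (\<bar>y\<bar> * u) * e \<le> e\<^sup>2 * u\<^sup>2 + y\<^sup>2"
    by (simp add: power2_diff power_mult_distrib algebra_simps)
  then have "\<bar>y\<bar> * u \<le> (e\<^sup>2 * u\<^sup>2 + y\<^sup>2) / (2 * e)" using assms by (simp add: field_simps)
  also have "\<dots> = e / 2 * u\<^sup>2 + y\<^sup>2 / (2 * e)" using assms by (simp add: field_simps power2_eq_square)
  also have "\<dots> \<le> e / 2 * (8 * kf x) + (2 * kf y) / (2 * e)"
    using x y assms unfolding u_def by (intro add_mono mult_left_mono divide_right_mono) auto
  also have "\<dots> \<le> 4 * e * kf x + (5 / e) * kf y" using assms by (simp add: field_simps)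
  finally show ?thesis unfolding u_def .
qed

text \<open>The increment is \<open>iexp x * ek y\<close>, of the size of \<open>ek y\<close>, plus
  a cross term \<open>y * (iexp x - 1)\<close> up to a unit factor. Keeping \<open>e\<close> free is
  what yields continuity: a small multiple of the modular at \<open>x\<close> plus a large multiple
  of the modular of the perturbation.\<close>

lemma norm_ek_add_diff:
  assumes "0 < e" "e \<le> 1"
  shows "norm (ek (x + y) - ek x) \<le> 4 * e * kf x + (9 / e) * kf y"
proof -
  have "ek (x + y) - ek x = iexp x * ek y + \<i> * of_real y * (iexp x - 1)"
    by (simp add: ek_def algebra_simps exp_add)
  then have "norm (ek (x + y) - ek x) \<le> norm (iexp x * ek y) + norm (\<i> * of_real y * (iexp x - 1))"
    using norm_triangle_ineq by metis
  also have "\<dots> \<le> 4 * kf y + \<bar>y\<bar> * min \<bar>x\<bar> 2"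
    using norm_ek_le[of y] norm_iexp_diff_1[of x]
    by (intro add_mono) (auto simp: norm_mult intro!: mult_left_mono)
  also have "\<dots> \<le> 4 * kf y + (4 * e * kf x + (5 / e) * kf y)"
    using abs_times_min_le[OF assms, of y x] by linarith
  also have "4 * kf y \<le> (4 / e) * kf y" using assms by (intro mult_right_mono) (auto simp: field_simps)
  then have "4 * kf y + (4 * e * kf x + (5 / e) * kf y) \<le> 4 * e * kf x + (9 / e) * kf y"
    using assms by (simp add: field_simps)
  finally show ?thesis .
qed

lemma half_mult_le:
  fixes a b p u v w :: real
  assumes "0 \<le> b" "0 \<le> p" "0 \<le> w" "v \<le> w" "u \<le> p + w" "a \<le> u + v"
  shows "b / 2 * a \<le> b * (4 * p + 9 * w)"
proof -
  have "a \<le> 8 * p + 18 * w" using assms(2-) by linarith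
  then have "b / 2 * a \<le> b / 2 * (8 * p + 18 * w)" by (rule mult_left_mono) (use assms(1) in auto)
  also have "\<dots> = b * (4 * p + 9 * w)" by (simp add: algebra_simps)
  finally show ?thesis .
qed

text \<open>A Levy measure whose large jumps have a finite first moment, as \<open>kf\<close> is
  comparable with min(|x|, x^2). This is the integrability that full compensation requires.\<close>

definition jump_measure :: "real measure \<Rightarrow> bool" where
  "jump_measure \<rho> \<longleftrightarrow> sets \<rho> = sets borel \<and> emeasure \<rho> {0} = 0 \<and> integrable \<rho> kf"

text \<open>The exponent of the infinitely divisible law with mean zero, Gaussian variance
  \<open>b\<^sup>2\<close> and Levy measure \<open>\<rho>\<close>.\<close>

definition cexp :: "real \<Rightarrow> real measure \<Rightarrow> real \<Rightarrow> complex" where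
  "cexp b \<rho> \<theta> = - of_real (b\<^sup>2 * \<theta>\<^sup>2 / 2) + (CLINT x|\<rho>. ek (\<theta> * x))"

text \<open>Counterpart of \<open>Phi1\<close> for centered exponents. Even, convex and of at most
  quadratic growth, it defines an Orlicz-type modular that bounds \<open>cexp\<close> and its
  increments.\<close>

definition KK :: "real \<Rightarrow> real measure \<Rightarrow> real \<Rightarrow> real" where
  "KK b \<rho> r = b\<^sup>2 * r\<^sup>2 + (LINT x|\<rho>. kf (r * x))"

lemma jump_measure_sets: "jump_measure \<rho> \<Longrightarrow> sets \<rho> = sets borel"
  by (simp add: jump_measure_def)

context
  fixes \<rho> :: "real measure" and b :: real
  assumes jm: "jump_measure \<rho>"
begin

lemma [measurable_cong]: "sets \<rho> = sets borel"
  using jm by (rule jump_measure_sets)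

lemma integrable_kf_scale: "integrable \<rho> (\<lambda>x. kf (r * x))"
proof (rule Bochner_Integration.integrable_bound)
  show "integrable \<rho> (\<lambda>x. max 1 (r\<^sup>2) * kf x)" using jm by (simp add: jump_measure_def)
  show "AE x in \<rho>. norm (kf (r * x)) \<le> norm (max 1 (r\<^sup>2) * kf x)"
    using kf_scale[of r] by (auto intro: order_trans[OF _ abs_ge_self])
qed measurable

lemma integrable_ek: "integrable \<rho> (\<lambda>x. ek (\<theta> * x))"
proof (rule Bochner_Integration.integrable_bound)
  show "integrable \<rho> (\<lambda>x. 4 * kf (\<theta> * x))" by (simp add: integrable_kf_scale)
qed (use norm_ek_le in auto, measurable)

lemma KK_nonneg [simp]: "0 \<le> KK b \<rho> r"
  by (simp add: KK_def)

lemma KK_0 [simp]: "KK b \<rho> 0 = 0"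
  by (simp add: KK_def)

lemma KK_minus [simp]: "KK b \<rho> (- r) = KK b \<rho> r"
  by (simp add: KK_def)

lemma KK_mono: "\<bar>r\<bar> \<le> \<bar>r'\<bar> \<Longrightarrow> KK b \<rho> r \<le> KK b \<rho> r'"
  unfolding KK_def
  by (intro add_mono mult_left_mono integral_mono integrable_kf_scale kf_mono)
     (auto simp: abs_mult abs_le_square_iff intro: mult_right_mono)

lemma KK_scale_le_1: "\<bar>c\<bar> \<le> 1 \<Longrightarrow> KK b \<rho> (c * r) \<le> \<bar>c\<bar> * KK b \<rho> r"
proof -
  assume c: "\<bar>c\<bar> \<le> 1"
  have "(LINT x|\<rho>. kf (c * r * x)) \<le> (LINT x|\<rho>. \<bar>c\<bar> * kf (r * x))"
    using kf_scale_le_1[OF c]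
    by (intro integral_mono integrable_mult_right integrable_kf_scale) (simp add: mult.assoc)
  moreover have "c\<^sup>2 \<le> \<bar>c\<bar>" using c
    by (metis abs_ge_zero mult_left_le_one_le power2_abs power2_eq_square)
  then have "b\<^sup>2 * (c * r)\<^sup>2 \<le> \<bar>c\<bar> * (b\<^sup>2 * r\<^sup>2)"
    using mult_right_mono[of "c\<^sup>2" _ "b\<^sup>2 * r\<^sup>2"] by (simp add: power_mult_distrib mult_ac)
  ultimately show ?thesis by (simp add: KK_def algebra_simps)
qed

lemma KK_scale: "KK b \<rho> (c * r) \<le> max 1 (c\<^sup>2) * KK b \<rho> r"
proof -
  have "(LINT x|\<rho>. kf (c * r * x)) \<le> (LINT x|\<rho>. max 1 (c\<^sup>2) * kf (r * x))"
    using kf_scale[of c]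
    by (intro integral_mono integrable_mult_right integrable_kf_scale) (simp add: mult.assoc)
  moreover have "b\<^sup>2 * (c * r)\<^sup>2 \<le> max 1 (c\<^sup>2) * (b\<^sup>2 * r\<^sup>2)"
    using mult_right_mono[of "c\<^sup>2" "max 1 (c\<^sup>2)" "b\<^sup>2 * r\<^sup>2"] by (simp add: power_mult_distrib mult_ac)
  ultimately show ?thesis by (simp add: KK_def algebra_simps)
qed

lemma KK_add: "KK b \<rho> (r + s) \<le> 2 * (KK b \<rho> r + KK b \<rho> s)"
proof -
  have "(LINT x|\<rho>. kf ((r + s) * x)) \<le> (LINT x|\<rho>. 2 * (kf (r * x) + kf (s * x)))"
    using kf_add
    by (intro integral_mono integrable_mult_right Bochner_Integration.integrable_add integrable_kf_scale)
       (simp add: distrib_right)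
  also have "\<dots> = 2 * ((LINT x|\<rho>. kf (r * x)) + (LINT x|\<rho>. kf (s * x)))"
    by (simp add: integrable_kf_scale)
  finally have "(LINT x|\<rho>. kf ((r + s) * x)) \<le> \<dots>" .
  moreover have "b\<^sup>2 * (r + s)\<^sup>2 \<le> b\<^sup>2 * (2 * (r\<^sup>2 + s\<^sup>2))"
    using zero_le_power2[of "r - s"]
    by (intro mult_left_mono) (auto simp: power2_sum power2_diff)
  ultimately show ?thesis by (simp add: KK_def algebra_simps)
qed

text \<open>Integrates the convexity of \<open>kf\<close>; the square is convex as well. Besides
  Jensen's inequality this supplies continuity of \<open>KK\<close>, a finite convex function on the
  line.\<close>

lemma convex_on_KK: "convex_on UNIV (KK b \<rho>)"
proof (rule convex_onI)
  fix t x y :: real assume t: "0 < t" "t < 1"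
  have "(LINT z|\<rho>. kf (((1 - t) *\<^sub>R x + t *\<^sub>R y) * z)) \<le>
        (LINT z|\<rho>. (1 - t) * kf (x * z) + t * kf (y * z))"
  proof (intro integral_mono)
    show "kf (((1 - t) *\<^sub>R x + t *\<^sub>R y) * z) \<le> (1 - t) * kf (x * z) + t * kf (y * z)" for z
      using convex_onD[OF convex_on_kf, of t "x * z" "y * z"] t by (simp add: algebra_simps)
  qed (simp_all add: integrable_kf_scale)
  also have "\<dots> = (1 - t) * (LINT z|\<rho>. kf (x * z)) + t * (LINT z|\<rho>. kf (y * z))"
    by (simp add: integrable_kf_scale)
  finally have "(LINT z|\<rho>. kf (((1 - t) *\<^sub>R x + t *\<^sub>R y) * z)) \<le> \<dots>" .
  moreover have "b\<^sup>2 * ((1 - t) * x + t * y)\<^sup>2 \<le> b\<^sup>2 * ((1 - t) * x\<^sup>2 + t * y\<^sup>2)"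
  proof (rule mult_left_mono)
    have "(1 - t) * x\<^sup>2 + t * y\<^sup>2 - ((1 - t) * x + t * y)\<^sup>2 = t * (1 - t) * (x - y)\<^sup>2"
      by algebra
    moreover have "0 \<le> t * (1 - t) * (x - y)\<^sup>2" using t by simp
    ultimately show "((1 - t) * x + t * y)\<^sup>2 \<le> (1 - t) * x\<^sup>2 + t * y\<^sup>2" by linarith
  qed simp
  ultimately show "KK b \<rho> ((1 - t) *\<^sub>R x + t *\<^sub>R y) \<le> (1 - t) * KK b \<rho> x + t * KK b \<rho> y"
    by (simp add: KK_def algebra_simps)
qed simp

lemma continuous_KK: "continuous_on UNIV (KK b \<rho>)"
  by (rule convex_on_continuous[OF open_UNIV convex_on_KK])

lemma cexp_0 [simp]: "cexp b \<rho> 0 = 0"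
  by (simp add: cexp_def)

text \<open>Jump part: integration of \<open>norm_ek_add_diff\<close>. Gaussian part: the cross term
  2uv is absorbed by a weighted arithmetic-geometric mean with the same \<open>e\<close>, so that
  both parts assemble to \<open>KK\<close>.\<close>

lemma norm_cexp_add_diff:
  assumes "0 < e" "e \<le> 1"
  shows "norm (cexp b \<rho> (u + v) - cexp b \<rho> u) \<le> 4 * e * KK b \<rho> u + (9 / e) * KK b \<rho> v"
proof -
  have "cexp b \<rho> (u + v) - cexp b \<rho> u =
      - of_real (b\<^sup>2 / 2 * (2 * u * v + v\<^sup>2)) + (CLINT x|\<rho>. ek (u * x + v * x) - ek (u * x))"
    using integrable_ek[of "u + v"] integrable_ek[of u]
    by (simp add: cexp_def algebra_simps power2_sum)
  also have "norm \<dots> \<le> b\<^sup>2 / 2 * \<bar>2 * u * v + v\<^sup>2\<bar> + (LINT x|\<rho>. 4 * e * kf (u * x) + (9 / e) * kf (v * x))"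
  proof (rule order_trans[OF norm_triangle_ineq], rule add_mono)
    show "norm (- of_real (b\<^sup>2 / 2 * (2 * u * v + v\<^sup>2)) :: complex) \<le> b\<^sup>2 / 2 * \<bar>2 * u * v + v\<^sup>2\<bar>"
      by (simp only: norm_minus_cancel norm_of_real abs_mult) simp
    show "norm (CLINT x|\<rho>. ek (u * x + v * x) - ek (u * x)) \<le>
        (LINT x|\<rho>. 4 * e * kf (u * x) + (9 / e) * kf (v * x))"
    proof (rule norm_integral_le)
      show "integrable \<rho> (\<lambda>x. ek (u * x + v * x) - ek (u * x))"
        using integrable_ek[of "u + v"] integrable_ek[of u] by (simp add: distrib_right)
    qed (use norm_ek_add_diff[OF assms] in \<open>simp_all add: integrable_kf_scale\<close>)
  qed
  also have "(LINT x|\<rho>. 4 * e * kf (u * x) + (9 / e) * kf (v * x)) =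
      4 * e * (LINT x|\<rho>. kf (u * x)) + (9 / e) * (LINT x|\<rho>. kf (v * x))"
    by (simp add: integrable_kf_scale)
  also have "b\<^sup>2 / 2 * \<bar>2 * u * v + v\<^sup>2\<bar> \<le> b\<^sup>2 * (4 * e * u\<^sup>2 + (9 / e) * v\<^sup>2)"
  proof -
    have "0 \<le> (e * \<bar>u\<bar> - \<bar>v\<bar>)\<^sup>2" by simp
    then have "2 * (\<bar>u\<bar> * \<bar>v\<bar>) * e \<le> e\<^sup>2 * u\<^sup>2 + v\<^sup>2"
      by (simp add: power2_diff power_mult_distrib algebra_simps)
    then have "2 * (\<bar>u\<bar> * \<bar>v\<bar>) \<le> (e\<^sup>2 * u\<^sup>2 + v\<^sup>2) / e" using assms by (simp add: field_simps)
    also have "\<dots> = e * u\<^sup>2 + v\<^sup>2 / e" using assms by (simp add: field_simps power2_eq_square)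
    finally have 1: "2 * (\<bar>u\<bar> * \<bar>v\<bar>) \<le> e * u\<^sup>2 + v\<^sup>2 / e" .
    have 2: "v\<^sup>2 \<le> v\<^sup>2 / e" using assms by (simp add: field_simps mult_left_le_one_le)
    have "b\<^sup>2 / 2 * \<bar>2 * u * v + v\<^sup>2\<bar> \<le> b\<^sup>2 * (4 * (e * u\<^sup>2) + 9 * (v\<^sup>2 / e))"
    proof (rule half_mult_le[OF _ _ _ 2 1])
      show "\<bar>2 * u * v + v\<^sup>2\<bar> \<le> 2 * (\<bar>u\<bar> * \<bar>v\<bar>) + v\<^sup>2"
        by (metis abs_mult abs_numeral abs_power2 abs_triangle_ineq mult.assoc)
    qed (use assms in auto)
    then show ?thesis by (simp only: mult.assoc times_divide_eq_left times_divide_eq_right)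
  qed
  finally have bound: "norm (cexp b \<rho> (u + v) - cexp b \<rho> u) \<le>
      b\<^sup>2 * (4 * e * u\<^sup>2 + (9 / e) * v\<^sup>2) +
      (4 * e * (LINT x|\<rho>. kf (u * x)) + (9 / e) * (LINT x|\<rho>. kf (v * x)))"
    by this simp_all
  have eq: "b\<^sup>2 * (p + c * w) + (a * i + c * j) = (b\<^sup>2 * p + a * i) + c * (b\<^sup>2 * w + j)"
    for p w c a i j :: real
    by (simp only: distrib_left distrib_right mult_ac add_ac)
  have eq2: "b\<^sup>2 * (4 * e * u\<^sup>2) + 4 * e * i = 4 * e * (b\<^sup>2 * u\<^sup>2 + i)" for i
    by (simp only: distrib_left mult_ac)
  show ?thesis unfolding KK_def using bound unfolding eq eq2 .
qed

lemma norm_cexp_le: "norm (cexp b \<rho> v) \<le> 9 * KK b \<rho> v"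
  using norm_cexp_add_diff[of 1 0 v] by simp

lemma continuous_cexp: "continuous_on UNIV (cexp b \<rho>)"
proof -
  have "isCont (cexp b \<rho>) u" for u
    unfolding isCont_iff LIM_def
  proof (intro allI impI)
    fix r :: real assume r: "0 < r"
    \<comment> \<open>With this \<open>e\<close> the term at the fixed point \<open>u\<close> stays
      below r/2; afterwards \<open>v\<close> is taken so small that \<open>KK b \<rho> v\<close>
      beats the factor 9/e. The added 1 keeps the denominator positive.\<close>
    define e where "e = min 1 (r / (8 * (KK b \<rho> u + 1)))"
    have K: "0 < KK b \<rho> u + 1" using KK_nonneg[of u] by linarith
    have e: "0 < e" "e \<le> 1" using r K by (auto simp: e_def)
    have "e \<le> r / (8 * (KK b \<rho> u + 1))" by (simp add: e_def)
    then have "8 * (KK b \<rho> u + 1) * e \<le> r" using K by (simp add: field_simps)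
    then have 1: "4 * e * KK b \<rho> u < r / 2" using e by (simp add: algebra_simps)
    have "isCont (KK b \<rho>) 0" using continuous_KK by (simp add: continuous_on_eq_continuous_at)
    moreover have "0 < r * e / 18" using r e by simp
    ultimately obtain s where s: "0 < s" "\<And>v. v \<noteq> 0 \<Longrightarrow> \<bar>v\<bar> < s \<Longrightarrow> \<bar>KK b \<rho> v\<bar> < r * e / 18"
      unfolding isCont_def LIM_def KK_0 dist_real_def diff_0_right by metis
    show "\<exists>s>0. \<forall>v::real. v \<noteq> 0 \<and> dist v 0 < s \<longrightarrow> dist (cexp b \<rho> (u + v)) (cexp b \<rho> u) < r"
    proof (intro exI[of _ s] conjI allI impI s)
      fix v :: real assume "v \<noteq> 0 \<and> dist v 0 < s"
      then have "KK b \<rho> v < r * e / 18" using s(2)[of v] by (simp add: dist_real_def)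
      then have "(9 / e) * KK b \<rho> v < (9 / e) * (r * e / 18)"
        using e by (intro mult_strict_left_mono) auto
      then have "(9 / e) * KK b \<rho> v < r / 2" using e by simp
      then show "dist (cexp b \<rho> (u + v)) (cexp b \<rho> u) < r"
        using norm_cexp_add_diff[OF e, of u v] 1 by (simp add: dist_norm)
    qed
  qed
  then show ?thesis by (simp add: continuous_on_eq_continuous_at)
qed

lemma cexp_measurable [measurable]: "cexp b \<rho> \<in> borel_measurable borel"
  by (rule borel_measurable_continuous_onI[OF continuous_cexp])

lemma KK_measurable [measurable]: "KK b \<rho> \<in> borel_measurable borel"
  by (rule borel_measurable_continuous_onI[OF continuous_KK])

lemma sigma_finite_jump_measure: "sigma_finite_measure \<rho>"
proof
  \<comment> \<open>Superlevel sets of \<open>kf\<close>: they have finite mass by Markov's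
    inequality and exhaust everything but the origin, where \<open>kf\<close> vanishes. The origin
    is adjoined as a null set.\<close>
  define A where "A n = {x. 1 / real (Suc n) \<le> kf x}" for n
  have A [measurable]: "A n \<in> sets borel" for n unfolding A_def by measurable
  have fin: "emeasure \<rho> (A n) \<noteq> \<infinity>" for n
  proof -
    have "emeasure \<rho> (A n) = (\<integral>\<^sup>+x. indicator (A n) x \<partial>\<rho>)"
      by simp
    also have "\<dots> \<le> (\<integral>\<^sup>+x. ennreal (real (Suc n) * kf x) \<partial>\<rho>)"
    proof (rule nn_integral_mono)
      fix x show "indicator (A n) x \<le> ennreal (real (Suc n) * kf x)"
        by (auto simp: A_def indicator_def field_simps simp flip: ennreal_1 simp del: ennreal_plus intro!: ennreal_leI)
    qed
    also have "\<dots> < \<infinity>"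
      using integrable_mult_right[of "real (Suc n)" \<rho> kf] jm
      unfolding jump_measure_def integrable_iff_bounded by (auto simp: abs_mult)
    finally show ?thesis by simp
  qed
  show "\<exists>B. countable B \<and> B \<subseteq> sets \<rho> \<and> \<Union> B = space \<rho> \<and> (\<forall>a\<in>B. emeasure \<rho> a \<noteq> \<infinity>)"
  proof (intro exI[of _ "insert {0} (range A)"] conjI)
    have "x \<in> \<Union> (insert {0} (range A))" for x
    proof (cases "x = 0")
      case False
      from reals_Archimedean[OF kf_pos[OF this]] obtain n where "inverse (real (Suc n)) < kf x" ..
      then have "x \<in> A n" by (simp add: A_def inverse_eq_divide)
      then show ?thesis by auto
    qed simp
    moreover have "space \<rho> = UNIV"
      using jm sets_eq_imp_space_eq[of \<rho> borel] by (simp add: jump_measure_def)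
    ultimately show "\<Union> (insert {0} (range A)) = space \<rho>" by auto
    show "\<forall>a\<in>insert {0} (range A). emeasure \<rho> a \<noteq> \<infinity>"
      using fin jm by (auto simp: jump_measure_def)
    show "countable (insert {0} (range A))" by simp
    show "insert {0} (range A) \<subseteq> sets \<rho>" unfolding jump_measure_sets[OF jm] using A by auto
  qed
qed

end

text \<open>For a centered basis, in_L_Phi1 amounts to finiteness of this modular.\<close>

definition modular :: "real \<Rightarrow> real measure \<Rightarrow> ('d::euclidean_space \<Rightarrow> real) \<Rightarrow> ennreal" where
  "modular b \<rho> h = (\<integral>\<^sup>+s. ennreal (KK b \<rho> (h s)) \<partial>lborel)"

definition expo :: "real \<Rightarrow> real measure \<Rightarrow> ('d::euclidean_space \<Rightarrow> real) \<Rightarrow> complex" where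
  "expo b \<rho> h = (CLINT s|lborel. cexp b \<rho> (h s))"

context
  fixes \<rho> :: "real measure" and b :: real
  assumes jm: "jump_measure \<rho>"
begin

lemmas [measurable] = KK_measurable[OF jm] cexp_measurable[OF jm]

lemma modular_0 [simp]: "modular b \<rho> (\<lambda>s. 0) = 0"
  using jm by (simp add: modular_def)

lemma integrable_KK:
  assumes [measurable]: "h \<in> borel_measurable borel" and "modular b \<rho> h < \<infinity>"
  shows "integrable lborel (\<lambda>s. KK b \<rho> (h s))"
  using assms(2) KK_nonneg[OF jm, of b] by (auto simp: modular_def intro!: integrableI_nonneg)

lemma integral_KK:
  assumes "h \<in> borel_measurable borel" and "modular b \<rho> h < \<infinity>"
  shows "(LINT s|lborel. KK b \<rho> (h s)) = enn2real (modular b \<rho> h)"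
  unfolding modular_def using KK_nonneg[OF jm, of b] nn_integral_eq_integral[OF integrable_KK[OF assms]]
  by simp

lemma integrable_cexp:
  assumes [measurable]: "h \<in> borel_measurable borel" and "modular b \<rho> h < \<infinity>"
  shows "integrable lborel (\<lambda>s. cexp b \<rho> (h s))"
  by (rule Bochner_Integration.integrable_bound[OF integrable_mult_right[OF integrable_KK[OF assms], of 9]])
     (use norm_cexp_le[OF jm] KK_nonneg[OF jm] in auto)

lemma modular_mono: "(\<And>s. \<bar>f s\<bar> \<le> \<bar>h s\<bar>) \<Longrightarrow> modular b \<rho> f \<le> modular b \<rho> h"
  unfolding modular_def by (intro nn_integral_mono ennreal_leI KK_mono[OF jm]) auto

lemma modular_add:
  assumes [measurable]: "f \<in> borel_measurable borel" "h \<in> borel_measurable borel"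
  shows "modular b \<rho> (\<lambda>s. f s + h s) \<le> 2 * (modular b \<rho> f + modular b \<rho> h)"
proof -
  have "modular b \<rho> (\<lambda>s. f s + h s) \<le> (\<integral>\<^sup>+s. 2 * (ennreal (KK b \<rho> (f s)) + ennreal (KK b \<rho> (h s))) \<partial>lborel)"
    unfolding modular_def
  proof (intro nn_integral_mono)
    fix s
    have "ennreal (KK b \<rho> (f s + h s)) \<le> ennreal (2 * (KK b \<rho> (f s) + KK b \<rho> (h s)))"
      by (intro ennreal_leI KK_add[OF jm])
    also have "\<dots> = 2 * (ennreal (KK b \<rho> (f s)) + ennreal (KK b \<rho> (h s)))"
      using KK_nonneg[OF jm] by (simp add: ennreal_mult ennreal_plus)
    finally show "ennreal (KK b \<rho> (f s + h s)) \<le> \<dots>" .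
  qed
  also have "\<dots> = 2 * (modular b \<rho> f + modular b \<rho> h)"
    unfolding modular_def by (subst nn_integral_cmult) (auto simp: nn_integral_add)
  finally show ?thesis .
qed

lemma modular_scale:
  assumes [measurable]: "f \<in> borel_measurable borel"
  shows "modular b \<rho> (\<lambda>s. c * f s) \<le> ennreal (max 1 (c\<^sup>2)) * modular b \<rho> f"
proof -
  have "modular b \<rho> (\<lambda>s. c * f s) \<le> (\<integral>\<^sup>+s. ennreal (max 1 (c\<^sup>2)) * ennreal (KK b \<rho> (f s)) \<partial>lborel)"
    unfolding modular_def using KK_scale[OF jm] KK_nonneg[OF jm]
    by (intro nn_integral_mono) (auto simp flip: ennreal_mult intro!: ennreal_leI)
  also have "\<dots> = ennreal (max 1 (c\<^sup>2)) * modular b \<rho> f"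
    unfolding modular_def by (rule nn_integral_cmult) auto
  finally show ?thesis .
qed

lemma modular_scale_finite:
  assumes "f \<in> borel_measurable borel" "modular b \<rho> f < \<infinity>"
  shows "modular b \<rho> (\<lambda>s. c * f s) < \<infinity>"
  by (rule order.strict_trans1[OF modular_scale[OF assms(1)]])
     (use assms(2) in \<open>simp add: ennreal_mult_less_top\<close>)

lemma modular_add_finite:
  assumes "f \<in> borel_measurable borel" "h \<in> borel_measurable borel"
    "modular b \<rho> f < \<infinity>" "modular b \<rho> h < \<infinity>"
  shows "modular b \<rho> (\<lambda>s. f s + h s) < \<infinity>"
  by (rule order.strict_trans1[OF modular_add[OF assms(1,2)]])
     (use assms(3,4) in \<open>simp add: ennreal_mult_less_top\<close>)

lemma modular_sum_finite:
  assumes "finite J" "\<And>j. j \<in> J \<Longrightarrow> f j \<in> borel_measurable borel" "\<And>j. j \<in> J \<Longrightarrow> modular b \<rho> (f j) < \<infinity>"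
  shows "modular b \<rho> (\<lambda>s. \<Sum>j\<in>J. \<theta> j * f j s) < \<infinity>"
  using assms
proof (induction J rule: finite_induct)
  case (insert i J)
  have [measurable]: "f i \<in> borel_measurable borel" "\<And>j. j \<in> J \<Longrightarrow> f j \<in> borel_measurable borel"
    using insert.prems by auto
  have "modular b \<rho> (\<lambda>s. \<theta> i * f i s + (\<Sum>j\<in>J. \<theta> j * f j s)) < \<infinity>"
    by (rule modular_add_finite) (use insert modular_scale_finite in auto)
  then show ?case using insert by simp
qed simp

lemma norm_expo_diff:
  assumes [measurable]: "h \<in> borel_measurable borel" "h' \<in> borel_measurable borel"
    and fin: "modular b \<rho> h < \<infinity>" "modular b \<rho> (\<lambda>s. h' s - h s) < \<infinity>" and e: "0 < e" "e \<le> 1"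
  shows "norm (expo b \<rho> h' - expo b \<rho> h) \<le>
    4 * e * enn2real (modular b \<rho> h) + (9 / e) * enn2real (modular b \<rho> (\<lambda>s. h' s - h s))"
proof -
  have fin': "modular b \<rho> h' < \<infinity>"
    using modular_add_finite[OF _ _ fin] by simp
  have "expo b \<rho> h' - expo b \<rho> h = (CLINT s|lborel. cexp b \<rho> (h s + (h' s - h s)) - cexp b \<rho> (h s))"
    unfolding expo_def using integrable_cexp[of h] integrable_cexp[of h'] fin fin'
    by (subst Bochner_Integration.integral_diff) auto
  also have "norm \<dots> \<le> (LINT s|lborel. 4 * e * KK b \<rho> (h s) + (9 / e) * KK b \<rho> (h' s - h s))"
    by (intro norm_integral_le norm_cexp_add_diff[OF jm e])
       (use integrable_cexp[of h] integrable_cexp[of h'] integrable_KK[of h]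
          integrable_KK[of "\<lambda>s. h' s - h s"] fin fin' in auto)
  also have "\<dots> = 4 * e * enn2real (modular b \<rho> h) + (9 / e) * enn2real (modular b \<rho> (\<lambda>s. h' s - h s))"
    using integral_KK[of h] integral_KK[of "\<lambda>s. h' s - h s"] integrable_KK[of h]
      integrable_KK[of "\<lambda>s. h' s - h s"] fin
    by (subst Bochner_Integration.integral_add) auto
  finally show ?thesis .
qed

text \<open>Order of choices: \<open>e\<close> is small depending on the finite modular of the limit
  \<open>h\<close>, and only then is the index taken so far out that the modular of the error beats
  9/e.\<close>

lemma expo_tendsto:
  assumes [measurable]: "h \<in> borel_measurable borel" "\<And>n. f n \<in> borel_measurable borel"
    and fin: "modular b \<rho> h < \<infinity>" and lim: "((\<lambda>n. modular b \<rho> (\<lambda>s. f n s - h s)) \<longlongrightarrow> 0) F"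
  shows "((\<lambda>n. expo b \<rho> (f n)) \<longlongrightarrow> expo b \<rho> h) F"
proof (rule tendstoI)
  fix r :: real assume r: "0 < r"
  define A where "A = enn2real (modular b \<rho> h)"
  have A: "0 \<le> A" by (simp add: A_def)
  define e where "e = min 1 (r / (8 * (A + 1)))"
  have e: "0 < e" "e \<le> 1" using r A by (auto simp: e_def)
  have "e \<le> r / (8 * (A + 1))" by (simp add: e_def)
  then have "8 * (A + 1) * e \<le> r" using A by (simp add: field_simps)
  then have 1: "4 * e * A < r / 2" using e by (simp add: algebra_simps)
  have "\<forall>\<^sub>F n in F. modular b \<rho> (\<lambda>s. f n s - h s) < ennreal (r * e / 18)"
    using r e by (intro order_tendstoD(2)[OF lim]) auto
  then show "\<forall>\<^sub>F n in F. dist (expo b \<rho> (f n)) (expo b \<rho> h) < r"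
  proof eventually_elim
    case (elim n)
    have fn: "modular b \<rho> (\<lambda>s. f n s - h s) < \<infinity>"
      using elim by (auto intro: order.strict_trans)
    have "enn2real (modular b \<rho> (\<lambda>s. f n s - h s)) < r * e / 18"
      using elim r e fn enn2real_less_iff[OF fn[unfolded infinity_ennreal_def]] by blast
    then have "(9 / e) * enn2real (modular b \<rho> (\<lambda>s. f n s - h s)) < (9 / e) * (r * e / 18)"
      using e by (intro mult_strict_left_mono) auto
    then have "(9 / e) * enn2real (modular b \<rho> (\<lambda>s. f n s - h s)) < r / 2" using e by simp
    then show ?case
      using norm_expo_diff[of h "f n" e, OF _ _ fin fn e] 1 by (simp add: dist_norm A_def)
  qed
qed

end

section \<open>Gliding humps and moment bounds\<close>

text \<open>Convergence of all the factors exp (integral of p k over B) rules out that mass of p k escapes to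
  infinity: otherwise a set B collecting every second hump would violate it.\<close>

lemma gliding_hump:
  fixes p :: "nat \<Rightarrow> 'd::euclidean_space \<Rightarrow> complex"
  assumes int: "\<And>k. integrable lborel (p k)"
    and lim0: "AE s in lborel. (\<lambda>k. p k s) \<longlonglongrightarrow> 0"
    and conv: "\<And>B. B \<in> sets borel \<Longrightarrow> convergent (\<lambda>k. exp (CLINT s:B|lborel. p k s))"
  shows "(\<lambda>k. exp (CLINT s|lborel. p k s)) \<longlonglongrightarrow> 1"
proof -
  have [measurable]: "p k \<in> borel_measurable borel" for k using int[of k] by auto
  \<comment> \<open>A convergent sequence is bounded, so almost every point lies in some
    \<open>D i\<close>. On \<open>D i\<close> all \<open>p k\<close> share an integrable bound, and
    dominated convergence applies.\<close>
  define D where "D i = {s. norm s \<le> real i \<and> (\<forall>k. norm (p k s) \<le> real i)}" for i :: nat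
  have [measurable]: "D i \<in> sets borel" for i unfolding D_def by measurable
  have Dmono: "D i \<subseteq> D j" if "i \<le> j" for i j
    using that unfolding D_def by (smt (verit) Collect_mono of_nat_le_iff)
  define J where "J k S = (LINT s|lborel. indicator S s * norm (p k s))" for k and S :: "'d set"
  have intJ: "integrable lborel (\<lambda>s. indicator S s * norm (p k s))" if [measurable]: "S \<in> sets borel" for k S
    by (rule Bochner_Integration.integrable_bound[OF integrable_norm[OF int[of k]]]) (auto simp: indicator_def)
  have J1: "(\<lambda>k. J k (D i)) \<longlonglongrightarrow> 0" for i
  proof -
    have "(\<lambda>k. J k (D i)) \<longlonglongrightarrow> (LINT s|(lborel :: 'd measure). 0)"
      unfolding J_def
    proof (rule integral_dominated_convergence)
      show "integrable lborel (\<lambda>s. real i * indicator (cball (0::'d) (real i)) s)"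
        by (rule integrable_mult_right, rule integrable_real_indicator[OF _ emeasure_lborel_cball_finite]) simp
      show "AE s in lborel. (\<lambda>k. indicator (D i) s * norm (p k s)) \<longlonglongrightarrow> 0"
        using lim0
      proof eventually_elim
        case (elim s)
        then show ?case by (intro tendsto_mult_right_zero tendsto_norm_zero)
      qed
      show "AE s in lborel. norm (indicator (D i) s * norm (p k s)) \<le> real i * indicator (cball 0 (real i)) s" for k
        by (auto simp: indicator_def D_def)
    qed auto
    then show ?thesis by simp
  qed
  have J2: "(\<lambda>i. J k (- D i)) \<longlonglongrightarrow> 0" for k
  proof -
    have "(\<lambda>i. J k (- D i)) \<longlonglongrightarrow> (LINT s|(lborel :: 'd measure). 0)"
      unfolding J_def
    proof (rule integral_dominated_convergence)
      show "integrable lborel (\<lambda>s. norm (p k s))" using int by auto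
      show "AE s in lborel. (\<lambda>i. indicator (- D i) s * norm (p k s)) \<longlonglongrightarrow> 0"
        using lim0
      proof eventually_elim
        case (elim s)
        then have "Bseq (\<lambda>k. p k s)" by (intro convergent_imp_Bseq convergentI)
        then obtain K where K: "\<And>k. norm (p k s) \<le> K" by (auto simp: Bseq_def)
        obtain i0 :: nat where i0: "max K (norm s) \<le> real i0" using real_arch_simple by blast
        have "eventually (\<lambda>i. indicator (- D i) s * norm (p k s) = 0) sequentially"
          using eventually_ge_at_top[of i0]
        proof eventually_elim
          case (elim i)
          then have "real i0 \<le> real i" by simp
          then have "s \<in> D i" using i0 K order_trans unfolding D_def by (smt (verit) mem_Collect_eq)
          then show ?case by simp
        qed
        then show ?case by (rule tendsto_eventually)
      qed
    qed (auto simp: indicator_def)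
    then show ?thesis by simp
  qed
  \<comment> \<open>A pair (k, i) records two alternating choices: \<open>k\<close> so late that
    \<open>p k\<close> has little mass on the previous set \<open>D\<close>, and \<open>i\<close> so
    large that it has little mass outside the next one. Hence \<open>p k\<close> lives essentially
    in a shell.\<close>
  define Q where "Q n x \<longleftrightarrow> J (fst x) (- D (snd x)) < (1/2) ^ n" for n and x :: "nat \<times> nat"
  define R where "R n x x' \<longleftrightarrow> fst x < fst x' \<and> snd x \<le> snd x' \<and> J (fst x') (D (snd x)) < (1/2) ^ n"
    for n and x x' :: "nat \<times> nat"
  have "\<exists>f. \<forall>n. Q n (f n) \<and> R n (f n) (f (Suc n))"
  proof (rule dependent_nat_choice)
    have "\<forall>\<^sub>F i in sequentially. J 0 (- D i) < (1/2) ^ 0"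
      unfolding power_0 by (rule order_tendstoD(2)[OF J2 zero_less_one])
    then obtain i where "J 0 (- D i) < (1/2) ^ 0" by (auto dest: eventually_happens)
    then show "\<exists>x. Q 0 x" by (auto simp: Q_def intro!: exI[of _ "(0, i)"])
  next
    fix x :: "nat \<times> nat" and n
    have half: "0 < (1/2::real) ^ n" for n by simp
    have "\<forall>\<^sub>F k in sequentially. J k (D (snd x)) < (1/2) ^ n" by (rule order_tendstoD(2)[OF J1 half])
    then have "\<forall>\<^sub>F k in sequentially. J k (D (snd x)) < (1/2) ^ n \<and> fst x < k"
      by (intro eventually_conj eventually_gt_at_top)
    then obtain k where k: "J k (D (snd x)) < (1/2) ^ n" "fst x < k" by (auto dest: eventually_happens)
    have "\<forall>\<^sub>F i in sequentially. J k (- D i) < (1/2) ^ Suc n" by (rule order_tendstoD(2)[OF J2 half])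
    then have "\<forall>\<^sub>F i in sequentially. J k (- D i) < (1/2) ^ Suc n \<and> snd x \<le> i"
      by (intro eventually_conj eventually_ge_at_top)
    then obtain i where "J k (- D i) < (1/2) ^ Suc n" "snd x \<le> i" by (auto dest: eventually_happens)
    then show "\<exists>x'. Q (Suc n) x' \<and> R n x x'" using k
      by (auto simp: Q_def R_def intro!: exI[of _ "(k, i)"])
  qed
  then obtain f where Q: "\<And>n. Q n (f n)" and R: "\<And>n. R n (f n) (f (Suc n))" by blast
  \<comment> \<open>The shift by one pairs the function chosen at step n + 1 with the set chosen at
    step n, so that the nth hump sits between \<open>D (i n)\<close> and
    \<open>D (i (Suc n))\<close>.\<close>
  define k where "k n = fst (f (Suc n))" for n
  define i where "i n = snd (f n)" for n
  have k_mono: "strict_mono k" unfolding strict_mono_Suc_iff using R by (auto simp: R_def k_def)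
  have i_mono: "mono i" unfolding mono_iff_le_Suc using R by (auto simp: R_def i_def)
  have Ja: "J (k n) (D (i n)) < (1/2) ^ n" for n using R by (auto simp: R_def i_def k_def)
  have Jb: "J (k n) (- D (i (Suc n))) < (1/2) ^ n" for n
  proof -
    have "J (k n) (- D (i (Suc n))) < (1/2) ^ Suc n" using Q[of "Suc n"] by (auto simp: Q_def i_def k_def)
    also have "\<dots> \<le> (1/2) ^ n" by simp
    finally show ?thesis .
  qed
  define A where "A n = D (i (Suc n)) - D (i n)" for n
  \<comment> \<open>Collecting every second shell makes the integrals over \<open>B\<close> nearly
    zero along odd humps and nearly equal to the full integrals along even ones.\<close>
  define B where "B = (\<Union>n\<in>{n. even n}. A n)"
  have [measurable]: "A n \<in> sets borel" for n unfolding A_def by measurable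
  have Bm [measurable]: "B \<in> sets borel" unfolding B_def by measurable
  have A_disj: "m = n" if "s \<in> A m" "s \<in> A n" for s m n
  proof (rule ccontr)
    assume "m \<noteq> n"
    then consider "Suc m \<le> n" | "Suc n \<le> m" by linarith
    then show False
    proof cases
      case 1
      from monoD[OF i_mono 1] have "D (i (Suc m)) \<subseteq> D (i n)" by (rule Dmono)
      then show ?thesis using that by (auto simp: A_def)
    next
      case 2
      from monoD[OF i_mono 2] have "D (i (Suc n)) \<subseteq> D (i m)" by (rule Dmono)
      then show ?thesis using that by (auto simp: A_def)
    qed
  qed
  define a where "a n = (CLINT s|lborel. p (k n) s)" for n
  define c where "c n = (CLINT s:B|lborel. p (k n) s)" for n
  have close: "norm (c n - of_bool (even n) * a n) \<le> 2 * (1/2) ^ n" for n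
  proof -
    have "c n - of_bool (even n) * a n =
        (CLINT s|lborel. indicator B s *\<^sub>R p (k n) s - of_bool (even n) * p (k n) s)"
      unfolding c_def a_def set_lebesgue_integral_def
      using int integrable_mult_indicator[OF _ int, of B]
      by (subst Bochner_Integration.integral_diff) auto
    also have "norm \<dots> \<le> (LINT s|lborel. indicator (D (i n)) s * norm (p (k n) s)
        + indicator (- D (i (Suc n))) s * norm (p (k n) s))"
    proof (rule norm_integral_le)
      show "integrable lborel (\<lambda>s. indicator B s *\<^sub>R p (k n) s - of_bool (even n) * p (k n) s)"
        using int integrable_mult_indicator[OF _ int, of B] by auto
      show "integrable lborel (\<lambda>s. indicator (D (i n)) s * norm (p (k n) s)
        + indicator (- D (i (Suc n))) s * norm (p (k n) s))"
        by (intro Bochner_Integration.integrable_add intJ) auto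
      fix s
      show "norm (indicator B s *\<^sub>R p (k n) s - of_bool (even n) * p (k n) s) \<le>
        indicator (D (i n)) s * norm (p (k n) s) + indicator (- D (i (Suc n))) s * norm (p (k n) s)"
      proof (cases "s \<in> A n")
        case True
        then have "s \<in> B \<longleftrightarrow> even n" using A_disj by (auto simp: B_def)
        then show ?thesis by (auto simp: indicator_def)
      next
        case False
        then have "1 \<le> indicator (D (i n)) s + (indicator (- D (i (Suc n))) s :: real)"
          by (auto simp: A_def indicator_def)
        then have "1 * norm (p (k n) s) \<le> (indicator (D (i n)) s + indicator (- D (i (Suc n))) s) * norm (p (k n) s)"
          by (intro mult_right_mono) auto
        moreover have "norm (indicator B s *\<^sub>R p (k n) s - of_bool (even n) * p (k n) s) \<le> norm (p (k n) s)"
          by (auto simp: indicator_def)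
        ultimately show ?thesis by (simp add: algebra_simps)
      qed
    qed
    also have "\<dots> = J (k n) (D (i n)) + J (k n) (- D (i (Suc n)))"
      unfolding J_def by (intro Bochner_Integration.integral_add intJ) auto
    finally show ?thesis using Ja[of n] Jb[of n] by simp
  qed
  have lim_close: "(\<lambda>n. c n - of_bool (even n) * a n) \<longlonglongrightarrow> 0"
  proof (rule Lim_null_comparison)
    show "\<forall>\<^sub>F n in sequentially. norm (c n - of_bool (even n) * a n) \<le> 2 * (1/2) ^ n"
      using close by simp
    show "(\<lambda>n. 2 * (1/2::real) ^ n) \<longlonglongrightarrow> 0" by (intro tendsto_mult_right_zero LIMSEQ_power_zero) auto
  qed
  obtain w where w: "(\<lambda>k. exp (CLINT s:B|lborel. p k s)) \<longlonglongrightarrow> w"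
    using conv[OF Bm] by (auto simp: convergent_def)
  have cw: "(\<lambda>n. exp (c n)) \<longlonglongrightarrow> w"
    using LIMSEQ_subseq_LIMSEQ[OF w k_mono] by (simp add: c_def o_def)
  obtain w' where w': "(\<lambda>k. exp (CLINT s|lborel. p k s)) \<longlonglongrightarrow> w'"
    using conv[of UNIV] by (auto simp: convergent_def set_lebesgue_integral_def)
  have aw: "(\<lambda>n. exp (a n)) \<longlonglongrightarrow> w'"
    using LIMSEQ_subseq_LIMSEQ[OF w' k_mono] by (simp add: a_def o_def)
  have so: "strict_mono (\<lambda>n. 2 * n + 1 :: nat)" and se: "strict_mono (\<lambda>n. 2 * n :: nat)"
    by (auto simp: strict_mono_def)
  have e0: "(\<lambda>n. exp (c n - of_bool (even n) * a n)) \<longlonglongrightarrow> 1"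
    using tendsto_exp[OF lim_close] by simp
  \<comment> \<open>Odd humps force the limit \<open>w\<close> belonging to \<open>B\<close> to be
    1, even humps force it to equal the limit \<open>w'\<close> belonging to the whole
    space.\<close>
  have "(\<lambda>n. exp (c (2 * n + 1))) \<longlonglongrightarrow> 1"
    using LIMSEQ_subseq_LIMSEQ[OF e0 so] by (simp add: o_def)
  with LIMSEQ_subseq_LIMSEQ[OF cw so] have "w = 1" by (auto simp: o_def intro: LIMSEQ_unique)
  have "(\<lambda>n. exp (c (2 * n) - a (2 * n))) \<longlonglongrightarrow> 1"
    using LIMSEQ_subseq_LIMSEQ[OF e0 se] by (simp add: o_def)
  then have "(\<lambda>n. exp (a (2 * n)) * exp (c (2 * n) - a (2 * n))) \<longlonglongrightarrow> w' * 1"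
    using LIMSEQ_subseq_LIMSEQ[OF aw se] by (intro tendsto_mult) (auto simp: o_def)
  then have "(\<lambda>n. exp (c (2 * n))) \<longlonglongrightarrow> w'" by (simp flip: exp_add)
  with LIMSEQ_subseq_LIMSEQ[OF cw se] have "w = w'" by (auto simp: o_def intro: LIMSEQ_unique)
  with w' \<open>w = 1\<close> show ?thesis by simp
qed

section \<open>Cosine integrals and first absolute moments\<close>

lemma one_minus_cos_le: "1 - cos (w::real) \<le> w\<^sup>2 / 2"
  using iexp_approx1[of w 1] complex_Re_le_cmod[of "-(iexp w - (\<Sum>k \<le> 1. (\<i> * w)^k / fact k))"]
  by (simp add: power2_eq_square Re_exp norm_minus_commute)

lemma one_minus_cos_ge:
  assumes "\<bar>w\<bar> \<le> (1::real)" shows "w\<^sup>2 / 4 \<le> 1 - cos w"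
proof -
  have sum: "(\<Sum>k \<le> 3. (\<i> * w)^k / fact k) = 1 + \<i> * w - w^2 / 2 - \<i> * (w ^ 3 / 6)"
    by (simp add: eval_nat_numeral power_mult_distrib algebra_simps)
  have "\<bar>Re (iexp w - (\<Sum>k \<le> 3. (\<i> * w)^k / fact k))\<bar> \<le> \<bar>w\<bar> ^ Suc 3 / fact (Suc 3)"
    by (rule order_trans[OF abs_Re_le_cmod iexp_approx1])
  moreover have "Re (iexp w - (\<Sum>k \<le> 3. (\<i> * w)^k / fact k)) = cos w - 1 + w\<^sup>2 / 2"
    unfolding sum by (simp add: Re_exp)
  moreover have "\<bar>w\<bar> ^ Suc 3 / fact (Suc 3) = w ^ 4 / 24"
    by (simp add: fact_numeral power_even_abs_numeral eval_nat_numeral)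
  ultimately have 1: "\<bar>cos w - 1 + w\<^sup>2 / 2\<bar> \<le> w ^ 4 / 24" by (simp only:)
  have "w ^ 4 \<le> w\<^sup>2"
    using assms power_decreasing[of 2 4 "\<bar>w\<bar>"] by simp
  moreover have "cos w - 1 + w\<^sup>2 / 2 \<le> w ^ 4 / 24" using 1 by (rule abs_le_D1)
  moreover have "0 \<le> w\<^sup>2" by simp
  ultimately show ?thesis by linarith
qed

lemma sq_div_self: "r \<noteq> 0 \<Longrightarrow> r * r / c * (1 / r) = r / c" for r c :: real
  by simp

lemma nn_integral_inverse_square:
  assumes "0 < (a::real)"
  shows "(\<integral>\<^sup>+t. ennreal (2 / t\<^sup>2) * indicator {a..} t \<partial>lborel) = ennreal (2 / a)"
proof -
  have "(\<integral>\<^sup>+t. ennreal (2 / t\<^sup>2) * indicator {a..} t \<partial>lborel) = 0 - (- 2 / a)"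
  proof (rule nn_integral_FTC_atLeast)
    show "((\<lambda>t::real. - 2 / t) has_real_derivative 2 / t\<^sup>2) (at t)" if "a \<le> t" for t
      using that assms by (auto intro!: derivative_eq_intros simp: power2_eq_square)
    show "((\<lambda>t::real. - 2 / t) \<longlongrightarrow> 0) at_top" by (rule tendsto_divide_0[OF tendsto_const filterlim_at_top_imp_at_infinity[OF filterlim_ident]])
  qed auto
  then show ?thesis by simp
qed

text \<open>The integral is in fact pi |y| / 2; the range t <= 1/|y| alone, where 1 - cos is at
  least a quarter of the square, already gives |y|/4. It expresses a first moment through real parts
  of a characteristic function.\<close>

lemma abs_le_nn_integral_cos:
  "ennreal (\<bar>y\<bar> / 4) \<le> (\<integral>\<^sup>+t. ennreal ((1 - cos (t * y)) / t\<^sup>2) * indicator {0<..} t \<partial>lborel)"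
proof (cases "y = 0")
  case y0: False
  have "(\<integral>\<^sup>+t. ennreal (y\<^sup>2 / 4) * indicator {0<..1 / \<bar>y\<bar>} t \<partial>lborel) = ennreal (y\<^sup>2 / 4) * ennreal (1 / \<bar>y\<bar>)"
    by (subst nn_integral_cmult_indicator) auto
  also have "\<dots> = ennreal (y\<^sup>2 / 4 * (1 / \<bar>y\<bar>))" by (rule ennreal_mult[symmetric]) auto
  also have "y\<^sup>2 / 4 * (1 / \<bar>y\<bar>) = \<bar>y\<bar> / 4"
    unfolding power2_eq_square by (rule sq_div_self[of "\<bar>y\<bar>" 4, unfolded abs_mult_self_eq abs_eq_0, OF y0])
  finally have "ennreal (\<bar>y\<bar> / 4) = (\<integral>\<^sup>+t. ennreal (y\<^sup>2 / 4) * indicator {0<..1 / \<bar>y\<bar>} t \<partial>lborel)"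
    by (rule sym)
  also have "\<dots> \<le> (\<integral>\<^sup>+t. ennreal ((1 - cos (t * y)) / t\<^sup>2) * indicator {0<..} t \<partial>lborel)"
  proof (rule nn_integral_mono)
    fix t :: real
    show "ennreal (y\<^sup>2 / 4) * indicator {0<..1 / \<bar>y\<bar>} t \<le> ennreal ((1 - cos (t * y)) / t\<^sup>2) * indicator {0<..} t"
    proof (cases "t \<in> {0<..1 / \<bar>y\<bar>}")
      case True
      then have "\<bar>t * y\<bar> \<le> 1" using y0 by (simp add: abs_mult field_simps)
      from one_minus_cos_ge[OF this] have "y\<^sup>2 / 4 \<le> (1 - cos (t * y)) / t\<^sup>2"
        using True by (simp add: field_simps power_mult_distrib)
      then show ?thesis using True by (auto intro!: ennreal_leI)
    qed auto
  qed
  finally show ?thesis .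
qed simp

text \<open>The cutoff \<open>T\<close> matters: over the whole half-line the integral is of order
  |y|, which \<open>kf\<close> does not dominate near 0. For |y| <= 1 the integrand is at most y^2/2
  and \<open>T\<close> is the length of the range; for larger |y| a split at 1/|y| gives 5/2 |y|,
  within \<open>6 * kf y\<close>.\<close>

lemma nn_integral_cos_le:
  assumes "1 \<le> T"
  shows "(\<integral>\<^sup>+t. ennreal ((1 - cos (t * y)) / t\<^sup>2) * indicator {0<..T} t \<partial>lborel) \<le> ennreal ((T + 6) * kf y)"
proof (cases "\<bar>y\<bar> \<le> 1")
  case True
  have "(\<integral>\<^sup>+t. ennreal ((1 - cos (t * y)) / t\<^sup>2) * indicator {0<..T} t \<partial>lborel) \<le>
      (\<integral>\<^sup>+t. ennreal (y\<^sup>2 / 2) * indicator {0<..T} t \<partial>lborel)"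
  proof (rule nn_integral_mono)
    fix t :: real
    show "ennreal ((1 - cos (t * y)) / t\<^sup>2) * indicator {0<..T} t \<le> ennreal (y\<^sup>2 / 2) * indicator {0<..T} t"
    proof (cases "t \<in> {0<..T}")
      case True
      have "(1 - cos (t * y)) / t\<^sup>2 \<le> y\<^sup>2 / 2"
        using one_minus_cos_le[of "t * y"] True by (simp add: field_simps power_mult_distrib)
      then show ?thesis using True by (auto intro!: ennreal_leI)
    qed auto
  qed
  also have "\<dots> = ennreal (y\<^sup>2 / 2 * T)"
    using assms by (subst nn_integral_cmult_indicator) (auto simp flip: ennreal_mult)
  also have "\<dots> \<le> ennreal ((T + 6) * kf y)"
  proof (rule ennreal_leI)
    have "y\<^sup>2 / 2 * T \<le> kf y * T" using sq_le_kf[OF True] assms by (intro mult_right_mono) auto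
    also have "\<dots> \<le> (T + 6) * kf y" by (simp add: algebra_simps)
    finally show "y\<^sup>2 / 2 * T \<le> (T + 6) * kf y" .
  qed
  finally show ?thesis .
next
  case False
  then have y0: "y \<noteq> 0" by auto
  have "(\<integral>\<^sup>+t. ennreal ((1 - cos (t * y)) / t\<^sup>2) * indicator {0<..T} t \<partial>lborel) \<le>
      (\<integral>\<^sup>+t. ennreal (y\<^sup>2 / 2) * indicator {0<..1/\<bar>y\<bar>} t + ennreal (2 / t\<^sup>2) * indicator {1/\<bar>y\<bar>..} t \<partial>lborel)"
  proof (rule nn_integral_mono)
    fix t :: real
    show "ennreal ((1 - cos (t * y)) / t\<^sup>2) * indicator {0<..T} t \<le>
      ennreal (y\<^sup>2 / 2) * indicator {0<..1/\<bar>y\<bar>} t + ennreal (2 / t\<^sup>2) * indicator {1/\<bar>y\<bar>..} t"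
    proof (cases "0 < t")
      case t: True
      have 1: "(1 - cos (t * y)) / t\<^sup>2 \<le> y\<^sup>2 / 2"
        using one_minus_cos_le[of "t * y"] t by (simp add: field_simps power_mult_distrib)
      have 2: "(1 - cos (t * y)) / t\<^sup>2 \<le> 2 / t\<^sup>2"
        using cos_ge_minus_one[of "t * y"] by (intro divide_right_mono) auto
      show ?thesis
      proof (cases "t \<le> 1 / \<bar>y\<bar>")
        case True
        then have "ennreal (y\<^sup>2 / 2) * indicator {0<..1/\<bar>y\<bar>} t = ennreal (y\<^sup>2 / 2)" using t by simp
        moreover have "ennreal ((1 - cos (t * y)) / t\<^sup>2) * indicator {0<..T} t \<le> ennreal (y\<^sup>2 / 2)"
          using 1 by (auto simp: indicator_def intro!: ennreal_leI)
        ultimately show ?thesis using add_increasing2 by (metis zero_le)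
      next
        case False
        then have "ennreal (2 / t\<^sup>2) * indicator {1/\<bar>y\<bar>..} t = ennreal (2 / t\<^sup>2)" by simp
        moreover have "ennreal ((1 - cos (t * y)) / t\<^sup>2) * indicator {0<..T} t \<le> ennreal (2 / t\<^sup>2)"
          using 2 by (auto simp: indicator_def intro!: ennreal_leI)
        ultimately show ?thesis using add_increasing by (metis zero_le)
      qed
    qed auto
  qed
  also have "\<dots> = (\<integral>\<^sup>+t. ennreal (y\<^sup>2 / 2) * indicator {0<..1/\<bar>y\<bar>} t \<partial>lborel) +
      (\<integral>\<^sup>+t. ennreal (2 / t\<^sup>2) * indicator {1/\<bar>y\<bar>..} t \<partial>lborel)"
    by (rule nn_integral_add) auto
  also have "(\<integral>\<^sup>+t. ennreal (y\<^sup>2 / 2) * indicator {0<..1/\<bar>y\<bar>} t \<partial>lborel) = ennreal (y\<^sup>2 / 2) * ennreal (1 / \<bar>y\<bar>)"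
    by (subst nn_integral_cmult_indicator) auto
  also have "\<dots> = ennreal (y\<^sup>2 / 2 * (1 / \<bar>y\<bar>))" by (rule ennreal_mult[symmetric]) auto
  also have "y\<^sup>2 / 2 * (1 / \<bar>y\<bar>) = \<bar>y\<bar> / 2"
    unfolding power2_eq_square by (rule sq_div_self[of "\<bar>y\<bar>" 2, unfolded abs_mult_self_eq abs_eq_0, OF y0])
  also have "(\<integral>\<^sup>+t. ennreal (2 / t\<^sup>2) * indicator {1/\<bar>y\<bar>..} t \<partial>lborel) = ennreal (2 * \<bar>y\<bar>)"
    using False nn_integral_inverse_square[of "1 / \<bar>y\<bar>"] by simp
  also have "ennreal (\<bar>y\<bar> / 2) + ennreal (2 * \<bar>y\<bar>) = ennreal (5 / 2 * \<bar>y\<bar>)"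
    by (subst ennreal_plus[symmetric]) auto
  also have "\<dots> \<le> ennreal ((T + 6) * kf y)"
  proof (rule ennreal_leI)
    have "5 / 2 * \<bar>y\<bar> \<le> 6 * kf y" using abs_le_kf_of_ge_1[of y] False by simp
    also have "\<dots> \<le> (T + 6) * kf y" using assms by (intro mult_right_mono) auto
    finally show "5 / 2 * \<bar>y\<bar> \<le> (T + 6) * kf y" .
  qed
  finally show ?thesis .
qed

text \<open>The imaginary part of the exponent enters quadratically, and so contributes a term of
  second order in the modular to the moment estimate.\<close>

lemma one_minus_Re_exp_le:
  assumes "Re z \<le> 0" shows "1 - Re (exp z) \<le> - Re z + (Im z)\<^sup>2 / 2"
proof -
  have "1 - Re (exp z) = (1 - exp (Re z)) + exp (Re z) * (1 - cos (Im z))"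
    by (simp add: Re_exp algebra_simps)
  also have "1 - exp (Re z) \<le> - Re z" using exp_ge_add_one_self[of "Re z"] by linarith
  also have "exp (Re z) * (1 - cos (Im z)) \<le> 1 * (1 - cos (Im z))"
    using assms by (intro mult_right_mono) auto
  also have "1 * (1 - cos (Im z)) \<le> (Im z)\<^sup>2 / 2" using one_minus_cos_le[of "Im z"] by simp
  finally show ?thesis by simp
qed

lemma kf_scale_upto:
  assumes "0 < t" "t \<le> T" "1 \<le> T" shows "kf (t * y) \<le> t * T * kf y"
proof (cases "t \<le> 1")
  case True
  then have "kf (t * y) \<le> t * kf y" using kf_scale_le_1[of t y] assms by simp
  also have "\<dots> \<le> t * T * kf y" using assms by (intro mult_right_mono) auto
  finally show ?thesis .
next
  case False
  then have "max 1 (t\<^sup>2) = t\<^sup>2" by (simp add: max_def)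
  then have "kf (t * y) \<le> t\<^sup>2 * kf y" using kf_scale[of t y] by simp
  also have "\<dots> \<le> t * T * kf y" unfolding power2_eq_square using assms by (intro mult_right_mono mult_left_mono) auto
  finally show ?thesis .
qed

lemma abs_le_square_of_le: "\<bar>x\<bar> \<le> y \<Longrightarrow> x\<^sup>2 \<le> y\<^sup>2" for x y :: real
  using power_mono[of "\<bar>x\<bar>" y 2] by simp

lemma nn_integral_one_minus_cos:
  assumes M: "prob_space M" and Y: "Y \<in> borel_measurable M"
  shows "(\<integral>\<^sup>+\<omega>. ennreal (1 - cos (t * Y \<omega>)) \<partial>M) = ennreal (1 - Re (CLINT \<omega>|M. iexp (t * Y \<omega>)))"
proof -
  interpret prob_space M by fact
  note [measurable] = Y
  have i: "integrable M (\<lambda>\<omega>. cos (t * Y \<omega>))"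
    by (rule integrable_const_bound[of _ 1]) auto
  have i': "integrable M (\<lambda>\<omega>. iexp (t * Y \<omega>))"
    by (rule integrable_const_bound[of _ 1]) auto
  have "(\<integral>\<^sup>+\<omega>. ennreal (1 - cos (t * Y \<omega>)) \<partial>M) = ennreal (LINT \<omega>|M. 1 - cos (t * Y \<omega>))"
    using i by (intro nn_integral_eq_integral) auto
  also have "(LINT \<omega>|M. 1 - cos (t * Y \<omega>)) = 1 - (LINT \<omega>|M. cos (t * Y \<omega>))"
    using i by (simp add: prob_space)
  also have "(LINT \<omega>|M. cos (t * Y \<omega>)) = Re (CLINT \<omega>|M. iexp (t * Y \<omega>))"
    using integral_Re[OF i'] by (simp add: Re_exp)
  finally show ?thesis .
qed

lemma measurable_pair_lborel:
  "f \<in> measurable (M \<Otimes>\<^sub>M borel) K \<Longrightarrow> f \<in> measurable (M \<Otimes>\<^sub>M lborel) K"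
  using measurable_cong_sets[OF sets_pair_measure_cong[OF refl sets_lborel] refl] by blast

text \<open>Integrates 1 minus the real part of the characteristic function against dt/t^2, as
  \<open>abs_le_nn_integral_cos\<close> suggests. Beyond \<open>T\<close> the trivial bound 2 leaves
  2/T; below \<open>T\<close> the real and imaginary parts of the exponent are controlled by
  \<open>v\<close> and \<open>\<kappa>\<close>. For fixed \<open>T\<close> every term but 2/T
  vanishes with \<open>v\<close> and \<open>\<kappa>\<close>, so a small modular implies a small
  first moment.\<close>

lemma moment_bound:
  fixes Y :: "'m \<Rightarrow> real" and y :: "'z \<Rightarrow> real"
  assumes M: "prob_space M" and Y [measurable]: "Y \<in> borel_measurable M"
    and N: "sigma_finite_measure N" and y [measurable]: "y \<in> borel_measurable N"
    and int: "integrable N (\<lambda>z. kf (y z))" and v: "0 \<le> v" and T: "1 \<le> T"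
    and char: "\<And>t. 0 < t \<Longrightarrow> (CLINT \<omega>|M. iexp (t * Y \<omega>)) =
      exp (- of_real (v * t\<^sup>2 / 2) + (CLINT z|N. ek (t * y z)))"
  defines "\<kappa> \<equiv> LINT z|N. kf (y z)"
  shows "(\<integral>\<^sup>+\<omega>. ennreal \<bar>Y \<omega>\<bar> \<partial>M) \<le>
    ennreal (4 * (2 / T + v / 2 * T + (T + 6) * \<kappa> + 8 * T\<^sup>2 * \<kappa>\<^sup>2 * T))"
proof -
  interpret M: prob_space M by fact
  interpret N: sigma_finite_measure N by fact
  interpret P: pair_sigma_finite M lborel ..
  interpret PN: pair_sigma_finite N lborel ..
  define h where "h w t = ennreal ((1 - cos (t * w)) / t\<^sup>2)" for w t :: real
  have h_meas [measurable]: "case_prod h \<in> borel_measurable (borel \<Otimes>\<^sub>M borel)"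
    unfolding h_def by measurable
  have ind_meas [measurable]: "(indicator A :: real \<Rightarrow> ennreal) \<in> borel_measurable borel"
    if "A \<in> sets borel" for A
    using that by simp
  have Hm: "(\<lambda>x. h (Y (fst x)) (snd x) * indicator {0<..} (snd x)) \<in> borel_measurable (M \<Otimes>\<^sub>M lborel)"
    by (rule measurable_pair_lborel) (unfold h_def, measurable)
  have HN: "(\<lambda>x. h (y (fst x)) (snd x) * indicator {0<..T} (snd x)) \<in> borel_measurable (N \<Otimes>\<^sub>M lborel)"
    by (rule measurable_pair_lborel) (unfold h_def, measurable)
  have \<kappa>: "0 \<le> \<kappa>" by (simp add: \<kappa>_def)
  have int_t: "integrable N (\<lambda>z. kf (t * y z))" for t
  proof (rule Bochner_Integration.integrable_bound)
    show "integrable N (\<lambda>z. max 1 (t\<^sup>2) * kf (y z))" using int by simp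
    show "AE z in N. norm (kf (t * y z)) \<le> norm (max 1 (t\<^sup>2) * kf (y z))"
      using kf_scale[of t] by (auto intro: order_trans[OF _ abs_ge_self])
  qed measurable
  have int_ek: "integrable N (\<lambda>z. ek (t * y z))" for t
  proof (rule Bochner_Integration.integrable_bound)
    show "integrable N (\<lambda>z. 4 * kf (t * y z))" using int_t by simp
  qed (use norm_ek_le in auto)
  define a where "a t = - of_real (v * t\<^sup>2 / 2) + (CLINT z|N. ek (t * y z))" for t
  have Re_int: "(LINT z|N. 1 - cos (t * y z)) = - Re (CLINT z|N. ek (t * y z))"
    and int_cos: "integrable N (\<lambda>z. 1 - cos (t * y z))" for t
  proof -
    have "integrable N (\<lambda>z. - Re (ek (t * y z)))" using int_ek by auto
    then show "integrable N (\<lambda>z. 1 - cos (t * y z))" by (simp add: ek_def Re_exp)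
    have "(LINT z|N. - Re (ek (t * y z))) = - Re (CLINT z|N. ek (t * y z))"
      using int_ek by simp
    then show "(LINT z|N. 1 - cos (t * y z)) = - Re (CLINT z|N. ek (t * y z))" by (simp add: ek_def Re_exp)
  qed
  have Re_a: "- Re (a t) = v * t\<^sup>2 / 2 + (LINT z|N. 1 - cos (t * y z))" for t
    by (simp add: a_def Re_int)
  have cos_nonneg: "0 \<le> (LINT z|N. 1 - cos (t * y z))" for t
    by (rule integral_nonneg_AE) simp
  have Re_a_le: "Re (a t) \<le> 0" for t
  proof -
    have "0 \<le> v * t\<^sup>2 / 2" using v by simp
    then show ?thesis using Re_a[of t] cos_nonneg[of t] by linarith
  qed
  have Im_a: "\<bar>Im (a t)\<bar> \<le> 4 * (t * T * \<kappa>)" if t: "0 < t" "t \<le> T" for t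
  proof -
    have "Im (a t) = Im (CLINT z|N. ek (t * y z))" by (simp add: a_def)
    then have "\<bar>Im (a t)\<bar> \<le> norm (CLINT z|N. ek (t * y z))" using abs_Im_le_cmod by metis
    also have "\<dots> \<le> (LINT z|N. 4 * (t * T * kf (y z)))"
    proof (rule norm_integral_le[OF int_ek])
      show "norm (ek (t * y z)) \<le> 4 * (t * T * kf (y z))" for z
        using norm_ek_le[of "t * y z"] kf_scale_upto[OF t T, of "y z"] by linarith
    qed (use int in simp)
    finally show ?thesis by (simp add: \<kappa>_def)
  qed
  \<comment> \<open>What is constant in t after division by t^2: the Gaussian part, and half the
    square of the bound \<open>4 * (t * T * \<kappa>)\<close> for the imaginary part.\<close>
  define C where "C = v / 2 + 8 * T\<^sup>2 * \<kappa>\<^sup>2"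
  have C: "0 \<le> C" using v by (simp add: C_def)
  have low: "(1 - Re (exp (a t))) / t\<^sup>2 \<le> C + (LINT z|N. (1 - cos (t * y z)) / t\<^sup>2)"
    if t: "0 < t" "t \<le> T" for t
  proof -
    have "(Im (a t))\<^sup>2 \<le> (4 * (t * T * \<kappa>))\<^sup>2"
      by (rule abs_le_square_of_le[OF Im_a[OF t]])
    then have I: "(Im (a t))\<^sup>2 / 2 \<le> 8 * T\<^sup>2 * \<kappa>\<^sup>2 * t\<^sup>2" by (simp add: power_mult_distrib mult_ac)
    have "1 - Re (exp (a t)) \<le> v * t\<^sup>2 / 2 + (LINT z|N. 1 - cos (t * y z)) + 8 * T\<^sup>2 * \<kappa>\<^sup>2 * t\<^sup>2"
      using one_minus_Re_exp_le[OF Re_a_le[of t]] I unfolding Re_a by linarith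
    also have "\<dots> = (C + (LINT z|N. 1 - cos (t * y z)) / t\<^sup>2) * t\<^sup>2"
      using t by (simp add: C_def algebra_simps)
    finally show ?thesis using t by (simp add: divide_le_eq)
  qed
  have high: "(1 - Re (exp (a t))) / t\<^sup>2 \<le> 2 / t\<^sup>2" for t
  proof (rule divide_right_mono)
    have "\<bar>Re (exp (a t))\<bar> \<le> norm (exp (a t))" by (rule abs_Re_le_cmod)
    also have "\<dots> \<le> 1" using Re_a_le[of t] by simp
    finally show "1 - Re (exp (a t)) \<le> 2" by linarith
  qed simp
  have hN: "(\<integral>\<^sup>+z. h (y z) t \<partial>N) = ennreal (LINT z|N. (1 - cos (t * y z)) / t\<^sup>2)" for t
    unfolding h_def using int_cos[of t] by (intro nn_integral_eq_integral) auto
  have hM: "(\<integral>\<^sup>+\<omega>. h (Y \<omega>) t \<partial>M) = ennreal ((1 - Re (exp (a t))) / t\<^sup>2)" if "0 < t" for t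
  proof -
    have "(\<integral>\<^sup>+\<omega>. h (Y \<omega>) t \<partial>M) = (\<integral>\<^sup>+\<omega>. ennreal (1 / t\<^sup>2) * ennreal (1 - cos (t * Y \<omega>)) \<partial>M)"
      unfolding h_def by (intro nn_integral_cong) (simp flip: ennreal_mult'')
    also have "\<dots> = ennreal (1 / t\<^sup>2) * ennreal (1 - Re (exp (a t)))"
      by (subst nn_integral_cmult, simp, simp only: nn_integral_one_minus_cos[OF M Y] char[OF that] a_def)
    also have "\<dots> = ennreal ((1 - Re (exp (a t))) / t\<^sup>2)"
      by (subst ennreal_mult'[symmetric]) auto
    finally show ?thesis .
  qed
  have "(\<integral>\<^sup>+\<omega>. ennreal \<bar>Y \<omega>\<bar> \<partial>M) = (\<integral>\<^sup>+\<omega>. 4 * ennreal (\<bar>Y \<omega>\<bar> / 4) \<partial>M)"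
    by (intro nn_integral_cong) (simp flip: ennreal_numeral ennreal_mult)
  also have "\<dots> \<le> (\<integral>\<^sup>+\<omega>. 4 * (\<integral>\<^sup>+t. h (Y \<omega>) t * indicator {0<..} t \<partial>lborel) \<partial>M)"
    unfolding h_def by (intro nn_integral_mono mult_left_mono abs_le_nn_integral_cos) auto
  also have "\<dots> = 4 * (\<integral>\<^sup>+\<omega>. (\<integral>\<^sup>+t. h (Y \<omega>) t * indicator {0<..} t \<partial>lborel) \<partial>M)"
    by (rule nn_integral_cmult, rule lborel.borel_measurable_nn_integral) (use Hm in \<open>simp add: case_prod_beta'\<close>)
  also have "(\<integral>\<^sup>+\<omega>. (\<integral>\<^sup>+t. h (Y \<omega>) t * indicator {0<..} t \<partial>lborel) \<partial>M) =
      (\<integral>\<^sup>+t. (\<integral>\<^sup>+\<omega>. h (Y \<omega>) t * indicator {0<..} t \<partial>M) \<partial>lborel)"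
    by (rule P.Fubini'[symmetric]) (use Hm in \<open>simp add: case_prod_beta'\<close>)
  also have "\<dots> = (\<integral>\<^sup>+t. (\<integral>\<^sup>+\<omega>. h (Y \<omega>) t \<partial>M) * indicator {0<..} t \<partial>lborel)"
    by (intro nn_integral_cong nn_integral_multc) measurable
  also have "\<dots> \<le> (\<integral>\<^sup>+t. ennreal (2 / t\<^sup>2) * indicator {T..} t +
      (ennreal C * indicator {0<..T} t + (\<integral>\<^sup>+z. h (y z) t \<partial>N) * indicator {0<..T} t) \<partial>lborel)"
  proof (rule nn_integral_mono)
    fix t :: real
    consider "t \<le> 0" | "0 < t" "t \<le> T" | "T < t" "0 < t" using T by linarith
    then show "(\<integral>\<^sup>+\<omega>. h (Y \<omega>) t \<partial>M) * indicator {0<..} t \<le> ennreal (2 / t\<^sup>2) * indicator {T..} t +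
      (ennreal C * indicator {0<..T} t + (\<integral>\<^sup>+z. h (y z) t \<partial>N) * indicator {0<..T} t)"
    proof cases
      case 2
      have "0 \<le> (LINT z|N. (1 - cos (t * y z)) / t\<^sup>2)" by (rule integral_nonneg_AE) simp
      then have "(\<integral>\<^sup>+\<omega>. h (Y \<omega>) t \<partial>M) \<le> ennreal C + (\<integral>\<^sup>+z. h (y z) t \<partial>N)"
        unfolding hM[OF 2(1)] hN using low[OF 2] C by (simp flip: ennreal_plus add: ennreal_leI)
      then show ?thesis using 2 by (simp add: add_increasing)
    next
      case 3
      then show ?thesis unfolding hM[OF 3(2)] using high[of t] by (simp add: ennreal_leI)
    qed simp
  qed
  also have "\<dots> = (\<integral>\<^sup>+t. ennreal (2 / t\<^sup>2) * indicator {T..} t \<partial>lborel) +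
      ((\<integral>\<^sup>+t. ennreal C * indicator {0<..T} t \<partial>lborel) +
      (\<integral>\<^sup>+t. (\<integral>\<^sup>+z. h (y z) t \<partial>N) * indicator {0<..T} t \<partial>lborel))"
  proof -
    have [measurable]: "(\<lambda>t. \<integral>\<^sup>+z. h (y z) t \<partial>N) \<in> borel_measurable borel"
      by (rule N.borel_measurable_nn_integral) (unfold h_def, measurable)
    show ?thesis by (subst nn_integral_add; simp add: nn_integral_add)
  qed
  also have "(\<integral>\<^sup>+t. ennreal (2 / t\<^sup>2) * indicator {T..} t \<partial>lborel) = ennreal (2 / T)"
    using T by (intro nn_integral_inverse_square) simp
  also have "(\<integral>\<^sup>+t. ennreal C * indicator {0<..T} t \<partial>lborel) = ennreal (C * T)"
    using T C by (subst nn_integral_cmult_indicator) (auto simp: ennreal_mult)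
  also have "(\<integral>\<^sup>+t. (\<integral>\<^sup>+z. h (y z) t \<partial>N) * indicator {0<..T} t \<partial>lborel) =
      (\<integral>\<^sup>+t. (\<integral>\<^sup>+z. h (y z) t * indicator {0<..T} t \<partial>N) \<partial>lborel)"
    by (intro nn_integral_cong nn_integral_multc[symmetric]) measurable
  also have "\<dots> = (\<integral>\<^sup>+z. (\<integral>\<^sup>+t. h (y z) t * indicator {0<..T} t \<partial>lborel) \<partial>N)"
    by (rule PN.Fubini') (use HN in \<open>simp add: case_prod_beta'\<close>)
  also have "\<dots> \<le> (\<integral>\<^sup>+z. ennreal ((T + 6) * kf (y z)) \<partial>N)"
    unfolding h_def by (intro nn_integral_mono nn_integral_cos_le T)
  also have "\<dots> = ennreal ((T + 6) * \<kappa>)"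
    unfolding \<kappa>_def using int T by (subst nn_integral_eq_integral) auto
  finally have "(\<integral>\<^sup>+\<omega>. ennreal \<bar>Y \<omega>\<bar> \<partial>M) \<le> 4 * (ennreal (2 / T) + (ennreal (C * T) + ennreal ((T + 6) * \<kappa>)))"
    by (simp add: mult_left_mono)
  also have "\<dots> = ennreal (4 * (2 / T + (C * T + (T + 6) * \<kappa>)))"
  proof -
    have gen: "4 * (ennreal a + (ennreal c + ennreal d)) = ennreal (4 * (a + (c + d)))"
      if "0 \<le> a" "0 \<le> c" "0 \<le> d" for a c d :: real
      unfolding ennreal_plus[OF that(2,3), symmetric] ennreal_plus[OF that(1) add_nonneg_nonneg[OF that(2,3)], symmetric]
      by (rule numeral_mult_ennreal) (use that in simp)
    show ?thesis by (rule gen) (use T C \<kappa> in simp_all)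
  qed
  also have "4 * (2 / T + (C * T + (T + 6) * \<kappa>)) =
      4 * (2 / T + v / 2 * T + (T + 6) * \<kappa> + 8 * T\<^sup>2 * \<kappa>\<^sup>2 * T)"
    by (simp add: C_def algebra_simps)
  finally show ?thesis .
qed

section \<open>The triple of a centered basis\<close>

lemma jump_measurable: "jump_measure \<rho> \<Longrightarrow> f \<in> measurable borel N \<Longrightarrow> f \<in> measurable \<rho> N"
  using measurable_cong_sets[OF jump_measure_sets refl] by blast

text \<open>\<open>kf\<close> lies below the integrand of the last part of \<open>Phi1\<close>, so
  the modular is dominated. Integrability of \<open>kf\<close> itself needs one nonzero
  \<open>r\<close> with a finite integral of \<open>kf (r * x)\<close>: otherwise
  \<open>Phi1\<close> would be infinite wherever \<open>g\<close> is nonzero, a set of positive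
  measure.\<close>

lemma jump_measure_and_modular_finite:
  fixes g :: "'d::euclidean_space \<Rightarrow> real"
  assumes lm: "levy_measure \<rho>" and g [measurable]: "g \<in> borel_measurable borel"
    and phi: "in_L_Phi1 \<gamma> b \<rho> g" and nz: "\<not> (AE s in lborel. g s = 0)"
  shows "jump_measure \<rho>" and "modular b \<rho> g < \<infinity>"
proof -
  have sets: "sets \<rho> = sets borel" and zero: "emeasure \<rho> {0} = 0" using lm by (auto simp: levy_measure_def)
  have kf_meas [measurable]: "(\<lambda>x. kf (r * x)) \<in> borel_measurable \<rho>" for r
    unfolding measurable_cong_sets[OF sets refl] by measurable
  have Phi: "ennreal (b\<^sup>2 * r\<^sup>2) + (\<integral>\<^sup>+x. ennreal (kf (r * x)) \<partial>\<rho>) \<le> Phi1 \<gamma> b \<rho> \<bar>r\<bar>" for r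
  proof -
    have le: "kf (r * x) \<le> (if \<bar>x * \<bar>r\<bar>\<bar> > 1 then \<bar>x * \<bar>r\<bar>\<bar> else (x * \<bar>r\<bar>)\<^sup>2)" for x
      using kf_le_abs[of "r * x"] kf_le_sq[of "r * x"]
      by (simp add: abs_mult mult.commute power_mult_distrib)
    have "(\<integral>\<^sup>+x. ennreal (kf (r * x)) \<partial>\<rho>) \<le>
        (\<integral>\<^sup>+x. ennreal (if \<bar>x * \<bar>r\<bar>\<bar> > 1 then \<bar>x * \<bar>r\<bar>\<bar> else (x * \<bar>r\<bar>)\<^sup>2) \<partial>\<rho>)"
      by (intro nn_integral_mono ennreal_leI le)
    then show ?thesis unfolding Phi1_def power2_abs
      by (intro add_mono) (auto intro: add_increasing)
  qed
  have int: "(\<integral>\<^sup>+s. Phi1 \<gamma> b \<rho> \<bar>g s\<bar> \<partial>lborel) < \<infinity>" using phi by (simp add: in_L_Phi1_def)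
  have "\<exists>r. r \<noteq> 0 \<and> (\<integral>\<^sup>+x. ennreal (kf (r * x)) \<partial>\<rho>) < \<infinity>"
  proof (rule ccontr)
    assume *: "\<not> ?thesis"
    have "(\<integral>\<^sup>+s. \<infinity> * indicator {s. g s \<noteq> 0} s \<partial>lborel) \<le> (\<integral>\<^sup>+s. Phi1 \<gamma> b \<rho> \<bar>g s\<bar> \<partial>lborel)"
    proof (rule nn_integral_mono)
      fix s
      show "\<infinity> * indicator {s. g s \<noteq> 0} s \<le> Phi1 \<gamma> b \<rho> \<bar>g s\<bar>"
      proof (cases "g s = 0")
        case False
        then have "(\<integral>\<^sup>+x. ennreal (kf (g s * x)) \<partial>\<rho>) = \<infinity>"
          using * False by (metis infinity_ennreal_def less_top)
        then show ?thesis using Phi[of "g s"] by (simp add: top_unique)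
      qed simp
    qed
    also have "\<dots> < \<infinity>" by (rule int)
    also have "(\<integral>\<^sup>+s. \<infinity> * indicator {s. g s \<noteq> 0} s \<partial>lborel) = \<infinity> * emeasure lborel {s. g s \<noteq> 0}"
      by (subst nn_integral_cmult_indicator) auto
    finally have "emeasure lborel {s. g s \<noteq> 0} = 0" by (auto simp: ennreal_mult_less_top)
    then have "AE s in lborel. g s = 0" by (subst AE_iff_measurable[OF _ refl]) auto
    then show False using nz by contradiction
  qed
  then obtain r where r: "r \<noteq> 0" "(\<integral>\<^sup>+x. ennreal (kf (r * x)) \<partial>\<rho>) < \<infinity>" by blast
  have "integrable \<rho> (\<lambda>x. kf (r * x))"
    using r(2) by (intro integrableI_nonneg) auto
  then have "integrable \<rho> (\<lambda>x. max 1 ((1 / r)\<^sup>2) * kf (r * x))" by simp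
  then have "integrable \<rho> kf"
  proof (rule Bochner_Integration.integrable_bound)
    show "AE x in \<rho>. norm (kf x) \<le> norm (max 1 ((1 / r)\<^sup>2) * kf (r * x))"
    proof (rule AE_I2)
      fix x
      have "kf x = kf (1 / r * (r * x))" using r(1) by simp
      also have "\<dots> \<le> max 1 ((1 / r)\<^sup>2) * kf (r * x)" by (rule kf_scale)
      finally show "norm (kf x) \<le> norm (max 1 ((1 / r)\<^sup>2) * kf (r * x))"
        using abs_ge_self order_trans by auto
    qed
  qed (use kf_meas[of 1] in simp)
  then show jm: "jump_measure \<rho>" unfolding jump_measure_def using sets zero by blast
  have "modular b \<rho> g \<le> (\<integral>\<^sup>+s. Phi1 \<gamma> b \<rho> \<bar>g s\<bar> \<partial>lborel)"
    unfolding modular_def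
  proof (rule nn_integral_mono)
    fix s
    have "ennreal (KK b \<rho> (g s)) = ennreal (b\<^sup>2 * (g s)\<^sup>2) + ennreal (LINT x|\<rho>. kf (g s * x))"
      unfolding KK_def by (rule ennreal_plus) auto
    also have "ennreal (LINT x|\<rho>. kf (g s * x)) = (\<integral>\<^sup>+x. ennreal (kf (g s * x)) \<partial>\<rho>)"
      by (rule nn_integral_eq_integral[symmetric, OF integrable_kf_scale[OF jm]]) simp
    finally show "ennreal (KK b \<rho> (g s)) \<le> Phi1 \<gamma> b \<rho> \<bar>g s\<bar>" using Phi[of "g s"] by simp
  qed
  then show "modular b \<rho> g < \<infinity>" using int by (rule order.strict_trans1)
qed

lemma norm_exp_minus_le:
  fixes z :: complex
  assumes "norm z \<le> 1" shows "norm (exp z - 1 - z) \<le> 3 * (norm z)\<^sup>2"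
proof -
  have "norm (exp z - (\<Sum>k\<le>1. z ^ k / fact k)) \<le> exp \<bar>Re z\<bar> * norm z ^ Suc 1 / fact 1"
    by (rule Taylor_exp)
  also have "\<dots> = exp \<bar>Re z\<bar> * (norm z)\<^sup>2" by (simp add: power2_eq_square)
  also have "\<dots> \<le> 3 * (norm z)\<^sup>2"
  proof (rule mult_right_mono)
    have "exp \<bar>Re z\<bar> \<le> exp 1" using assms abs_Re_le_cmod[of z] by (intro iffD2[OF exp_le_cancel_iff]) linarith
    then show "exp \<bar>Re z\<bar> \<le> 3" using exp_le by linarith
  qed simp
  finally show ?thesis by (simp add: algebra_simps)
qed

text \<open>The remainder exp z - 1 - z is of order |z|^2, and after scaling it is |c z| |z|, a
  bounded factor times a null one. It serves for derivatives of characteristic functions at 0 and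
  for passing from roots to exponents.\<close>

lemma tendsto_scaled_exp_minus_1:
  fixes z :: "nat \<Rightarrow> complex" and c :: "nat \<Rightarrow> real"
  assumes lim: "(\<lambda>n. c n *\<^sub>R z n) \<longlonglongrightarrow> w" and z: "z \<longlonglongrightarrow> 0"
  shows "(\<lambda>n. c n *\<^sub>R (exp (z n) - 1)) \<longlonglongrightarrow> w"
proof -
  have "(\<lambda>n. c n *\<^sub>R (exp (z n) - 1 - z n)) \<longlonglongrightarrow> 0"
  proof (rule Lim_null_comparison)
    show "(\<lambda>n. 3 * (norm (c n *\<^sub>R z n) * norm (z n))) \<longlonglongrightarrow> 0"
      using tendsto_mult[OF tendsto_norm[OF lim] tendsto_norm[OF z]] by (intro tendsto_mult_right_zero) simp
    have "\<forall>\<^sub>F n in sequentially. norm (z n) < 1"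
      using order_tendstoD(2)[OF tendsto_norm[OF z], of 1] by simp
    then show "\<forall>\<^sub>F n in sequentially. norm (c n *\<^sub>R (exp (z n) - 1 - z n)) \<le> 3 * (norm (c n *\<^sub>R z n) * norm (z n))"
    proof eventually_elim
      case (elim n)
      have "norm (c n *\<^sub>R (exp (z n) - 1 - z n)) \<le> \<bar>c n\<bar> * (3 * (norm (z n))\<^sup>2)"
        unfolding norm_scaleR using norm_exp_minus_le[of "z n"] elim by (intro mult_left_mono) auto
      then show ?case by (simp add: power2_eq_square mult_ac)
    qed
  qed
  from tendsto_add[OF this lim] show ?thesis by (simp flip: scaleR_add_right)
qed

text \<open>Dominated convergence: n kf(x/n) is at most x^2/n and at most \<open>kf x\<close>.
  Consequently \<open>cexp\<close> has derivative 0 along the sequence 1/n, the analytic form of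
  mean zero.\<close>

lemma KK_small:
  assumes jm: "jump_measure \<rho>"
  shows "(\<lambda>n. real (Suc n) * KK b \<rho> (1 / real (Suc n))) \<longlonglongrightarrow> 0"
proof -
  have pt: "(\<lambda>n. real (Suc n) * kf (1 / real (Suc n) * x)) \<longlonglongrightarrow> 0" for x
  proof (rule Lim_null_comparison)
    show "(\<lambda>n. x\<^sup>2 * (1 / real (Suc n))) \<longlonglongrightarrow> 0"
      by (intro tendsto_mult_right_zero LIMSEQ_Suc[OF lim_1_over_n])
    have "real (Suc n) * kf (1 / real (Suc n) * x) \<le> real (Suc n) * (1 / real (Suc n) * x)\<^sup>2" for n
      by (intro mult_left_mono kf_le_sq) simp
    also have "real (Suc n) * (1 / real (Suc n) * x)\<^sup>2 = x\<^sup>2 * (1 / real (Suc n))" for n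
      by (simp add: power2_eq_square)
    finally show "\<forall>\<^sub>F n in sequentially. norm (real (Suc n) * kf (1 / real (Suc n) * x)) \<le> x\<^sup>2 * (1 / real (Suc n))"
      by (simp add: abs_mult)
  qed
  have "(\<lambda>n. LINT x|\<rho>. real (Suc n) * kf (1 / real (Suc n) * x)) \<longlonglongrightarrow> (LINT x|\<rho>. 0)"
  proof (rule integral_dominated_convergence)
    show "integrable \<rho> kf" using jm unfolding jump_measure_def by blast
    show "AE x in \<rho>. (\<lambda>n. real (Suc n) * kf (1 / real (Suc n) * x)) \<longlonglongrightarrow> 0" using pt by simp
    have "real (Suc n) * kf (1 / real (Suc n) * x) \<le> real (Suc n) * (\<bar>1 / real (Suc n)\<bar> * kf x)" for n x
      by (intro mult_left_mono kf_scale_le_1) auto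
    then show "AE x in \<rho>. norm (real (Suc n) * kf (1 / real (Suc n) * x)) \<le> kf x" for n
      by (simp add: abs_mult)
  qed (auto intro: jump_measurable[OF jm])
  moreover have "(\<lambda>n. b\<^sup>2 * (1 / real (Suc n))) \<longlonglongrightarrow> 0"
    by (intro tendsto_mult_right_zero LIMSEQ_Suc[OF lim_1_over_n])
  moreover have aux: "N * (b\<^sup>2 * (1 / N)\<^sup>2 + i) = b\<^sup>2 * (1 / N) + N * i" if "N \<noteq> 0" for N i :: real
    using that by (simp add: power2_eq_square distrib_left)
  ultimately have "(\<lambda>n. b\<^sup>2 * (1 / real (Suc n)) + (LINT x|\<rho>. real (Suc n) * kf (1 / real (Suc n) * x))) \<longlonglongrightarrow> 0 + 0"
    by (intro tendsto_add) simp_all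
  also have "(\<lambda>n. b\<^sup>2 * (1 / real (Suc n)) + (LINT x|\<rho>. real (Suc n) * kf (1 / real (Suc n) * x))) =
      (\<lambda>n. real (Suc n) * KK b \<rho> (1 / real (Suc n)))"
    unfolding KK_def integral_mult_right_zero by (intro ext aux[symmetric]) simp
  finally show ?thesis by simp
qed

text \<open>The two compensators differ by \<open>x - tau1 x\<close>, which vanishes for |x| <= 1
  and is bounded by |x| elsewhere, hence is integrable; its integral moves into the drift.\<close>

lemma lk_exponent_eq:
  assumes jm: "jump_measure \<rho>"
  shows "lk_exponent \<gamma> b \<rho> \<theta> = \<i> * of_real ((\<gamma> + (LINT x|\<rho>. x - tau1 x)) * \<theta>) + cexp b \<rho> \<theta>"
proof -
  have [measurable]: "tau1 \<in> borel_measurable borel" unfolding tau1_def by measurable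
  have tau: "\<bar>x - tau1 x\<bar> \<le> 2 * kf x" for x
  proof (cases "\<bar>x\<bar> \<le> 1")
    case False
    then have "tau1 x = sgn x" by (simp add: tau1_def max_def sgn_div_norm divide_inverse)
    then have "\<bar>x - tau1 x\<bar> = \<bar>x\<bar> - 1" using False by (cases "0 < x") auto
    then show ?thesis using abs_le_kf_of_ge_1[of x] False by linarith
  qed (simp add: tau1_def max_def)
  have int: "integrable \<rho> (\<lambda>x. x - tau1 x)"
  proof (rule Bochner_Integration.integrable_bound)
    show "integrable \<rho> (\<lambda>x. 2 * kf x)" using jm unfolding jump_measure_def by simp
    show "AE x in \<rho>. norm (x - tau1 x) \<le> norm (2 * kf x)" using tau by simp
  qed (auto intro: jump_measurable[OF jm])
  have "(CLINT x|\<rho>. iexp (\<theta> * x) - 1 - \<i> * complex_of_real (\<theta> * tau1 x)) =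
      (CLINT x|\<rho>. ek (\<theta> * x) + \<i> * of_real (\<theta> * (x - tau1 x)))"
    by (rule Bochner_Integration.integral_cong) (auto simp: ek_def algebra_simps)
  also have "\<dots> = (CLINT x|\<rho>. ek (\<theta> * x)) + (CLINT x|\<rho>. \<i> * of_real (\<theta> * (x - tau1 x)))"
    using int by (intro Bochner_Integration.integral_add integrable_ek[OF jm] integrable_mult_right integrable_of_real) auto
  also have "(CLINT x|\<rho>. \<i> * complex_of_real (\<theta> * (x - tau1 x))) = \<i> * of_real (\<theta> * (LINT x|\<rho>. x - tau1 x))"
    unfolding integral_mult_right_zero integral_complex_of_real ..
  finally show ?thesis by (simp add: lk_exponent_def cexp_def algebra_simps)
qed

lemma bdd_borel_finite: "A \<in> bdd_borel \<Longrightarrow> emeasure lborel A < \<infinity>"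
  using emeasure_bounded_finite by (auto simp: bdd_borel_def)

lemma bdd_borel_sets: "A \<in> bdd_borel \<Longrightarrow> A \<in> sets borel"
  by (simp add: bdd_borel_def)

lemma bdd_borel_subset: "A \<in> bdd_borel \<Longrightarrow> B \<in> sets borel \<Longrightarrow> B \<subseteq> A \<Longrightarrow> B \<in> bdd_borel"
  by (auto simp: bdd_borel_def intro: bounded_subset)

text \<open>The derivative at 0 of the characteristic function of \<open>L A\<close>, with
  \<open>A\<close> the unit ball, is computed twice along 1/(n+1): through the exponent it is i
  times volume times drift, through dominated convergence it is i times the mean, that is, 0. The
  volume being positive, the drift vanishes.\<close>

lemma lk_exponent_eq_cexp:
  fixes L :: "'d::euclidean_space set \<Rightarrow> 'a \<Rightarrow> real"
  assumes jm: "jump_measure \<rho>" and M: "prob_space M"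
    and hlb: "homogeneous_levy_basis M L \<gamma> b \<rho>" and cen: "centered M L"
  shows "lk_exponent \<gamma> b \<rho> \<theta> = cexp b \<rho> \<theta>"
proof -
  interpret prob_space M by fact
  define \<delta> where "\<delta> = \<gamma> + (LINT x|\<rho>. x - tau1 x)"
  define A where "A = cball (0::'d) 1"
  have A: "A \<in> bdd_borel" by (simp add: A_def bdd_borel_def)
  define v where "v = measure lborel A"
  have v: "0 < v" unfolding v_def A_def using content_cball_pos[of 1 "0::'d"] by simp
  have LA [measurable]: "L A \<in> borel_measurable M" and int: "integrable M (L A)" and E0: "expectation (L A) = 0"
    using hlb cen A by (auto simp: homogeneous_levy_basis_def centered_def)
  have char: "(CLINT \<omega>|M. iexp (t * L A \<omega>)) = exp (of_real v * (\<i> * of_real (\<delta> * t) + cexp b \<rho> t))" for t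
  proof -
    have "char (distr M borel (L A)) t = exp (complex_of_real (measure lborel A) * lk_exponent \<gamma> b \<rho> t)"
      using hlb A by (auto simp: homogeneous_levy_basis_def)
    moreover have "char (distr M borel (L A)) t = (CLINT \<omega>|M. iexp (t * L A \<omega>))"
      unfolding char_def by (subst integral_distr) auto
    ultimately show ?thesis by (simp add: v_def lk_exponent_eq[OF jm] \<delta>_def)
  qed
  define r where "r n = 1 / real (Suc n)" for n
  have r0: "r \<longlonglongrightarrow> 0" unfolding r_def by (rule LIMSEQ_Suc[OF lim_1_over_n])
  define z where "z n = of_real v * (\<i> * of_real (\<delta> * r n) + cexp b \<rho> (r n))" for n
  have zlim: "(\<lambda>n. real (Suc n) *\<^sub>R z n) \<longlonglongrightarrow> of_real v * (\<i> * of_real \<delta> + 0)"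
  proof -
    have c0: "(\<lambda>n. real (Suc n) *\<^sub>R cexp b \<rho> (r n)) \<longlonglongrightarrow> 0"
    proof (rule Lim_null_comparison)
      show "(\<lambda>n. 9 * (real (Suc n) * KK b \<rho> (1 / real (Suc n)))) \<longlonglongrightarrow> 0"
        by (intro tendsto_mult_right_zero KK_small[OF jm])
      have "real (Suc n) * norm (cexp b \<rho> (r n)) \<le> real (Suc n) * (9 * KK b \<rho> (r n))" for n
        by (intro mult_left_mono norm_cexp_le[OF jm]) simp
      then show "\<forall>\<^sub>F n in sequentially. norm (real (Suc n) *\<^sub>R cexp b \<rho> (r n)) \<le> 9 * (real (Suc n) * KK b \<rho> (1 / real (Suc n)))"
        by (simp add: r_def mult_ac)
    qed
    have "real (Suc n) *\<^sub>R z n = of_real v * (\<i> * of_real \<delta> + real (Suc n) *\<^sub>R cexp b \<rho> (r n))" for n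
    proof -
      have "real (Suc n) * r n = 1" by (simp add: r_def)
      then have "complex_of_real (real (Suc n)) * of_real (r n) = 1" by (metis of_real_1 of_real_mult)
      then show ?thesis unfolding z_def scaleR_conv_of_real of_real_mult by algebra
    qed
    then show ?thesis using tendsto_mult_left[OF tendsto_add[OF tendsto_const c0]] by simp
  qed
  have z0: "z \<longlonglongrightarrow> 0"
  proof -
    have "(\<lambda>n. r n *\<^sub>R (real (Suc n) *\<^sub>R z n)) \<longlonglongrightarrow> 0 *\<^sub>R (of_real v * (\<i> * of_real \<delta> + 0))"
      by (rule tendsto_scaleR[OF r0 zlim])
    moreover have "r n *\<^sub>R (real (Suc n) *\<^sub>R z n) = z n" for n by (simp add: r_def)
    ultimately show ?thesis by simp
  qed
  have 1: "(\<lambda>n. real (Suc n) *\<^sub>R (exp (z n) - 1)) \<longlonglongrightarrow> of_real v * (\<i> * of_real \<delta> + 0)"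
    by (rule tendsto_scaled_exp_minus_1[OF zlim z0])
  have 2: "(\<lambda>n. CLINT \<omega>|M. real (Suc n) *\<^sub>R (iexp (r n * L A \<omega>) - 1)) \<longlonglongrightarrow> (CLINT \<omega>|M. \<i> * of_real (L A \<omega>))"
  proof (rule integral_dominated_convergence)
    show "integrable M (\<lambda>\<omega>. \<bar>L A \<omega>\<bar>)" using int by simp
    show "AE \<omega> in M. (\<lambda>n. real (Suc n) *\<^sub>R (iexp (r n * L A \<omega>) - 1)) \<longlonglongrightarrow> \<i> * of_real (L A \<omega>)"
    proof (rule AE_I2)
      fix \<omega>
      show "(\<lambda>n. real (Suc n) *\<^sub>R (iexp (r n * L A \<omega>) - 1)) \<longlonglongrightarrow> \<i> * of_real (L A \<omega>)"
      proof (rule tendsto_scaled_exp_minus_1)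
        have "real (Suc n) *\<^sub>R (\<i> * of_real (r n * L A \<omega>)) = \<i> * of_real (L A \<omega>)" for n
        proof -
          have "real (Suc n) * r n = 1" by (simp add: r_def)
          then have "complex_of_real (real (Suc n)) * of_real (r n) = 1" by (metis of_real_1 of_real_mult)
          then show ?thesis unfolding scaleR_conv_of_real of_real_mult by algebra
        qed
        then show "(\<lambda>n. real (Suc n) *\<^sub>R (\<i> * of_real (r n * L A \<omega>))) \<longlonglongrightarrow> \<i> * of_real (L A \<omega>)"
          by simp
        have "(\<lambda>n. \<i> * of_real (r n * L A \<omega>)) \<longlonglongrightarrow> \<i> * of_real (0 * L A \<omega>)"
          by (intro tendsto_intros r0)
        then show "(\<lambda>n. \<i> * of_real (r n * L A \<omega>)) \<longlonglongrightarrow> 0" by simp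
      qed
    qed
    show "AE \<omega> in M. norm (real (Suc n) *\<^sub>R (iexp (r n * L A \<omega>) - 1)) \<le> \<bar>L A \<omega>\<bar>" for n
    proof (rule AE_I2)
      fix \<omega>
      have "norm (iexp (r n * L A \<omega>) - 1) \<le> \<bar>r n * L A \<omega>\<bar>"
        using norm_iexp_diff_1[of "r n * L A \<omega>"] by simp
      then have "real (Suc n) * norm (iexp (r n * L A \<omega>) - 1) \<le> real (Suc n) * \<bar>r n * L A \<omega>\<bar>"
        by (intro mult_left_mono) auto
      also have "\<dots> = \<bar>L A \<omega>\<bar>" by (simp add: r_def abs_mult)
      finally show "norm (real (Suc n) *\<^sub>R (iexp (r n * L A \<omega>) - 1)) \<le> \<bar>L A \<omega>\<bar>" by simp
    qed
  qed measurable
  have eq: "(CLINT \<omega>|M. real (Suc n) *\<^sub>R (iexp (r n * L A \<omega>) - 1)) = real (Suc n) *\<^sub>R (exp (z n) - 1)" for n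
  proof -
    have "integrable M (\<lambda>\<omega>. iexp (r n * L A \<omega>))" by (rule integrable_const_bound[of _ 1]) auto
    then have "(CLINT \<omega>|M. iexp (r n * L A \<omega>) - 1) = exp (z n) - 1"
      using char[of "r n"] by (subst Bochner_Integration.integral_diff) (auto simp: z_def prob_space)
    then show ?thesis by (simp only: integral_scaleR_right)
  qed
  have "(CLINT \<omega>|M. \<i> * of_real (L A \<omega>)) = \<i> * of_real (LINT \<omega>|M. L A \<omega>)"
    unfolding integral_mult_right_zero integral_complex_of_real ..
  then have "(CLINT \<omega>|M. \<i> * of_real (L A \<omega>)) = 0" using E0 by simp
  with 2 have "(\<lambda>n. real (Suc n) *\<^sub>R (exp (z n) - 1)) \<longlonglongrightarrow> 0" unfolding eq by simp
  from LIMSEQ_unique[OF this 1] have "\<delta> = 0" using v by simp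
  then show ?thesis unfolding lk_exponent_eq[OF jm] by (simp add: \<delta>_def)
qed

section \<open>Finite-dimensional laws of the basis and of stochastic integrals\<close>

text \<open>Centering is recorded as \<open>lk\<close>, an identity of exponents, so that all later
  computations run with \<open>cexp\<close>.\<close>

locale centered_levy_basis = prob_space M for M :: "'a measure" +
  fixes L :: "'d::euclidean_space set \<Rightarrow> 'a \<Rightarrow> real" and \<gamma> b :: real and \<rho> :: "real measure"
  assumes hlb: "homogeneous_levy_basis M L \<gamma> b \<rho>"
    and jm: "jump_measure \<rho>"
    and lk: "\<And>\<theta>. lk_exponent \<gamma> b \<rho> \<theta> = cexp b \<rho> \<theta>"
begin

lemma L_measurable [measurable (raw)]: "A \<in> bdd_borel \<Longrightarrow> L A \<in> borel_measurable M"
  using hlb unfolding homogeneous_levy_basis_def by blast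

lemma L_char: "A \<in> bdd_borel \<Longrightarrow> char (distr M borel (L A)) t = exp (of_real (measure lborel A) * cexp b \<rho> t)"
  using hlb unfolding homogeneous_levy_basis_def lk by blast

lemma L_indep: "finite F \<Longrightarrow> F \<subseteq> bdd_borel \<Longrightarrow> disjoint F \<Longrightarrow> indep_vars (\<lambda>_. borel) L F"
  using hlb unfolding homogeneous_levy_basis_def by blast

lemma L_sums:
  "range A \<subseteq> bdd_borel \<Longrightarrow> disjoint_family A \<Longrightarrow> bounded (\<Union>n. A n) \<Longrightarrow>
    AE \<omega> in M. (\<lambda>n. L (A n) \<omega>) sums L (\<Union>n. A n) \<omega>"
  using hlb unfolding homogeneous_levy_basis_def by blast

lemma empty_bdd_borel: "{} \<in> bdd_borel"
  by (simp add: bdd_borel_def)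

text \<open>Countable additivity for a sequence of empty sets yields a convergent series of equal
  terms, which must be 0.\<close>

lemma L_empty: "AE \<omega> in M. L {} \<omega> = 0"
proof -
  have "AE \<omega> in M. (\<lambda>n::nat. L {} \<omega>) sums L (\<Union>n::nat. {}) \<omega>"
    by (rule L_sums) (auto simp: empty_bdd_borel disjoint_family_on_def)
  then show ?thesis
    by eventually_elim (auto dest!: sums_summable simp: summable_const_iff)
qed

lemma bdd_borel_Un: "A \<in> bdd_borel \<Longrightarrow> B \<in> bdd_borel \<Longrightarrow> A \<union> B \<in> bdd_borel"
  by (auto simp: bdd_borel_def)

lemma L_Un:
  assumes A: "A \<in> bdd_borel" and B: "B \<in> bdd_borel" and disj: "A \<inter> B = {}"
  shows "AE \<omega> in M. L (A \<union> B) \<omega> = L A \<omega> + L B \<omega>"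
proof -
  have "AE \<omega> in M. (\<lambda>n. L (binaryset A B n) \<omega>) sums L (\<Union>n. binaryset A B n) \<omega>"
  proof (rule L_sums)
    show "disjoint_family (binaryset A B)"
      using disj by (auto simp: disjoint_family_on_def binaryset_def)
    show "bounded (\<Union>n. binaryset A B n)"
      using A B by (simp add: UN_binaryset_eq bdd_borel_def)
  qed (use A B in \<open>auto simp: range_binaryset_eq empty_bdd_borel\<close>)
  with L_empty show ?thesis
  proof eventually_elim
    case (elim \<omega>)
    then have "(\<lambda>n. L (binaryset A B n) \<omega>) sums (L A \<omega> + L B \<omega>)"
      by (intro binaryset_sums) simp
    with elim show ?case by (auto simp: UN_binaryset_eq dest: sums_unique2)
  qed
qed

lemma L_UNION:
  assumes "finite F" "F \<subseteq> bdd_borel" "disjoint F"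
  shows "\<Union>F \<in> bdd_borel \<and> (AE \<omega> in M. L (\<Union>F) \<omega> = (\<Sum>D\<in>F. L D \<omega>))"
  using assms
proof (induction F rule: finite_induct)
  case empty
  then show ?case using L_empty by (simp add: empty_bdd_borel)
next
  case (insert D F)
  then have D: "D \<in> bdd_borel" and F: "\<Union>F \<in> bdd_borel" and "AE \<omega> in M. L (\<Union>F) \<omega> = (\<Sum>D\<in>F. L D \<omega>)"
    by (auto simp: pairwise_insert)
  moreover have "D \<inter> \<Union>F = {}"
    using insert.hyps insert.prems by (auto simp: pairwise_insert disjnt_def)
  from L_Un[OF D F this] have "AE \<omega> in M. L (D \<union> \<Union>F) \<omega> = L D \<omega> + L (\<Union>F) \<omega>" .
  ultimately have "AE \<omega> in M. L (D \<union> \<Union>F) \<omega> = L D \<omega> + (\<Sum>D\<in>F. L D \<omega>)" by auto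
  then show ?case using insert.hyps bdd_borel_Un[OF D F] by simp
qed

lemma modular_indicator_finite: "A \<in> bdd_borel \<Longrightarrow> modular b \<rho> (indicator A) < \<infinity>"
proof -
  assume A: "A \<in> bdd_borel"
  have "modular b \<rho> (indicator A) = (\<integral>\<^sup>+s. ennreal (KK b \<rho> 1) * indicator A s \<partial>lborel)"
    unfolding modular_def by (intro nn_integral_cong) (auto simp: indicator_def KK_0[OF jm])
  also have "\<dots> = ennreal (KK b \<rho> 1) * emeasure lborel A"
    using bdd_borel_sets[OF A] by (intro nn_integral_cmult_indicator) auto
  also have "\<dots> < \<infinity>"
    using bdd_borel_finite[OF A] by (simp add: ennreal_mult_less_top)
  finally show ?thesis .
qed

text \<open>The sets \<open>S j\<close> may overlap, so they are cut into the atoms of the finite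
  algebra they generate: on atoms \<open>L\<close> is independent, and additivity recovers each
  \<open>L (S j)\<close>. The product over atoms is the exponential of an integral because the
  combined kernel is constant on each atom.\<close>

lemma L_fd_char:
  assumes J: "finite J" and S: "\<And>j. j \<in> J \<Longrightarrow> S j \<in> bdd_borel"
  shows "(CLINT \<omega>|M. iexp (\<Sum>j\<in>J. a j * L (S j) \<omega>)) = exp (expo b \<rho> (\<lambda>s. \<Sum>j\<in>J. a j * indicator (S j) s))"
proof -
  define atom where "atom T = {s. {j\<in>J. s \<in> S j} = T}" for T
  \<comment> \<open>The index set {} is left out, since its atom is the unbounded complement of all
    \<open>S j\<close>, and so are empty atoms. \<open>F\<close> is a set of sets, hence no atom
    occurs twice.\<close>
  define F where "F = atom ` (Pow J - {{}}) - {{}}"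
  have fin: "finite F" unfolding F_def using J by simp
  have atom_bdd: "atom T \<in> bdd_borel" if T: "T \<subseteq> J" "T \<noteq> {}" for T
  proof -
    from T obtain j where j: "j \<in> J" "j \<in> T" by auto
    have "atom T = {s \<in> space borel. \<forall>j\<in>J. s \<in> S j \<longleftrightarrow> j \<in> T}" using T by (auto simp: atom_def)
    also have "\<dots> \<in> sets borel"
    proof (intro sets.sets_Collect_finite_All' J)
      fix i assume "i \<in> J"
      then have [measurable]: "S i \<in> sets borel" using S bdd_borel_sets by auto
      show "{s \<in> space borel. s \<in> S i \<longleftrightarrow> i \<in> T} \<in> sets borel" by measurable
    qed (use j in auto)
    finally have "atom T \<in> sets borel" .
    then show ?thesis
    proof (rule bdd_borel_subset[OF S[OF j(1)]])
      show "atom T \<subseteq> S j"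
      proof
        fix s assume "s \<in> atom T"
        then have "{j\<in>J. s \<in> S j} = T" by (simp add: atom_def)
        then show "s \<in> S j" using j by blast
      qed
    qed
  qed
  have F_bdd: "F \<subseteq> bdd_borel" unfolding F_def using atom_bdd by auto
  have F_disj: "disjoint F"
  proof (rule pairwiseI)
    fix D D' assume "D \<in> F" "D' \<in> F" and ne: "D \<noteq> D'"
    then obtain T T' where T: "D = atom T" "D' = atom T'" unfolding F_def by blast
    show "disjnt D D'"
      unfolding disjnt_iff
    proof (intro allI notI)
      fix s assume "s \<in> D \<and> s \<in> D'"
      then have "{j\<in>J. s \<in> S j} = T" "{j\<in>J. s \<in> S j} = T'" unfolding T atom_def by blast+
      then show False using ne T by simp
    qed
  qed
  define c where "c D = (\<Sum>j\<in>J. if D \<subseteq> S j then a j else 0)" for D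
  have in_atom: "(if D \<subseteq> S j then 1 else 0 :: real) = indicator (S j) s"
    if "D \<in> F" "s \<in> D" "j \<in> J" for D j s
  proof -
    from that obtain T where T: "D = atom T" by (auto simp: F_def)
    then have "D \<subseteq> S j \<longleftrightarrow> s \<in> S j" using that by (auto simp: atom_def)
    then show ?thesis by (simp add: indicator_def)
  qed
  have cover: "s \<in> \<Union>F" if "s \<in> S j" "j \<in> J" for s j
  proof -
    have "s \<in> atom {j\<in>J. s \<in> S j}" "{j\<in>J. s \<in> S j} \<in> Pow J - {{}}" using that by (auto simp: atom_def)
    then show ?thesis unfolding F_def by blast
  qed
  have S_eq: "\<Union>{D\<in>F. D \<subseteq> S j} = S j" if j: "j \<in> J" for j
  proof
    show "S j \<subseteq> \<Union>{D\<in>F. D \<subseteq> S j}"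
    proof
      fix s assume s: "s \<in> S j"
      from cover[OF s j] obtain D where D: "D \<in> F" "s \<in> D" by auto
      then have "D \<subseteq> S j" using in_atom[OF D j] s by (auto split: if_splits)
      then show "s \<in> \<Union>{D\<in>F. D \<subseteq> S j}" using D by auto
    qed
  qed auto
  have "AE \<omega> in M. L (S j) \<omega> = (\<Sum>D\<in>{D\<in>F. D \<subseteq> S j}. L D \<omega>)" if j: "j \<in> J" for j
  proof -
    have "disjoint {D\<in>F. D \<subseteq> S j}" using F_disj by (rule pairwise_subset) auto
    then show ?thesis using L_UNION[of "{D\<in>F. D \<subseteq> S j}"] fin F_bdd S_eq[OF j] by auto
  qed
  then have "AE \<omega> in M. \<forall>j\<in>J. L (S j) \<omega> = (\<Sum>D\<in>{D\<in>F. D \<subseteq> S j}. L D \<omega>)"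
    using J by (simp add: AE_finite_all)
  then have ae: "AE \<omega> in M. (\<Sum>j\<in>J. a j * L (S j) \<omega>) = (\<Sum>D\<in>F. c D * L D \<omega>)"
  proof eventually_elim
    case (elim \<omega>)
    have "(\<Sum>j\<in>J. a j * L (S j) \<omega>) = (\<Sum>j\<in>J. \<Sum>D\<in>F. (if D \<subseteq> S j then a j else 0) * L D \<omega>)"
    proof (rule sum.cong[OF refl])
      fix j assume "j \<in> J"
      then have "a j * L (S j) \<omega> = a j * (\<Sum>D\<in>F. if D \<subseteq> S j then L D \<omega> else 0)"
        using elim fin by (simp add: sum.inter_filter)
      also have "\<dots> = (\<Sum>D\<in>F. (if D \<subseteq> S j then a j else 0) * L D \<omega>)"
        unfolding sum_distrib_left by (intro sum.cong) auto
      finally show "a j * L (S j) \<omega> = (\<Sum>D\<in>F. (if D \<subseteq> S j then a j else 0) * L D \<omega>)" .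
    qed
    also have "\<dots> = (\<Sum>D\<in>F. c D * L D \<omega>)"
      unfolding c_def sum_distrib_right by (rule sum.swap)
    finally show ?case .
  qed
  have [measurable]: "D \<in> F \<Longrightarrow> L D \<in> borel_measurable M" for D using F_bdd by auto
  have [measurable]: "j \<in> J \<Longrightarrow> L (S j) \<in> borel_measurable M" for j using S by auto
  \<comment> \<open>The factor 1 is the argument at which the characteristic function of the sum is
    evaluated, the coefficients being part of the summands.\<close>
  have "(CLINT \<omega>|M. iexp (\<Sum>j\<in>J. a j * L (S j) \<omega>)) = (CLINT \<omega>|M. iexp (1 * (\<Sum>D\<in>F. c D * L D \<omega>)))"
  proof (rule integral_cong_AE)
    show "AE \<omega> in M. iexp (\<Sum>j\<in>J. a j * L (S j) \<omega>) = iexp (1 * (\<Sum>D\<in>F. c D * L D \<omega>))"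
      using ae by eventually_elim (simp only: mult_1)
  qed measurable
  also have "\<dots> = char (distr M borel (\<lambda>\<omega>. \<Sum>D\<in>F. c D * L D \<omega>)) 1"
    unfolding char_def by (subst integral_distr) auto
  also have "\<dots> = (\<Prod>D\<in>F. char (distr M borel (\<lambda>\<omega>. c D * L D \<omega>)) 1)"
  proof (rule char_distr_sum)
    show "indep_vars (\<lambda>i. borel) (\<lambda>D \<omega>. c D * L D \<omega>) F"
      by (rule indep_vars_compose2[OF L_indep[OF fin F_bdd F_disj], where Y = "\<lambda>D x. c D * x"]) measurable
  qed
  also have "\<dots> = (\<Prod>D\<in>F. exp (of_real (measure lborel D) * cexp b \<rho> (c D)))"
  proof (rule prod.cong[OF refl])
    fix D assume D: "D \<in> F"
    then have "char (distr M borel (\<lambda>\<omega>. c D * L D \<omega>)) 1 = char (distr M borel (L D)) (c D)"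
      unfolding char_def by (subst (1 2) integral_distr) auto
    also have "\<dots> = exp (of_real (measure lborel D) * cexp b \<rho> (c D))"
      using D F_bdd by (intro L_char) auto
    finally show "char (distr M borel (\<lambda>\<omega>. c D * L D \<omega>)) 1 = \<dots>" .
  qed
  also have "\<dots> = exp (\<Sum>D\<in>F. of_real (measure lborel D) * cexp b \<rho> (c D))"
    using fin by (simp add: exp_sum)
  also have "(\<Sum>D\<in>F. of_real (measure lborel D) * cexp b \<rho> (c D)) =
      (\<Sum>D\<in>F. CLINT s|lborel. indicator D s *\<^sub>R cexp b \<rho> (c D))"
  proof (rule sum.cong[OF refl])
    fix D assume "D \<in> F"
    then have D: "D \<in> bdd_borel" using F_bdd by auto
    have "(CLINT s|lborel. indicator D s *\<^sub>R cexp b \<rho> (c D)) = measure lborel D *\<^sub>R cexp b \<rho> (c D)"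
      using bdd_borel_finite[OF D] bdd_borel_sets[OF D]
      by (subst integral_scaleR_left) (simp_all add: integrable_indicator_iff)
    then show "of_real (measure lborel D) * cexp b \<rho> (c D) = (CLINT s|lborel. indicator D s *\<^sub>R cexp b \<rho> (c D))"
      by (simp add: scaleR_conv_of_real)
  qed
  also have "\<dots> = (CLINT s|lborel. \<Sum>D\<in>F. indicator D s *\<^sub>R cexp b \<rho> (c D))"
  proof (rule Bochner_Integration.integral_sum[symmetric])
    fix D assume "D \<in> F"
    then have D: "D \<in> bdd_borel" using F_bdd by auto
    show "integrable lborel (\<lambda>s. indicator D s *\<^sub>R cexp b \<rho> (c D))"
      using bdd_borel_finite[OF D] bdd_borel_sets[OF D] by (intro integrable_scaleR_left) (auto simp: integrable_indicator_iff)
  qed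
  also have "(\<lambda>s. \<Sum>D\<in>F. indicator D s *\<^sub>R cexp b \<rho> (c D)) = (\<lambda>s. cexp b \<rho> (\<Sum>j\<in>J. a j * indicator (S j) s))"
  proof
    fix s
    show "(\<Sum>D\<in>F. indicator D s *\<^sub>R cexp b \<rho> (c D)) = cexp b \<rho> (\<Sum>j\<in>J. a j * indicator (S j) s)"
    proof (cases "s \<in> \<Union>F")
      case True
      then obtain D where D: "D \<in> F" "s \<in> D" by auto
      have other: "s \<notin> D'" if "D' \<in> F" "D' \<noteq> D" for D'
        using F_disj D that by (auto simp: pairwise_def disjnt_def)
      have "(\<Sum>D\<in>F. indicator D s *\<^sub>R cexp b \<rho> (c D)) = (\<Sum>D\<in>{D}. indicator D s *\<^sub>R cexp b \<rho> (c D))"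
        using fin D other by (intro sum.mono_neutral_right) auto
      also have "\<dots> = cexp b \<rho> (c D)" using D by simp
      also have "c D = (\<Sum>j\<in>J. a j * indicator (S j) s)"
        unfolding c_def
      proof (rule sum.cong[OF refl])
        fix j assume "j \<in> J"
        from in_atom[OF D this] show "(if D \<subseteq> S j then a j else 0) = a j * indicator (S j) s"
          by (auto split: if_splits)
      qed
      finally show ?thesis .
    next
      case False
      then have "(\<Sum>j\<in>J. a j * indicator (S j) s) = (\<Sum>j\<in>J. 0)"
        using cover by (intro sum.cong) (auto simp: indicator_def)
      moreover have "(\<Sum>D\<in>F. indicator D s *\<^sub>R cexp b \<rho> (c D)) = (\<Sum>D\<in>F. 0)"
        using False by (intro sum.cong) (auto simp: indicator_def)
      ultimately show ?thesis using cexp_0[OF jm] by simp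
    qed
  qed
  finally show ?thesis unfolding expo_def .
qed

end

section \<open>Convergence in probability and linearity of the stochastic integral\<close>

lemma conv_in_prob_char:
  assumes M: "prob_space M" and Y [measurable]: "\<And>k. Y k \<in> borel_measurable M" and conv: "conv_in_prob M Y Z"
  shows "(\<lambda>k. CLINT \<omega>|M. iexp (t * Y k \<omega>)) \<longlonglongrightarrow> (CLINT \<omega>|M. iexp (t * Z \<omega>))"
proof (rule LIMSEQ_I)
  interpret prob_space M by fact
  have Z [measurable]: "Z \<in> borel_measurable M" using conv by (simp add: conv_in_prob_def)
  fix r :: real assume r: "0 < r"
  \<comment> \<open>Off the exceptional set the exponentials differ by at most |t| e <= r/4, on it
    by at most 2; adding 1 to |t| covers t = 0.\<close>
  define e where "e = r / (4 * (\<bar>t\<bar> + 1))"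
  have e: "0 < e" using r by (simp add: e_def add_nonneg_pos)
  have te: "\<bar>t\<bar> * e \<le> r / 4"
    using r by (simp add: e_def field_simps)
  define B where "B k = {\<omega>\<in>space M. \<bar>Y k \<omega> - Z \<omega>\<bar> > e}" for k
  have [measurable]: "B k \<in> sets M" for k unfolding B_def by measurable
  have "(\<lambda>k. measure M (B k)) \<longlonglongrightarrow> 0" using conv e by (simp add: conv_in_prob_def B_def)
  from order_tendstoD(2)[OF this, of "r / 4"] r have "\<forall>\<^sub>F k in sequentially. measure M (B k) < r / 4" by simp
  then obtain K where K: "\<And>k. K \<le> k \<Longrightarrow> measure M (B k) < r / 4" by (auto simp: eventually_sequentially)
  show "\<exists>K. \<forall>k\<ge>K. norm ((CLINT \<omega>|M. iexp (t * Y k \<omega>)) - (CLINT \<omega>|M. iexp (t * Z \<omega>))) < r"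
  proof (intro exI allI impI)
    fix k assume k: "K \<le> k"
    have i: "integrable M (\<lambda>\<omega>. iexp (t * Y k \<omega>))" "integrable M (\<lambda>\<omega>. iexp (t * Z \<omega>))"
      by (rule integrable_const_bound[of _ 1]; auto)+
    have "(CLINT \<omega>|M. iexp (t * Y k \<omega>)) - (CLINT \<omega>|M. iexp (t * Z \<omega>)) =
        (CLINT \<omega>|M. iexp (t * Y k \<omega>) - iexp (t * Z \<omega>))"
      by (rule Bochner_Integration.integral_diff[symmetric, OF i])
    also have "norm \<dots> \<le> (LINT \<omega>|M. r / 4 + 2 * indicator (B k) \<omega>)"
    proof (rule order_trans[OF integral_norm_bound], rule integral_mono)
      show "integrable M (\<lambda>\<omega>. norm (iexp (t * Y k \<omega>) - iexp (t * Z \<omega>)))" using i by auto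
      show "integrable M (\<lambda>\<omega>. r / 4 + 2 * indicator (B k) \<omega> :: real)"
        by (intro Bochner_Integration.integrable_add integrable_const integrable_mult_right
          integrable_real_indicator) (simp_all add: emeasure_eq_measure)
      fix \<omega> assume \<omega>: "\<omega> \<in> space M"
      have "iexp (t * Y k \<omega>) - iexp (t * Z \<omega>) = iexp (t * Z \<omega>) * (iexp (t * (Y k \<omega> - Z \<omega>)) - 1)"
        by (simp add: algebra_simps flip: exp_add)
      then have "norm (iexp (t * Y k \<omega>) - iexp (t * Z \<omega>)) = norm (iexp (t * (Y k \<omega> - Z \<omega>)) - 1)"
        by (simp only: norm_mult norm_exp_i_times mult_1)
      also have "\<dots> \<le> min (\<bar>t * (Y k \<omega> - Z \<omega>)\<bar>) 2" by (rule norm_iexp_diff_1)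
      also have "\<dots> \<le> r / 4 + 2 * indicator (B k) \<omega>"
      proof (cases "\<omega> \<in> B k")
        case False
        then have "\<bar>Y k \<omega> - Z \<omega>\<bar> \<le> e" using \<omega> by (simp add: B_def)
        then have "\<bar>t\<bar> * \<bar>Y k \<omega> - Z \<omega>\<bar> \<le> \<bar>t\<bar> * e" by (rule mult_left_mono) simp
        then have "\<bar>t * (Y k \<omega> - Z \<omega>)\<bar> \<le> r / 4" unfolding abs_mult using te by linarith
        then show ?thesis using False by simp
      qed (use r in simp)
      finally show "norm (iexp (t * Y k \<omega>) - iexp (t * Z \<omega>)) \<le> r / 4 + 2 * indicator (B k) \<omega>" .
    qed
    also have "\<dots> = r / 4 + 2 * measure M (B k)"
    proof -
      have "integrable M (indicator (B k) :: _ \<Rightarrow> real)"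
        by (intro integrable_real_indicator) (simp_all add: emeasure_eq_measure)
      then show ?thesis
        by (subst Bochner_Integration.integral_add) (simp_all add: prob_space)
    qed
    also have "\<dots> < r" using K[OF k] r by linarith
    finally show "norm ((CLINT \<omega>|M. iexp (t * Y k \<omega>)) - (CLINT \<omega>|M. iexp (t * Z \<omega>))) < r" .
  qed
qed

lemma conv_in_prob_add_scaled:
  assumes M: "prob_space M"
    and Y [measurable]: "\<And>k. Y k \<in> borel_measurable M" "\<And>k. Y' k \<in> borel_measurable M"
    and c1: "conv_in_prob M Y Z" and c2: "conv_in_prob M Y' Z'"
  shows "conv_in_prob M (\<lambda>k \<omega>. Y k \<omega> + c * Y' k \<omega>) (\<lambda>\<omega>. Z \<omega> + c * Z' \<omega>)"
  unfolding conv_in_prob_def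
proof (intro conjI allI impI)
  interpret prob_space M by fact
  have Z [measurable]: "Z \<in> borel_measurable M" "Z' \<in> borel_measurable M"
    using c1 c2 by (auto simp: conv_in_prob_def)
  show "(\<lambda>\<omega>. Z \<omega> + c * Z' \<omega>) \<in> borel_measurable M" by measurable
  fix e :: real assume e: "0 < e"
  define d where "d = e / (2 * (\<bar>c\<bar> + 1))"
  have d: "0 < d" using e by (simp add: d_def add_nonneg_pos)
  have cd: "\<bar>c\<bar> * d \<le> e / 2" using e by (simp add: d_def field_simps)
  define A where "A k = {\<omega>\<in>space M. \<bar>Y k \<omega> - Z \<omega>\<bar> > e / 2}" for k
  define B where "B k = {\<omega>\<in>space M. \<bar>Y' k \<omega> - Z' \<omega>\<bar> > d}" for k
  define C where "C k = {\<omega>\<in>space M. \<bar>(Y k \<omega> + c * Y' k \<omega>) - (Z \<omega> + c * Z' \<omega>)\<bar> > e}" for k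
  have [measurable]: "A k \<in> sets M" "B k \<in> sets M" "C k \<in> sets M" for k
    unfolding A_def B_def C_def by measurable
  have sub: "C k \<subseteq> A k \<union> B k" for k
  proof
    fix \<omega> assume w: "\<omega> \<in> C k"
    show "\<omega> \<in> A k \<union> B k"
    proof (rule ccontr)
      assume n: "\<omega> \<notin> A k \<union> B k"
      then have 1: "\<bar>Y k \<omega> - Z \<omega>\<bar> \<le> e / 2" and 2: "\<bar>Y' k \<omega> - Z' \<omega>\<bar> \<le> d"
        using w by (auto simp: A_def B_def C_def)
      from 2 have "\<bar>c\<bar> * \<bar>Y' k \<omega> - Z' \<omega>\<bar> \<le> \<bar>c\<bar> * d" by (rule mult_left_mono) simp
      then have "\<bar>c * (Y' k \<omega> - Z' \<omega>)\<bar> \<le> e / 2" unfolding abs_mult using cd by linarith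
      moreover have "(Y k \<omega> + c * Y' k \<omega>) - (Z \<omega> + c * Z' \<omega>) = (Y k \<omega> - Z \<omega>) + c * (Y' k \<omega> - Z' \<omega>)"
        by (simp add: algebra_simps)
      ultimately have "\<bar>(Y k \<omega> + c * Y' k \<omega>) - (Z \<omega> + c * Z' \<omega>)\<bar> \<le> e"
        using 1 abs_triangle_ineq[of "Y k \<omega> - Z \<omega>" "c * (Y' k \<omega> - Z' \<omega>)"] by linarith
      then show False using w by (simp add: C_def)
    qed
  qed
  have le: "measure M (C k) \<le> measure M (A k) + measure M (B k)" for k
  proof -
    have "measure M (C k) \<le> measure M (A k \<union> B k)" by (rule finite_measure_mono[OF sub]) measurable
    also have "\<dots> \<le> measure M (A k) + measure M (B k)" by (rule measure_Un_le) measurable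
    finally show ?thesis .
  qed
  have lim: "(\<lambda>k. measure M (A k) + measure M (B k)) \<longlonglongrightarrow> 0 + 0"
  proof (rule tendsto_add)
    show "(\<lambda>k. measure M (A k)) \<longlonglongrightarrow> 0" unfolding A_def
      using c1[unfolded conv_in_prob_def, THEN conjunct2, rule_format, OF half_gt_zero[OF e]] .
    show "(\<lambda>k. measure M (B k)) \<longlonglongrightarrow> 0" unfolding B_def
      using c2[unfolded conv_in_prob_def, THEN conjunct2, rule_format, OF d] .
  qed
  have "(\<lambda>k. measure M (C k)) \<longlonglongrightarrow> 0"
  proof (rule tendsto_sandwich)
    show "\<forall>\<^sub>F k in sequentially. 0 \<le> measure M (C k)" by simp
    show "\<forall>\<^sub>F k in sequentially. measure M (C k) \<le> measure M (A k) + measure M (B k)" using le by simp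
    show "(\<lambda>k. 0::real) \<longlonglongrightarrow> 0" by simp
    show "(\<lambda>k. measure M (A k) + measure M (B k)) \<longlonglongrightarrow> 0" using lim by simp
  qed
  then show "(\<lambda>k. measure M {\<omega>\<in>space M. \<bar>(Y k \<omega> + c * Y' k \<omega>) - (Z \<omega> + c * Z' \<omega>)\<bar> > e}) \<longlonglongrightarrow> 0"
    by (simp add: C_def)
qed

lemma sum_lessThan_add_split:
  "(\<Sum>j<m + n. f j) = (\<Sum>j<m. f j) + (\<Sum>j<n. f (m + j))" for f :: "nat \<Rightarrow> 'x::comm_monoid_add"
  by (induction n) (simp_all add: add.assoc)

text \<open>\<open>levy_integral\<close> with its witnesses as arguments, so that one approximating
  sequence is fixed for all its properties.\<close>

definition levy_approx ::
  "'a measure \<Rightarrow> ('d::euclidean_space set \<Rightarrow> 'a \<Rightarrow> real) \<Rightarrow> ('d \<Rightarrow> real) \<Rightarrow> ('a \<Rightarrow> real) \<Rightarrow>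
    (nat \<Rightarrow> nat) \<Rightarrow> (nat \<Rightarrow> nat \<Rightarrow> real) \<Rightarrow> (nat \<Rightarrow> nat \<Rightarrow> 'd set) \<Rightarrow> bool" where
  "levy_approx M L f Z n a S \<longleftrightarrow>
     (\<forall>k j. S k j \<in> bdd_borel) \<and>
     (AE s in lborel. (\<lambda>k. \<Sum>j<n k. a k j * indicator (S k j) s) \<longlonglongrightarrow> f s) \<and>
     (\<forall>B\<in>sets borel. \<exists>W. conv_in_prob M (\<lambda>k \<omega>. \<Sum>j<n k. a k j * L (B \<inter> S k j) \<omega>) W) \<and>
     conv_in_prob M (\<lambda>k \<omega>. \<Sum>j<n k. a k j * L (S k j) \<omega>) Z"

lemma levy_integral_iff: "levy_integral M L f Z \<longleftrightarrow> (\<exists>n a S. levy_approx M L f Z n a S)"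
  unfolding levy_integral_def levy_approx_def ..

lemma levy_approxD:
  assumes "levy_approx M L f Z n a S"
  shows "S k j \<in> bdd_borel"
    and "AE s in lborel. (\<lambda>k. \<Sum>j<n k. a k j * indicator (S k j) s) \<longlonglongrightarrow> f s"
    and "B \<in> sets borel \<Longrightarrow> \<exists>W. conv_in_prob M (\<lambda>k \<omega>. \<Sum>j<n k. a k j * L (B \<inter> S k j) \<omega>) W"
    and "conv_in_prob M (\<lambda>k \<omega>. \<Sum>j<n k. a k j * L (S k j) \<omega>) Z"
proof -
  note A = assms[unfolded levy_approx_def]
  show "S k j \<in> bdd_borel" using A[THEN conjunct1] by simp
  show "AE s in lborel. (\<lambda>k. \<Sum>j<n k. a k j * indicator (S k j) s) \<longlonglongrightarrow> f s"
    by (rule A[THEN conjunct2, THEN conjunct1])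
  show "\<exists>W. conv_in_prob M (\<lambda>k \<omega>. \<Sum>j<n k. a k j * L (B \<inter> S k j) \<omega>) W" if "B \<in> sets borel"
    by (rule bspec[OF A[THEN conjunct2, THEN conjunct2, THEN conjunct1] that])
  show "conv_in_prob M (\<lambda>k \<omega>. \<Sum>j<n k. a k j * L (S k j) \<omega>) Z"
    by (rule A[THEN conjunct2, THEN conjunct2, THEN conjunct2])
qed

context centered_levy_basis
begin

lemma bdd_borel_Int: "B \<in> sets borel \<Longrightarrow> S \<in> bdd_borel \<Longrightarrow> B \<inter> S \<in> bdd_borel"
  by (rule bdd_borel_subset[of S]) (auto dest: bdd_borel_sets)

lemma levy_integral_zero: "levy_integral M L (\<lambda>s. 0) (\<lambda>\<omega>. 0)"
  unfolding levy_integral_def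
  by (rule exI[of _ "\<lambda>k. 0"], rule exI[of _ "\<lambda>k j. 0"], rule exI[of _ "\<lambda>k j. {}"])
     (auto simp: empty_bdd_borel conv_in_prob_def intro!: exI[of _ "\<lambda>\<omega>. 0"])

lemma levy_integral_add_scaled:
  assumes "levy_integral M L f Z" "levy_integral M L f' Z'"
  shows "levy_integral M L (\<lambda>s. f s + c * f' s) (\<lambda>\<omega>. Z \<omega> + c * Z' \<omega>)"
proof -
  from assms obtain n a S n' a' S' where
    "levy_approx M L f Z n a S" and "levy_approx M L f' Z' n' a' S'"
    unfolding levy_integral_iff by blast
  note S = levy_approxD(1)[OF this(1)] and lim = levy_approxD(2)[OF this(1)]
    and conv = levy_approxD(3)[OF this(1)] and convZ = levy_approxD(4)[OF this(1)]
    and S' = levy_approxD(1)[OF this(2)] and lim' = levy_approxD(2)[OF this(2)]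
    and conv' = levy_approxD(3)[OF this(2)] and convZ' = levy_approxD(4)[OF this(2)]
  \<comment> \<open>Simple kernels are added by concatenation: the second list of sets, with
    coefficients scaled by \<open>c\<close>, is appended from index \<open>n k\<close> on.\<close>
  define N where "N k = n k + n' k" for k
  define A where "A k j = (if j < n k then a k j else c * a' k (j - n k))" for k j
  define T where "T k j = (if j < n k then S k j else S' k (j - n k))" for k j
  have split_sum: "(\<Sum>j<N k. A k j * F (T k j)) = (\<Sum>j<n k. a k j * F (S k j)) + c * (\<Sum>j<n' k. a' k j * F (S' k j))"
    for k and F :: "'d set \<Rightarrow> real"
    unfolding N_def sum_lessThan_add_split by (simp add: A_def T_def sum_distrib_left mult.assoc)
  have m: "(\<lambda>\<omega>. \<Sum>j<n k. a k j * L (B \<inter> S k j) \<omega>) \<in> borel_measurable M"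
    "(\<lambda>\<omega>. \<Sum>j<n' k. a' k j * L (B \<inter> S' k j) \<omega>) \<in> borel_measurable M" if "B \<in> sets borel" for B k
    using bdd_borel_Int[OF that S] bdd_borel_Int[OF that S'] by measurable
  show ?thesis
    unfolding levy_integral_def
  proof (intro exI conjI)
    show "\<forall>k j. T k j \<in> bdd_borel" using S S' by (simp add: T_def)
    show "AE s in lborel. (\<lambda>k. \<Sum>j<N k. A k j * indicator (T k j) s) \<longlonglongrightarrow> f s + c * f' s"
      using lim lim'
    proof eventually_elim
      case (elim s)
      then show ?case unfolding split_sum[of _ "\<lambda>D. indicator D s"] by (intro tendsto_intros)
    qed
    show "\<forall>B\<in>sets borel. \<exists>W. conv_in_prob M (\<lambda>k \<omega>. \<Sum>j<N k. A k j * L (B \<inter> T k j) \<omega>) W"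
    proof
      fix B :: "'d set" assume B: "B \<in> sets borel"
      from conv[OF B] conv'[OF B] obtain W W' where
        "conv_in_prob M (\<lambda>k \<omega>. \<Sum>j<n k. a k j * L (B \<inter> S k j) \<omega>) W"
        "conv_in_prob M (\<lambda>k \<omega>. \<Sum>j<n' k. a' k j * L (B \<inter> S' k j) \<omega>) W'" by blast
      from conv_in_prob_add_scaled[OF prob_space_axioms m[OF B] this, of c]
      show "\<exists>W. conv_in_prob M (\<lambda>k \<omega>. \<Sum>j<N k. A k j * L (B \<inter> T k j) \<omega>) W"
        unfolding split_sum[of _ "\<lambda>D. L (B \<inter> D) \<omega>" for \<omega>] by blast
    qed
    have "(\<lambda>\<omega>. \<Sum>j<n k. a k j * L (S k j) \<omega>) \<in> borel_measurable M"
      "(\<lambda>\<omega>. \<Sum>j<n' k. a' k j * L (S' k j) \<omega>) \<in> borel_measurable M" for k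
      using m[of UNIV k] by simp_all
    from conv_in_prob_add_scaled[OF prob_space_axioms this convZ convZ']
    show "conv_in_prob M (\<lambda>k \<omega>. \<Sum>j<N k. A k j * L (T k j) \<omega>) (\<lambda>\<omega>. Z \<omega> + c * Z' \<omega>)"
      unfolding split_sum[of _ "\<lambda>D. L D \<omega>" for \<omega>] .
  qed
qed

lemma levy_integral_sum:
  assumes "finite J" "\<And>j. j \<in> J \<Longrightarrow> levy_integral M L (f j) (Z j)"
  shows "levy_integral M L (\<lambda>s. \<Sum>j\<in>J. \<theta> j * f j s) (\<lambda>\<omega>. \<Sum>j\<in>J. \<theta> j * Z j \<omega>)"
  using assms
proof (induction J rule: finite_induct)
  case empty
  then show ?case using levy_integral_zero by simp
next
  case (insert i J)
  then have "levy_integral M L (\<lambda>s. (\<Sum>j\<in>J. \<theta> j * f j s) + \<theta> i * f i s) (\<lambda>\<omega>. (\<Sum>j\<in>J. \<theta> j * Z j \<omega>) + \<theta> i * Z i \<omega>)"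
    by (intro levy_integral_add_scaled) auto
  then show ?case using insert.hyps by (simp add: add.commute)
qed

lemma levy_integral_measurable: "levy_integral M L f Z \<Longrightarrow> Z \<in> borel_measurable M"
  by (auto simp: levy_integral_def conv_in_prob_def)

text \<open>For simple kernels the formula is \<open>L_fd_char\<close>. Their exponents converge
  pointwise by continuity of \<open>cexp\<close> but need not be dominated; convergence in
  probability over every Borel set \<open>B\<close> is what lets \<open>gliding_hump\<close> exclude
  escaping mass.\<close>

lemma levy_integral_char:
  assumes li: "levy_integral M L f Z" and f [measurable]: "f \<in> borel_measurable borel"
    and fin: "modular b \<rho> f < \<infinity>"
  shows "(CLINT \<omega>|M. iexp (t * Z \<omega>)) = exp (expo b \<rho> (\<lambda>s. t * f s))"
proof -
  note [measurable] = cexp_measurable[OF jm]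
  from li obtain n a S where "levy_approx M L f Z n a S" unfolding levy_integral_iff by blast
  note S = levy_approxD(1)[OF this] and lim = levy_approxD(2)[OF this]
    and conv = levy_approxD(3)[OF this] and convZ = levy_approxD(4)[OF this]
  define h where "h k s = (\<Sum>j<n k. a k j * indicator (S k j) s)" for k s
  have [measurable]: "S k j \<in> sets borel" for k j using S bdd_borel_sets by auto
  have h [measurable]: "h k \<in> borel_measurable borel" for k unfolding h_def by measurable
  have hfin: "modular b \<rho> (h k) < \<infinity>" for k
    unfolding h_def by (rule modular_sum_finite[OF jm]) (use modular_indicator_finite[OF S] in \<open>simp_all\<close>)
  define Y where "Y B k \<omega> = (\<Sum>j<n k. a k j * L (B \<inter> S k j) \<omega>)" for B k \<omega>
  have Ym: "Y B k \<in> borel_measurable M" if "B \<in> sets borel" for B k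
    unfolding Y_def using bdd_borel_Int[OF that S] by measurable
  have charY: "(CLINT \<omega>|M. iexp (t * Y B k \<omega>)) = exp (expo b \<rho> (\<lambda>s. t * (indicator B s * h k s)))"
    if B: "B \<in> sets borel" for B k
  proof -
    have "(CLINT \<omega>|M. iexp (\<Sum>j<n k. (t * a k j) * L (B \<inter> S k j) \<omega>)) =
        exp (expo b \<rho> (\<lambda>s. \<Sum>j<n k. (t * a k j) * indicator (B \<inter> S k j) s))"
      by (rule L_fd_char) (auto intro: bdd_borel_Int B S)
    also have "(\<lambda>s. \<Sum>j<n k. (t * a k j) * indicator (B \<inter> S k j) s) = (\<lambda>s. t * (indicator B s * h k s))"
      unfolding h_def sum_distrib_left by (intro ext sum.cong) (auto simp: indicator_inter_arith)
    finally show ?thesis by (simp only: Y_def sum_distrib_left mult.assoc)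
  qed
  \<comment> \<open>The limiting exponent is subtracted in advance, since
    \<open>gliding_hump\<close> concerns functions tending to 0; its integrability is the hypothesis
    on the modular of \<open>f\<close>.\<close>
  define p where "p k s = cexp b \<rho> (t * h k s) - cexp b \<rho> (t * f s)" for k s
  have int1: "integrable lborel (\<lambda>s. cexp b \<rho> (t * h k s))" for k
    by (intro integrable_cexp[OF jm] modular_scale_finite[OF jm] hfin) measurable
  have int2: "integrable lborel (\<lambda>s. cexp b \<rho> (t * f s))"
    by (intro integrable_cexp[OF jm] modular_scale_finite[OF jm] fin) measurable
  define c where "c B = (CLINT s:B|lborel. cexp b \<rho> (t * f s))" for B
  have split: "(CLINT s:B|lborel. p k s) = expo b \<rho> (\<lambda>s. t * (indicator B s * h k s)) - c B"
    if B [measurable]: "B \<in> sets borel" for B k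
  proof -
    have "(CLINT s:B|lborel. p k s) =
        (CLINT s|lborel. indicator B s *\<^sub>R cexp b \<rho> (t * h k s) - indicator B s *\<^sub>R cexp b \<rho> (t * f s))"
      unfolding set_lebesgue_integral_def p_def by (simp only: scaleR_diff_right)
    also have "\<dots> = (CLINT s|lborel. indicator B s *\<^sub>R cexp b \<rho> (t * h k s)) - c B"
      unfolding c_def set_lebesgue_integral_def
      by (intro Bochner_Integration.integral_diff integrable_mult_indicator int1 int2) simp_all
    also have "(\<lambda>s. indicator B s *\<^sub>R cexp b \<rho> (t * h k s)) = (\<lambda>s. cexp b \<rho> (t * (indicator B s * h k s)))"
      using cexp_0[OF jm] by (intro ext) (simp add: indicator_def)
    finally show ?thesis unfolding expo_def .
  qed
  have hump: "(\<lambda>k. exp (CLINT s|lborel. p k s)) \<longlonglongrightarrow> 1"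
  proof (rule gliding_hump)
    show "integrable lborel (p k)" for k
      unfolding p_def using int1 int2 by (rule Bochner_Integration.integrable_diff)
    have cont: "isCont (cexp b \<rho>) x" for x
      using continuous_cexp[OF jm] by (simp add: continuous_on_eq_continuous_at)
    show "AE s in lborel. (\<lambda>k. p k s) \<longlonglongrightarrow> 0"
      using lim
    proof eventually_elim
      case (elim s)
      then have "(\<lambda>k. t * h k s) \<longlonglongrightarrow> t * f s" unfolding h_def by (intro tendsto_intros)
      from isCont_tendsto_compose[OF cont this] have "(\<lambda>k. cexp b \<rho> (t * h k s)) \<longlonglongrightarrow> cexp b \<rho> (t * f s)" .
      then show ?case unfolding p_def by (rule LIM_zero)
    qed
    fix B :: "'d set" assume B: "B \<in> sets borel"
    from conv[OF B] obtain W where "conv_in_prob M (Y B) W" unfolding Y_def by blast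
    from conv_in_prob_char[OF prob_space_axioms Ym[OF B] this, of t]
    have "(\<lambda>k. (CLINT \<omega>|M. iexp (t * Y B k \<omega>)) * exp (- c B)) \<longlonglongrightarrow> (CLINT \<omega>|M. iexp (t * W \<omega>)) * exp (- c B)"
      by (intro tendsto_mult tendsto_const)
    also have "(\<lambda>k. (CLINT \<omega>|M. iexp (t * Y B k \<omega>)) * exp (- c B)) = (\<lambda>k. exp (CLINT s:B|lborel. p k s))"
      unfolding charY[OF B] split[OF B] by (simp only: diff_conv_add_uminus exp_add)
    finally show "convergent (\<lambda>k. exp (CLINT s:B|lborel. p k s))" by (rule convergentI)
  qed
  have eq: "exp (CLINT s|lborel. p k s) * exp (expo b \<rho> (\<lambda>s. t * f s)) = (CLINT \<omega>|M. iexp (t * Y UNIV k \<omega>))" for k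
  proof -
    have "(CLINT s|lborel. p k s) = expo b \<rho> (\<lambda>s. t * h k s) - expo b \<rho> (\<lambda>s. t * f s)"
      unfolding p_def expo_def by (rule Bochner_Integration.integral_diff[OF int1 int2])
    then show ?thesis using charY[of UNIV k] by (simp flip: exp_add)
  qed
  have "(\<lambda>k. CLINT \<omega>|M. iexp (t * Y UNIV k \<omega>)) \<longlonglongrightarrow> 1 * exp (expo b \<rho> (\<lambda>s. t * f s))"
    unfolding eq[symmetric] by (intro tendsto_mult hump tendsto_const)
  moreover have "conv_in_prob M (Y UNIV) Z" using convZ unfolding Y_def by simp
  from conv_in_prob_char[OF prob_space_axioms Ym this, of t]
  have "(\<lambda>k. CLINT \<omega>|M. iexp (t * Y UNIV k \<omega>)) \<longlonglongrightarrow> (CLINT \<omega>|M. iexp (t * Z \<omega>))" by simp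
  ultimately show ?thesis using LIMSEQ_unique by fastforce
qed

text \<open>A linear combination of integrals is the integral of the combined kernel, so the scalar
  formula at argument 1 suffices.\<close>

lemma levy_integral_fd_char:
  assumes J: "finite J" and li: "\<And>j. j \<in> J \<Longrightarrow> levy_integral M L (f j) (Z j)"
    and f: "\<And>j. j \<in> J \<Longrightarrow> f j \<in> borel_measurable borel" and fin: "\<And>j. j \<in> J \<Longrightarrow> modular b \<rho> (f j) < \<infinity>"
  shows "(CLINT \<omega>|M. iexp (\<Sum>j\<in>J. \<theta> j * Z j \<omega>)) = exp (expo b \<rho> (\<lambda>s. \<Sum>j\<in>J. \<theta> j * f j s))"
proof -
  have "(CLINT \<omega>|M. iexp (1 * (\<Sum>j\<in>J. \<theta> j * Z j \<omega>))) = exp (expo b \<rho> (\<lambda>s. 1 * (\<Sum>j\<in>J. \<theta> j * f j s)))"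
  proof (rule levy_integral_char[OF levy_integral_sum[OF J li]])
    show "(\<lambda>s. \<Sum>j\<in>J. \<theta> j * f j s) \<in> borel_measurable borel" using f by measurable
    show "modular b \<rho> (\<lambda>s. \<Sum>j\<in>J. \<theta> j * f j s) < \<infinity>" by (rule modular_sum_finite[OF jm J f fin])
  qed
  then show ?thesis by simp
qed

end

section \<open>Translations and mixtures of kernels\<close>

lemma lborel_reflect:
  fixes f :: "'d::euclidean_space \<Rightarrow> ennreal"
  assumes [measurable]: "f \<in> borel_measurable borel"
  shows "(\<integral>\<^sup>+s. f (u - s) \<partial>lborel) = (\<integral>\<^sup>+s. f s \<partial>lborel)"
proof -
  have "(lborel :: 'd measure) = density (distr lborel borel (\<lambda>x. u + (- 1) *\<^sub>R x)) (\<lambda>_. ennreal (\<bar>- 1\<bar> ^ DIM('d)))"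
    by (rule lborel_affine) simp
  then have "(\<integral>\<^sup>+s. f s \<partial>lborel) = (\<integral>\<^sup>+s. f s \<partial>density (distr lborel borel (\<lambda>x. u + (- 1) *\<^sub>R x)) (\<lambda>_. ennreal (\<bar>- 1\<bar> ^ DIM('d))))"
    by metis
  also have "\<dots> = (\<integral>\<^sup>+s. f (u - s) \<partial>lborel)"
    by (simp add: nn_integral_density nn_integral_distr)
  finally show ?thesis by simp
qed

context
  fixes \<rho> :: "real measure" and b :: real
  assumes jm: "jump_measure \<rho>"
begin

lemmas [measurable] = KK_measurable[OF jm]

lemma modular_reflect:
  fixes h :: "'d::euclidean_space \<Rightarrow> real"
  assumes [measurable]: "h \<in> borel_measurable borel"
  shows "modular b \<rho> (\<lambda>s. h (u - s)) = modular b \<rho> h"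
  unfolding modular_def by (rule lborel_reflect[of "\<lambda>s. ennreal (KK b \<rho> (h s))"]) measurable

lemma modular_dominated:
  fixes f :: "nat \<Rightarrow> 'd::euclidean_space \<Rightarrow> real"
  assumes [measurable]: "\<And>n. f n \<in> borel_measurable borel" "F \<in> borel_measurable borel"
    and bound: "\<And>n. AE s in lborel. \<bar>f n s\<bar> \<le> \<bar>F s\<bar>" and fin: "modular b \<rho> F < \<infinity>"
    and lim: "AE s in lborel. (\<lambda>n. f n s) \<longlonglongrightarrow> 0"
  shows "(\<lambda>n. modular b \<rho> (f n)) \<longlonglongrightarrow> 0"
proof -
  have "(\<lambda>n. \<integral>\<^sup>+s. ennreal (KK b \<rho> (f n s)) \<partial>lborel) \<longlonglongrightarrow> (\<integral>\<^sup>+s. 0 \<partial>(lborel :: 'd measure))"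
  proof (rule nn_integral_dominated_convergence[where w = "\<lambda>s. ennreal (KK b \<rho> (F s))"])
    show "(\<integral>\<^sup>+s. ennreal (KK b \<rho> (F s)) \<partial>lborel) < \<infinity>" using fin by (simp add: modular_def)
    show "AE s in lborel. ennreal (KK b \<rho> (f n s)) \<le> ennreal (KK b \<rho> (F s))" for n
      using bound[of n] by eventually_elim (intro ennreal_leI KK_mono[OF jm])
    have cont: "isCont (KK b \<rho>) 0"
      using continuous_KK[OF jm] by (simp add: continuous_on_eq_continuous_at)
    show "AE s in lborel. (\<lambda>n. ennreal (KK b \<rho> (f n s))) \<longlonglongrightarrow> 0"
      using lim
    proof eventually_elim
      case (elim s)
      from isCont_tendsto_compose[OF cont elim] have "(\<lambda>n. KK b \<rho> (f n s)) \<longlonglongrightarrow> 0"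
        by (simp add: KK_0[OF jm])
      from tendsto_ennrealI[OF this] show ?case by simp
    qed
  qed measurable
  then show ?thesis by (simp add: modular_def)
qed

lemma modular_ball_finite: "modular b \<rho> (\<lambda>s::'d::euclidean_space. c * indicator (cball 0 R) s) < \<infinity>"
proof -
  have "modular b \<rho> (\<lambda>s::'d. c * indicator (cball 0 R) s) =
      (\<integral>\<^sup>+s. ennreal (KK b \<rho> c) * indicator (cball (0::'d) R) s \<partial>lborel)"
    unfolding modular_def by (intro nn_integral_cong) (simp add: indicator_def KK_0[OF jm])
  also have "\<dots> = ennreal (KK b \<rho> c) * emeasure lborel (cball (0::'d) R)"
    by (rule nn_integral_cmult_indicator) simp
  also have "\<dots> < \<infinity>"
    using emeasure_lborel_cball_finite[of "0::'d" R] by (simp add: ennreal_mult_less_top)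
  finally show ?thesis .
qed

lemma modular_add_less:
  assumes "f \<in> borel_measurable borel" "h \<in> borel_measurable borel"
    and "modular b \<rho> f < ennreal x" "modular b \<rho> h < ennreal y" and "0 \<le> x" "0 \<le> y"
  shows "modular b \<rho> (\<lambda>s. f s + h s) < ennreal (2 * (x + y))"
proof -
  have "modular b \<rho> f + modular b \<rho> h < ennreal x + ennreal y"
    using assms(3,4) by (rule add_strict_mono)
  then have "modular b \<rho> f + modular b \<rho> h < ennreal (x + y)" using assms(5,6) by simp
  then have "2 * (modular b \<rho> f + modular b \<rho> h) < 2 * ennreal (x + y)"
    by (intro ennreal_mult_strict_left_mono) auto
  also have "2 * ennreal (x + y) = ennreal (2 * (x + y))"
    using assms(5,6) by (intro numeral_mult_ennreal) simp
  finally show ?thesis using modular_add[OF jm assms(1,2)] by (rule order.strict_trans1[rotated])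
qed

text \<open>Truncation in value and in space precedes the approximation by continuous functions: the
  latter holds only almost everywhere and then becomes dominated by a multiple of the indicator of a
  ball, whose modular is finite.\<close>

lemma approx_continuous:
  fixes h :: "'d::euclidean_space \<Rightarrow> real"
  assumes h [measurable]: "h \<in> borel_measurable borel" and fin: "modular b \<rho> h < \<infinity>" and e: "0 < e"
  shows "\<exists>p R K. continuous_on UNIV p \<and> (\<forall>s. \<bar>p s\<bar> \<le> K * indicator (cball 0 R) s) \<and>
    modular b \<rho> (\<lambda>s. h s - p s) < ennreal e"
proof -
  define clip where "clip N x = max (- real N) (min (real N) x)" for N and x :: real
  \<comment> \<open>Decreases linearly from 1 to 0 between the radii N and N + 1; an indicator would
    spoil continuity.\<close>
  define cut where "cut N s = max 0 (min 1 (real N + 1 - norm s))" for N and s :: 'd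
  have clip_m [measurable]: "clip N \<in> borel_measurable borel" for N unfolding clip_def by measurable
  have cut_m [measurable]: "cut N \<in> borel_measurable borel" for N unfolding cut_def by measurable
  define q where "q N s = clip N (h s) * cut N s" for N s
  have q_m [measurable]: "q N \<in> borel_measurable borel" for N unfolding q_def by measurable
  have cut01: "0 \<le> cut N s" "cut N s \<le> 1" for N s by (auto simp: cut_def)
  have cut0: "cut N s = 0" if "s \<notin> cball 0 (real N + 1)" for N s using that by (simp add: cut_def)
  have clipN: "\<bar>clip N x\<bar> \<le> real N" for N x by (auto simp: clip_def)
  have prodN: "\<bar>clip N x * cut N s\<bar> \<le> real N * indicator (cball 0 (real N + 1)) s" for N x s
  proof (cases "s \<in> cball 0 (real N + 1)")
    case True
    have "\<bar>clip N x\<bar> * \<bar>cut N s\<bar> \<le> real N * 1" using clipN cut01[of N s] by (intro mult_mono) auto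
    then show ?thesis using True by (simp add: abs_mult)
  qed (simp add: cut0)
  have "(\<lambda>N. modular b \<rho> (\<lambda>s. h s - q N s)) \<longlonglongrightarrow> 0"
  proof (rule modular_dominated[OF _ h _ fin])
    show "AE s in lborel. \<bar>h s - q N s\<bar> \<le> \<bar>h s\<bar>" for N
    proof (rule AE_I2)
      fix s
      have "\<bar>x - c * d\<bar> \<le> \<bar>x\<bar>" if "0 \<le> x \<and> 0 \<le> c \<and> c \<le> x \<or> x \<le> 0 \<and> c \<le> 0 \<and> x \<le> c" "0 \<le> d" "d \<le> 1" for x c d :: real
      proof -
        have "\<bar>c * d\<bar> \<le> \<bar>c\<bar>" unfolding abs_mult using that by (simp add: mult_left_le)
        moreover have "0 \<le> c \<Longrightarrow> 0 \<le> c * d" "c \<le> 0 \<Longrightarrow> c * d \<le> 0"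
          using that by (simp_all add: mult_nonpos_nonneg)
        ultimately show ?thesis using that(1) by linarith
      qed
      moreover have "0 \<le> h s \<and> 0 \<le> clip N (h s) \<and> clip N (h s) \<le> h s \<or> h s \<le> 0 \<and> clip N (h s) \<le> 0 \<and> h s \<le> clip N (h s)"
        by (auto simp: clip_def)
      ultimately show "\<bar>h s - q N s\<bar> \<le> \<bar>h s\<bar>" unfolding q_def using cut01 by blast
    qed
    show "AE s in lborel. (\<lambda>N. h s - q N s) \<longlonglongrightarrow> 0"
    proof (rule AE_I2)
      fix s
      obtain N0 :: nat where N0: "max \<bar>h s\<bar> (norm s) \<le> real N0" using real_arch_simple by blast
      have "\<forall>\<^sub>F N in sequentially. h s - q N s = 0"
        using eventually_ge_at_top[of N0]
      proof eventually_elim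
        case (elim N)
        then have "real N0 \<le> real N" by simp
        then have "\<bar>h s\<bar> \<le> real N" "norm s \<le> real N" using N0 by auto
        then have "clip N (h s) = h s" "cut N s = 1" by (auto simp: clip_def cut_def)
        then show ?case by (simp add: q_def)
      qed
      then show "(\<lambda>N. h s - q N s) \<longlonglongrightarrow> 0" by (rule tendsto_eventually)
    qed
  qed measurable
  from order_tendstoD(2)[OF this, of "ennreal (e / 4)"] e
  obtain N where N: "modular b \<rho> (\<lambda>s. h s - q N s) < ennreal (e / 4)"
    by (auto dest: eventually_happens)
  \<comment> \<open>\<open>measurable_on\<close> unfolds to being the limit of continuous functions
    off a negligible set, the source of the approximants \<open>c n\<close>.\<close>
  have "h measurable_on UNIV"
    by (rule lebesgue_measurable_imp_measurable_on) (auto intro: borel_measurable_if_I measurable_completion)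
  then obtain Z c where Z: "negligible Z" and c: "\<And>n. continuous_on UNIV (c n)"
    and lim: "\<And>s. s \<notin> Z \<Longrightarrow> (\<lambda>n. c n s) \<longlonglongrightarrow> h s"
    unfolding measurable_on_def by auto
  have [measurable]: "c n \<in> borel_measurable borel" for n by (rule borel_measurable_continuous_onI[OF c])
  \<comment> \<open>Clipping with the same bounds gives the sequence \<open>c n\<close> the
    domination it lacks; the limit is \<open>q N\<close>, as clipping is continuous.\<close>
  define p where "p n s = clip N (c n s) * cut N s" for n s
  have p_m [measurable]: "p n \<in> borel_measurable borel" for n unfolding p_def by measurable
  have p_cont: "continuous_on UNIV (p n)" for n
    unfolding p_def clip_def cut_def by (intro continuous_intros c)
  have "(\<lambda>n. modular b \<rho> (\<lambda>s. q N s - p n s)) \<longlonglongrightarrow> 0"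
  proof (rule modular_dominated[where F = "\<lambda>s. (2 * real N) * indicator (cball 0 (real N + 1)) s"])
    show "AE s in lborel. \<bar>q N s - p n s\<bar> \<le> \<bar>2 * real N * indicator (cball 0 (real N + 1)) s\<bar>" for n
    proof (rule AE_I2)
      fix s
      show "\<bar>q N s - p n s\<bar> \<le> \<bar>2 * real N * indicator (cball 0 (real N + 1)) s\<bar>"
        using prodN[of N "h s" s] prodN[of N "c n s" s] by (auto simp: q_def p_def indicator_def split: if_splits)
    qed
    have "AE s in lborel. s \<notin> Z"
    proof -
      have "AE s in lebesgue. s \<notin> Z"
        using Z by (intro AE_not_in) (simp add: negligible_iff_null_sets)
      then show ?thesis by (rule AE_completion_iff[THEN iffD1, rotated])
    qed
    then show "AE s in lborel. (\<lambda>n. q N s - p n s) \<longlonglongrightarrow> 0"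
    proof eventually_elim
      case (elim s)
      have "(\<lambda>n. q N s - p n s) \<longlonglongrightarrow> q N s - q N s"
        unfolding p_def q_def clip_def by (intro tendsto_intros lim[OF elim])
      then show ?case by simp
    qed
    show "(\<lambda>s. q N s - p n s) \<in> borel_measurable borel" for n by measurable
    show "(\<lambda>s::'d. 2 * real N * indicator (cball 0 (real N + 1)) s) \<in> borel_measurable borel"
      by (intro borel_measurable_times borel_measurable_const borel_measurable_indicator) simp
    show "modular b \<rho> (\<lambda>s::'d. 2 * real N * indicator (cball 0 (real N + 1)) s) < \<infinity>"
      by (rule modular_ball_finite)
  qed
  from order_tendstoD(2)[OF this, of "ennreal (e / 4)"] e
  obtain n where n: "modular b \<rho> (\<lambda>s. q N s - p n s) < ennreal (e / 4)"
    by (auto dest: eventually_happens)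
  have "modular b \<rho> (\<lambda>s. (h s - q N s) + (q N s - p n s)) < ennreal (2 * (e / 4 + e / 4))"
    using e by (intro modular_add_less N n) auto
  then have "modular b \<rho> (\<lambda>s. h s - p n s) < ennreal e" by simp
  moreover have "\<forall>s. \<bar>p n s\<bar> \<le> real N * indicator (cball 0 (real N + 1)) s"
    using prodN by (simp add: p_def)
  ultimately show ?thesis using p_cont by blast
qed

text \<open>For continuous kernels of compact support dominated convergence suffices, all translates
  involved living in one ball because \<open>v\<close> is bounded. A general kernel is within small
  modular of such a kernel, uniformly over translations.\<close>

lemma translation_continuous:
  fixes h :: "'d::euclidean_space \<Rightarrow> real"
  assumes h [measurable]: "h \<in> borel_measurable borel" and fin: "modular b \<rho> h < \<infinity>" and u: "v \<longlonglongrightarrow> u"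
  shows "(\<lambda>n. modular b \<rho> (\<lambda>s. h (v n - s) - h (u - s))) \<longlonglongrightarrow> 0"
proof (rule order_tendstoI)
  fix a :: ennreal assume "0 < a"
  then have "\<exists>e>0. ennreal e \<le> a" by (cases a) (auto intro: exI[of _ 1])
  then obtain e where e: "0 < e" "ennreal e \<le> a" by blast
  \<comment> \<open>Each triangle inequality for the modular costs a factor 2: e/16 + e/16 becomes
    e/4, and then e/16 + e/4 becomes 5e/8, below e.\<close>
  have "0 < e / 16" using e by simp
  from approx_continuous[OF h fin this] obtain p R K where p: "continuous_on UNIV p"
      "\<And>s. \<bar>p s\<bar> \<le> K * indicator (cball 0 R) s"
    and close: "modular b \<rho> (\<lambda>s. h s - p s) < ennreal (e / 16)"
    by blast
  have p_m [measurable]: "p \<in> borel_measurable borel" by (rule borel_measurable_continuous_onI[OF p(1)])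
  have close': "modular b \<rho> (\<lambda>s. h (w - s) - p (w - s)) < ennreal (e / 16)" for w
    using modular_reflect[of "\<lambda>s. h s - p s" w] close by simp
  have close'': "modular b \<rho> (\<lambda>s. p (w - s) - h (w - s)) < ennreal (e / 16)" for w
  proof -
    have "modular b \<rho> (\<lambda>s. p (w - s) - h (w - s)) = modular b \<rho> (\<lambda>s. h (w - s) - p (w - s))"
      unfolding modular_def by (intro nn_integral_cong) (metis KK_minus[OF jm] minus_diff_eq)
    then show ?thesis using close' by simp
  qed
  have "Bseq v" using u by (intro convergent_imp_Bseq convergentI)
  then obtain V where V: "\<And>n. norm (v n) \<le> V" by (auto simp: Bseq_def)
  have Vu: "norm u \<le> V" using tendsto_norm[OF u] V by (intro LIMSEQ_le_const2) auto
  have "(\<lambda>n. modular b \<rho> (\<lambda>s. p (v n - s) - p (u - s))) \<longlonglongrightarrow> 0"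
  proof (rule modular_dominated[where F = "\<lambda>s. (2 * K) * indicator (cball 0 (R + V)) s"])
    show "AE s in lborel. \<bar>p (v n - s) - p (u - s)\<bar> \<le> \<bar>(2 * K) * indicator (cball 0 (R + V)) s\<bar>" for n
    proof (rule AE_I2)
      fix s :: 'd
      show "\<bar>p (v n - s) - p (u - s)\<bar> \<le> \<bar>(2 * K) * indicator (cball 0 (R + V)) s\<bar>"
      proof (cases "norm s \<le> R + V")
        case True
        have "K * indicator (cball 0 R) w \<le> \<bar>K\<bar>" for w :: 'd by (simp add: indicator_def abs_ge_self)
        then have "\<bar>p w\<bar> \<le> \<bar>K\<bar>" for w using p(2)[of w] order_trans by blast
        from this[of "v n - s"] this[of "u - s"] show ?thesis using True by (simp add: abs_mult)
      next
        case False
        have "norm (v n - s) > R" "norm (u - s) > R"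
          using False V[of n] Vu norm_triangle_ineq2[of s "v n"] norm_triangle_ineq2[of s u]
          by (auto simp: norm_minus_commute)
        then show ?thesis using p(2)[of "v n - s"] p(2)[of "u - s"] by simp
      qed
    qed
    show "AE s in lborel. (\<lambda>n. p (v n - s) - p (u - s)) \<longlonglongrightarrow> 0"
    proof (rule AE_I2)
      fix s :: 'd
      have "isCont p (u - s)" using p(1) by (simp add: continuous_on_eq_continuous_at)
      moreover have "(\<lambda>n. v n - s) \<longlonglongrightarrow> u - s" by (intro tendsto_intros u)
      ultimately have "(\<lambda>n. p (v n - s)) \<longlonglongrightarrow> p (u - s)" by (rule isCont_tendsto_compose)
      then show "(\<lambda>n. p (v n - s) - p (u - s)) \<longlonglongrightarrow> 0" by (rule LIM_zero)
    qed
    show "(\<lambda>s. p (v n - s) - p (u - s)) \<in> borel_measurable borel" for n by measurable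
    show "(\<lambda>s::'d. 2 * K * indicator (cball 0 (R + V)) s) \<in> borel_measurable borel"
      by (intro borel_measurable_times borel_measurable_const borel_measurable_indicator) simp
    show "modular b \<rho> (\<lambda>s::'d. 2 * K * indicator (cball 0 (R + V)) s) < \<infinity>"
      by (rule modular_ball_finite)
  qed
  from order_tendstoD(2)[OF this, of "ennreal (e / 16)"] e
  have "\<forall>\<^sub>F n in sequentially. modular b \<rho> (\<lambda>s. p (v n - s) - p (u - s)) < ennreal (e / 16)" by simp
  then show "\<forall>\<^sub>F n in sequentially. modular b \<rho> (\<lambda>s. h (v n - s) - h (u - s)) < a"
  proof eventually_elim
    case (elim n)
    have "modular b \<rho> (\<lambda>s. (p (v n - s) - p (u - s)) + (p (u - s) - h (u - s))) < ennreal (2 * (e / 16 + e / 16))"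
      using e by (intro modular_add_less elim close'') auto
    then have "modular b \<rho> (\<lambda>s. p (v n - s) - h (u - s)) < ennreal (e / 4)" by simp
    then have "modular b \<rho> (\<lambda>s. (h (v n - s) - p (v n - s)) + (p (v n - s) - h (u - s))) < ennreal (2 * (e / 16 + e / 4))"
      using e by (intro modular_add_less close') auto
    then have "modular b \<rho> (\<lambda>s. h (v n - s) - h (u - s)) < ennreal (2 * (e / 16 + e / 4))" by simp
    also have "\<dots> \<le> ennreal e" using e by (intro ennreal_leI) simp
    finally show ?case using e(2) by simp
  qed
qed simp

text \<open>For a measure of mass \<open>T\<close> Jensen's inequality is applied to the normalised
  measure and to \<open>T * f\<close>; pulling \<open>T\<close> out of \<open>KK\<close> costs at
  most \<open>T * max 1 T\<close>, and the average gives back 1/T. If \<open>f\<close> is not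
  integrable, its integral is 0 by convention and the bound is trivial.\<close>

lemma KK_jensen:
  fixes f :: "'u \<Rightarrow> real"
  assumes "finite_measure \<nu>" and f [measurable]: "f \<in> borel_measurable \<nu>"
  shows "ennreal (KK b \<rho> (LINT u|\<nu>. f u)) \<le>
    ennreal (max 1 (measure \<nu> (space \<nu>))) * (\<integral>\<^sup>+u. ennreal (KK b \<rho> (f u)) \<partial>\<nu>)"
proof -
  interpret finite_measure \<nu> by fact
  define T where "T = measure \<nu> (space \<nu>)"
  define I where "I = (\<integral>\<^sup>+u. ennreal (KK b \<rho> (f u)) \<partial>\<nu>)"
  show ?thesis
  proof (cases "integrable \<nu> f \<and> I < \<infinity>")
    case False
    then consider "\<not> integrable \<nu> f" | "I = \<infinity>" by (metis infinity_ennreal_def less_top)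
    then show ?thesis
    proof cases
      case 1
      then show ?thesis by (simp add: not_integrable_integral_eq KK_0[OF jm])
    next
      case 2
      then show ?thesis unfolding I_def[symmetric] by (simp add: ennreal_mult_top max_def)
    qed
  next
    case True
    then have int: "integrable \<nu> f" and Ifin: "I < \<infinity>" by auto
    have intK: "integrable \<nu> (\<lambda>u. KK b \<rho> (f u))"
      using Ifin KK_nonneg[OF jm, of b] unfolding I_def by (intro integrableI_nonneg) auto
    have I_eq: "I = ennreal (LINT u|\<nu>. KK b \<rho> (f u))"
      unfolding I_def using intK KK_nonneg[OF jm, of b] by (intro nn_integral_eq_integral) auto
    have "KK b \<rho> (LINT u|\<nu>. f u) \<le> max 1 T * (LINT u|\<nu>. KK b \<rho> (f u))"
    proof (cases "T = 0")
      case True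
      then have "emeasure \<nu> (space \<nu>) = 0" by (simp add: T_def emeasure_eq_measure)
      then have "AE u in \<nu>. f u = 0"
        by (intro AE_I[of _ _ "space \<nu>"]) auto
      then have "(LINT u|\<nu>. f u) = (LINT u|\<nu>. 0)" by (intro integral_cong_AE) auto
      then have "(LINT u|\<nu>. f u) = 0" by simp
      moreover have "0 \<le> (LINT u|\<nu>. KK b \<rho> (f u))" using KK_nonneg[OF jm] by simp
      ultimately show ?thesis by (simp add: KK_0[OF jm])
    next
      case False
      then have T: "0 < T" by (simp add: T_def less_le)
      define P where "P = density \<nu> (\<lambda>_. ennreal (1 / T))"
      interpret P: prob_space P
      proof
        have "emeasure P (space P) = ennreal (1 / T) * emeasure \<nu> (space \<nu>)"
          unfolding P_def by (simp add: emeasure_density nn_integral_cmult_indicator)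
        also have "\<dots> = ennreal (1 / T) * ennreal T" by (simp add: emeasure_eq_measure T_def)
        also have "\<dots> = ennreal (1 / T * T)" using T by (intro ennreal_mult[symmetric]) auto
        finally show "emeasure P (space P) = 1" using T by simp
      qed
      have intP: "(LINT u|P. w u) = (LINT u|\<nu>. w u) / T" if "w \<in> borel_measurable \<nu>" for w :: "'u \<Rightarrow> real"
        unfolding P_def using T that by (subst integral_density) auto
      have integP: "integrable P w" if "integrable \<nu> w" for w :: "'u \<Rightarrow> real"
        unfolding P_def using T that by (subst integrable_density) auto
      have K_le: "KK b \<rho> (T * x) \<le> (T * max 1 T) * KK b \<rho> x" for x
      proof (cases "T \<le> 1")
        case True
        then show ?thesis using KK_scale_le_1[OF jm, of T b x] T by simp
      next
        case False
        then have "1 \<le> T\<^sup>2" by (simp add: one_le_power)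
        then have "max 1 (T\<^sup>2) = T * max 1 T" using False by (simp add: max_absorb2 power2_eq_square)
        then show ?thesis using KK_scale[OF jm, of b T x] by simp
      qed
      have m: "(\<lambda>u. T * f u) \<in> borel_measurable \<nu>" "(\<lambda>u. KK b \<rho> (f u)) \<in> borel_measurable \<nu>" by measurable
      have intKT: "integrable \<nu> (\<lambda>u. KK b \<rho> (T * f u))"
      proof (rule Bochner_Integration.integrable_bound)
        show "integrable \<nu> (\<lambda>u. (T * max 1 T) * KK b \<rho> (f u))" using intK by simp
        show "AE u in \<nu>. norm (KK b \<rho> (T * f u)) \<le> norm ((T * max 1 T) * KK b \<rho> (f u))"
          using K_le KK_nonneg[OF jm] by (auto intro: order_trans[OF _ abs_ge_self])
      qed measurable
      have "KK b \<rho> (P.expectation (\<lambda>u. T * f u)) \<le> P.expectation (\<lambda>u. KK b \<rho> (T * f u))"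
        by (rule P.jensens_inequality[where I = UNIV])
           (use integP[OF intKT] integP[OF integrable_mult_right[OF int]] convex_on_KK[OF jm] in auto)
      also have "P.expectation (\<lambda>u. KK b \<rho> (T * f u)) \<le> P.expectation (\<lambda>u. (T * max 1 T) * KK b \<rho> (f u))"
        by (intro integral_mono integP intKT integrable_mult_right intK K_le)
      also have "\<dots> = (T * max 1 T) * ((LINT u|\<nu>. KK b \<rho> (f u)) / T)"
        using intP[OF m(2)] by simp
      also have "\<dots> = max 1 T * (LINT u|\<nu>. KK b \<rho> (f u))" using T by simp
      also have "P.expectation (\<lambda>u. T * f u) = (LINT u|\<nu>. f u)" using intP[OF m(1)] T by simp
      finally show ?thesis .
    qed
    then have "ennreal (KK b \<rho> (LINT u|\<nu>. f u)) \<le> ennreal (max 1 T * (LINT u|\<nu>. KK b \<rho> (f u)))"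
      by (rule ennreal_leI)
    also have "\<dots> = ennreal (max 1 T) * I"
      unfolding I_eq by (rule ennreal_mult) (use KK_nonneg[OF jm] in auto)
    finally show ?thesis unfolding T_def I_def .
  qed
qed

text \<open>Jensen's inequality at each point of space, followed by Tonelli. Mixtures over a measure
  of small mass thus have small modular when the members are uniformly bounded in it, which controls
  the approximations of averaged kernels.\<close>

lemma modular_mix:
  fixes H :: "'u \<Rightarrow> 'd::euclidean_space \<Rightarrow> real"
  assumes \<nu>: "finite_measure \<nu>" and H [measurable]: "case_prod H \<in> borel_measurable (\<nu> \<Otimes>\<^sub>M borel)"
  shows "modular b \<rho> (\<lambda>s. LINT u|\<nu>. H u s) \<le>
    ennreal (max 1 (measure \<nu> (space \<nu>))) * (\<integral>\<^sup>+u. modular b \<rho> (H u) \<partial>\<nu>)"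
proof -
  interpret finite_measure \<nu> by fact
  interpret P: pair_sigma_finite \<nu> lborel ..
  define T where "T = max 1 (measure \<nu> (space \<nu>))"
  have m: "(\<lambda>x. ennreal (KK b \<rho> (H (fst x) (snd x)))) \<in> borel_measurable (\<nu> \<Otimes>\<^sub>M borel)" by measurable
  have m': "(\<lambda>x. ennreal (KK b \<rho> (H (snd x) (fst x)))) \<in> borel_measurable (borel \<Otimes>\<^sub>M \<nu>)" by measurable
  have "modular b \<rho> (\<lambda>s. LINT u|\<nu>. H u s) \<le> (\<integral>\<^sup>+s. ennreal T * (\<integral>\<^sup>+u. ennreal (KK b \<rho> (H u s)) \<partial>\<nu>) \<partial>lborel)"
    unfolding modular_def T_def by (intro nn_integral_mono KK_jensen \<nu>) measurable
  also have "\<dots> = ennreal T * (\<integral>\<^sup>+s. (\<integral>\<^sup>+u. ennreal (KK b \<rho> (H u s)) \<partial>\<nu>) \<partial>lborel)"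
  proof (rule nn_integral_cmult)
    have "(\<lambda>s. \<integral>\<^sup>+u. ennreal (KK b \<rho> (H u s)) \<partial>\<nu>) \<in> borel_measurable borel"
      using m' by (intro borel_measurable_nn_integral) (simp add: case_prod_beta')
    then show "(\<lambda>s. \<integral>\<^sup>+u. ennreal (KK b \<rho> (H u s)) \<partial>\<nu>) \<in> borel_measurable lborel" by simp
  qed
  also have "(\<integral>\<^sup>+s. (\<integral>\<^sup>+u. ennreal (KK b \<rho> (H u s)) \<partial>\<nu>) \<partial>lborel) =
      (\<integral>\<^sup>+u. (\<integral>\<^sup>+s. ennreal (KK b \<rho> (H u s)) \<partial>lborel) \<partial>\<nu>)"
    by (rule P.Fubini') (use measurable_pair_lborel[OF m] in \<open>simp add: case_prod_beta'\<close>)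
  finally show ?thesis unfolding T_def modular_def .
qed

end

section \<open>Existence of finite-dimensional laws with given exponent\<close>

definition fd_law :: "'i set \<Rightarrow> (('i \<Rightarrow> real) \<Rightarrow> complex) \<Rightarrow> bool" where
  "fd_law J \<phi> \<longleftrightarrow> (\<exists>\<eta>. fd_prob J \<eta> \<and> (\<forall>\<theta>. fd_char J \<eta> \<theta> = \<phi> \<theta>))"

lemma fd_prob_distr:
  assumes M: "prob_space M" and Y: "\<And>j. j \<in> J \<Longrightarrow> Y j \<in> borel_measurable M"
  shows "fd_prob J (distr M (PiM J (\<lambda>_. borel)) (\<lambda>\<omega>. \<lambda>j\<in>J. Y j \<omega>))"
proof -
  have m: "(\<lambda>\<omega>. \<lambda>j\<in>J. Y j \<omega>) \<in> measurable M (PiM J (\<lambda>_. borel))"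
    using Y by (rule measurable_restrict)
  show ?thesis unfolding fd_prob_def using prob_space.prob_space_distr[OF M m] by simp
qed

lemma fd_char_distr:
  assumes J: "finite J" and Y: "\<And>j. j \<in> J \<Longrightarrow> Y j \<in> borel_measurable M"
  shows "fd_char J (distr M (PiM J (\<lambda>_. borel)) (\<lambda>\<omega>. \<lambda>j\<in>J. Y j \<omega>)) \<theta> =
    (CLINT \<omega>|M. iexp (\<Sum>j\<in>J. \<theta> j * Y j \<omega>))"
proof -
  have m: "(\<lambda>\<omega>. \<lambda>j\<in>J. Y j \<omega>) \<in> measurable M (PiM J (\<lambda>_. borel))"
    using Y by (rule measurable_restrict)
  have "(\<lambda>x. iexp (\<Sum>j\<in>J. \<theta> j * x j)) \<in> borel_measurable (PiM J (\<lambda>_. borel))"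
    by measurable
  from integral_distr[OF m this] show ?thesis
    unfolding fd_char_def by (simp cong: sum.cong)
qed

lemma fd_law_rv:
  assumes "prob_space M" "finite J" "\<And>j. j \<in> J \<Longrightarrow> Y j \<in> borel_measurable M"
  shows "fd_law J (\<lambda>\<theta>. CLINT \<omega>|M. iexp (\<Sum>j\<in>J. \<theta> j * Y j \<omega>))"
  unfolding fd_law_def using fd_prob_distr[of M J Y] fd_char_distr[of J Y M] assms by blast

lemma fd_lawD:
  assumes "fd_law J \<phi>"
  shows "\<exists>\<eta>. prob_space \<eta> \<and> (\<forall>j\<in>J. (\<lambda>x. x j) \<in> borel_measurable \<eta>) \<and>
    (\<forall>\<theta>. (CLINT x|\<eta>. iexp (\<Sum>j\<in>J. \<theta> j * x j)) = \<phi> \<theta>)"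
proof -
  from assms obtain \<eta> where \<eta>: "fd_prob J \<eta>" "\<And>\<theta>. fd_char J \<eta> \<theta> = \<phi> \<theta>"
    unfolding fd_law_def by blast
  have s: "sets \<eta> = sets (PiM J (\<lambda>_. borel))" using \<eta>(1) by (simp add: fd_prob_def)
  have "(\<lambda>x. x j) \<in> borel_measurable \<eta>" if "j \<in> J" for j
    unfolding measurable_cong_sets[OF s refl] using that by (rule measurable_component_singleton)
  then show ?thesis using \<eta> unfolding fd_prob_def fd_char_def by blast
qed

lemma fd_law_const: "finite J \<Longrightarrow> fd_law J (\<lambda>\<theta>. iexp (\<Sum>j\<in>J. \<theta> j * c j))"
  using fd_law_rv[of "measure_pmf (return_pmf ())" J "\<lambda>j _. c j"]
  by (simp add: measure_pmf.prob_space_axioms)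

text \<open>Convolution, realised as the sum of the two coordinates on a product space.\<close>

lemma fd_law_mult:
  assumes J: "finite J" and 1: "fd_law J \<phi>" and 2: "fd_law J \<psi>"
  shows "fd_law J (\<lambda>\<theta>. \<phi> \<theta> * \<psi> \<theta>)"
proof -
  obtain \<eta> where \<eta>: "prob_space \<eta>" and \<eta>m: "\<And>j. j \<in> J \<Longrightarrow> (\<lambda>x. x j) \<in> borel_measurable \<eta>"
    and \<phi>: "\<And>\<theta>. (CLINT x|\<eta>. iexp (\<Sum>j\<in>J. \<theta> j * x j)) = \<phi> \<theta>" using fd_lawD[OF 1] by blast
  obtain \<zeta> where \<zeta>: "prob_space \<zeta>" and \<zeta>m: "\<And>j. j \<in> J \<Longrightarrow> (\<lambda>x. x j) \<in> borel_measurable \<zeta>"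
    and \<psi>: "\<And>\<theta>. (CLINT x|\<zeta>. iexp (\<Sum>j\<in>J. \<theta> j * x j)) = \<psi> \<theta>" using fd_lawD[OF 2] by blast
  interpret \<eta>: prob_space \<eta> by fact
  interpret \<zeta>: prob_space \<zeta> by fact
  interpret P: pair_prob_space \<eta> \<zeta> ..
  have m1: "(\<lambda>x. fst x j) \<in> borel_measurable (\<eta> \<Otimes>\<^sub>M \<zeta>)" if "j \<in> J" for j
    by (rule measurable_compose[OF measurable_fst \<eta>m[OF that]])
  have m2: "(\<lambda>x. snd x j) \<in> borel_measurable (\<eta> \<Otimes>\<^sub>M \<zeta>)" if "j \<in> J" for j
    by (rule measurable_compose[OF measurable_snd \<zeta>m[OF that]])
  have m: "(\<lambda>x. fst x j + snd x j) \<in> borel_measurable (\<eta> \<Otimes>\<^sub>M \<zeta>)" if "j \<in> J" for j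
    using m1[OF that] m2[OF that] by (rule borel_measurable_add)
  have "fd_law J (\<lambda>\<theta>. CLINT x|\<eta> \<Otimes>\<^sub>M \<zeta>. iexp (\<Sum>j\<in>J. \<theta> j * (fst x j + snd x j)))"
    by (rule fd_law_rv[OF P.prob_space_axioms J m])
  moreover have "(CLINT x|\<eta> \<Otimes>\<^sub>M \<zeta>. iexp (\<Sum>j\<in>J. \<theta> j * (fst x j + snd x j))) = \<phi> \<theta> * \<psi> \<theta>" for \<theta>
  proof -
    have "integrable (\<eta> \<Otimes>\<^sub>M \<zeta>) (\<lambda>x. iexp (\<Sum>j\<in>J. \<theta> j * (fst x j + snd x j)))"
    proof (rule P.integrable_const_bound[of _ 1])
      show "(\<lambda>x. iexp (\<Sum>j\<in>J. \<theta> j * (fst x j + snd x j))) \<in> borel_measurable (\<eta> \<Otimes>\<^sub>M \<zeta>)"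
        using m by measurable
    qed auto
    from P.integral_fst'[OF this]
    have "(CLINT x|\<eta> \<Otimes>\<^sub>M \<zeta>. iexp (\<Sum>j\<in>J. \<theta> j * (fst x j + snd x j))) =
        (CLINT x|\<eta>. CLINT y|\<zeta>. iexp (\<Sum>j\<in>J. \<theta> j * (x j + y j)))" by simp
    also have "\<dots> = (CLINT x|\<eta>. CLINT y|\<zeta>. iexp (\<Sum>j\<in>J. \<theta> j * x j) * iexp (\<Sum>j\<in>J. \<theta> j * y j))"
      by (simp add: distrib_left sum.distrib exp_add)
    also have "\<dots> = \<phi> \<theta> * \<psi> \<theta>"
      unfolding integral_mult_right_zero integral_mult_left_zero \<phi> \<psi> ..
    finally show ?thesis .
  qed
  ultimately show ?thesis by simp
qed

lemma fd_law_power: "finite J \<Longrightarrow> fd_law J \<phi> \<Longrightarrow> fd_law J (\<lambda>\<theta>. \<phi> \<theta> ^ n)"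
proof (induction n)
  case 0
  then show ?case using fd_law_const[of J "\<lambda>_. 0"] by simp
next
  case (Suc n)
  then show ?case using fd_law_mult[of J \<phi> "\<lambda>\<theta>. \<phi> \<theta> ^ n"] by simp
qed

lemma fd_law_gauss_rank_one:
  assumes J: "finite J"
  shows "fd_law J (\<lambda>\<theta>. of_real (exp (- ((\<Sum>j\<in>J. \<theta> j * c j)\<^sup>2 / 2))))"
proof -
  interpret real_distribution std_normal_distribution by (rule real_dist_normal_dist)
  have "fd_law J (\<lambda>\<theta>. CLINT x|std_normal_distribution. iexp (\<Sum>j\<in>J. \<theta> j * (c j * x)))"
    by (rule fd_law_rv[OF prob_space_axioms J]) simp
  moreover have "(CLINT x|std_normal_distribution. iexp (\<Sum>j\<in>J. \<theta> j * (c j * x))) =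
      of_real (exp (- ((\<Sum>j\<in>J. \<theta> j * c j)\<^sup>2 / 2)))" for \<theta>
  proof -
    have "(CLINT x|std_normal_distribution. iexp (\<Sum>j\<in>J. \<theta> j * (c j * x))) =
        char std_normal_distribution (\<Sum>j\<in>J. \<theta> j * c j)"
      unfolding char_def by (simp only: sum_distrib_right mult.assoc)
    then show ?thesis by (simp add: char_std_normal_distribution)
  qed
  ultimately show ?thesis by simp
qed

lemma integrable_prod_of_squares:
  fixes f g :: "'z \<Rightarrow> real"
  assumes [measurable]: "f \<in> borel_measurable N" "g \<in> borel_measurable N"
    and "integrable N (\<lambda>z. (f z)\<^sup>2)" "integrable N (\<lambda>z. (g z)\<^sup>2)"
  shows "integrable N (\<lambda>z. f z * g z)"
proof (rule Bochner_Integration.integrable_bound)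
  show "integrable N (\<lambda>z. (f z)\<^sup>2 + (g z)\<^sup>2)" using assms(3,4) by simp
  have "\<bar>x * y\<bar> \<le> x\<^sup>2 + y\<^sup>2" for x y :: real
  proof -
    have "2 * \<bar>x\<bar> * \<bar>y\<bar> \<le> x\<^sup>2 + y\<^sup>2" using sum_squares_bound[of "\<bar>x\<bar>" "\<bar>y\<bar>"] by simp
    moreover have "0 \<le> \<bar>x\<bar> * \<bar>y\<bar>" by simp
    ultimately show ?thesis unfolding abs_mult by linarith
  qed
  then show "AE z in N. norm (f z * g z) \<le> norm ((f z)\<^sup>2 + (g z)\<^sup>2)" by simp
qed measurable

(* Completing the square removes one coordinate function at a time. *)
lemma fd_law_gauss_aux:
  fixes f :: "'i \<Rightarrow> 'z \<Rightarrow> real"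
  assumes J: "finite J" and A: "finite A"
    and "\<And>j. j \<in> J \<Longrightarrow> f j \<in> borel_measurable N" "\<And>j. j \<in> J \<Longrightarrow> integrable N (\<lambda>z. (f j z)\<^sup>2)"
    and "\<And>j. j \<in> J - A \<Longrightarrow> AE z in N. f j z = 0"
  shows "fd_law J (\<lambda>\<theta>. of_real (exp (- ((LINT z|N. (\<Sum>j\<in>J. \<theta> j * f j z)\<^sup>2) / 2))))"
  using A assms(3-)
proof (induction A arbitrary: f rule: finite_induct)
  case empty
  have "(LINT z|N. (\<Sum>j\<in>J. \<theta> j * f j z)\<^sup>2) = 0" for \<theta>
  proof -
    have "AE z in N. \<forall>j\<in>J. f j z = 0" using empty J by (simp add: AE_finite_all)
    then have "AE z in N. (\<Sum>j\<in>J. \<theta> j * f j z)\<^sup>2 = 0" by eventually_elim simp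
    then show ?thesis by (rule integral_eq_zero_AE)
  qed
  then show ?case using fd_law_const[OF J, of "\<lambda>_. 0"] by simp
next
  case (insert i A)
  note fm = insert.prems(1) and fi = insert.prems(2) and f0 = insert.prems(3)
  define q where "q = (LINT z|N. (f i z)\<^sup>2)"
  show ?case
  proof (cases "i \<in> J \<and> q \<noteq> 0")
    case False
    \<comment> \<open>Either \<open>i\<close> is no index of the vector or \<open>f i\<close>
      vanishes almost everywhere; in both cases \<open>A\<close> without \<open>i\<close> already
      suffices.\<close>
    have "AE z in N. f j z = 0" if "j \<in> J - A" for j
    proof (cases "j = i")
      case True
      then have "q = 0" "j \<in> J" using False that by auto
      then have "AE z in N. (f j z)\<^sup>2 = 0"
        using integral_nonneg_eq_0_iff_AE[OF fi[of j]] by (simp add: q_def True)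
      then show ?thesis by simp
    qed (use f0 that in auto)
    with fm fi show ?thesis by (intro insert.IH[of f])
  next
    case True
    then have i: "i \<in> J" and q: "q \<noteq> 0" by auto
    have "0 \<le> q" unfolding q_def by simp
    then have q0: "0 < q" using q by simp
    \<comment> \<open>Gram--Schmidt: \<open>f' j\<close> is the component of \<open>f j\<close>
      orthogonal to \<open>f i\<close>. The quadratic form splits into a square of rank one, a
      scalar Gaussian, and the form of the \<open>f'\<close>, whose member \<open>i\<close> is
      zero.\<close>
    define c where "c j = (LINT z|N. f j z * f i z)" for j
    define f' where "f' j z = f j z - c j / q * f i z" for j z
    have f'm: "f' j \<in> borel_measurable N" if "j \<in> J" for j
      unfolding f'_def using fm[OF that] fm[OF i] by measurable
    have int2: "integrable N (\<lambda>z. f j z * f k z)" if "j \<in> J" "k \<in> J" for j k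
      by (rule integrable_prod_of_squares) (use fm fi that in auto)
    have f'i: "integrable N (\<lambda>z. (f' j z)\<^sup>2)" if j: "j \<in> J" for j
    proof -
      have "(f' j z)\<^sup>2 = (f j z)\<^sup>2 - 2 * (c j / q) * (f j z * f i z) + (c j / q)\<^sup>2 * (f i z)\<^sup>2" for z
        unfolding f'_def by (simp add: power2_eq_square algebra_simps)
      moreover have "integrable N (\<lambda>z. (f j z)\<^sup>2 - 2 * (c j / q) * (f j z * f i z) + (c j / q)\<^sup>2 * (f i z)\<^sup>2)"
        by (intro Bochner_Integration.integrable_add Bochner_Integration.integrable_diff
          integrable_mult_right fi int2 j i)
      ultimately show ?thesis by simp
    qed
    have f'0: "AE z in N. f' j z = 0" if j: "j \<in> J - A" for j
    proof (cases "j = i")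
      case True
      have "c i = q" by (simp add: c_def q_def power2_eq_square)
      then show ?thesis using q True by (simp add: f'_def)
    next
      case False
      then have z: "AE z in N. f j z = 0" using f0 j by auto
      then have "AE z in N. f j z * f i z = 0" by eventually_elim simp
      then have "c j = 0" unfolding c_def by (rule integral_eq_zero_AE)
      then show ?thesis using z by (simp add: f'_def)
    qed
    have IH: "fd_law J (\<lambda>\<theta>. of_real (exp (- ((LINT z|N. (\<Sum>j\<in>J. \<theta> j * f' j z)\<^sup>2) / 2))))"
      using f'm f'i f'0 by (intro insert.IH[of f'])
    have "(LINT z|N. (\<Sum>j\<in>J. \<theta> j * f j z)\<^sup>2) =
        (\<Sum>j\<in>J. \<theta> j * (c j / sqrt q))\<^sup>2 + (LINT z|N. (\<Sum>j\<in>J. \<theta> j * f' j z)\<^sup>2)" for \<theta>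
    proof -
      define B where "B = (\<Sum>j\<in>J. \<theta> j * c j)"
      define F where "F z = (\<Sum>j\<in>J. \<theta> j * f j z)" for z
      have F': "(\<Sum>j\<in>J. \<theta> j * f' j z) = F z - B / q * f i z" for z
        unfolding f'_def F_def B_def
        by (simp add: algebra_simps sum_subtractf sum_distrib_left sum_divide_distrib)
      have Ffi: "F z * f i z = (\<Sum>j\<in>J. \<theta> j * (f j z * f i z))" for z
        unfolding F_def by (simp add: sum_distrib_right mult.assoc)
      have intFfi: "integrable N (\<lambda>z. F z * f i z)"
        unfolding Ffi by (intro Bochner_Integration.integrable_sum integrable_mult_right int2 i)
      have LB: "(LINT z|N. F z * f i z) = B"
        unfolding Ffi B_def c_def using int2 i by (subst Bochner_Integration.integral_sum) auto
      have F2: "(F z)\<^sup>2 = (\<Sum>j\<in>J. \<Sum>k\<in>J. \<theta> j * \<theta> k * (f j z * f k z))" for z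
        unfolding F_def power2_eq_square sum_product by (intro sum.cong) (auto simp: mult_ac)
      have intF2: "integrable N (\<lambda>z. (F z)\<^sup>2)"
        unfolding F2 by (intro Bochner_Integration.integrable_sum integrable_mult_right int2)
      have "(LINT z|N. (\<Sum>j\<in>J. \<theta> j * f' j z)\<^sup>2) =
          (LINT z|N. (F z)\<^sup>2 - 2 * (B / q) * (F z * f i z) + (B / q)\<^sup>2 * (f i z)\<^sup>2)"
        unfolding F' by (intro Bochner_Integration.integral_cong refl) (simp add: power2_eq_square algebra_simps)
      also have "\<dots> = (LINT z|N. (F z)\<^sup>2) - 2 * (B / q) * B + (B / q)\<^sup>2 * q"
        using intF2 intFfi fi[OF i] LB by (simp add: q_def)
      also have "\<dots> = (LINT z|N. (F z)\<^sup>2) - B\<^sup>2 / q"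
        using q by (simp add: power2_eq_square field_simps)
      also have "B\<^sup>2 / q = (\<Sum>j\<in>J. \<theta> j * (c j / sqrt q))\<^sup>2"
      proof -
        have "(\<Sum>j\<in>J. \<theta> j * (c j / sqrt q)) = B / sqrt q" by (simp add: B_def sum_divide_distrib)
        then show ?thesis using q0 by (simp add: power_divide)
      qed
      finally show ?thesis by (simp add: F_def)
    qed
    then have "of_real (exp (- ((LINT z|N. (\<Sum>j\<in>J. \<theta> j * f j z)\<^sup>2) / 2))) =
        of_real (exp (- ((\<Sum>j\<in>J. \<theta> j * (c j / sqrt q))\<^sup>2 / 2))) *
        (of_real (exp (- ((LINT z|N. (\<Sum>j\<in>J. \<theta> j * f' j z)\<^sup>2) / 2))) :: complex)" for \<theta>
      by (simp add: add_divide_distrib exp_add[symmetric] flip: of_real_mult)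
    then show ?thesis
      using fd_law_mult[OF J fd_law_gauss_rank_one[OF J, of "\<lambda>j. c j / sqrt q"] IH] by simp
  qed
qed

lemma fd_law_gauss:
  assumes "finite J" "\<And>j. j \<in> J \<Longrightarrow> f j \<in> borel_measurable N" "\<And>j. j \<in> J \<Longrightarrow> integrable N (\<lambda>z. (f j z)\<^sup>2)"
  shows "fd_law J (\<lambda>\<theta>. of_real (exp (- ((LINT z|N. (\<Sum>j\<in>J. \<theta> j * f j z)\<^sup>2) / 2))))"
  by (rule fd_law_gauss_aux[OF assms(1) assms(1)]) (use assms in auto)

section \<open>Compound Poisson laws\<close>

lemma product_coordinates_indep:
  assumes \<eta>: "\<And>n. prob_space (\<eta> n)"
  shows "prob_space.indep_vars (PiM UNIV \<eta>) \<eta> (\<lambda>n x. x n) (UNIV :: nat set)"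
proof -
  interpret product_prob_space \<eta> UNIV
    by (intro product_prob_spaceI \<eta>)
  show ?thesis
  proof (subst indep_vars_iff_distr_eq_PiM)
    show "distr (PiM UNIV \<eta>) (PiM UNIV \<eta>) (\<lambda>x. \<lambda>i\<in>UNIV. x i) = PiM UNIV (\<lambda>i. distr (PiM UNIV \<eta>) (\<eta> i) (\<lambda>x. x i))"
      using PiM_component by (simp add: restrict_UNIV distr_id)
  qed auto
qed

text \<open>No random sum is formed: on an infinite product whose coordinate n has characteristic
  function \<open>\<xi> \<theta> ^ n\<close>, the coordinate at an independent Poisson index has the
  Poisson mixture of these powers, which is the exponential series.\<close>

lemma fd_law_compound:
  fixes r :: real and J :: "'i set"
  assumes J: "finite J" and \<xi>: "fd_law J \<xi>" and r: "0 < r"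
  shows "fd_law J (\<lambda>\<theta>. exp (of_real r * (\<xi> \<theta> - 1)))"
proof -
  define Q where "Q n \<eta> \<longleftrightarrow> prob_space \<eta> \<and> (\<forall>j\<in>J. (\<lambda>x. x j) \<in> borel_measurable \<eta>) \<and>
    (\<forall>\<theta>. (CLINT x|\<eta>. iexp (\<Sum>j\<in>J. \<theta> j * x j)) = \<xi> \<theta> ^ n)" for n and \<eta> :: "('i \<Rightarrow> real) measure"
  have "\<forall>n. \<exists>\<eta>. Q n \<eta>"
    unfolding Q_def by (intro allI fd_lawD[OF fd_law_power[OF J \<xi>]])
  from choice[OF this] obtain \<eta> where Q: "\<And>n. Q n (\<eta> n)" by blast
  have \<eta>: "prob_space (\<eta> n)" for n
    using Q[of n] unfolding Q_def by blast
  have \<eta>m: "(\<lambda>x. x j) \<in> borel_measurable (\<eta> n)" if "j \<in> J" for n j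
    using Q[of n] that unfolding Q_def by blast
  have \<eta>c: "(CLINT x|\<eta> n. iexp (\<Sum>j\<in>J. \<theta> j * x j)) = \<xi> \<theta> ^ n" for n \<theta>
    using Q[of n] unfolding Q_def by blast
  interpret PP: product_prob_space \<eta> UNIV
    by (intro product_prob_spaceI \<eta>)
  define p where "p = measure_pmf (poisson_pmf r)"
  interpret p: prob_space p unfolding p_def by (rule measure_pmf.prob_space_axioms)
  interpret P: pair_prob_space p "PiM UNIV \<eta>" ..
  have c_meas: "(\<lambda>x. x n j) \<in> borel_measurable (PiM UNIV \<eta>)" if "j \<in> J" for n j
    using measurable_compose[OF measurable_component_singleton[of n UNIV \<eta>] \<eta>m[OF that, of n]] by simp
  \<comment> \<open>Joint measurability of the evaluation at a random index: there are countably
    many indices, so it suffices to fix one.\<close>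
  have m: "(\<lambda>z. snd z (fst z) j) \<in> borel_measurable (p \<Otimes>\<^sub>M PiM UNIV \<eta>)" if j: "j \<in> J" for j
  proof -
    have "(\<lambda>z. snd z (fst z) j) \<in> borel_measurable (count_space UNIV \<Otimes>\<^sub>M PiM UNIV \<eta>)"
    proof (rule measurable_pair_measure_countable1)
      show "countable (UNIV :: nat set)" by simp
      show "(\<lambda>y. snd (n, y) (fst (n, y)) j) \<in> borel_measurable (PiM UNIV \<eta>)" for n
        using c_meas[OF j, of n] by simp
    qed
    moreover have "sets (p \<Otimes>\<^sub>M PiM UNIV \<eta>) = sets (count_space UNIV \<Otimes>\<^sub>M PiM UNIV \<eta>)"
      unfolding p_def by (intro sets_pair_measure_cong) auto
    ultimately show ?thesis using measurable_cong_sets by blast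
  qed
  have "fd_law J (\<lambda>\<theta>. CLINT z|p \<Otimes>\<^sub>M PiM UNIV \<eta>. iexp (\<Sum>j\<in>J. \<theta> j * snd z (fst z) j))"
    by (rule fd_law_rv[OF P.prob_space_axioms J m])
  moreover have "(CLINT z|p \<Otimes>\<^sub>M PiM UNIV \<eta>. iexp (\<Sum>j\<in>J. \<theta> j * snd z (fst z) j)) =
      exp (of_real r * (\<xi> \<theta> - 1))" for \<theta>
  proof -
    have "integrable (p \<Otimes>\<^sub>M PiM UNIV \<eta>) (\<lambda>z. iexp (\<Sum>j\<in>J. \<theta> j * snd z (fst z) j))"
    proof (rule P.integrable_const_bound[of _ 1])
      show "(\<lambda>z. iexp (\<Sum>j\<in>J. \<theta> j * snd z (fst z) j)) \<in> borel_measurable (p \<Otimes>\<^sub>M PiM UNIV \<eta>)"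
        using m by measurable
    qed auto
    from P.integral_fst'[OF this]
    have "(CLINT z|p \<Otimes>\<^sub>M PiM UNIV \<eta>. iexp (\<Sum>j\<in>J. \<theta> j * snd z (fst z) j)) =
        (CLINT n|p. CLINT x|PiM UNIV \<eta>. iexp (\<Sum>j\<in>J. \<theta> j * x n j))" by simp
    also have "\<dots> = (CLINT n|p. \<xi> \<theta> ^ n)"
    proof (rule Bochner_Integration.integral_cong[OF refl])
      fix n
      have "(CLINT x|PiM UNIV \<eta>. iexp (\<Sum>j\<in>J. \<theta> j * x n j)) =
          (CLINT y|distr (PiM UNIV \<eta>) (\<eta> n) (\<lambda>x. x n). iexp (\<Sum>j\<in>J. \<theta> j * y j))"
      proof (rule integral_distr[symmetric])
        show "(\<lambda>y. iexp (\<Sum>j\<in>J. \<theta> j * y j)) \<in> borel_measurable (\<eta> n)" using \<eta>m by measurable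
      qed simp
      then show "(CLINT x|PiM UNIV \<eta>. iexp (\<Sum>j\<in>J. \<theta> j * x n j)) = \<xi> \<theta> ^ n"
        using PP.PiM_component[of n] \<eta>c by simp
    qed
    also have "\<dots> = (CLINT n|count_space UNIV. pmf (poisson_pmf r) n *\<^sub>R \<xi> \<theta> ^ n)"
      unfolding p_def measure_pmf_eq_density by (subst integral_density) auto
    also have "\<dots> = exp (of_real r * (\<xi> \<theta> - 1))"
    proof -
      have \<xi>1: "norm (\<xi> \<theta>) \<le> 1"
      proof -
        have "norm (CLINT x|\<eta> 1. iexp (\<Sum>j\<in>J. \<theta> j * x j)) \<le> (LINT x|\<eta> 1. norm (iexp (\<Sum>j\<in>J. \<theta> j * x j)))"
          by (rule integral_norm_bound)
        then show ?thesis unfolding \<eta>c by (simp add: prob_space.prob_space[OF \<eta>])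
      qed
      have "integrable p (\<lambda>n. \<xi> \<theta> ^ n)"
      proof (rule p.integrable_const_bound[of _ 1])
        show "AE n in p. norm (\<xi> \<theta> ^ n) \<le> 1" using \<xi>1 by (simp add: norm_power power_le_one)
      qed (simp add: p_def)
      then have "integrable (count_space UNIV) (\<lambda>n. pmf (poisson_pmf r) n *\<^sub>R \<xi> \<theta> ^ n)"
        unfolding p_def measure_pmf_eq_density by (subst (asm) integrable_density) auto
      then have 1: "(\<lambda>n. pmf (poisson_pmf r) n *\<^sub>R \<xi> \<theta> ^ n) sums
          (CLINT n|count_space UNIV. pmf (poisson_pmf r) n *\<^sub>R \<xi> \<theta> ^ n)"
        by (rule sums_integral_count_space_nat)
      have "(\<lambda>n. exp (- of_real r) * ((of_real r * \<xi> \<theta>) ^ n /\<^sub>R fact n)) sums (exp (- of_real r) * exp (of_real r * \<xi> \<theta>))"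
        by (intro sums_mult exp_converges)
      moreover have "exp (- of_real r) * ((of_real r * \<xi> \<theta>) ^ n /\<^sub>R fact n) = pmf (poisson_pmf r) n *\<^sub>R \<xi> \<theta> ^ n" for n
      proof -
        have "exp (- complex_of_real r) = of_real (exp (- r))" by (metis exp_of_real of_real_minus)
        then show ?thesis
          using r by (simp add: scaleR_conv_of_real power_mult_distrib divide_inverse)
      qed
      ultimately have 2: "(\<lambda>n. pmf (poisson_pmf r) n *\<^sub>R \<xi> \<theta> ^ n) sums (exp (- of_real r) * exp (of_real r * \<xi> \<theta>))"
        by simp
      from sums_unique2[OF 1 2] show ?thesis by (simp add: algebra_simps flip: exp_add)
    qed
    finally show ?thesis .
  qed
  ultimately show ?thesis by simp
qed

text \<open>A finite measure is its mass times a probability measure, and the mass is the Poisson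
  rate. Mass 0 gives the point mass at 0.\<close>

lemma fd_law_compound_poisson:
  fixes y :: "'i \<Rightarrow> 'z \<Rightarrow> real"
  assumes N: "finite_measure N" and J: "finite J" and y: "\<And>j. j \<in> J \<Longrightarrow> y j \<in> borel_measurable N"
  shows "fd_law J (\<lambda>\<theta>. exp (CLINT z|N. iexp (\<Sum>j\<in>J. \<theta> j * y j z) - 1))"
proof -
  interpret finite_measure N by fact
  define r where "r = measure N (space N)"
  show ?thesis
  proof (cases "r = 0")
    case True
    then have "emeasure N (space N) = 0" by (simp add: r_def emeasure_eq_measure)
    then have "AE z in N. P z" for P by (intro AE_I[of _ _ "space N"]) auto
    then have "(CLINT z|N. iexp (\<Sum>j\<in>J. \<theta> j * y j z) - 1) = 0" for \<theta> by (intro integral_eq_zero_AE)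
    then show ?thesis using fd_law_const[OF J, of "\<lambda>_. 0"] by simp
  next
    case False
    then have r: "0 < r" by (simp add: r_def less_le)
    define P where "P = density N (\<lambda>_. ennreal (1 / r))"
    have P: "prob_space P"
    proof
      have "emeasure P (space P) = ennreal (1 / r) * emeasure N (space N)"
        unfolding P_def by (simp add: emeasure_density nn_integral_cmult_indicator)
      also have "\<dots> = ennreal (1 / r) * ennreal r" by (simp add: emeasure_eq_measure r_def)
      also have "\<dots> = ennreal (1 / r * r)" using r by (intro ennreal_mult[symmetric]) auto
      finally show "emeasure P (space P) = 1" using r by simp
    qed
    have "fd_law J (\<lambda>\<theta>. CLINT z|P. iexp (\<Sum>j\<in>J. \<theta> j * y j z))"
      by (rule fd_law_rv[OF P J]) (simp add: P_def y)
    from fd_law_compound[OF J this r]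
    have "fd_law J (\<lambda>\<theta>. exp (of_real r * ((CLINT z|P. iexp (\<Sum>j\<in>J. \<theta> j * y j z)) - 1)))" .
    moreover have "of_real r * ((CLINT z|P. iexp (\<Sum>j\<in>J. \<theta> j * y j z)) - 1) =
        (CLINT z|N. iexp (\<Sum>j\<in>J. \<theta> j * y j z) - 1)" for \<theta>
    proof -
      have m: "(\<lambda>z. iexp (\<Sum>j\<in>J. \<theta> j * y j z)) \<in> borel_measurable N" using y by measurable
      have i: "integrable N (\<lambda>z. iexp (\<Sum>j\<in>J. \<theta> j * y j z))"
        by (rule integrable_const_bound[of _ 1]) (use m in auto)
      have "(CLINT z|P. iexp (\<Sum>j\<in>J. \<theta> j * y j z)) = (1 / r) *\<^sub>R (CLINT z|N. iexp (\<Sum>j\<in>J. \<theta> j * y j z))"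
        unfolding P_def using r m by (subst integral_density) auto
      then have "of_real r * (CLINT z|P. iexp (\<Sum>j\<in>J. \<theta> j * y j z)) = (CLINT z|N. iexp (\<Sum>j\<in>J. \<theta> j * y j z))"
        using r by (simp add: scaleR_conv_of_real)
      moreover have "(CLINT z|N. iexp (\<Sum>j\<in>J. \<theta> j * y j z) - 1) =
          (CLINT z|N. iexp (\<Sum>j\<in>J. \<theta> j * y j z)) - of_real r"
        using i by (subst Bochner_Integration.integral_diff) (auto simp: r_def scaleR_conv_of_real)
      ultimately show ?thesis by (simp add: right_diff_distrib)
    qed
    ultimately show ?thesis by simp
  qed
qed

text \<open>Completeness of L^1: an almost everywhere Cauchy subsequence supplies the limit, and
  Fatou's lemma carries the Cauchy bound over to the distance from it.\<close>

lemma L1_limit_exists: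
  fixes s :: "nat \<Rightarrow> 'm \<Rightarrow> real"
  assumes int: "\<And>n. integrable M (s n)"
    and cau: "\<And>e. 0 < e \<Longrightarrow> \<exists>N. \<forall>i\<ge>N. \<forall>j\<ge>N. (LINT x|M. \<bar>s i x - s j x\<bar>) < e"
  shows "\<exists>f. integrable M f \<and> (\<lambda>n. LINT x|M. \<bar>s n x - f x\<bar>) \<longlonglongrightarrow> 0"
proof -
  have [measurable]: "s n \<in> borel_measurable M" for n using int by auto
  obtain r where r: "strict_mono r" and C: "AE x in M. Cauchy (\<lambda>i. s (r i) x)"
    using cauchy_L1_AE_cauchy_subseq[of M s] int cau by auto
  define f where "f x = lim (\<lambda>i. s (r i) x)" for x
  have f_m [measurable]: "f \<in> borel_measurable M" unfolding f_def by measurable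
  have lim: "AE x in M. (\<lambda>i. s (r i) x) \<longlonglongrightarrow> f x"
    using C by eventually_elim (simp add: f_def Cauchy_convergent_iff convergent_LIMSEQ_iff)
  have key: "\<exists>N. \<forall>n\<ge>N. (\<integral>\<^sup>+x. ennreal \<bar>s n x - f x\<bar> \<partial>M) \<le> ennreal e" if e: "0 < e" for e
  proof -
    obtain N where N: "\<And>i j. N \<le> i \<Longrightarrow> N \<le> j \<Longrightarrow> (LINT x|M. \<bar>s i x - s j x\<bar>) < e"
      using cau[OF e] by blast
    have "(\<integral>\<^sup>+x. ennreal \<bar>s n x - f x\<bar> \<partial>M) \<le> ennreal e" if n: "N \<le> n" for n
    proof -
      have "(\<integral>\<^sup>+x. ennreal \<bar>s n x - f x\<bar> \<partial>M) = (\<integral>\<^sup>+x. liminf (\<lambda>i. ennreal \<bar>s n x - s (r i) x\<bar>) \<partial>M)"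
      proof (rule nn_integral_cong_AE)
        show "AE x in M. ennreal \<bar>s n x - f x\<bar> = liminf (\<lambda>i. ennreal \<bar>s n x - s (r i) x\<bar>)"
          using lim
        proof eventually_elim
          case (elim x)
          then have "(\<lambda>i. ennreal \<bar>s n x - s (r i) x\<bar>) \<longlonglongrightarrow> ennreal \<bar>s n x - f x\<bar>"
            by (intro tendsto_intros)
          then show ?case by (intro lim_imp_Liminf[symmetric]) auto
        qed
      qed
      also have "\<dots> \<le> liminf (\<lambda>i. \<integral>\<^sup>+x. ennreal \<bar>s n x - s (r i) x\<bar> \<partial>M)"
        by (rule nn_integral_liminf) measurable
      also have "\<dots> \<le> ennreal e"
      proof (rule Liminf_le)
        show "\<forall>\<^sub>F i in sequentially. (\<integral>\<^sup>+x. ennreal \<bar>s n x - s (r i) x\<bar> \<partial>M) \<le> ennreal e"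
          using eventually_ge_at_top[of N]
        proof eventually_elim
          case (elim i)
          then have "N \<le> r i" using seq_suble[OF r, of i] by simp
          then have "(LINT x|M. \<bar>s n x - s (r i) x\<bar>) \<le> e" using N[OF n] by (intro less_imp_le)
          moreover have "(\<integral>\<^sup>+x. ennreal \<bar>s n x - s (r i) x\<bar> \<partial>M) = ennreal (LINT x|M. \<bar>s n x - s (r i) x\<bar>)"
            using int by (intro nn_integral_eq_integral) auto
          ultimately show ?case by (simp add: ennreal_leI)
        qed
      qed simp
      finally show ?thesis .
    qed
    then show ?thesis by blast
  qed
  have int_diff: "\<exists>N. \<forall>n\<ge>N. integrable M (\<lambda>x. s n x - f x) \<and> (LINT x|M. \<bar>s n x - f x\<bar>) \<le> e" if e: "0 < e" for e
  proof -
    obtain N where N: "\<And>n. N \<le> n \<Longrightarrow> (\<integral>\<^sup>+x. ennreal \<bar>s n x - f x\<bar> \<partial>M) \<le> ennreal e" using key[OF e] by blast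
    have "integrable M (\<lambda>x. s n x - f x) \<and> (LINT x|M. \<bar>s n x - f x\<bar>) \<le> e" if n: "N \<le> n" for n
    proof
      have "(\<integral>\<^sup>+x. ennreal (norm (s n x - f x)) \<partial>M) < \<infinity>"
        using order.strict_trans1[OF N[OF n] ennreal_less_top] by simp
      then show i: "integrable M (\<lambda>x. s n x - f x)" by (intro integrableI_bounded) auto
      have "ennreal (LINT x|M. \<bar>s n x - f x\<bar>) = (\<integral>\<^sup>+x. ennreal \<bar>s n x - f x\<bar> \<partial>M)"
        using i by (intro nn_integral_eq_integral[symmetric]) auto
      then have "ennreal (LINT x|M. \<bar>s n x - f x\<bar>) \<le> ennreal e" using N[OF n] by (simp only:)
      then show "(LINT x|M. \<bar>s n x - f x\<bar>) \<le> e" using e by (simp add: ennreal_le_iff)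
    qed
    then show ?thesis by blast
  qed
  have "integrable M f"
  proof -
    obtain n where "integrable M (\<lambda>x. s n x - f x)" using int_diff[of 1] by auto
    from Bochner_Integration.integrable_diff[OF int[of n] this] show ?thesis by simp
  qed
  moreover have "(\<lambda>n. LINT x|M. \<bar>s n x - f x\<bar>) \<longlonglongrightarrow> 0"
  proof (rule LIMSEQ_I)
    fix e :: real assume e: "0 < e"
    then obtain N where N: "\<And>n. N \<le> n \<Longrightarrow> (LINT x|M. \<bar>s n x - f x\<bar>) \<le> e / 2" using int_diff[of "e / 2"] by auto
    have "norm ((LINT x|M. \<bar>s n x - f x\<bar>) - 0) < e" if "N \<le> n" for n
    proof -
      have "0 \<le> (LINT x|M. \<bar>s n x - f x\<bar>)" by simp
      then show ?thesis using N[OF that] e by simp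
    qed
    then show "\<exists>N. \<forall>n\<ge>N. norm ((LINT x|M. \<bar>s n x - f x\<bar>) - 0) < e" by blast
  qed
  ultimately show ?thesis by blast
qed

lemma fd_char_L1_limit:
  fixes S :: "nat \<Rightarrow> 'i \<Rightarrow> 'm \<Rightarrow> real"
  assumes M: "prob_space M" and J: "finite J"
    and S: "\<And>n j. j \<in> J \<Longrightarrow> integrable M (S n j)" and Z: "\<And>j. j \<in> J \<Longrightarrow> integrable M (Z j)"
    and lim: "\<And>j. j \<in> J \<Longrightarrow> (\<lambda>n. LINT x|M. \<bar>S n j x - Z j x\<bar>) \<longlonglongrightarrow> 0"
  shows "(\<lambda>n. CLINT x|M. iexp (\<Sum>j\<in>J. \<theta> j * S n j x)) \<longlonglongrightarrow> (CLINT x|M. iexp (\<Sum>j\<in>J. \<theta> j * Z j x))"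
proof -
  interpret prob_space M by fact
  have Sm: "S n j \<in> borel_measurable M" if "j \<in> J" for n j using S[OF that] by auto
  have Zm: "Z j \<in> borel_measurable M" if "j \<in> J" for j using Z[OF that] by auto
  define A where "A n x = (\<Sum>j\<in>J. \<theta> j * S n j x)" for n x
  define B where "B x = (\<Sum>j\<in>J. \<theta> j * Z j x)" for x
  have [measurable]: "A n \<in> borel_measurable M" "B \<in> borel_measurable M" for n
    unfolding A_def B_def using Sm Zm by measurable
  have i: "integrable M (\<lambda>x. iexp (A n x))" "integrable M (\<lambda>x. iexp (B x))" for n
    by (rule integrable_const_bound[of _ 1]; auto)+
  have bound: "norm ((CLINT x|M. iexp (A n x)) - (CLINT x|M. iexp (B x))) \<le> (\<Sum>j\<in>J. \<bar>\<theta> j\<bar> * (LINT x|M. \<bar>S n j x - Z j x\<bar>))" for n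
  proof -
    have "(CLINT x|M. iexp (A n x)) - (CLINT x|M. iexp (B x)) = (CLINT x|M. iexp (A n x) - iexp (B x))"
      by (rule Bochner_Integration.integral_diff[symmetric, OF i])
    also have "norm \<dots> \<le> (LINT x|M. (\<Sum>j\<in>J. \<bar>\<theta> j\<bar> * \<bar>S n j x - Z j x\<bar>))"
    proof (rule norm_integral_le)
      show "integrable M (\<lambda>x. iexp (A n x) - iexp (B x))" using i by (rule Bochner_Integration.integrable_diff)
      show "integrable M (\<lambda>x. \<Sum>j\<in>J. \<bar>\<theta> j\<bar> * \<bar>S n j x - Z j x\<bar>)"
        using S Z by (intro Bochner_Integration.integrable_sum integrable_mult_right integrable_abs
          Bochner_Integration.integrable_diff) auto
      fix x
      have "iexp (A n x) - iexp (B x) = iexp (B x) * (iexp (A n x - B x) - 1)"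
        by (simp add: algebra_simps flip: exp_add)
      then have "norm (iexp (A n x) - iexp (B x)) = norm (iexp (A n x - B x) - 1)"
        by (simp only: norm_mult norm_exp_i_times mult_1)
      also have "\<dots> \<le> \<bar>A n x - B x\<bar>" using norm_iexp_diff_1[of "A n x - B x"] by simp
      also have "A n x - B x = (\<Sum>j\<in>J. \<theta> j * (S n j x - Z j x))"
        by (simp add: A_def B_def right_diff_distrib sum_subtractf)
      also have "\<bar>\<dots>\<bar> \<le> (\<Sum>j\<in>J. \<bar>\<theta> j * (S n j x - Z j x)\<bar>)" by (rule sum_abs)
      finally show "norm (iexp (A n x) - iexp (B x)) \<le> (\<Sum>j\<in>J. \<bar>\<theta> j\<bar> * \<bar>S n j x - Z j x\<bar>)"
        by (simp only: abs_mult)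
    qed
    also have "\<dots> = (\<Sum>j\<in>J. \<bar>\<theta> j\<bar> * (LINT x|M. \<bar>S n j x - Z j x\<bar>))"
      using S Z by (subst Bochner_Integration.integral_sum) auto
    finally show ?thesis .
  qed
  have "(\<lambda>n. (CLINT x|M. iexp (A n x)) - (CLINT x|M. iexp (B x))) \<longlonglongrightarrow> 0"
  proof (rule Lim_null_comparison)
    show "\<forall>\<^sub>F n in sequentially. norm ((CLINT x|M. iexp (A n x)) - (CLINT x|M. iexp (B x))) \<le>
      (\<Sum>j\<in>J. \<bar>\<theta> j\<bar> * (LINT x|M. \<bar>S n j x - Z j x\<bar>))" using bound by simp
    have "(\<lambda>n. \<Sum>j\<in>J. \<bar>\<theta> j\<bar> * (LINT x|M. \<bar>S n j x - Z j x\<bar>)) \<longlonglongrightarrow> (\<Sum>j\<in>J. \<bar>\<theta> j\<bar> * 0)"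
      by (intro tendsto_sum tendsto_mult_left lim)
    then show "(\<lambda>n. \<Sum>j\<in>J. \<bar>\<theta> j\<bar> * (LINT x|M. \<bar>S n j x - Z j x\<bar>)) \<longlonglongrightarrow> 0" by simp
  qed
  then show ?thesis unfolding A_def B_def by (rule LIM_zero_cancel)
qed

lemma integrable_kf_sum:
  fixes y :: "'i \<Rightarrow> 'z \<Rightarrow> real"
  assumes "finite J" "\<And>j. j \<in> J \<Longrightarrow> y j \<in> borel_measurable N" "\<And>j. j \<in> J \<Longrightarrow> integrable N (\<lambda>z. kf (y j z))"
  shows "integrable N (\<lambda>z. kf (\<Sum>j\<in>J. \<theta> j * y j z))"
  using assms
proof (induction J rule: finite_induct)
  case (insert i J)
  have m: "y j \<in> borel_measurable N" if "j \<in> insert i J" for j using insert.prems(1) that .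
  have m1: "(\<lambda>z. \<Sum>j\<in>J. \<theta> j * y j z) \<in> borel_measurable N" using m by measurable
  have m2: "y i \<in> borel_measurable N" using m by simp
  have "integrable N (\<lambda>z. kf (\<theta> i * y i z + (\<Sum>j\<in>J. \<theta> j * y j z)))"
  proof (rule Bochner_Integration.integrable_bound)
    show "integrable N (\<lambda>z. 2 * (max 1 ((\<theta> i)\<^sup>2) * kf (y i z) + kf (\<Sum>j\<in>J. \<theta> j * y j z)))"
      using insert by auto
    show "AE z in N. norm (kf (\<theta> i * y i z + (\<Sum>j\<in>J. \<theta> j * y j z))) \<le>
        norm (2 * (max 1 ((\<theta> i)\<^sup>2) * kf (y i z) + kf (\<Sum>j\<in>J. \<theta> j * y j z)))"
    proof (rule AE_I2)
      fix z
      have "kf (\<theta> i * y i z + (\<Sum>j\<in>J. \<theta> j * y j z)) \<le> 2 * (max 1 ((\<theta> i)\<^sup>2) * kf (y i z) + kf (\<Sum>j\<in>J. \<theta> j * y j z))"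
        using kf_add[of "\<theta> i * y i z" "\<Sum>j\<in>J. \<theta> j * y j z"] kf_scale[of "\<theta> i" "y i z"] by simp
      then show "norm (kf (\<theta> i * y i z + (\<Sum>j\<in>J. \<theta> j * y j z))) \<le>
        norm (2 * (max 1 ((\<theta> i)\<^sup>2) * kf (y i z) + kf (\<Sum>j\<in>J. \<theta> j * y j z)))"
        using kf_nonneg[of "\<theta> i * y i z + (\<Sum>j\<in>J. \<theta> j * y j z)"] unfolding real_norm_def by linarith
    qed
  qed (use m1 m2 in measurable)
  then show ?case using insert.hyps by simp
qed simp

lemma integrable_ek_of_kf:
  assumes [measurable]: "y \<in> borel_measurable N" and "integrable N (\<lambda>z. kf (y z))"
  shows "integrable N (\<lambda>z. ek (y z))"
proof (rule Bochner_Integration.integrable_bound)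
  show "integrable N (\<lambda>z. 4 * kf (y z))" using assms by simp
qed (use norm_ek_le in auto)

definition restr :: "'z measure \<Rightarrow> 'z set \<Rightarrow> 'z measure" where
  "restr N A = density N (indicator A)"

lemma sets_restr [simp, measurable_cong]: "sets (restr N A) = sets N"
  by (simp add: restr_def)

lemma integral_restr:
  fixes h :: "'z \<Rightarrow> 'b::{banach, second_countable_topology}"
  assumes A [measurable]: "A \<in> sets N" and h [measurable]: "h \<in> borel_measurable N"
  shows "integral\<^sup>L (restr N A) h = (LINT z|N. indicator A z *\<^sub>R h z)"
    and "integrable (restr N A) h \<longleftrightarrow> integrable N (\<lambda>z. indicator A z *\<^sub>R h z)"
proof -
  have eq: "(indicator A :: 'z \<Rightarrow> ennreal) = (\<lambda>z. ennreal (indicator A z))"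
    by (intro ext) (simp add: ennreal_indicator)
  show "integral\<^sup>L (restr N A) h = (LINT z|N. indicator A z *\<^sub>R h z)"
    unfolding restr_def eq by (rule integral_density) auto
  show "integrable (restr N A) h \<longleftrightarrow> integrable N (\<lambda>z. indicator A z *\<^sub>R h z)"
    unfolding restr_def eq by (rule integrable_density) auto
qed

lemma finite_measure_restr:
  assumes [measurable]: "A \<in> sets N" and "emeasure N A \<noteq> \<infinity>" shows "finite_measure (restr N A)"
proof
  have "emeasure (restr N A) (space N) = (\<integral>\<^sup>+z. indicator A z * indicator (space N) z \<partial>N)"
    unfolding restr_def by (rule emeasure_density) auto
  also have "\<dots> = (\<integral>\<^sup>+z. indicator A z \<partial>N)"
    by (rule nn_integral_cong) (simp add: indicator_def)
  also have "\<dots> = emeasure N A" by simp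
  finally have "emeasure (restr N A) (space (restr N A)) = emeasure N A" by (simp add: restr_def)
  then show "emeasure (restr N A) (space (restr N A)) \<noteq> \<infinity>" using assms(2) by simp
qed

lemma iexp_sum: "finite A \<Longrightarrow> iexp (\<Sum>n\<in>A. a n) = (\<Prod>n\<in>A. iexp (a n))"
  by (simp add: exp_sum sum_distrib_left)

text \<open>Against a finite measure the bound \<open>\<bar>y\<bar> \<le> 1 + 2 * kf y\<close> makes
  each \<open>y j\<close> integrable, so full compensation is a shift of the compound Poisson law by
  minus its mean.\<close>

lemma fd_law_ek_finite:
  fixes y :: "'i \<Rightarrow> 'z \<Rightarrow> real"
  assumes N: "finite_measure N" and J: "finite J" and y: "\<And>j. j \<in> J \<Longrightarrow> y j \<in> borel_measurable N"
    and int: "\<And>j. j \<in> J \<Longrightarrow> integrable N (\<lambda>z. kf (y j z))"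
  shows "fd_law J (\<lambda>\<theta>. exp (CLINT z|N. ek (\<Sum>j\<in>J. \<theta> j * y j z)))"
proof -
  interpret finite_measure N by fact
  have yi: "integrable N (y j)" if j: "j \<in> J" for j
  proof (rule Bochner_Integration.integrable_bound)
    show "integrable N (\<lambda>z. 1 + 2 * kf (y j z))" using int[OF j] by simp
    show "AE z in N. norm (y j z) \<le> norm (1 + 2 * kf (y j z))" using abs_le_kf by auto
  qed (rule y[OF j])
  have m: "(\<lambda>z. \<Sum>j\<in>J. \<theta> j * y j z) \<in> borel_measurable N" for \<theta> using y by measurable
  have "(CLINT z|N. ek (\<Sum>j\<in>J. \<theta> j * y j z)) =
      (CLINT z|N. iexp (\<Sum>j\<in>J. \<theta> j * y j z) - 1) + \<i> * of_real (\<Sum>j\<in>J. \<theta> j * (- (LINT z|N. y j z)))" for \<theta>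
  proof -
    have i1: "integrable N (\<lambda>z. iexp (\<Sum>j\<in>J. \<theta> j * y j z) - 1)"
    proof (rule integrable_const_bound)
      show "AE z in N. norm (iexp (\<Sum>j\<in>J. \<theta> j * y j z) - 1) \<le> 2"
        by (intro AE_I2 order_trans[OF norm_iexp_diff_1]) simp
      show "(\<lambda>z. iexp (\<Sum>j\<in>J. \<theta> j * y j z) - 1) \<in> borel_measurable N"
        using y by measurable
    qed
    have i2: "integrable N (\<lambda>z. \<Sum>j\<in>J. \<theta> j * y j z)"
      by (intro Bochner_Integration.integrable_sum integrable_mult_right yi)
    have "(CLINT z|N. ek (\<Sum>j\<in>J. \<theta> j * y j z)) =
        (CLINT z|N. iexp (\<Sum>j\<in>J. \<theta> j * y j z) - 1) - (CLINT z|N. \<i> * of_real (\<Sum>j\<in>J. \<theta> j * y j z))"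
      unfolding ek_def by (intro Bochner_Integration.integral_diff i1 integrable_mult_right integrable_of_real i2)
    also have "(CLINT z|N. \<i> * of_real (\<Sum>j\<in>J. \<theta> j * y j z)) = \<i> * of_real (LINT z|N. (\<Sum>j\<in>J. \<theta> j * y j z))"
      unfolding integral_mult_right_zero integral_complex_of_real ..
    also have "(LINT z|N. (\<Sum>j\<in>J. \<theta> j * y j z)) = (\<Sum>j\<in>J. \<theta> j * (LINT z|N. y j z))"
      using yi by (subst Bochner_Integration.integral_sum) auto
    finally show ?thesis by (simp add: sum_negf)
  qed
  then have "exp (CLINT z|N. ek (\<Sum>j\<in>J. \<theta> j * y j z)) =
      exp (CLINT z|N. iexp (\<Sum>j\<in>J. \<theta> j * y j z) - 1) * iexp (\<Sum>j\<in>J. \<theta> j * (- (LINT z|N. y j z)))" for \<theta>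
    by (simp only: exp_add)
  then show ?thesis
    using fd_law_mult[OF J fd_law_compound_poisson[OF N J y] fd_law_const[OF J, of "\<lambda>j. - (LINT z|N. y j z)"]]
    by simp
qed

lemma tail_integral_tendsto_0:
  fixes h :: "'z \<Rightarrow> real"
  assumes h: "integrable N h" and A: "\<And>n. A n \<in> sets N" and disj: "disjoint_family (A :: nat \<Rightarrow> 'z set)"
  shows "(\<lambda>m. LINT z|N. indicator (\<Union>n\<in>{m..}. A n) z * h z) \<longlonglongrightarrow> 0"
proof -
  have "(\<lambda>m. LINT z|N. indicator (\<Union>n\<in>{m..}. A n) z * h z) \<longlonglongrightarrow> (LINT z|N. 0)"
  proof (rule integral_dominated_convergence)
    show "integrable N (\<lambda>z. norm (h z))" using h by simp
    show "AE z in N. (\<lambda>m. indicator (\<Union>n\<in>{m..}. A n) z * h z) \<longlonglongrightarrow> 0"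
    proof (rule AE_I2)
      fix z
      obtain k where k: "\<And>n. z \<in> A n \<Longrightarrow> n < k"
      proof (cases "\<exists>n. z \<in> A n")
        case True
        then obtain n where n: "z \<in> A n" by blast
        have "n' < Suc n" if "z \<in> A n'" for n'
          using disj n that unfolding disjoint_family_on_def by (cases "n = n'") auto
        then show ?thesis by (rule that)
      next
        case False
        then show ?thesis by (intro that[of 0]) auto
      qed
      have "\<forall>\<^sub>F m in sequentially. indicator (\<Union>n\<in>{m..}. A n) z * h z = 0"
        using eventually_ge_at_top[of k]
      proof eventually_elim
        case (elim m)
        then have "z \<notin> (\<Union>n\<in>{m..}. A n)" using k by fastforce
        then show ?case by simp
      qed
      then show "(\<lambda>m. indicator (\<Union>n\<in>{m..}. A n) z * h z) \<longlonglongrightarrow> 0" by (rule tendsto_eventually)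
    qed
    show "AE z in N. norm (indicator (\<Union>n\<in>{m..}. A n) z * h z) \<le> norm (h z)" for m
      by (simp add: indicator_def)
    show "(\<lambda>z. indicator (\<Union>n\<in>{m..}. A n) z * h z) \<in> borel_measurable N" for m
      using h A by (intro borel_measurable_times borel_measurable_indicator sets.countable_UN') auto
  qed simp
  then show ?thesis by simp
qed

text \<open>The jump part of the Levy--Khintchine theorem for a sigma-finite intensity. Space is cut
  into disjoint pieces of finite measure, giving independent compensated Poisson vectors; their
  partial sums are Cauchy in L^1 by \<open>moment_bound\<close>, because the tails of the integral
  of \<open>kf (y j z)\<close> vanish.\<close>

lemma fd_law_ek:
  fixes y :: "'i \<Rightarrow> 'z \<Rightarrow> real"
  assumes N: "sigma_finite_measure N" and J: "finite J" and y: "\<And>j. j \<in> J \<Longrightarrow> y j \<in> borel_measurable N"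
    and int: "\<And>j. j \<in> J \<Longrightarrow> integrable N (\<lambda>z. kf (y j z))"
  shows "fd_law J (\<lambda>\<theta>. exp (CLINT z|N. ek (\<Sum>j\<in>J. \<theta> j * y j z)))"
proof -
  interpret N: sigma_finite_measure N by fact
  obtain A :: "nat \<Rightarrow> 'z set" where A_range: "range A \<subseteq> sets N" and A_cover: "(\<Union>i. A i) = space N"
    and A_fin: "\<And>i. emeasure N (A i) \<noteq> \<infinity>" and A_disj: "disjoint_family A"
    using N.sigma_finite_disjoint by metis
  have A [measurable]: "A n \<in> sets N" for n using A_range by auto
  define h where "h \<theta> z = ek (\<Sum>j\<in>J. \<theta> j * y j z)" for \<theta> z
  have ym: "(\<lambda>z. \<Sum>j\<in>J. \<theta> j * y j z) \<in> borel_measurable N" for \<theta> using y by measurable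
  have h_int: "integrable N (h \<theta>)" for \<theta>
    unfolding h_def by (intro integrable_ek_of_kf integrable_kf_sum J y int ym)
  then have h_m [measurable]: "h \<theta> \<in> borel_measurable N" for \<theta> by auto
  have hA_int: "integrable N (\<lambda>z. indicator B z *\<^sub>R h \<theta> z)" if "B \<in> sets N" for B \<theta>
    by (rule integrable_mult_indicator[OF that h_int])
  have piece: "fd_law J (\<lambda>\<theta>. exp (CLINT z|N. indicator (A n) z *\<^sub>R h \<theta> z))" for n
  proof -
    have "fd_law J (\<lambda>\<theta>. exp (CLINT z|restr N (A n). h \<theta> z))"
      unfolding h_def
    proof (rule fd_law_ek_finite[OF finite_measure_restr[OF A A_fin] J])
      show "y j \<in> borel_measurable (restr N (A n))" if "j \<in> J" for j using y[OF that] by measurable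
      show "integrable (restr N (A n)) (\<lambda>z. kf (y j z))" if "j \<in> J" for j
        using y[OF that] integrable_mult_indicator[OF A int[OF that], of n]
        by (subst integral_restr(2)) auto
    qed
    then show ?thesis by (simp add: integral_restr(1)[OF A h_m])
  qed
  define Q where "Q n \<eta> \<longleftrightarrow> prob_space \<eta> \<and> (\<forall>j\<in>J. (\<lambda>x. x j) \<in> borel_measurable \<eta>) \<and>
    (\<forall>\<theta>. (CLINT x|\<eta>. iexp (\<Sum>j\<in>J. \<theta> j * x j)) = exp (CLINT z|N. indicator (A n) z *\<^sub>R h \<theta> z))"
    for n and \<eta> :: "('i \<Rightarrow> real) measure"
  have "\<forall>n. \<exists>\<eta>. Q n \<eta>"
    unfolding Q_def by (intro allI fd_lawD[OF piece])
  from choice[OF this] obtain \<eta> where Q: "\<And>n. Q n (\<eta> n)" by blast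
  have \<eta>: "prob_space (\<eta> n)" for n
    using Q[of n] unfolding Q_def by blast
  have \<eta>m: "(\<lambda>x. x j) \<in> borel_measurable (\<eta> n)" if "j \<in> J" for n j
    using Q[of n] that unfolding Q_def by blast
  have \<eta>c: "(CLINT x|\<eta> n. iexp (\<Sum>j\<in>J. \<theta> j * x j)) = exp (CLINT z|N. indicator (A n) z *\<^sub>R h \<theta> z)" for n \<theta>
    using Q[of n] unfolding Q_def by blast
  \<comment> \<open>One independent vector per piece: coordinate n carries the law belonging to
    \<open>A n\<close>.\<close>
  define P where "P = PiM UNIV \<eta>"
  have P: "prob_space P" unfolding P_def by (rule prob_space_PiM[OF \<eta>])
  interpret P: prob_space P by (rule P)
  interpret PP: product_prob_space \<eta> UNIV by (intro product_prob_spaceI \<eta>)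
  have comp: "distr P (\<eta> n) (\<lambda>x. x n) = \<eta> n" for n unfolding P_def by (rule PP.PiM_component) simp
  have cm: "(\<lambda>x. x n) \<in> measurable P (\<eta> n)" for n
    unfolding P_def by (rule measurable_component_singleton) simp
  have c_meas: "(\<lambda>x. x n j) \<in> borel_measurable P" if "j \<in> J" for n j
    by (rule measurable_compose[OF cm \<eta>m[OF that]])
  define S where "S m j x = (\<Sum>n<m. x n j)" for m j and x :: "nat \<Rightarrow> 'i \<Rightarrow> real"
  have S_m: "S m j \<in> borel_measurable P" if "j \<in> J" for m j
    unfolding S_def using c_meas[OF that] by measurable
  have S_diff: "S m2 j x - S m1 j x = (\<Sum>n\<in>{m1..<m2}. x n j)" if "m1 \<le> m2" for m1 m2 j x
  proof -
    have "S m2 j x = S m1 j x + (\<Sum>n\<in>{m1..<m2}. x n j)"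
      unfolding S_def lessThan_atLeast0 by (rule sum.atLeastLessThan_concat[symmetric]) (use that in auto)
    then show ?thesis by simp
  qed
  \<comment> \<open>The increment of the partial sums from m1 to m2 is governed by the union of the
    pieces m1, ..., m2 - 1.\<close>
  define U where "U m1 m2 = (\<Union>n\<in>{m1..<m2}. A n)" for m1 m2
  have U [measurable]: "U m1 m2 \<in> sets N" for m1 m2 unfolding U_def by (intro sets.finite_UN) auto
  have U_ind: "indicator (U m1 m2) z = (\<Sum>n\<in>{m1..<m2}. indicator (A n) z :: real)" for m1 m2 z
    unfolding U_def using A_disj
    by (intro indicator_UN_disjoint) (auto simp: disjoint_family_on_def)
  have char: "(CLINT x|P. iexp (\<Sum>j\<in>J. \<theta> j * (S m2 j x - S m1 j x))) =
      exp (CLINT z|N. indicator (U m1 m2) z *\<^sub>R h \<theta> z)" if le: "m1 \<le> m2" for \<theta> m1 m2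
  proof -
    define X where "X n x = iexp (\<Sum>j\<in>J. \<theta> j * x n j)" for n and x :: "nat \<Rightarrow> 'i \<Rightarrow> real"
    have em: "(\<lambda>x. iexp (\<Sum>j\<in>J. \<theta> j * x j)) \<in> borel_measurable (\<eta> n)" for n
      using \<eta>m by measurable
    have Xm: "X n \<in> borel_measurable P" for n
      unfolding X_def by (rule measurable_compose[OF cm em])
    have "(CLINT x|P. iexp (\<Sum>j\<in>J. \<theta> j * (S m2 j x - S m1 j x))) = (CLINT x|P. (\<Prod>n\<in>{m1..<m2}. X n x))"
    proof (rule Bochner_Integration.integral_cong[OF refl])
      fix x
      have "(\<Sum>j\<in>J. \<theta> j * (S m2 j x - S m1 j x)) = (\<Sum>n\<in>{m1..<m2}. \<Sum>j\<in>J. \<theta> j * x n j)"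
        unfolding S_diff[OF le] sum_distrib_left by (rule sum.swap)
      then show "iexp (\<Sum>j\<in>J. \<theta> j * (S m2 j x - S m1 j x)) = (\<Prod>n\<in>{m1..<m2}. X n x)"
        unfolding X_def by (simp only: iexp_sum finite_atLeastLessThan)
    qed
    also have "\<dots> = (\<Prod>n\<in>{m1..<m2}. CLINT x|P. X n x)"
    proof (rule P.indep_vars_lebesgue_integral)
      have "P.indep_vars \<eta> (\<lambda>n x. x n) {m1..<m2}"
        using P.indep_vars_subset[OF product_coordinates_indep[of \<eta>, OF \<eta>, folded P_def]] by simp
      from P.indep_vars_compose2[OF this, where Y = "\<lambda>n y. iexp (\<Sum>j\<in>J. \<theta> j * y j)" and N = "\<lambda>_. borel"] em
      show "P.indep_vars (\<lambda>_. borel) X {m1..<m2}" unfolding X_def by simp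
      show "integrable P (X n)" for n
        by (rule P.integrable_const_bound[of _ 1]) (use Xm in \<open>auto simp: X_def\<close>)
    qed simp
    also have "\<dots> = (\<Prod>n\<in>{m1..<m2}. exp (CLINT z|N. indicator (A n) z *\<^sub>R h \<theta> z))"
    proof (rule prod.cong[OF refl])
      fix n
      have "(CLINT x|P. X n x) = (CLINT y|distr P (\<eta> n) (\<lambda>x. x n). iexp (\<Sum>j\<in>J. \<theta> j * y j))"
        unfolding X_def by (rule integral_distr[symmetric, OF cm em])
      then show "(CLINT x|P. X n x) = exp (CLINT z|N. indicator (A n) z *\<^sub>R h \<theta> z)"
        by (simp only: comp \<eta>c)
    qed
    also have "\<dots> = exp (\<Sum>n\<in>{m1..<m2}. CLINT z|N. indicator (A n) z *\<^sub>R h \<theta> z)"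
      by (simp add: exp_sum)
    also have "(\<Sum>n\<in>{m1..<m2}. CLINT z|N. indicator (A n) z *\<^sub>R h \<theta> z) = (CLINT z|N. \<Sum>n\<in>{m1..<m2}. indicator (A n) z *\<^sub>R h \<theta> z)"
      by (intro Bochner_Integration.integral_sum[symmetric] hA_int A)
    also have "(\<lambda>z. \<Sum>n\<in>{m1..<m2}. indicator (A n) z *\<^sub>R h \<theta> z) = (\<lambda>z. indicator (U m1 m2) z *\<^sub>R h \<theta> z)"
      unfolding U_ind by (simp add: scaleR_sum_left)
    finally show ?thesis .
  qed
  define \<kappa> where "\<kappa> j m = (LINT z|N. indicator (\<Union>n\<in>{m..}. A n) z * kf (y j z))" for j m
  \<comment> \<open>The bound of \<open>moment_bound\<close> with Gaussian variance 0 and with the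
    integral of \<open>kf\<close> over all pieces from \<open>m\<close> on, hence independent of
    where the block ends.\<close>
  define bd where "bd j T m = 4 * (2 / T + 0 / 2 * T + (T + 6) * \<kappa> j m + 8 * T\<^sup>2 * (\<kappa> j m)\<^sup>2 * T)" for j T m
  have \<kappa>_lim: "\<kappa> j \<longlonglongrightarrow> 0" if "j \<in> J" for j
    unfolding \<kappa>_def by (rule tail_integral_tendsto_0[OF int[OF that] A A_disj])
  have moment: "(\<integral>\<^sup>+x. ennreal \<bar>S m2 j x - S m1 j x\<bar> \<partial>P) \<le> ennreal (bd j T m1)"
    if j: "j \<in> J" and le: "m1 \<le> m2" and T: "1 \<le> T" for j m1 m2 T
  proof -
    define N' where "N' = restr N (U m1 m2)"
    have yj [measurable]: "y j \<in> borel_measurable N" by (rule y[OF j])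
    have fin: "emeasure N (U m1 m2) \<noteq> \<infinity>"
    proof -
      have "emeasure N (U m1 m2) \<le> (\<Sum>n\<in>{m1..<m2}. emeasure N (A n))"
        unfolding U_def by (rule emeasure_subadditive_finite) auto
      also have "\<dots> < \<infinity>" using A_fin by (simp add: less_top)
      finally show ?thesis by simp
    qed
    interpret N': finite_measure N' unfolding N'_def by (rule finite_measure_restr[OF U fin])
    have sf: "sigma_finite_measure N'" by (rule N'.sigma_finite_measure_axioms)
    define k where "k = (LINT z|N'. kf (y j z))"
    have k_eq: "k = (LINT z|N. indicator (U m1 m2) z * kf (y j z))"
      unfolding k_def N'_def by (subst integral_restr(1)) auto
    have k0: "0 \<le> k" unfolding k_def by simp
    have kle: "k \<le> \<kappa> j m1"
      unfolding k_eq \<kappa>_def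
    proof (rule integral_mono)
      show "integrable N (\<lambda>z. indicator (U m1 m2) z * kf (y j z))"
        using integrable_mult_indicator[OF U int[OF j], of m1 m2] by simp
      have "(\<Union>n\<in>{m1..}. A n) \<in> sets N" by (intro sets.countable_UN') auto
      from integrable_mult_indicator[OF this int[OF j]]
      show "integrable N (\<lambda>z. indicator (\<Union>n\<in>{m1..}. A n) z * kf (y j z))" by simp
      show "indicator (U m1 m2) z * kf (y j z) \<le> indicator (\<Union>n\<in>{m1..}. A n) z * kf (y j z)" for z
        by (intro mult_right_mono) (auto simp: U_def indicator_def)
    qed
    have "(\<integral>\<^sup>+x. ennreal \<bar>S m2 j x - S m1 j x\<bar> \<partial>P) \<le>
        ennreal (4 * (2 / T + 0 / 2 * T + (T + 6) * k + 8 * T\<^sup>2 * k\<^sup>2 * T))"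
      unfolding k_def
    proof (rule moment_bound[OF P _ sf])
      show "(\<lambda>x. S m2 j x - S m1 j x) \<in> borel_measurable P" using S_m[OF j] by measurable
      show "y j \<in> borel_measurable N'" unfolding N'_def by measurable
      show "integrable N' (\<lambda>z. kf (y j z))"
        unfolding N'_def using integrable_mult_indicator[OF U int[OF j], of m1 m2]
        by (subst integral_restr(2)) auto
      fix t :: real
      \<comment> \<open>A coefficient vector supported at \<open>j\<close> extracts the
        one-dimensional increment from the joint formula.\<close>
      define \<theta> where "\<theta> i = (if i = j then t else 0)" for i
      have \<theta>: "(\<Sum>i\<in>J. \<theta> i * w i) = t * w j" for w
        unfolding \<theta>_def using J j by (simp add: if_distrib[of "\<lambda>c. c * _"] sum.delta cong: if_cong)
      have m: "(\<lambda>z. ek (t * y j z)) \<in> borel_measurable N" by measurable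
      have "(CLINT x|P. iexp (t * (S m2 j x - S m1 j x))) = exp (CLINT z|N. indicator (U m1 m2) z *\<^sub>R h \<theta> z)"
        using char[OF le, of \<theta>] unfolding \<theta> .
      also have "(CLINT z|N. indicator (U m1 m2) z *\<^sub>R h \<theta> z) = (CLINT z|N'. ek (t * y j z))"
        unfolding N'_def h_def \<theta> by (rule integral_restr(1)[symmetric, OF U m])
      finally show "(CLINT x|P. iexp (t * (S m2 j x - S m1 j x))) =
          exp (- of_real (0 * t\<^sup>2 / 2) + (CLINT z|N'. ek (t * y j z)))" by simp
    qed (use T in auto)
    also have "\<dots> \<le> ennreal (bd j T m1)"
      unfolding bd_def using T k0 kle
      by (intro ennreal_leI mult_left_mono add_mono mult_right_mono power_mono order_refl) auto
    finally show ?thesis .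
  qed
  have S_int: "integrable P (S m j)" if j: "j \<in> J" for m j
  proof (rule integrableI_bounded)
    have "(\<integral>\<^sup>+x. ennreal (norm (S m j x)) \<partial>P) \<le> ennreal (bd j 1 0)"
      using moment[OF j, of 0 m 1] by (simp add: S_def)
    then show "(\<integral>\<^sup>+x. ennreal (norm (S m j x)) \<partial>P) < \<infinity>" by (rule order.strict_trans1) simp
  qed (rule S_m[OF j])
  have bd0: "0 \<le> bd j T m" if "1 \<le> T" for j T m
  proof -
    have "0 \<le> \<kappa> j m" unfolding \<kappa>_def by (intro integral_nonneg_AE) simp
    then show ?thesis unfolding bd_def using that by (intro mult_nonneg_nonneg add_nonneg_nonneg) auto
  qed
  have S_E: "(LINT x|P. \<bar>S m2 j x - S m1 j x\<bar>) \<le> bd j T m1"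
    if j: "j \<in> J" and le: "m1 \<le> m2" and T: "1 \<le> T" for j m1 m2 T
  proof -
    have "ennreal (LINT x|P. \<bar>S m2 j x - S m1 j x\<bar>) = (\<integral>\<^sup>+x. ennreal \<bar>S m2 j x - S m1 j x\<bar> \<partial>P)"
      using S_int[OF j] by (intro nn_integral_eq_integral[symmetric]) auto
    then have "ennreal (LINT x|P. \<bar>S m2 j x - S m1 j x\<bar>) \<le> ennreal (bd j T m1)"
      using moment[OF j le T] by (simp only:)
    then show ?thesis using bd0[OF T, of j m1] by (simp add: ennreal_le_iff)
  qed
  have "\<exists>f. integrable P f \<and> (\<lambda>m. LINT x|P. \<bar>S m j x - f x\<bar>) \<longlonglongrightarrow> 0" if j: "j \<in> J" for j
  proof (rule L1_limit_exists[OF S_int[OF j]])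
    fix e :: real assume e: "0 < e"
    \<comment> \<open>Makes 8/T, the only term of the bound that survives as m tends to infinity, at
      most e/2.\<close>
    define T where "T = max 1 (16 / e)"
    have T: "1 \<le> T" by (simp add: T_def)
    have "16 / e \<le> T" by (simp add: T_def)
    then have Te: "8 / T \<le> e / 2" using T e by (simp add: field_simps)
    have "bd j T \<longlonglongrightarrow> 4 * (2 / T + 0 / 2 * T + (T + 6) * 0 + 8 * T\<^sup>2 * 0\<^sup>2 * T)"
      unfolding bd_def by (intro tendsto_intros \<kappa>_lim[OF j])
    then have "bd j T \<longlonglongrightarrow> 8 / T" by simp
    moreover have "8 / T < e" using Te e by simp
    ultimately have "\<forall>\<^sub>F m in sequentially. bd j T m < e" by (rule order_tendstoD(2))
    then obtain m0 where m0: "\<And>m. m0 \<le> m \<Longrightarrow> bd j T m < e" by (auto simp: eventually_sequentially)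
    have "(LINT x|P. \<bar>S m1 j x - S m2 j x\<bar>) < e" if "m0 \<le> m1" "m0 \<le> m2" for m1 m2
    proof (cases "m1 \<le> m2")
      case True
      then show ?thesis using S_E[OF j True T] m0[OF that(1)] by (simp add: abs_minus_commute)
    next
      case False
      then show ?thesis using S_E[OF j _ T, of m2 m1] m0[OF that(2)] by simp
    qed
    then show "\<exists>N. \<forall>m1\<ge>N. \<forall>m2\<ge>N. (LINT x|P. \<bar>S m1 j x - S m2 j x\<bar>) < e" by blast
  qed
  then have "\<forall>j\<in>J. \<exists>f. integrable P f \<and> (\<lambda>m. LINT x|P. \<bar>S m j x - f x\<bar>) \<longlonglongrightarrow> 0" by blast
  from bchoice[OF this] obtain Z where Z: "\<And>j. j \<in> J \<Longrightarrow> integrable P (Z j)"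
    and Z_lim: "\<And>j. j \<in> J \<Longrightarrow> (\<lambda>m. LINT x|P. \<bar>S m j x - Z j x\<bar>) \<longlonglongrightarrow> 0" by blast
  have "(CLINT x|P. iexp (\<Sum>j\<in>J. \<theta> j * Z j x)) = exp (CLINT z|N. h \<theta> z)" for \<theta>
  proof (rule LIMSEQ_unique)
    show "(\<lambda>m. CLINT x|P. iexp (\<Sum>j\<in>J. \<theta> j * S m j x)) \<longlonglongrightarrow> (CLINT x|P. iexp (\<Sum>j\<in>J. \<theta> j * Z j x))"
      by (rule fd_char_L1_limit[OF P J S_int Z Z_lim])
    have eq: "(CLINT x|P. iexp (\<Sum>j\<in>J. \<theta> j * S m j x)) = exp (CLINT z|N. indicator (U 0 m) z *\<^sub>R h \<theta> z)" for m
      using char[of 0 m \<theta>] by (simp add: S_def)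
    have "(\<lambda>m. CLINT z|N. indicator (U 0 m) z *\<^sub>R h \<theta> z) \<longlonglongrightarrow> (CLINT z|N. h \<theta> z)"
    proof (rule integral_dominated_convergence)
      show "integrable N (\<lambda>z. norm (h \<theta> z))" using h_int by simp
      show "AE z in N. (\<lambda>m. indicator (U 0 m) z *\<^sub>R h \<theta> z) \<longlonglongrightarrow> h \<theta> z"
      proof (rule AE_I2)
        fix z assume "z \<in> space N"
        then obtain k where k: "z \<in> A k" using A_cover by blast
        have "\<forall>\<^sub>F m in sequentially. indicator (U 0 m) z *\<^sub>R h \<theta> z = h \<theta> z"
          using eventually_gt_at_top[of k]
        proof eventually_elim
          case (elim m)
          then have "z \<in> U 0 m" using k by (auto simp: U_def)
          then show ?case by simp
        qed
        then show "(\<lambda>m. indicator (U 0 m) z *\<^sub>R h \<theta> z) \<longlonglongrightarrow> h \<theta> z" by (rule tendsto_eventually)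
      qed
      show "AE z in N. norm (indicator (U 0 m) z *\<^sub>R h \<theta> z) \<le> norm (h \<theta> z)" for m
        by (simp add: indicator_def)
    qed measurable
    then show "(\<lambda>m. CLINT x|P. iexp (\<Sum>j\<in>J. \<theta> j * S m j x)) \<longlonglongrightarrow> exp (CLINT z|N. h \<theta> z)"
      unfolding eq by (rule tendsto_exp)
  qed
  moreover have "fd_law J (\<lambda>\<theta>. CLINT x|P. iexp (\<Sum>j\<in>J. \<theta> j * Z j x))"
    by (rule fd_law_rv[OF P J]) (use Z in auto)
  ultimately show ?thesis by (simp add: h_def)
qed

section \<open>Decomposability of the Levy measure\<close>

context
  fixes \<rho> :: "real measure" and b :: real and h :: "'d::euclidean_space \<Rightarrow> real"
  assumes jm: "jump_measure \<rho>" and h [measurable]: "h \<in> borel_measurable borel"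
    and fin: "modular b \<rho> h < \<infinity>"
begin

lemma integrable_gauss_part: "integrable lborel (\<lambda>s. (b * h s)\<^sup>2)"
proof (rule Bochner_Integration.integrable_bound)
  show "integrable lborel (\<lambda>s. KK b \<rho> (h s))" by (rule integrable_KK[OF jm h fin])
  have "(b * r)\<^sup>2 \<le> KK b \<rho> r" for r unfolding KK_def by (simp add: power_mult_distrib)
  then show "AE s in lborel. norm ((b * h s)\<^sup>2) \<le> norm (KK b \<rho> (h s))"
    using KK_nonneg[OF jm] by simp
qed measurable

lemma jump_product_measurable: "(\<lambda>z. h (snd z) * fst z) \<in> borel_measurable (\<rho> \<Otimes>\<^sub>M lborel)"
proof -
  have "(\<lambda>z. h (snd z) * fst z) \<in> borel_measurable (borel \<Otimes>\<^sub>M borel)" by measurable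
  moreover have "sets (\<rho> \<Otimes>\<^sub>M (lborel :: 'd measure)) = sets (borel \<Otimes>\<^sub>M borel)"
    using jump_measure_sets[OF jm] by (intro sets_pair_measure_cong) auto
  ultimately show ?thesis using measurable_cong_sets by blast
qed

lemma integrable_jump_part: "integrable (\<rho> \<Otimes>\<^sub>M lborel) (\<lambda>z. kf (h (snd z) * fst z))"
proof (rule integrableI_bounded)
  interpret \<rho>: sigma_finite_measure \<rho> by (rule sigma_finite_jump_measure[OF jm])
  interpret P: pair_sigma_finite \<rho> "lborel :: 'd measure" ..
  note [measurable] = jump_product_measurable
  have "(\<integral>\<^sup>+z. ennreal (norm (kf (h (snd z) * fst z))) \<partial>(\<rho> \<Otimes>\<^sub>M lborel)) =
      (\<integral>\<^sup>+s. \<integral>\<^sup>+x. ennreal (norm (kf (h s * x))) \<partial>\<rho> \<partial>lborel)"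
    by (subst P.nn_integral_snd[symmetric]) simp_all
  also have "\<dots> \<le> modular b \<rho> h"
    unfolding modular_def
  proof (rule nn_integral_mono)
    fix s
    have "(\<integral>\<^sup>+x. ennreal (norm (kf (h s * x))) \<partial>\<rho>) = ennreal (LINT x|\<rho>. kf (h s * x))"
      by (simp add: nn_integral_eq_integral[OF integrable_kf_scale[OF jm]])
    also have "\<dots> \<le> ennreal (KK b \<rho> (h s))" by (intro ennreal_leI) (simp add: KK_def)
    finally show "(\<integral>\<^sup>+x. ennreal (norm (kf (h s * x))) \<partial>\<rho>) \<le> ennreal (KK b \<rho> (h s))" .
  qed
  finally show "(\<integral>\<^sup>+z. ennreal (norm (kf (h (snd z) * fst z))) \<partial>(\<rho> \<Otimes>\<^sub>M lborel)) < \<infinity>"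
    using fin by (rule order.strict_trans1)
  show "(\<lambda>z. kf (h (snd z) * fst z)) \<in> borel_measurable (\<rho> \<Otimes>\<^sub>M lborel)" by measurable
qed

lemma modular_eq:
  "enn2real (modular b \<rho> h) = (LINT s|lborel. (b * h s)\<^sup>2) + (LINT z|(\<rho> \<Otimes>\<^sub>M lborel). kf (h (snd z) * fst z))"
proof -
  interpret \<rho>: sigma_finite_measure \<rho> by (rule sigma_finite_jump_measure[OF jm])
  interpret P: pair_sigma_finite \<rho> "lborel :: 'd measure" ..
  have i: "integrable lborel (\<lambda>s. LINT x|\<rho>. kf (h s * x))"
    using P.integrable_snd[of "\<lambda>x s. kf (h s * x)"] integrable_jump_part by (simp add: case_prod_beta')
  have "enn2real (modular b \<rho> h) = (LINT s|lborel. KK b \<rho> (h s))"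
    by (rule integral_KK[OF jm h fin, symmetric])
  also have "\<dots> = (LINT s|lborel. (b * h s)\<^sup>2) + (LINT s|lborel. LINT x|\<rho>. kf (h s * x))"
    unfolding KK_def power_mult_distrib[symmetric]
    by (rule Bochner_Integration.integral_add[OF integrable_gauss_part i])
  also have "(LINT s|lborel. LINT x|\<rho>. kf (h s * x)) = (LINT z|(\<rho> \<Otimes>\<^sub>M lborel). kf (h (snd z) * fst z))"
    using P.integral_snd[of "\<lambda>x s. kf (h s * x)"] integrable_jump_part by (simp add: case_prod_beta')
  finally show ?thesis .
qed

text \<open>Fubini: a kernel turns a jump x at the place s into h(s) x, so the jump part becomes an
  integral over \<open>\<rho> \<Otimes>\<^sub>M lborel\<close>, the form in which
  \<open>fd_law_ek\<close> and \<open>moment_bound\<close> apply.\<close>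

lemma expo_eq:
  "expo b \<rho> h = - of_real ((LINT s|lborel. (b * h s)\<^sup>2) / 2) + (CLINT z|(\<rho> \<Otimes>\<^sub>M lborel). ek (h (snd z) * fst z))"
proof -
  interpret \<rho>: sigma_finite_measure \<rho> by (rule sigma_finite_jump_measure[OF jm])
  interpret P: pair_sigma_finite \<rho> "lborel :: 'd measure" ..
  have ie: "integrable (\<rho> \<Otimes>\<^sub>M lborel) (\<lambda>z. ek (h (snd z) * fst z))"
    by (rule integrable_ek_of_kf[OF jump_product_measurable integrable_jump_part])
  have i: "integrable lborel (\<lambda>s. CLINT x|\<rho>. ek (h s * x))"
    using P.integrable_snd[of "\<lambda>x s. ek (h s * x)"] ie by (simp add: case_prod_beta')
  have ig: "integrable lborel (\<lambda>s. complex_of_real ((b * h s)\<^sup>2 / 2))"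
    using integrable_gauss_part by (intro integrable_of_real) simp
  have "expo b \<rho> h = (CLINT s|lborel. - complex_of_real ((b * h s)\<^sup>2 / 2) + (CLINT x|\<rho>. ek (h s * x)))"
    unfolding expo_def cexp_def power_mult_distrib ..
  also have "\<dots> = (CLINT s|lborel. - complex_of_real ((b * h s)\<^sup>2 / 2)) + (CLINT s|lborel. CLINT x|\<rho>. ek (h s * x))"
    by (rule Bochner_Integration.integral_add[OF integrable_minus[OF ig] i])
  also have "(CLINT s|lborel. - complex_of_real ((b * h s)\<^sup>2 / 2)) = - of_real ((LINT s|lborel. (b * h s)\<^sup>2) / 2)"
    unfolding integral_minus integral_complex_of_real by simp
  also have "(CLINT s|lborel. CLINT x|\<rho>. ek (h s * x)) = (CLINT z|(\<rho> \<Otimes>\<^sub>M lborel). ek (h (snd z) * fst z))"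
    using P.integral_snd[of "\<lambda>x s. ek (h s * x)"] ie by (simp add: case_prod_beta')
  finally show ?thesis .
qed

end

lemma sigma_finite_jump_product:
  assumes "jump_measure \<rho>" shows "sigma_finite_measure (\<rho> \<Otimes>\<^sub>M (lborel :: 'd::euclidean_space measure))"
proof -
  interpret \<rho>: sigma_finite_measure \<rho> by (rule sigma_finite_jump_measure[OF assms])
  interpret P: pair_sigma_finite \<rho> "lborel :: 'd measure" ..
  show ?thesis by (rule P.sigma_finite_measure_axioms)
qed

lemma fd_law_expo:
  fixes f :: "'i \<Rightarrow> 'd::euclidean_space \<Rightarrow> real"
  assumes jm: "jump_measure \<rho>" and J: "finite J"
    and f: "\<And>j. j \<in> J \<Longrightarrow> f j \<in> borel_measurable borel" and fin: "\<And>j. j \<in> J \<Longrightarrow> modular b \<rho> (f j) < \<infinity>"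
  shows "fd_law J (\<lambda>\<theta>. exp (expo b \<rho> (\<lambda>s. \<Sum>j\<in>J. \<theta> j * f j s)))"
proof -
  let ?N = "\<rho> \<Otimes>\<^sub>M (lborel :: 'd measure)"
  have gauss: "fd_law J (\<lambda>\<theta>. of_real (exp (- ((LINT s|lborel. (\<Sum>j\<in>J. \<theta> j * (b * f j s))\<^sup>2) / 2))))"
  proof (rule fd_law_gauss[OF J])
    show "(\<lambda>s. b * f j s) \<in> borel_measurable lborel" if "j \<in> J" for j using f[OF that] by measurable
  qed (rule integrable_gauss_part[OF jm f fin])
  have jump: "fd_law J (\<lambda>\<theta>. exp (CLINT z|?N. ek (\<Sum>j\<in>J. \<theta> j * (f j (snd z) * fst z))))"
    by (rule fd_law_ek[OF sigma_finite_jump_product[OF jm] J])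
       (auto intro: jump_product_measurable[OF jm f fin] integrable_jump_part[OF jm f fin])
  have "exp (expo b \<rho> (\<lambda>s. \<Sum>j\<in>J. \<theta> j * f j s)) =
      of_real (exp (- ((LINT s|lborel. (\<Sum>j\<in>J. \<theta> j * (b * f j s))\<^sup>2) / 2))) *
      exp (CLINT z|?N. ek (\<Sum>j\<in>J. \<theta> j * (f j (snd z) * fst z)))" for \<theta>
  proof -
    have m: "(\<lambda>s. \<Sum>j\<in>J. \<theta> j * f j s) \<in> borel_measurable borel" using f by measurable
    have 1: "b * (\<Sum>j\<in>J. \<theta> j * f j s) = (\<Sum>j\<in>J. \<theta> j * (b * f j s))" for s
      by (simp add: sum_distrib_left mult.left_commute)
    have 2: "(\<Sum>j\<in>J. \<theta> j * f j s) * x = (\<Sum>j\<in>J. \<theta> j * (f j s * x))" for s x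
      by (simp add: sum_distrib_right mult.assoc)
    have "expo b \<rho> (\<lambda>s. \<Sum>j\<in>J. \<theta> j * f j s) =
        - of_real ((LINT s|lborel. (\<Sum>j\<in>J. \<theta> j * (b * f j s))\<^sup>2) / 2) +
        (CLINT z|?N. ek (\<Sum>j\<in>J. \<theta> j * (f j (snd z) * fst z)))"
      unfolding 1[symmetric] 2[symmetric]
      by (rule expo_eq[OF jm m modular_sum_finite[OF jm J f fin]])
    then show ?thesis by (simp only: exp_add of_real_minus[symmetric] exp_of_real)
  qed
  then show ?thesis using fd_law_mult[OF J gauss jump] by simp
qed

lemma moment_expo:
  fixes h :: "'d::euclidean_space \<Rightarrow> real"
  assumes jm: "jump_measure \<rho>" and M: "prob_space M" and Y: "Y \<in> borel_measurable M"
    and h: "h \<in> borel_measurable borel" and fin: "modular b \<rho> h < \<infinity>" and T: "1 \<le> T"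
    and char: "\<And>t. (CLINT \<omega>|M. iexp (t * Y \<omega>)) = exp (expo b \<rho> (\<lambda>s. t * h s))"
  defines "\<kappa> \<equiv> enn2real (modular b \<rho> h)"
  shows "(\<integral>\<^sup>+\<omega>. ennreal \<bar>Y \<omega>\<bar> \<partial>M) \<le> ennreal (4 * (2 / T + (T + 6) * \<kappa> + 8 * T\<^sup>2 * \<kappa>\<^sup>2 * T))"
proof -
  let ?N = "\<rho> \<Otimes>\<^sub>M (lborel :: 'd measure)"
  define v where "v = (LINT s|lborel. (b * h s)\<^sup>2)"
  define k where "k = (LINT z|?N. kf (h (snd z) * fst z))"
  have v: "0 \<le> v" and k: "0 \<le> k" by (simp_all add: v_def k_def)
  have \<kappa>: "\<kappa> = v + k" unfolding \<kappa>_def v_def k_def by (rule modular_eq[OF jm h fin])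
  have "(\<integral>\<^sup>+\<omega>. ennreal \<bar>Y \<omega>\<bar> \<partial>M) \<le> ennreal (4 * (2 / T + v / 2 * T + (T + 6) * k + 8 * T\<^sup>2 * k\<^sup>2 * T))"
    unfolding k_def
  proof (rule moment_bound[OF M Y sigma_finite_jump_product[OF jm] jump_product_measurable[OF jm h fin]
      integrable_jump_part[OF jm h fin] v T])
    fix t :: real
    have th: "(\<lambda>s. t * h s) \<in> borel_measurable borel" using h by measurable
    have "(LINT s|lborel. (b * (t * h s))\<^sup>2) = v * t\<^sup>2"
    proof -
      have "(LINT s|lborel. (b * (t * h s))\<^sup>2) = (LINT s|lborel. t\<^sup>2 * (b * h s)\<^sup>2)"
        by (simp add: power_mult_distrib mult_ac)
      then show ?thesis by (simp add: v_def)
    qed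
    then show "(CLINT \<omega>|M. iexp (t * Y \<omega>)) =
        exp (- of_real (v * t\<^sup>2 / 2) + (CLINT z|?N. ek (t * (h (snd z) * fst z))))"
      unfolding char expo_eq[OF jm th modular_scale_finite[OF jm h fin]] by (simp only: mult.assoc)
  qed
  also have "\<dots> \<le> ennreal (4 * (2 / T + (T + 6) * \<kappa> + 8 * T\<^sup>2 * \<kappa>\<^sup>2 * T))"
  proof (rule ennreal_leI, rule mult_left_mono)
    have "v / 2 * T \<le> (T + 6) * v" using v T by (simp add: algebra_simps)
    moreover have "(T + 6) * \<kappa> = (T + 6) * v + (T + 6) * k" by (simp add: \<kappa> distrib_left)
    moreover have "8 * T\<^sup>2 * k\<^sup>2 * T \<le> 8 * T\<^sup>2 * \<kappa>\<^sup>2 * T"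
      using k v T \<kappa> by (intro mult_right_mono mult_left_mono power_mono) auto
    ultimately show "2 / T + v / 2 * T + (T + 6) * k + 8 * T\<^sup>2 * k\<^sup>2 * T \<le> 2 / T + (T + 6) * \<kappa> + 8 * T\<^sup>2 * \<kappa>\<^sup>2 * T"
      by linarith
  qed simp
  finally show ?thesis .
qed

section \<open>Integrals against a sum of two measures\<close>

lemma nn_integral_add_measure:
  assumes A: "sets A = sets M" and B: "sets B = sets M"
    and eq: "\<And>S. S \<in> sets M \<Longrightarrow> emeasure M S = emeasure A S + emeasure B S"
    and f: "f \<in> borel_measurable M"
  shows "(\<integral>\<^sup>+x. f x \<partial>M) = (\<integral>\<^sup>+x. f x \<partial>A) + (\<integral>\<^sup>+x. f x \<partial>B)"
  using f
proof (induction f rule: borel_measurable_induct)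
  have conv: "u \<in> borel_measurable A" "u \<in> borel_measurable B" if "u \<in> borel_measurable M" for u :: "_ \<Rightarrow> ennreal"
    unfolding measurable_cong_sets[OF A refl] measurable_cong_sets[OF B refl] using that by this+
{
  case (cong f g)
  have "space A = space M" "space B = space M" using A B by (auto dest: sets_eq_imp_space_eq)
  then have "(\<integral>\<^sup>+x. g x \<partial>M) = (\<integral>\<^sup>+x. f x \<partial>M)" "(\<integral>\<^sup>+x. g x \<partial>A) = (\<integral>\<^sup>+x. f x \<partial>A)"
    "(\<integral>\<^sup>+x. g x \<partial>B) = (\<integral>\<^sup>+x. f x \<partial>B)"
    using cong.hyps(3) by (auto intro!: nn_integral_cong)
  then show ?case using cong.IH by simp
next
  case (set S)
  then show ?case using eq A B by simp
next
  case (mult u c)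
  show ?case using mult conv[OF mult.hyps(2)] by (simp add: nn_integral_cmult distrib_left)
next
  case (add u v)
  have m: "u \<in> borel_measurable M" "v \<in> borel_measurable M" using add.hyps by auto
  show ?case using add.IH m conv[OF m(1)] conv[OF m(2)] by (simp add: nn_integral_add algebra_simps)
next
  case (seq U)
  have UA: "U i \<in> borel_measurable A" and UB: "U i \<in> borel_measurable B" for i
    using conv[OF seq.hyps(1)] by auto
  have mono: "incseq (\<lambda>i. \<integral>\<^sup>+x. U i x \<partial>A)" "incseq (\<lambda>i. \<integral>\<^sup>+x. U i x \<partial>B)"
    using seq.hyps(3) by (auto simp: incseq_def le_fun_def intro!: nn_integral_mono)
  have "(\<integral>\<^sup>+x. (SUP i. U i) x \<partial>M) = (SUP i. \<integral>\<^sup>+x. U i x \<partial>M)"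
    unfolding SUP_apply using seq.hyps by (intro nn_integral_monotone_convergence_SUP) auto
  also have "\<dots> = (SUP i. (\<integral>\<^sup>+x. U i x \<partial>A) + (\<integral>\<^sup>+x. U i x \<partial>B))"
    using seq.IH by simp
  also have "\<dots> = (SUP i. \<integral>\<^sup>+x. U i x \<partial>A) + (SUP i. \<integral>\<^sup>+x. U i x \<partial>B)"
    by (rule ennreal_SUP_add[OF mono])
  also have "(SUP i. \<integral>\<^sup>+x. U i x \<partial>A) = (\<integral>\<^sup>+x. (SUP i. U i) x \<partial>A)"
    unfolding SUP_apply using seq.hyps UA by (intro nn_integral_monotone_convergence_SUP[symmetric]) auto
  also have "(SUP i. \<integral>\<^sup>+x. U i x \<partial>B) = (\<integral>\<^sup>+x. (SUP i. U i) x \<partial>B)"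
    unfolding SUP_apply using seq.hyps UB by (intro nn_integral_monotone_convergence_SUP[symmetric]) auto
  finally show ?case .
}
qed

lemma integral_add_measure_real:
  fixes f :: "'x \<Rightarrow> real"
  assumes A: "sets A = sets M" and B: "sets B = sets M"
    and eq: "\<And>S. S \<in> sets M \<Longrightarrow> emeasure M S = emeasure A S + emeasure B S"
    and f: "integrable M f"
  shows "integrable A f" "integrable B f" "integral\<^sup>L M f = integral\<^sup>L A f + integral\<^sup>L B f"
proof -
  have nn: "(\<integral>\<^sup>+x. w x \<partial>M) = (\<integral>\<^sup>+x. w x \<partial>A) + (\<integral>\<^sup>+x. w x \<partial>B)" if "w \<in> borel_measurable M" for w
    by (rule nn_integral_add_measure[OF A B eq that])
  have m: "f \<in> borel_measurable M" using f by auto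
  have mA: "f \<in> borel_measurable A" and mB: "f \<in> borel_measurable B"
    unfolding measurable_cong_sets[OF A refl] measurable_cong_sets[OF B refl] using m by this+
  have nm: "(\<lambda>x. ennreal (norm (f x))) \<in> borel_measurable M" using m by measurable
  have "(\<integral>\<^sup>+x. ennreal (norm (f x)) \<partial>A) + (\<integral>\<^sup>+x. ennreal (norm (f x)) \<partial>B) < \<infinity>"
    using f nn[OF nm] by (simp add: integrable_iff_bounded)
  then show iA: "integrable A f" and iB: "integrable B f"
    using mA mB by (auto simp: integrable_iff_bounded)
  have pm: "(\<lambda>x. ennreal (f x)) \<in> borel_measurable M" "(\<lambda>x. ennreal (- f x)) \<in> borel_measurable M"
    using m by measurable
  have fin: "(\<integral>\<^sup>+x. ennreal (f x) \<partial>A) \<noteq> \<infinity>" "(\<integral>\<^sup>+x. ennreal (- f x) \<partial>A) \<noteq> \<infinity>"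
    "(\<integral>\<^sup>+x. ennreal (f x) \<partial>B) \<noteq> \<infinity>" "(\<integral>\<^sup>+x. ennreal (- f x) \<partial>B) \<noteq> \<infinity>"
    using iA iB by (auto simp: real_integrable_def)
  show "integral\<^sup>L M f = integral\<^sup>L A f + integral\<^sup>L B f"
    unfolding real_lebesgue_integral_def[OF f] real_lebesgue_integral_def[OF iA] real_lebesgue_integral_def[OF iB]
      nn[OF pm(1)] nn[OF pm(2)]
    using fin by (simp add: enn2real_plus less_top)
qed

lemma integral_add_measure_complex:
  fixes f :: "'x \<Rightarrow> complex"
  assumes A: "sets A = sets M" and B: "sets B = sets M"
    and eq: "\<And>S. S \<in> sets M \<Longrightarrow> emeasure M S = emeasure A S + emeasure B S"
    and f: "integrable M f"
  shows "integral\<^sup>L M f = integral\<^sup>L A f + integral\<^sup>L B f"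
proof -
  have Re: "integrable M (\<lambda>x. Re (f x))" and Im: "integrable M (\<lambda>x. Im (f x))" using f by auto
  have m: "f \<in> borel_measurable M" using f by auto
  have mA: "f \<in> borel_measurable A" and mB: "f \<in> borel_measurable B"
    unfolding measurable_cong_sets[OF A refl] measurable_cong_sets[OF B refl] using m by this+
  have nf: "integrable M (\<lambda>x. norm (f x))" using f by simp
  have "integrable A (\<lambda>x. norm (f x))" "integrable B (\<lambda>x. norm (f x))"
    by (rule integral_add_measure_real(1)[OF A B eq nf] integral_add_measure_real(2)[OF A B eq nf]; assumption)+
  then have fA: "integrable A f" and fB: "integrable B f"
    using mA mB by (simp_all add: integrable_norm_iff)
  have "(LINT x|M. Re (f x)) = (LINT x|A. Re (f x)) + (LINT x|B. Re (f x))"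
    by (rule integral_add_measure_real(3)[OF A B eq Re])
  moreover have "(LINT x|M. Im (f x)) = (LINT x|A. Im (f x)) + (LINT x|B. Im (f x))"
    by (rule integral_add_measure_real(3)[OF A B eq Im])
  ultimately show ?thesis using f fA fB by (intro complex_eqI) simp_all
qed

text \<open>\<open>\<rho>'\<close> is the Levy measure of the cofactor of the law with Levy measure \<open>\<rho>\<close> at scale \<open>q\<close>.\<close>

definition splits :: "real measure \<Rightarrow> real \<Rightarrow> real measure \<Rightarrow> bool" where
  "splits \<rho> q \<rho>' \<longleftrightarrow> jump_measure \<rho>' \<and>
    (\<forall>A\<in>sets borel. emeasure \<rho> A = emeasure \<rho>' A + emeasure (distr \<rho> borel (\<lambda>x. x / q)) A)"

text \<open>Mirrors the recursion of \<open>urbanik\<close> clause by clause, with a nonnegative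
  difference of measures in place of a cofactor. No kernel appears, which is what lets the three
  fields be compared.\<close>

fun decomp_class :: "nat \<Rightarrow> real measure \<Rightarrow> bool" where
  "decomp_class 0 \<rho> \<longleftrightarrow> (\<forall>q>1. \<exists>\<rho>'. splits \<rho> q \<rho>')"
| "decomp_class (Suc m) \<rho> \<longleftrightarrow> decomp_class 0 \<rho> \<and> (\<forall>q>1. \<exists>\<rho>'. decomp_class m \<rho>' \<and> splits \<rho> q \<rho>')"

text \<open>A centered Gaussian law is selfdecomposable: this is, up to the sign of
  \<open>b\<close>, the standard deviation of its cofactor at scale \<open>q\<close>.\<close>

definition residual_gauss :: "real \<Rightarrow> real \<Rightarrow> real" where
  "residual_gauss b q = b * sqrt (1 - 1 / q\<^sup>2)"

lemma residual_gauss_sq: "1 < q \<Longrightarrow> (residual_gauss b q)\<^sup>2 = b\<^sup>2 - b\<^sup>2 / q\<^sup>2"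
proof -
  assume q: "1 < q"
  then have "1 \<le> q\<^sup>2" by (simp add: one_le_power)
  moreover have "0 < q\<^sup>2" using q by simp
  ultimately have "0 \<le> 1 - 1 / q\<^sup>2" by (simp add: field_simps)
  then show ?thesis by (simp add: residual_gauss_def power_mult_distrib right_diff_distrib)
qed

context
  fixes \<rho> \<rho>' :: "real measure" and q b :: real
  assumes jm: "jump_measure \<rho>" and q: "1 < q" and sp: "splits \<rho> q \<rho>'"
begin

lemma splits_jump: "jump_measure \<rho>'"
  using sp by (simp add: splits_def)

lemma splits_emeasure:
  "A \<in> sets \<rho> \<Longrightarrow> emeasure \<rho> A = emeasure \<rho>' A + emeasure (distr \<rho> borel (\<lambda>x. x / q)) A"
  using sp jump_measure_sets[OF jm] by (simp add: splits_def)

lemma splits_sets: "sets \<rho>' = sets \<rho>" "sets (distr \<rho> borel (\<lambda>x. x / q)) = sets \<rho>"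
  using jump_measure_sets[OF jm] jump_measure_sets[OF splits_jump] by auto

lemma splits_cexp: "cexp b \<rho> \<theta> = cexp b \<rho> (\<theta> / q) + cexp (residual_gauss b q) \<rho>' \<theta>"
proof -
  have "(CLINT x|\<rho>. ek (\<theta> * x)) = (CLINT x|\<rho>'. ek (\<theta> * x)) + (CLINT x|distr \<rho> borel (\<lambda>x. x / q). ek (\<theta> * x))"
    by (rule integral_add_measure_complex[OF splits_sets splits_emeasure integrable_ek[OF jm]])
  also have "(CLINT x|distr \<rho> borel (\<lambda>x. x / q). ek (\<theta> * x)) = (CLINT x|\<rho>. ek (\<theta> / q * x))"
    by (subst integral_distr) (auto intro: jump_measurable[OF jm])
  finally show ?thesis
    unfolding cexp_def residual_gauss_sq[OF q] by (simp add: power_divide left_diff_distrib diff_divide_distrib)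
qed

text \<open>Lets kernels and approximations admissible for \<open>\<rho>\<close> be reused for the
  cofactor, which drives both inductions on the order of the class.\<close>

lemma splits_KK: "KK (residual_gauss b q) \<rho>' r \<le> KK b \<rho> r"
proof -
  have "(LINT x|\<rho>. kf (r * x)) = (LINT x|\<rho>'. kf (r * x)) + (LINT x|distr \<rho> borel (\<lambda>x. x / q). kf (r * x))"
    by (rule integral_add_measure_real(3)[OF splits_sets splits_emeasure integrable_kf_scale[OF jm]])
  moreover have "0 \<le> (LINT x|distr \<rho> borel (\<lambda>x. x / q). kf (r * x))" by simp
  moreover have "(residual_gauss b q)\<^sup>2 * r\<^sup>2 \<le> b\<^sup>2 * r\<^sup>2"
    unfolding residual_gauss_sq[OF q] by (intro mult_right_mono) auto
  ultimately show ?thesis unfolding KK_def by linarith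
qed

lemma splits_modular: "modular (residual_gauss b q) \<rho>' h \<le> modular b \<rho> h"
  unfolding modular_def by (intro nn_integral_mono ennreal_leI splits_KK)

lemma splits_expo:
  assumes h [measurable]: "h \<in> borel_measurable borel" and fin: "modular b \<rho> h < \<infinity>"
  shows "expo b \<rho> h = expo b \<rho> (\<lambda>s. h s / q) + expo (residual_gauss b q) \<rho>' h"
proof -
  have fin1: "modular b \<rho> (\<lambda>s. h s / q) < \<infinity>"
    using modular_scale_finite[OF jm h fin, of "1 / q"] by simp
  have fin2: "modular (residual_gauss b q) \<rho>' h < \<infinity>"
    using splits_modular fin by (rule order.strict_trans1)
  have m: "(\<lambda>s. h s / q) \<in> borel_measurable borel" by measurable
  show ?thesis
    unfolding expo_def splits_cexp[of "h s" for s]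
    by (rule Bochner_Integration.integral_add[OF integrable_cexp[OF jm m fin1] integrable_cexp[OF splits_jump h fin2]])
qed

end

text \<open>Dividing the Levy measure and the Gaussian variance by \<open>n\<close> divides the
  exponent and does not increase the modular, so the existence theorem applies to the root.\<close>

lemma fd_law_expo_root:
  fixes f :: "'i \<Rightarrow> 'd::euclidean_space \<Rightarrow> real"
  assumes jm: "jump_measure \<rho>" and J: "finite J" and n: "0 < (n::nat)"
    and f: "\<And>j. j \<in> J \<Longrightarrow> f j \<in> borel_measurable borel" and fin: "\<And>j. j \<in> J \<Longrightarrow> modular b \<rho> (f j) < \<infinity>"
  shows "fd_law J (\<lambda>\<theta>. exp (expo b \<rho> (\<lambda>s. \<Sum>j\<in>J. \<theta> j * f j s) / of_nat n))"
proof -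
  define \<rho>n where "\<rho>n = density \<rho> (\<lambda>_. ennreal (1 / real n))"
  define bn where "bn = b / sqrt (real n)"
  have sets: "sets \<rho>n = sets borel" using jump_measure_sets[OF jm] by (simp add: \<rho>n_def)
  have int_r: "integrable \<rho>n w" "integral\<^sup>L \<rho>n w = integral\<^sup>L \<rho> w / real n" if "integrable \<rho> w" for w :: "real \<Rightarrow> real"
  proof -
    have m: "w \<in> borel_measurable \<rho>" using that by auto
    show "integrable \<rho>n w" unfolding \<rho>n_def using that m n by (subst integrable_density) auto
    show "integral\<^sup>L \<rho>n w = integral\<^sup>L \<rho> w / real n" unfolding \<rho>n_def using m n by (subst integral_density) auto
  qed
  have int_c: "integral\<^sup>L \<rho>n w = integral\<^sup>L \<rho> w / of_nat n" if "integrable \<rho> w" for w :: "real \<Rightarrow> complex"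
  proof -
    have m: "w \<in> borel_measurable \<rho>" using that by auto
    show ?thesis unfolding \<rho>n_def using m n
      by (subst integral_density) (auto simp: scaleR_conv_of_real divide_inverse mult.commute)
  qed
  have jn: "jump_measure \<rho>n"
    unfolding jump_measure_def
  proof (intro conjI sets)
    show "emeasure \<rho>n {0} = 0"
      using jm jump_measure_sets[OF jm] unfolding \<rho>n_def jump_measure_def
      by (subst emeasure_density) (simp_all add: nn_integral_cmult_indicator)
    show "integrable \<rho>n kf" using int_r(1)[of kf] jm unfolding jump_measure_def by blast
  qed
  have bn2: "bn\<^sup>2 = b\<^sup>2 / real n" by (simp add: bn_def power_divide)
  have cexp_n: "cexp bn \<rho>n \<theta> = cexp b \<rho> \<theta> / of_nat n" for \<theta>
    unfolding cexp_def int_c[OF integrable_ek[OF jm]] bn2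
    by (simp add: add_divide_distrib diff_divide_distrib mult.commute)
  have KK_n: "KK bn \<rho>n r = KK b \<rho> r / real n" for r
    unfolding KK_def int_r(2)[OF integrable_kf_scale[OF jm]] bn2 by (simp add: add_divide_distrib)
  have "modular bn \<rho>n (f j) < \<infinity>" if j: "j \<in> J" for j
  proof -
    have "modular bn \<rho>n (f j) \<le> modular b \<rho> (f j)"
      unfolding modular_def KK_n
    proof (intro nn_integral_mono ennreal_leI)
      fix s
      have "KK b \<rho> (f j s) / real n \<le> KK b \<rho> (f j s) / 1"
        using n KK_nonneg[OF jm] by (intro divide_left_mono) auto
      then show "KK b \<rho> (f j s) / real n \<le> KK b \<rho> (f j s)" by simp
    qed
    then show ?thesis using fin[OF j] by (rule order.strict_trans1)
  qed
  from fd_law_expo[OF jn J f this]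
  have "fd_law J (\<lambda>\<theta>. exp (expo bn \<rho>n (\<lambda>s. \<Sum>j\<in>J. \<theta> j * f j s)))" .
  then show ?thesis unfolding expo_def cexp_n by simp
qed

lemma fd_inf_div_expo:
  fixes f :: "'i \<Rightarrow> 'd::euclidean_space \<Rightarrow> real"
  assumes jm: "jump_measure \<rho>" and J: "finite J"
    and f: "\<And>j. j \<in> J \<Longrightarrow> f j \<in> borel_measurable borel" and fin: "\<And>j. j \<in> J \<Longrightarrow> modular b \<rho> (f j) < \<infinity>"
    and \<nu>: "fd_prob J \<nu>" and char: "\<And>\<theta>. fd_char J \<nu> \<theta> = exp (expo b \<rho> (\<lambda>s. \<Sum>j\<in>J. \<theta> j * f j s))"
  shows "fd_inf_div J \<nu>"
  unfolding fd_inf_div_def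
proof (intro conjI allI impI \<nu>)
  fix n :: nat assume n: "0 < n"
  have "fd_law J (\<lambda>\<theta>. exp (expo b \<rho> (\<lambda>s. \<Sum>j\<in>J. \<theta> j * f j s) / of_nat n))"
    by (rule fd_law_expo_root[OF jm J n f fin])
  then obtain \<eta> where \<eta>: "fd_prob J \<eta>"
    and c: "\<And>\<theta>. fd_char J \<eta> \<theta> = exp (expo b \<rho> (\<lambda>s. \<Sum>j\<in>J. \<theta> j * f j s) / of_nat n)"
    unfolding fd_law_def by blast
  have "exp (w / of_nat n) ^ n = exp w" for w :: complex
    using n by (simp flip: exp_of_nat_mult)
  then show "\<exists>\<eta>. fd_prob J \<eta> \<and> (\<forall>\<theta>. fd_char J \<nu> \<theta> = fd_char J \<eta> \<theta> ^ n)"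
    using \<eta> char c by (intro exI[of _ \<eta>]) simp
qed

text \<open>The cofactor at scale \<open>q\<close> has the same kernels, with \<open>\<rho>'\<close>
  and \<open>residual_gauss b q\<close> in place of \<open>\<rho>\<close> and \<open>b\<close>;
  hence the induction leaves \<open>\<rho>\<close>, \<open>b\<close> and the law arbitrary while the
  kernels stay fixed. That the cofactor exists as a law is \<open>fd_law_expo\<close>.\<close>

lemma urbanik_of_decomp_class:
  fixes f :: "'i \<Rightarrow> 'd::euclidean_space \<Rightarrow> real"
  assumes J: "finite J" and f: "\<And>j. j \<in> J \<Longrightarrow> f j \<in> borel_measurable borel"
    and "jump_measure \<rho>" "decomp_class m \<rho>" "\<And>j. j \<in> J \<Longrightarrow> modular b \<rho> (f j) < \<infinity>"
    and "fd_prob J \<nu>" "\<And>\<theta>. fd_char J \<nu> \<theta> = exp (expo b \<rho> (\<lambda>s. \<Sum>j\<in>J. \<theta> j * f j s))"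
  shows "urbanik m J \<nu>"
  using assms(3-)
proof (induction m arbitrary: \<rho> b \<nu>)
  have residual: "\<exists>\<eta>. fd_prob J \<eta> \<and> fd_factor J \<nu> q \<eta> \<and>
      (\<forall>j\<in>J. modular (residual_gauss b q) \<rho>' (f j) < \<infinity>) \<and>
      (\<forall>\<theta>. fd_char J \<eta> \<theta> = exp (expo (residual_gauss b q) \<rho>' (\<lambda>s. \<Sum>j\<in>J. \<theta> j * f j s)))"
    if jm: "jump_measure \<rho>" and fin0: "\<forall>j\<in>J. modular b \<rho> (f j) < \<infinity>"
      and char0: "\<forall>\<theta>. fd_char J \<nu> \<theta> = exp (expo b \<rho> (\<lambda>s. \<Sum>j\<in>J. \<theta> j * f j s))"
      and q: "1 < q" and sp: "splits \<rho> q \<rho>'" for \<rho> b \<nu> q \<rho>'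
  proof -
    have fin: "modular b \<rho> (f j) < \<infinity>" if "j \<in> J" for j using fin0 that by blast
    have char: "fd_char J \<nu> \<theta> = exp (expo b \<rho> (\<lambda>s. \<Sum>j\<in>J. \<theta> j * f j s))" for \<theta> using char0 by blast
    have fin': "modular (residual_gauss b q) \<rho>' (f j) < \<infinity>" if "j \<in> J" for j
      using splits_modular[OF jm q sp] fin[OF that] by (rule order.strict_trans1)
    have "fd_law J (\<lambda>\<theta>. exp (expo (residual_gauss b q) \<rho>' (\<lambda>s. \<Sum>j\<in>J. \<theta> j * f j s)))"
      by (rule fd_law_expo[OF splits_jump[OF jm q sp] J f fin'])
    then obtain \<eta> where \<eta>: "fd_prob J \<eta>"
      and c: "\<And>\<theta>. fd_char J \<eta> \<theta> = exp (expo (residual_gauss b q) \<rho>' (\<lambda>s. \<Sum>j\<in>J. \<theta> j * f j s))"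
      unfolding fd_law_def by blast
    have "fd_factor J \<nu> q \<eta>"
      unfolding fd_factor_def
    proof
      fix \<theta> :: "'i \<Rightarrow> real"
      have m: "(\<lambda>s. \<Sum>j\<in>J. \<theta> j * f j s) \<in> borel_measurable borel" using f by measurable
      have sE: "expo b \<rho> (\<lambda>s. \<Sum>j\<in>J. \<theta> j * f j s) = expo b \<rho> (\<lambda>s. (\<Sum>j\<in>J. \<theta> j * f j s) / q) +
          expo (residual_gauss b q) \<rho>' (\<lambda>s. \<Sum>j\<in>J. \<theta> j * f j s)"
        by (rule splits_expo[OF jm q sp m modular_sum_finite[OF jm J f fin]])
      have "(\<Sum>j\<in>J. \<theta> j / q * f j s) = (\<Sum>j\<in>J. \<theta> j * f j s) / q" for s
        by (simp add: sum_divide_distrib)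
      then show "fd_char J \<nu> \<theta> = fd_char J \<nu> (\<lambda>j. \<theta> j / q) * fd_char J \<eta> \<theta>"
        unfolding char c sE by (simp add: exp_add)
    qed
    then show ?thesis using \<eta> c fin' by blast
  qed
  have zero: "urbanik 0 J \<nu>"
    if jm: "jump_measure \<rho>" and D: "decomp_class 0 \<rho>" and fin: "\<forall>j\<in>J. modular b \<rho> (f j) < \<infinity>"
      and \<nu>: "fd_prob J \<nu>" and char: "\<forall>\<theta>. fd_char J \<nu> \<theta> = exp (expo b \<rho> (\<lambda>s. \<Sum>j\<in>J. \<theta> j * f j s))" for \<rho> b \<nu>
    unfolding urbanik.simps
  proof (intro conjI \<nu> allI impI)
    fix q :: real assume q: "1 < q"
    with D obtain \<rho>' where sp: "splits \<rho> q \<rho>'" by auto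
    from residual[OF jm fin char q sp] obtain \<eta> where \<eta>: "fd_prob J \<eta>" "fd_factor J \<nu> q \<eta>"
      and fin': "\<And>j. j \<in> J \<Longrightarrow> modular (residual_gauss b q) \<rho>' (f j) < \<infinity>"
      and c: "\<And>\<theta>. fd_char J \<eta> \<theta> = exp (expo (residual_gauss b q) \<rho>' (\<lambda>s. \<Sum>j\<in>J. \<theta> j * f j s))" by blast
    have "fd_inf_div J \<eta>" by (rule fd_inf_div_expo[OF splits_jump[OF jm q sp] J f fin' \<eta>(1) c])
    then show "\<exists>\<eta>. fd_inf_div J \<eta> \<and> fd_factor J \<nu> q \<eta>" using \<eta>(2) by blast
  qed
  {
    case 0
    show ?case by (rule zero[OF 0(1,2) _ 0(4)]) (use 0(3,5) in blast)+
  next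
    case (Suc m)
    note jm = Suc.prems(1) and \<nu> = Suc.prems(4)
    have fin: "\<forall>j\<in>J. modular b \<rho> (f j) < \<infinity>" using Suc.prems(3) by blast
    have char: "\<forall>\<theta>. fd_char J \<nu> \<theta> = exp (expo b \<rho> (\<lambda>s. \<Sum>j\<in>J. \<theta> j * f j s))" using Suc.prems(5) by blast
    have D0: "decomp_class 0 \<rho>" using Suc.prems(2) by simp
    have "urbanik 0 J \<nu>" by (rule zero[OF jm D0 fin \<nu> char])
    moreover have "\<exists>\<eta>. urbanik m J \<eta> \<and> fd_factor J \<nu> q \<eta>" if q: "1 < q" for q
    proof -
      from Suc.prems(2) q obtain \<rho>' where D: "decomp_class m \<rho>'" and sp: "splits \<rho> q \<rho>'" by auto
      from residual[OF jm fin char q sp] obtain \<eta> where \<eta>: "fd_prob J \<eta>" "fd_factor J \<nu> q \<eta>"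
        and fin': "\<And>j. j \<in> J \<Longrightarrow> modular (residual_gauss b q) \<rho>' (f j) < \<infinity>"
        and c: "\<And>\<theta>. fd_char J \<eta> \<theta> = exp (expo (residual_gauss b q) \<rho>' (\<lambda>s. \<Sum>j\<in>J. \<theta> j * f j s))" by blast
      have "urbanik m J \<eta>" by (rule Suc.IH[OF splits_jump[OF jm q sp] D fin' \<eta>(1) c])
      then show ?thesis using \<eta>(2) by blast
    qed
    ultimately show ?case unfolding urbanik.simps by blast
  }
qed

section \<open>Recovering a Levy measure from limits of characteristic functions\<close>

definition add_measure :: "'x measure \<Rightarrow> 'x measure \<Rightarrow> 'x measure" where
  "add_measure A B = measure_of (space A) (sets A) (\<lambda>S. emeasure A S + emeasure B S)"

lemma sets_add_measure [simp, measurable_cong]: "sets (add_measure A B) = sets A"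
  by (simp add: add_measure_def)

lemma space_add_measure [simp]: "space (add_measure A B) = space A"
  by (simp add: add_measure_def)

lemma emeasure_add_measure:
  assumes "sets B = sets A" "S \<in> sets A"
  shows "emeasure (add_measure A B) S = emeasure A S + emeasure B S"
proof (rule emeasure_measure_of[OF add_measure_def])
  show "sets A \<subseteq> Pow (space A)" by (rule sets.space_closed)
  show "positive (sets (add_measure A B)) (\<lambda>S. emeasure A S + emeasure B S)"
    by (simp add: positive_def)
  show "countably_additive (sets (add_measure A B)) (\<lambda>S. emeasure A S + emeasure B S)"
    unfolding countably_additive_def
  proof (intro allI impI)
    fix F :: "nat \<Rightarrow> 'a set"
    assume F: "range F \<subseteq> sets (add_measure A B)" and disj: "disjoint_family F"
    have FA: "range F \<subseteq> sets A" and FB: "range F \<subseteq> sets B" using F assms(1) by auto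
    have "(\<Sum>i. emeasure A (F i) + emeasure B (F i)) = (\<Sum>i. emeasure A (F i)) + (\<Sum>i. emeasure B (F i))"
      by (rule suminf_add[symmetric]) auto
    then show "(\<Sum>i. emeasure A (F i) + emeasure B (F i)) = emeasure A (\<Union>(range F)) + emeasure B (\<Union>(range F))"
      unfolding suminf_emeasure[OF FA disj] suminf_emeasure[OF FB disj] .
  qed
qed (use assms in simp)

lemma finite_measure_add_measure:
  assumes s: "sets B = sets A" and "finite_measure A" "finite_measure B"
  shows "finite_measure (add_measure A B)"
proof
  interpret A: finite_measure A by fact
  interpret B: finite_measure B by fact
  have "space A = space B" using s by (metis sets_eq_imp_space_eq)
  then show "emeasure (add_measure A B) (space (add_measure A B)) \<noteq> \<infinity>"
    using s by (subst emeasure_add_measure) auto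
qed

lemma integral_add_measure_iexp:
  assumes s: "sets B = sets A" and sA: "sets A = sets borel" and A: "finite_measure A" and B: "finite_measure B"
  shows "(CLINT x|add_measure A B. iexp (t * x)) = (CLINT x|A. iexp (t * x)) + (CLINT x|B. iexp (t * x))"
proof (rule integral_add_measure_complex)
  interpret finite_measure "add_measure A B" by (rule finite_measure_add_measure[OF s A B])
  have "(\<lambda>x. iexp (t * x)) \<in> borel_measurable (add_measure A B)"
    unfolding measurable_cong_sets[OF sets_add_measure refl] measurable_cong_sets[OF sA refl] by measurable
  then show "integrable (add_measure A B) (\<lambda>x. iexp (t * x))"
    by (intro integrable_const_bound[of _ 1]) auto
qed (use s emeasure_add_measure[OF s] in auto)

lemma normalized_real_distribution:
  assumes s: "sets A = sets borel" and A: "finite_measure A" and pos: "0 < measure A UNIV"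
  shows "real_distribution (density A (\<lambda>_. ennreal (1 / measure A UNIV)))"
    and "char (density A (\<lambda>_. ennreal (1 / measure A UNIV))) t = (CLINT x|A. iexp (t * x)) / of_real (measure A UNIV)"
    and "S \<in> sets borel \<Longrightarrow> measure (density A (\<lambda>_. ennreal (1 / measure A UNIV))) S = measure A S / measure A UNIV"
proof -
  interpret finite_measure A by fact
  define r where "r = measure A UNIV"
  have r: "0 < r" using pos by (simp add: r_def)
  have sp: "space A = UNIV" using sets_eq_imp_space_eq[OF s] by simp
  have em: "emeasure (density A (\<lambda>_. ennreal (1 / r))) S = ennreal (measure A S / r)" if "S \<in> sets borel" for S
  proof -
    have "emeasure (density A (\<lambda>_. ennreal (1 / r))) S = ennreal (1 / r) * emeasure A S"
      using that s by (subst emeasure_density) (auto simp: nn_integral_cmult_indicator)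
    also have "\<dots> = ennreal (1 / r * measure A S)"
      unfolding emeasure_eq_measure using r by (intro ennreal_mult[symmetric]) auto
    finally show ?thesis by simp
  qed
  show "measure (density A (\<lambda>_. ennreal (1 / measure A UNIV))) S = measure A S / measure A UNIV" if "S \<in> sets borel"
    using em[OF that] r unfolding r_def measure_def by simp
  have "prob_space (density A (\<lambda>_. ennreal (1 / r)))"
  proof
    show "emeasure (density A (\<lambda>_. ennreal (1 / r))) (space (density A (\<lambda>_. ennreal (1 / r)))) = 1"
      using em[of UNIV] r by (simp add: sp r_def)
  qed
  then show "real_distribution (density A (\<lambda>_. ennreal (1 / measure A UNIV)))"
    unfolding real_distribution_def real_distribution_axioms_def using s sp by (simp add: r_def)
  have m: "(\<lambda>x. iexp (t * x)) \<in> borel_measurable A"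
    unfolding measurable_cong_sets[OF s refl] by measurable
  have "char (density A (\<lambda>_. ennreal (1 / r))) t = (CLINT x|A. (1 / r) *\<^sub>R iexp (t * x))"
    unfolding char_def using m r by (intro integral_density) auto
  then show "char (density A (\<lambda>_. ennreal (1 / measure A UNIV))) t = (CLINT x|A. iexp (t * x)) / of_real (measure A UNIV)"
    by (simp add: r_def scaleR_conv_of_real divide_inverse mult.commute)
qed

lemma integral_iexp_0:
  assumes s: "sets A = sets borel" and A: "finite_measure A"
  shows "(CLINT x|A. iexp (0 * x)) = of_real (measure A UNIV)"
proof -
  have sp: "space A = UNIV" using sets_eq_imp_space_eq[OF s] by simp
  show ?thesis by (simp add: sp scaleR_conv_of_real)
qed

text \<open>The sums of \<open>A\<close> and \<open>G k\<close> converge weakly to \<open>B\<close>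
  by Levy's continuity theorem, once normalised by their total masses, which converge too (argument
  0). As \<open>G k\<close> is nonnegative, interval masses of \<open>A\<close> lie below those of
  the sums, and these converge when the endpoints carry no mass of \<open>B\<close>.\<close>

lemma interval_measure_le_of_char_limit:
  fixes A B :: "real measure" and G :: "nat \<Rightarrow> real measure"
  assumes A: "finite_measure A" "sets A = sets borel" and B: "finite_measure B" "sets B = sets borel"
    and G: "\<And>k. finite_measure (G k)" "\<And>k. sets (G k) = sets borel" and pos: "0 < measure B UNIV"
    and lim: "\<And>t. (\<lambda>k. (CLINT x|A. iexp (t * x)) + (CLINT x|G k. iexp (t * x))) \<longlonglongrightarrow> (CLINT x|B. iexp (t * x))"
    and xy: "x < y" "measure B {x} = 0" "measure B {y} = 0"
  shows "measure A {x<..y} \<le> measure B {x<..y}"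
proof -
  interpret A: finite_measure A by (rule A)
  interpret B: finite_measure B by (rule B)
  define H where "H k = add_measure A (G k)" for k
  have Hs: "sets (H k) = sets borel" for k using A by (simp add: H_def)
  have Hf: "finite_measure (H k)" for k
    unfolding H_def using A G by (intro finite_measure_add_measure) auto
  have Hc: "(CLINT x|H k. iexp (t * x)) = (CLINT x|A. iexp (t * x)) + (CLINT x|G k. iexp (t * x))" for t k
    unfolding H_def using A G by (intro integral_add_measure_iexp) auto
  define m where "m k = measure (H k) UNIV" for k
  define r where "r = measure B UNIV"
  have "(\<lambda>k. complex_of_real (m k)) \<longlonglongrightarrow> of_real r"
    using lim[of 0] unfolding Hc[symmetric] integral_iexp_0[OF Hs Hf] integral_iexp_0[OF B(2,1)] m_def r_def .
  then have m_lim: "m \<longlonglongrightarrow> r" by (simp add: tendsto_of_real_iff)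
  have r: "0 < r" using pos by (simp add: r_def)
  define P where "P = density B (\<lambda>_. ennreal (1 / r))"
  note Pprops = normalized_real_distribution[OF B(2,1) pos, folded r_def, folded P_def]
  \<comment> \<open>The second branch is a placeholder that makes every \<open>Q k\<close> a
    distribution; it concerns finitely many \<open>k\<close>, since the limiting mass is
    positive.\<close>
  define Q where "Q k = (if 0 < m k then density (H k) (\<lambda>_. ennreal (1 / m k)) else P)" for k
  have Qd: "real_distribution (Q k)" for k
    unfolding Q_def m_def using normalized_real_distribution(1)[OF Hs Hf] Pprops(1) by simp
  have mpos: "\<forall>\<^sub>F k in sequentially. 0 < m k" by (rule order_tendstoD(1)[OF m_lim r])
  have "weak_conv_m Q P"
  proof (rule levy_continuity[OF Qd Pprops(1)])
    fix t
    have "(\<lambda>k. (CLINT x|H k. iexp (t * x)) / of_real (m k)) \<longlonglongrightarrow> (CLINT x|B. iexp (t * x)) / of_real r"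
      using r unfolding Hc by (intro tendsto_divide lim tendsto_of_real m_lim) auto
    then show "(\<lambda>k. char (Q k) t) \<longlonglongrightarrow> char P t"
      unfolding Pprops(2)
    proof (rule Lim_transform_eventually)
      show "\<forall>\<^sub>F k in sequentially. (CLINT x|H k. iexp (t * x)) / of_real (m k) = char (Q k) t"
        using mpos
      proof eventually_elim
        case (elim k)
        then show ?case
          using normalized_real_distribution(2)[OF Hs Hf, of k t] by (simp add: Q_def m_def)
      qed
    qed
  qed
  then have w: "(\<lambda>k. cdf (Q k) x) \<longlonglongrightarrow> cdf P x" if "isCont (cdf P) x" for x
    using that by (simp add: weak_conv_m_def weak_conv_def)
  interpret P: real_distribution P by (rule Pprops(1))
  have "isCont (cdf P) x" "isCont (cdf P) y"
    unfolding P.isCont_cdf using Pprops(3) xy by simp_all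
  from tendsto_diff[OF w[OF this(2)] w[OF this(1)]]
  have "(\<lambda>k. m k * (cdf (Q k) y - cdf (Q k) x)) \<longlonglongrightarrow> r * (cdf P y - cdf P x)"
    by (intro tendsto_mult m_lim)
  moreover have "r * (cdf P y - cdf P x) = measure B {x<..y}"
    using P.cdf_diff_eq[OF xy(1)] Pprops(3)[of "{x<..y}"] r by simp
  moreover have "\<forall>\<^sub>F k in sequentially. measure A {x<..y} \<le> m k * (cdf (Q k) y - cdf (Q k) x)"
    using mpos
  proof eventually_elim
    case (elim k)
    interpret Q: real_distribution "Q k" by (rule Qd)
    interpret H: finite_measure "H k" by (rule Hf)
    have "m k * (cdf (Q k) y - cdf (Q k) x) = measure (H k) {x<..y}"
      using Q.cdf_diff_eq[OF xy(1)] normalized_real_distribution(3)[OF Hs Hf, of k "{x<..y}"] elim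
      by (simp add: Q_def m_def)
    moreover have "emeasure A {x<..y} \<le> emeasure (H k) {x<..y}"
      unfolding H_def using A G by (subst emeasure_add_measure) (auto intro: add_increasing2)
    ultimately show ?case by (simp add: A.emeasure_eq_measure H.emeasure_eq_measure)
  qed
  ultimately show ?thesis
    using tendsto_lowerbound[of _ _ sequentially] by (metis trivial_limit_sequentially)
qed

lemma finite_borel_measureI: "finite_measure A \<Longrightarrow> sets A = sets borel \<Longrightarrow> finite_borel_measure A"
  unfolding finite_borel_measure_def finite_borel_measure_axioms_def by simp

text \<open>The difference of the distribution functions is right-continuous, and monotone between
  points without mass of \<open>B\<close>. Such points are dense, atoms being countable, so limits
  from the right extend monotonicity to all points, and the Stieltjes measure of the difference is
  the measure sought.\<close>

lemma difference_measure:
  fixes A B :: "real measure" and G :: "nat \<Rightarrow> real measure"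
  assumes A: "finite_measure A" "sets A = sets borel" and B: "finite_measure B" "sets B = sets borel"
    and G: "\<And>k. finite_measure (G k)" "\<And>k. sets (G k) = sets borel" and pos: "0 < measure B UNIV"
    and lim: "\<And>t. (\<lambda>k. (CLINT x|A. iexp (t * x)) + (CLINT x|G k. iexp (t * x))) \<longlonglongrightarrow> (CLINT x|B. iexp (t * x))"
  shows "\<exists>C. sets C = sets borel \<and> (\<forall>S\<in>sets borel. emeasure B S = emeasure C S + emeasure A S)"
proof -
  interpret A: finite_borel_measure A by (rule finite_borel_measureI[OF A])
  interpret B: finite_borel_measure B by (rule finite_borel_measureI[OF B])
  define F where "F x = cdf B x - cdf A x" for x
  have dense: "\<exists>c. x < c \<and> c < y \<and> measure B {c} = 0" if "x < y" for x y
  proof -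
    have "uncountable {x<..<y}" using that by (simp add: uncountable_open_interval)
    moreover have "countable {c. measure B {c} > 0}" using B.countable_support by (simp add: zero_less_measure_iff)
    ultimately have "\<not> {x<..<y} \<subseteq> {c. measure B {c} > 0}" using countable_subset by blast
    then obtain c where "c \<in> {x<..<y}" "c \<notin> {c. measure B {c} > 0}" by blast
    then show ?thesis by (intro exI[of _ c]) (simp add: zero_less_measure_iff)
  qed
  \<comment> \<open>Points without mass approaching \<open>x\<close> strictly from the right, the
    side on which \<open>F\<close> is continuous.\<close>
  have approx: "\<exists>c. (\<forall>n. x < c n \<and> measure B {c n} = 0 \<and> c n < x + 1 / real (Suc n))" for x
    using dense[of x "x + 1 / real (Suc n)" for n] by (intro choice allI) auto
  have Fcont: "continuous (at_right x) F" for x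
    unfolding F_def by (intro continuous_diff A.cdf_is_right_cont B.cdf_is_right_cont)
  have Fmono0: "F x \<le> F y" if "x < y" "measure B {x} = 0" "measure B {y} = 0" for x y
    using interval_measure_le_of_char_limit[OF A B G pos lim that]
    unfolding F_def A.cdf_diff_eq[OF that(1), symmetric] B.cdf_diff_eq[OF that(1), symmetric] by simp
  have Flim: "(\<lambda>n. F (c n)) \<longlonglongrightarrow> F x" if c: "\<And>n. x < c n \<and> measure B {c n} = 0 \<and> c n < x + 1 / real (Suc n)" for x c
  proof -
    have "(\<lambda>n. x + 1 / real (Suc n)) \<longlonglongrightarrow> x + 0"
      by (intro tendsto_add tendsto_const LIMSEQ_Suc[OF lim_1_over_n])
    then have "c \<longlonglongrightarrow> x"
      using c by (intro tendsto_sandwich[of "\<lambda>_. x" c sequentially "\<lambda>n. x + 1 / real (Suc n)"])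
        (auto intro: less_imp_le always_eventually)
    then have "filterlim c (at_right x) sequentially"
      using c by (auto simp: filterlim_at intro: always_eventually)
    then show ?thesis
      using Fcont[of x] unfolding continuous_within by (rule filterlim_compose[rotated])
  qed
  have Fmono: "F x \<le> F y" if "x \<le> y" for x y
  proof (cases "x = y")
    case False
    then have xy: "x < y" using that by simp
    obtain c where c: "\<And>n. x < c n \<and> measure B {c n} = 0 \<and> c n < x + 1 / real (Suc n)" using approx[of x] by blast
    obtain d where d: "\<And>n. y < d n \<and> measure B {d n} = 0 \<and> d n < y + 1 / real (Suc n)" using approx[of y] by blast
    have "\<forall>\<^sub>F n in sequentially. c n < y"
    proof -
      have "(\<lambda>n. x + 1 / real (Suc n)) \<longlonglongrightarrow> x + 0"
        by (intro tendsto_add tendsto_const LIMSEQ_Suc[OF lim_1_over_n])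
      from order_tendstoD(2)[OF this, of y] xy have "\<forall>\<^sub>F n in sequentially. x + 1 / real (Suc n) < y" by simp
      then show ?thesis by eventually_elim (use c in \<open>meson order.strict_trans\<close>)
    qed
    then have "\<forall>\<^sub>F n in sequentially. F (c n) \<le> F (d n)"
    proof eventually_elim
      case (elim n)
      then have "c n < d n" using d[of n] by linarith
      then show ?case using Fmono0 c d by blast
    qed
    then show ?thesis by (rule tendsto_le[OF trivial_limit_sequentially Flim[OF d] Flim[OF c]])
  qed simp
  define C where "C = interval_measure F"
  have Cs: "sets C = sets borel" by (simp add: C_def)
  have C_Ioc: "emeasure C {a<..b'} = ennreal (F b' - F a)" if "a \<le> b'" for a b'
    unfolding C_def by (rule emeasure_interval_measure_Ioc[OF that]) (use Fmono Fcont in auto)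
  have Ioc: "emeasure B {a<..b'} = emeasure (add_measure C A) {a<..b'}" if "a \<le> b'" for a b'
  proof (cases "a = b'")
    case False
    then have ab: "a < b'" using that by simp
    have "emeasure (add_measure C A) {a<..b'} = ennreal (F b' - F a) + ennreal (measure A {a<..b'})"
      using A(2) Cs C_Ioc[OF that] by (subst emeasure_add_measure) (auto simp: A.emeasure_eq_measure)
    also have "\<dots> = ennreal (F b' - F a + measure A {a<..b'})"
      using Fmono[OF that] by (intro ennreal_plus[symmetric]) auto
    also have "F b' - F a + measure A {a<..b'} = measure B {a<..b'}"
      unfolding F_def using A.cdf_diff_eq[OF ab] B.cdf_diff_eq[OF ab] by simp
    finally show ?thesis by (simp add: B.emeasure_eq_measure)
  qed simp
  have "B = add_measure C A"
  proof (rule measure_eqI_lessThan)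
    show "sets B = sets borel" "sets (add_measure C A) = sets borel" using B Cs by simp_all
    fix x :: real
    show "emeasure B {x<..} < \<infinity>" by (simp add: B.emeasure_eq_measure)
    have U: "(\<Union>n. {x<..x + real n}) = {x<..}"
    proof
      show "{x<..} \<subseteq> (\<Union>n. {x<..x + real n})"
      proof
        fix z assume z: "z \<in> {x<..}"
        obtain n where "z - x \<le> real n" using real_arch_simple by blast
        then have "z \<in> {x<..x + real n}" using z by auto
        then show "z \<in> (\<Union>n. {x<..x + real n})" by blast
      qed
    qed auto
    have inc: "incseq (\<lambda>n. {x<..x + real n})" by (auto simp: incseq_def)
    have "emeasure B {x<..} = (SUP n. emeasure B {x<..x + real n})"
      unfolding U[symmetric] by (rule SUP_emeasure_incseq[OF _ inc, symmetric]) (use B in \<open>simp add: image_subset_iff\<close>)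
    also have "\<dots> = (SUP n. emeasure (add_measure C A) {x<..x + real n})" by (simp add: Ioc)
    also have "\<dots> = emeasure (add_measure C A) {x<..}"
      unfolding U[symmetric] by (rule SUP_emeasure_incseq[OF _ inc]) (use Cs in \<open>simp add: image_subset_iff\<close>)
    finally show "emeasure B {x<..} = emeasure (add_measure C A) {x<..}" .
  qed
  then have "emeasure B S = emeasure C S + emeasure A S" if "S \<in> sets borel" for S
    using emeasure_add_measure[of A C S] that A(2) Cs by simp
  then show ?thesis using Cs by blast
qed

text \<open>Parity of the exponent of 2: odd on the left, even on the right. This is the
  irrationality of \<open>sqrt 2\<close> in the form that \<open>wt_pos\<close> uses.\<close>

lemma two_times_square_neq_square:
  fixes m n :: int assumes "2 * n\<^sup>2 = m\<^sup>2" shows "n = 0"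
proof (rule ccontr)
  assume n: "n \<noteq> 0"
  then have m: "m \<noteq> 0" using assms by auto
  have "multiplicity 2 (2 * n\<^sup>2) = Suc (2 * multiplicity 2 n)"
    using n by (subst prime_elem_multiplicity_mult_distrib)
      (auto simp: prime_elem_multiplicity_power_distrib)
  moreover have "multiplicity 2 (m\<^sup>2) = 2 * multiplicity 2 m"
    using m by (auto simp: prime_elem_multiplicity_power_distrib)
  ultimately have "Suc (2 * multiplicity 2 n) = 2 * multiplicity 2 m" using assms by simp
  then show False by presburger
qed

text \<open>The weight produced by second differences with steps 1 and \<open>sqrt 2\<close>; irrationality of \<open>sqrt 2\<close>
  makes it positive off the origin, so that a Levy measure can be recovered from its weighted version.\<close>

definition wt :: "real \<Rightarrow> real" where
  "wt x = 4 - 2 * cos x - 2 * cos (sqrt 2 * x)"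

lemma wt_nonneg [simp]: "0 \<le> wt x"
proof -
  have "cos x \<le> 1" "cos (sqrt 2 * x) \<le> 1" by simp_all
  then show ?thesis unfolding wt_def by linarith
qed

lemma wt_measurable [measurable]: "wt \<in> borel_measurable borel"
  unfolding wt_def by measurable

lemma wt_pos: assumes "x \<noteq> 0" shows "0 < wt x"
proof (rule ccontr)
  assume "\<not> 0 < wt x"
  moreover have "cos x \<le> 1" "cos (sqrt 2 * x) \<le> 1" by simp_all
  ultimately have "cos x = 1" "cos (sqrt 2 * x) = 1" unfolding wt_def by linarith+
  then obtain n m :: int where n: "x = of_int n * (2 * pi)" and m: "sqrt 2 * x = of_int m * (2 * pi)"
    by (auto simp: cos_one_2pi_int mult.assoc)
  have "(sqrt 2 * of_int n) * (2 * pi) = of_int m * (2 * pi)" using n m by simp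
  then have "sqrt 2 * of_int n = of_int m" by simp
  then have "(sqrt 2 * of_int n)\<^sup>2 = (of_int m :: real)\<^sup>2" by simp
  then have "2 * (of_int n)\<^sup>2 = (of_int m :: real)\<^sup>2" by (simp add: power_mult_distrib)
  then have "of_int (2 * n\<^sup>2) = (of_int (m\<^sup>2) :: real)" by simp
  then have "2 * n\<^sup>2 = m\<^sup>2" by (simp only: of_int_eq_iff)
  then have "n = 0" by (rule two_times_square_neq_square)
  then show False using n assms by simp
qed

lemma wt_le: "wt x \<le> 16 * kf x"
proof (cases "\<bar>x\<bar> \<le> 1")
  case True
  have "1 - cos x \<le> x\<^sup>2 / 2" "1 - cos (sqrt 2 * x) \<le> x\<^sup>2"
    using one_minus_cos_le[of x] one_minus_cos_le[of "sqrt 2 * x"] by (simp_all add: power_mult_distrib)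
  then have "wt x \<le> 3 * x\<^sup>2" unfolding wt_def by linarith
  then show ?thesis using sq_le_kf[OF True] kf_nonneg[of x] by linarith
next
  case False
  have "- 1 \<le> cos x" "- 1 \<le> cos (sqrt 2 * x)" by simp_all
  then have "wt x \<le> 8" unfolding wt_def by linarith
  then show ?thesis using abs_le_kf_of_ge_1[of x] False by linarith
qed

text \<open>Annihilates affine functions of t, hence the compensator in \<open>ek\<close>, and
  multiplies \<open>iexp (t * x)\<close> by a nonnegative weight. A Levy--Khintchine exponent thus
  becomes the Fourier transform of a finite measure.\<close>

definition second_diff :: "(real \<Rightarrow> complex) \<Rightarrow> real \<Rightarrow> complex" where
  "second_diff F t = (2 * F t - F (t + 1) - F (t - 1)) + (2 * F t - F (t + sqrt 2) - F (t - sqrt 2))"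

lemma second_diff_iexp: "second_diff (\<lambda>t. iexp (t * x)) t = wt x *\<^sub>R iexp (t * x)"
proof -
  have e: "iexp ((t + c) * x) + iexp ((t - c) * x) = of_real (2 * cos (c * x)) * iexp (t * x)" for c
  proof -
    have "iexp ((t + c) * x) = iexp (t * x) * iexp (c * x)" "iexp ((t - c) * x) = iexp (t * x) * exp (- (\<i> * of_real (c * x)))"
      by (simp_all add: algebra_simps flip: exp_add)
    then have "iexp ((t + c) * x) + iexp ((t - c) * x) =
        iexp (t * x) * (iexp (c * x) + exp (- (\<i> * of_real (c * x))))"
      by (simp only: distrib_left)
    also have "iexp (c * x) + exp (- (\<i> * of_real (c * x))) = 2 * cos (of_real (c * x))"
      by (simp add: cos_exp_eq)
    also have "\<dots> = of_real (2 * cos (c * x))" unfolding cos_of_real of_real_mult[of 2 "cos (c * x)"] of_real_numeral ..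
    finally show ?thesis by (simp only: mult.commute)
  qed
  have "second_diff (\<lambda>t. iexp (t * x)) t = 4 * iexp (t * x) - (iexp ((t + 1) * x) + iexp ((t - 1) * x))
      - (iexp ((t + sqrt 2) * x) + iexp ((t - sqrt 2) * x))"
    unfolding second_diff_def by (simp add: algebra_simps)
  also have "\<dots> = of_real (wt x) * iexp (t * x)"
    unfolding e by (simp only: wt_def of_real_diff left_diff_distrib of_real_numeral mult_1)
  finally show ?thesis by (simp add: scaleR_conv_of_real)
qed

lemma second_diff_affine: "second_diff (\<lambda>t. F t - 1 - \<i> * of_real (t * x)) t = second_diff F t"
  unfolding second_diff_def by (simp add: algebra_simps)

lemma second_diff_ek: "second_diff (\<lambda>t. ek (t * x)) t = wt x *\<^sub>R iexp (t * x)"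
  unfolding ek_def second_diff_affine second_diff_iexp ..

lemma second_diff_integral:
  assumes "\<And>t. integrable N (F t)"
  shows "second_diff (\<lambda>t. CLINT x|N. F t x) t = (CLINT x|N. second_diff (\<lambda>t. F t x) t)"
  unfolding second_diff_def using assms by simp

lemma second_diff_add: "second_diff (\<lambda>t. F t + G t) t = second_diff F t + second_diff G t"
  unfolding second_diff_def by (simp add: algebra_simps)

lemma second_diff_diff: "second_diff (\<lambda>t. F t - G t) t = second_diff F t - second_diff G t"
  unfolding second_diff_def by (simp add: algebra_simps)

lemma second_diff_tendsto:
  assumes "\<And>t. (\<lambda>k. F k t) \<longlonglongrightarrow> f t"
  shows "(\<lambda>k. second_diff (F k) t) \<longlonglongrightarrow> second_diff f t"
  unfolding second_diff_def by (intro tendsto_intros assms)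

text \<open>The steps 1 and \<open>sqrt 2\<close> contribute 2 and 4 times
  \<open>b\<^sup>2 / 2\<close>, which accounts for the factor 3.\<close>

lemma second_diff_square: "second_diff (\<lambda>t. - of_real (b\<^sup>2 * t\<^sup>2 / 2)) t = of_real (3 * b\<^sup>2)"
proof -
  have "second_diff (\<lambda>t. - of_real (b\<^sup>2 * t\<^sup>2 / 2)) t =
      of_real (- (b\<^sup>2 / 2) * ((2 * t\<^sup>2 - (t + 1)\<^sup>2 - (t - 1)\<^sup>2) + (2 * t\<^sup>2 - (t + sqrt 2)\<^sup>2 - (t - sqrt 2)\<^sup>2)))"
    unfolding second_diff_def of_real_mult of_real_add of_real_diff of_real_minus of_real_divide
    by (simp add: algebra_simps)
  also have "- (b\<^sup>2 / 2) * ((2 * t\<^sup>2 - (t + 1)\<^sup>2 - (t - 1)\<^sup>2) + (2 * t\<^sup>2 - (t + sqrt 2)\<^sup>2 - (t - sqrt 2)\<^sup>2)) = 3 * b\<^sup>2"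
    by (simp add: power2_sum power2_diff algebra_simps)
  finally show ?thesis .
qed

lemma second_diff_cexp:
  assumes jm: "jump_measure \<rho>"
  shows "second_diff (cexp b \<rho>) t = of_real (3 * b\<^sup>2) + (CLINT x|\<rho>. wt x *\<^sub>R iexp (t * x))"
proof -
  have "second_diff (cexp b \<rho>) t =
      second_diff (\<lambda>t. - of_real (b\<^sup>2 * t\<^sup>2 / 2)) t + second_diff (\<lambda>t. CLINT x|\<rho>. ek (t * x)) t"
    unfolding cexp_def[abs_def] by (rule second_diff_add)
  also have "second_diff (\<lambda>t. CLINT x|\<rho>. ek (t * x)) t = (CLINT x|\<rho>. wt x *\<^sub>R iexp (t * x))"
    unfolding second_diff_integral[OF integrable_ek[OF jm]] second_diff_ek ..
  finally show ?thesis unfolding second_diff_square .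
qed

text \<open>The atom at 0 absorbs the Gaussian part.\<close>

definition weighted :: "real \<Rightarrow> real measure \<Rightarrow> real measure" where
  "weighted c \<rho> = add_measure (density \<rho> (\<lambda>x. ennreal (wt x))) (density (return borel 0) (\<lambda>_. ennreal c))"

context
  fixes \<rho> :: "real measure" and c :: real
  assumes jm: "jump_measure \<rho>" and c: "0 \<le> c"
begin

lemma sets_weighted: "sets (weighted c \<rho>) = sets borel"
  using jump_measure_sets[OF jm] by (simp add: weighted_def)

lemma integrable_wt: "integrable \<rho> wt"
proof (rule Bochner_Integration.integrable_bound)
  show "integrable \<rho> (\<lambda>x. 16 * kf x)" using jm unfolding jump_measure_def by simp
  show "AE x in \<rho>. norm (wt x) \<le> norm (16 * kf x)" using wt_le by simp
qed (auto intro: jump_measurable[OF jm])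

lemma finite_density_wt: "finite_measure (density \<rho> (\<lambda>x. ennreal (wt x)))"
proof
  have "emeasure (density \<rho> (\<lambda>x. ennreal (wt x))) (space \<rho>) = (\<integral>\<^sup>+x. ennreal (wt x) \<partial>\<rho>)"
    by (subst emeasure_density) (auto intro!: nn_integral_cong jump_measurable[OF jm] measurable_compose[OF wt_measurable])
  also have "\<dots> = ennreal (LINT x|\<rho>. wt x)" by (rule nn_integral_eq_integral[OF integrable_wt]) simp
  finally show "emeasure (density \<rho> (\<lambda>x. ennreal (wt x))) (space (density \<rho> (\<lambda>x. ennreal (wt x)))) \<noteq> \<infinity>" by simp
qed

lemma finite_point: "finite_measure (density (return borel (0::real)) (\<lambda>_. ennreal c))"
  by (rule finite_measureI) (simp add: emeasure_density nn_integral_return)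

lemma finite_weighted: "finite_measure (weighted c \<rho>)"
  unfolding weighted_def
  by (rule finite_measure_add_measure[OF _ finite_density_wt finite_point])
     (simp add: jump_measure_sets[OF jm])

lemma weighted_iexp:
  "(CLINT x|weighted c \<rho>. iexp (t * x)) = of_real c + (CLINT x|\<rho>. wt x *\<^sub>R iexp (t * x))"
proof -
  have "(CLINT x|weighted c \<rho>. iexp (t * x)) = (CLINT x|density \<rho> (\<lambda>x. ennreal (wt x)). iexp (t * x)) +
      (CLINT x|density (return borel 0) (\<lambda>_. ennreal c). iexp (t * x))"
    unfolding weighted_def
    by (rule integral_add_measure_iexp[OF _ _ finite_density_wt finite_point])
       (simp_all add: jump_measure_sets[OF jm])
  also have "(CLINT x|density \<rho> (\<lambda>x. ennreal (wt x)). iexp (t * x)) = (CLINT x|\<rho>. wt x *\<^sub>R iexp (t * x))"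
    by (rule integral_density) (auto intro!: jump_measurable[OF jm])
  also have "(CLINT x|density (return borel 0) (\<lambda>_. ennreal c). iexp (t * x)) = (CLINT x|return borel 0. c *\<^sub>R iexp (t * x))"
    using c by (intro integral_density) auto
  also have "\<dots> = of_real c" by (subst integral_return) (auto simp: scaleR_conv_of_real)
  finally show ?thesis by simp
qed

text \<open>Functions vanishing at 0 do not see the atom placed there.\<close>

lemma weighted_nn_integral:
  assumes [measurable]: "f \<in> borel_measurable borel" and f0: "f 0 = 0"
  shows "(\<integral>\<^sup>+x. f x \<partial>weighted c \<rho>) = (\<integral>\<^sup>+x. ennreal (wt x) * f x \<partial>\<rho>)"
proof -
  have sd: "sets (density \<rho> (\<lambda>x. ennreal (wt x))) = sets borel" using jump_measure_sets[OF jm] by simp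
  have "(\<integral>\<^sup>+x. f x \<partial>weighted c \<rho>) = (\<integral>\<^sup>+x. f x \<partial>density \<rho> (\<lambda>x. ennreal (wt x))) +
      (\<integral>\<^sup>+x. f x \<partial>density (return borel 0) (\<lambda>_. ennreal c))"
  proof (rule nn_integral_add_measure)
    show "f \<in> borel_measurable (weighted c \<rho>)"
      unfolding measurable_cong_sets[OF sets_weighted refl] by measurable
    show "emeasure (weighted c \<rho>) S = emeasure (density \<rho> (\<lambda>x. ennreal (wt x))) S +
        emeasure (density (return borel 0) (\<lambda>_. ennreal c)) S" if "S \<in> sets (weighted c \<rho>)" for S
      unfolding weighted_def by (rule emeasure_add_measure) (use that sd sets_weighted in auto)
  qed (use sd sets_weighted in auto)
  also have "(\<integral>\<^sup>+x. f x \<partial>density (return borel 0) (\<lambda>_. ennreal c)) = 0"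
    by (subst nn_integral_density) (auto simp: nn_integral_return f0)
  also have "(\<integral>\<^sup>+x. f x \<partial>density \<rho> (\<lambda>x. ennreal (wt x))) = (\<integral>\<^sup>+x. ennreal (wt x) * f x \<partial>\<rho>)"
    by (rule nn_integral_density) (auto intro!: jump_measurable[OF jm])
  finally show ?thesis by simp
qed

end

lemma jump_measure_scaled:
  assumes jm: "jump_measure \<rho>" and q: "1 < q"
  shows "jump_measure (distr \<rho> borel (\<lambda>x. x / q))"
  unfolding jump_measure_def
proof (intro conjI)
  have m: "(\<lambda>x. x / q) \<in> borel_measurable \<rho>" by (rule jump_measurable[OF jm]) simp
  have "(\<lambda>x. x / q) -` {0} \<inter> space \<rho> = {0}"
    using q sets_eq_imp_space_eq[OF jump_measure_sets[OF jm]] by auto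
  then show "emeasure (distr \<rho> borel (\<lambda>x. x / q)) {0} = 0"
    using jm by (subst emeasure_distr[OF m]) (auto simp: jump_measure_def)
  show "integrable (distr \<rho> borel (\<lambda>x. x / q)) kf"
    using integrable_kf_scale[OF jm, of "1 / q"] by (subst integrable_distr_eq[OF m]) auto
qed simp

lemma cexp_scaled:
  assumes jm: "jump_measure \<rho>"
  shows "cexp (b / q) (distr \<rho> borel (\<lambda>x. x / q)) t = cexp b \<rho> (t / q)"
proof -
  have "(CLINT x|distr \<rho> borel (\<lambda>x. x / q). ek (t * x)) = (CLINT x|\<rho>. ek (t / q * x))"
    by (subst integral_distr) (auto intro: jump_measurable[OF jm])
  then show ?thesis by (simp add: cexp_def power_divide)
qed

text \<open>Second differences of \<open>r k *\<^sub>R (char (\<xi> k) t - 1)\<close> are Fourier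
  transforms of nonnegative measures with density \<open>r k * wt x\<close> relative to
  \<open>\<xi> k\<close>. In the limit these fill the gap between the weighted versions of the image
  measure and of \<open>\<rho>\<close>, so \<open>difference_measure\<close> applies, and dividing
  by \<open>wt\<close> yields \<open>\<rho>'\<close>.\<close>

lemma splits_of_char_limit:
  fixes \<xi> :: "nat \<Rightarrow> real measure" and r :: "nat \<Rightarrow> real"
  assumes jm: "jump_measure \<rho>" and q: "1 < q" and \<xi>: "\<And>k. real_distribution (\<xi> k)" and r: "\<And>k. 0 \<le> r k"
    and lim: "\<And>t. (\<lambda>k. r k *\<^sub>R (char (\<xi> k) t - 1)) \<longlonglongrightarrow> cexp b \<rho> t - cexp b \<rho> (t / q)"
  shows "\<exists>\<rho>'. splits \<rho> q \<rho>'"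
proof -
  define \<rho>q where "\<rho>q = distr \<rho> borel (\<lambda>x. x / q)"
  have jq: "jump_measure \<rho>q" unfolding \<rho>q_def by (rule jump_measure_scaled[OF jm q])
  \<comment> \<open>The extra unit at the origin occurs in both \<open>A\<close> and
    \<open>B\<close> and cancels; it ensures that \<open>B\<close> is not the zero measure. The
    factors 3 come from \<open>second_diff_square\<close>.\<close>
  define A where "A = weighted (3 * (b / q)\<^sup>2 + 1) \<rho>q"
  define B where "B = weighted (3 * b\<^sup>2 + 1) \<rho>"
  have cA: "0 \<le> 3 * (b / q)\<^sup>2 + 1" and cB: "0 \<le> 3 * b\<^sup>2 + 1" by simp_all
  define G where "G k = density (\<xi> k) (\<lambda>x. ennreal (r k * wt x))" for k
  have Am: "finite_measure A" "sets A = sets borel"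
    unfolding A_def by (rule finite_weighted[OF jq cA] sets_weighted[OF jq cA])+
  have Bm: "finite_measure B" "sets B = sets borel"
    unfolding B_def by (rule finite_weighted[OF jm cB] sets_weighted[OF jm cB])+
  have \<xi>s: "sets (\<xi> k) = sets borel" for k
  proof -
    interpret real_distribution "\<xi> k" by (rule \<xi>)
    show ?thesis by simp
  qed
  have wm: "wt \<in> borel_measurable (\<xi> k)" for k
    unfolding measurable_cong_sets[OF \<xi>s refl] by measurable
  have Gs: "sets (G k) = sets borel" for k using \<xi>s by (simp add: G_def)
  have Gf: "finite_measure (G k)" for k
  proof
    interpret real_distribution "\<xi> k" by (rule \<xi>)
    have "emeasure (G k) (space (G k)) = (\<integral>\<^sup>+x. ennreal (r k * wt x) \<partial>\<xi> k)"
      unfolding G_def using wm[of k] by (subst emeasure_density) (auto intro!: nn_integral_cong)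
    also have "\<dots> \<le> (\<integral>\<^sup>+x. ennreal (r k * 8) \<partial>\<xi> k)"
    proof (intro nn_integral_mono ennreal_leI mult_left_mono r)
      fix x
      have "- 1 \<le> cos x" "- 1 \<le> cos (sqrt 2 * x)" by simp_all
      then show "wt x \<le> 8" unfolding wt_def by linarith
    qed
    also have "\<dots> = ennreal (r k * 8)" using emeasure_space_1 by simp
    also have "\<dots> < \<infinity>" by simp
    finally show "emeasure (G k) (space (G k)) \<noteq> \<infinity>" by simp
  qed
  have Gc: "(CLINT x|G k. iexp (t * x)) = second_diff (\<lambda>t. r k *\<^sub>R (char (\<xi> k) t - 1)) t" for k t
  proof -
    interpret real_distribution "\<xi> k" by (rule \<xi>)
    have i: "integrable (\<xi> k) (\<lambda>x. iexp (t * x))" for t by (rule integrable_iexp) simp_all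
    have "second_diff (\<lambda>t. r k *\<^sub>R (char (\<xi> k) t - 1)) t = r k *\<^sub>R second_diff (\<lambda>t. CLINT x|\<xi> k. iexp (t * x)) t"
      unfolding second_diff_def char_def by (simp add: scaleR_diff_right scaleR_add_right algebra_simps scaleR_conv_of_real)
    also have "\<dots> = r k *\<^sub>R (CLINT x|\<xi> k. wt x *\<^sub>R iexp (t * x))"
      unfolding second_diff_integral[OF i] second_diff_iexp ..
    also have "\<dots> = (CLINT x|\<xi> k. (r k * wt x) *\<^sub>R iexp (t * x))"
      unfolding integral_scaleR_right[symmetric] scaleR_scaleR ..
    also have "\<dots> = (CLINT x|G k. iexp (t * x))"
      unfolding G_def using wm[of k] r by (intro integral_density[symmetric]) auto
    finally show ?thesis by simp
  qed
  have lim': "(\<lambda>k. (CLINT x|A. iexp (t * x)) + (CLINT x|G k. iexp (t * x))) \<longlonglongrightarrow> (CLINT x|B. iexp (t * x))" for t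
  proof -
    have A_eq: "(CLINT x|A. iexp (t * x)) = 1 + second_diff (\<lambda>t. cexp b \<rho> (t / q)) t"
    proof -
      have "(\<lambda>t. cexp b \<rho> (t / q)) = cexp (b / q) \<rho>q" unfolding \<rho>q_def cexp_scaled[OF jm] ..
      then show ?thesis unfolding A_def weighted_iexp[OF jq cA] by (simp add: second_diff_cexp[OF jq])
    qed
    have B_eq: "(CLINT x|B. iexp (t * x)) = 1 + second_diff (cexp b \<rho>) t"
      unfolding B_def weighted_iexp[OF jm cB] by (simp add: second_diff_cexp[OF jm])
    have "(\<lambda>k. second_diff (\<lambda>t. r k *\<^sub>R (char (\<xi> k) t - 1)) t) \<longlonglongrightarrow> second_diff (\<lambda>t. cexp b \<rho> t - cexp b \<rho> (t / q)) t"
      by (rule second_diff_tendsto[OF lim])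
    then have "(\<lambda>k. (1 + second_diff (\<lambda>t. cexp b \<rho> (t / q)) t) + second_diff (\<lambda>t. r k *\<^sub>R (char (\<xi> k) t - 1)) t) \<longlonglongrightarrow>
        (1 + second_diff (\<lambda>t. cexp b \<rho> (t / q)) t) + second_diff (\<lambda>t. cexp b \<rho> t - cexp b \<rho> (t / q)) t"
      by (intro tendsto_add tendsto_const)
    then show ?thesis unfolding A_eq B_eq Gc second_diff_diff by simp
  qed
  have pos: "0 < measure B UNIV"
  proof -
    have "complex_of_real (measure B UNIV) = of_real (3 * b\<^sup>2 + 1) + (CLINT x|\<rho>. wt x *\<^sub>R iexp (0 * x))"
      using integral_iexp_0[OF Bm(2,1)] weighted_iexp[OF jm cB, of 0] by (simp add: B_def)
    also have "(CLINT x|\<rho>. wt x *\<^sub>R iexp (0 * x)) = of_real (LINT x|\<rho>. wt x)"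
      by (simp add: scaleR_conv_of_real)
    finally have "complex_of_real (measure B UNIV) = of_real (3 * b\<^sup>2 + 1 + (LINT x|\<rho>. wt x))" by simp
    then have "measure B UNIV = 3 * b\<^sup>2 + 1 + (LINT x|\<rho>. wt x)" by (simp only: of_real_eq_iff)
    moreover have "0 \<le> (LINT x|\<rho>. wt x)" by simp
    moreover have "0 \<le> b\<^sup>2" by simp
    ultimately show ?thesis by linarith
  qed
  from difference_measure[OF Am Bm Gf Gs pos lim'] obtain C where C: "sets C = sets borel"
    and BC: "\<And>S. S \<in> sets borel \<Longrightarrow> emeasure B S = emeasure C S + emeasure A S" by blast
  \<comment> \<open>Undoes the weight off the origin. The value 0 at the origin discards the atom
    there, which carries the Gaussian parts and the extra unit.\<close>
  define u where "u x = (if x = 0 then 0 else ennreal (1 / wt x))" for x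
  have u_m [measurable]: "u \<in> borel_measurable borel" unfolding u_def by measurable
  define \<rho>' where "\<rho>' = density C u"
  have s': "sets \<rho>' = sets borel" by (simp add: \<rho>'_def C)
  have sq: "sets \<rho>q = sets borel" by (rule jump_measure_sets[OF jq])
  have recover: "(\<integral>\<^sup>+x. u x * indicator S x \<partial>weighted c \<sigma>) = emeasure \<sigma> S"
    if j: "jump_measure \<sigma>" and c: "0 \<le> c" and S [measurable]: "S \<in> sets borel" for c \<sigma> S
  proof -
    have "(\<integral>\<^sup>+x. u x * indicator S x \<partial>weighted c \<sigma>) = (\<integral>\<^sup>+x. ennreal (wt x) * (u x * indicator S x) \<partial>\<sigma>)"
      by (rule weighted_nn_integral[OF j c]) (measurable, simp add: u_def)
    also have "\<dots> = (\<integral>\<^sup>+x. indicator S x \<partial>\<sigma>)"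
    proof (rule nn_integral_cong_AE)
      have "AE x in \<sigma>. x \<noteq> 0"
        using j jump_measure_sets[OF j] by (intro AE_I[of _ _ "{0}"]) (auto simp: jump_measure_def)
      then show "AE x in \<sigma>. ennreal (wt x) * (u x * indicator S x) = indicator S x"
      proof eventually_elim
        case (elim x)
        have "ennreal (wt x) * ennreal (1 / wt x) = ennreal (wt x * (1 / wt x))"
          by (rule ennreal_mult[symmetric]) auto
        also have "wt x * (1 / wt x) = 1" using wt_pos[OF elim] by simp
        finally show ?case using elim by (simp add: u_def mult.assoc[symmetric])
      qed
    qed
    also have "\<dots> = emeasure \<sigma> S" using jump_measure_sets[OF j] by simp
    finally show ?thesis .
  qed
  have split: "emeasure \<rho> S = emeasure \<rho>' S + emeasure \<rho>q S" if S [measurable]: "S \<in> sets borel" for S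
  proof -
    have "emeasure \<rho> S = (\<integral>\<^sup>+x. u x * indicator S x \<partial>B)" unfolding B_def by (rule recover[OF jm cB S, symmetric])
    also have "\<dots> = (\<integral>\<^sup>+x. u x * indicator S x \<partial>C) + (\<integral>\<^sup>+x. u x * indicator S x \<partial>A)"
    proof (rule nn_integral_add_measure)
      show "sets C = sets B" "sets A = sets B" using C Am Bm by simp_all
      show "emeasure B T = emeasure C T + emeasure A T" if "T \<in> sets B" for T using BC that Bm by simp
      show "(\<lambda>x. u x * indicator S x) \<in> borel_measurable B"
        unfolding measurable_cong_sets[OF Bm(2) refl] by measurable
    qed
    also have "(\<integral>\<^sup>+x. u x * indicator S x \<partial>A) = emeasure \<rho>q S" unfolding A_def by (rule recover[OF jq cA S])
    also have "(\<integral>\<^sup>+x. u x * indicator S x \<partial>C) = emeasure \<rho>' S"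
    proof -
      have "u \<in> borel_measurable C" unfolding measurable_cong_sets[OF C refl] by measurable
      then show ?thesis unfolding \<rho>'_def using C by (intro emeasure_density[symmetric]) auto
    qed
    finally show ?thesis .
  qed
  have "jump_measure \<rho>'"
    unfolding jump_measure_def
  proof (intro conjI s')
    have "emeasure \<rho> {0} = 0" using jm unfolding jump_measure_def by blast
    then show "emeasure \<rho>' {0} = 0" using split[of "{0}"] by simp
    show "integrable \<rho>' kf"
    proof (rule integral_add_measure_real(1)[of \<rho>' \<rho> \<rho>q])
      show "emeasure \<rho> S = emeasure \<rho>' S + emeasure \<rho>q S" if "S \<in> sets \<rho>" for S
        using split that jump_measure_sets[OF jm] by blast
      show "integrable \<rho> kf" using jm unfolding jump_measure_def by blast
    qed (use s' sq jump_measure_sets[OF jm] in simp_all)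
  qed
  then show ?thesis unfolding splits_def using split by (auto simp: \<rho>q_def)
qed

section \<open>Rich families of kernels\<close>

text \<open>The quotient of both sides is continuous on the line with values among the nth roots of
  unity, hence constant, and it is 1 at t = 0.\<close>

lemma continuous_root_of_exp:
  fixes \<phi> a :: "real \<Rightarrow> complex"
  assumes \<phi>: "continuous_on UNIV \<phi>" "\<phi> 0 = 1" and a: "continuous_on UNIV a" "a 0 = 0"
    and n: "0 < n" and pow: "\<And>t. \<phi> t ^ n = exp (a t)"
  shows "\<phi> t = exp (a t / of_nat n)"
proof -
  define w where "w t = \<phi> t * exp (- (a t / of_nat n))" for t
  have w1: "w t ^ n = 1" for t
  proof -
    have "exp (- (a t / of_nat n)) ^ n = exp (- a t)" using n by (simp flip: exp_of_nat_mult)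
    then show ?thesis unfolding w_def power_mult_distrib pow by (simp flip: exp_add)
  qed
  have "finite (w ` UNIV)"
  proof (rule finite_subset)
    show "w ` UNIV \<subseteq> {z. z ^ n = 1}" using w1 by auto
    show "finite {z :: complex. z ^ n = 1}" by (rule finite_roots_unity) (use n in simp)
  qed
  moreover have "continuous_on UNIV w" unfolding w_def using n by (intro continuous_intros \<phi> a) auto
  ultimately have "w constant_on UNIV" by (intro continuous_finite_range_constant connected_UNIV)
  then have "w t = w 0" by (auto simp: constant_on_def)
  also have "w 0 = 1" using \<phi> a by (simp add: w_def)
  finally have "\<phi> t * exp (- (a t / of_nat n)) * exp (a t / of_nat n) = exp (a t / of_nat n)" by (simp add: w_def)
  then show ?thesis by (simp add: mult.assoc flip: exp_add)
qed

lemma real_law_of_fd_prob: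
  assumes \<eta>: "fd_prob J \<eta>"
  shows "real_distribution (distr \<eta> borel (\<lambda>x. \<Sum>j\<in>J. \<theta> j * x j))"
    and "char (distr \<eta> borel (\<lambda>x. \<Sum>j\<in>J. \<theta> j * x j)) t = fd_char J \<eta> (\<lambda>j. t * \<theta> j)"
proof -
  have s: "sets \<eta> = sets (PiM J (\<lambda>_. borel))" and p: "prob_space \<eta>" using \<eta> by (simp_all add: fd_prob_def)
  have m: "(\<lambda>x. \<Sum>j\<in>J. \<theta> j * x j) \<in> borel_measurable \<eta>"
    unfolding measurable_cong_sets[OF s refl] by measurable
  show "real_distribution (distr \<eta> borel (\<lambda>x. \<Sum>j\<in>J. \<theta> j * x j))"
    unfolding real_distribution_def real_distribution_axioms_def
    using prob_space.prob_space_distr[OF p m] by simp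
  have "(\<lambda>x. iexp (t * x)) \<in> borel_measurable borel" by measurable
  then have "char (distr \<eta> borel (\<lambda>x. \<Sum>j\<in>J. \<theta> j * x j)) t = (CLINT x|\<eta>. iexp (t * (\<Sum>j\<in>J. \<theta> j * x j)))"
    unfolding char_def by (rule integral_distr[OF m])
  then show "char (distr \<eta> borel (\<lambda>x. \<Sum>j\<in>J. \<theta> j * x j)) t = fd_char J \<eta> (\<lambda>j. t * \<theta> j)"
    by (simp add: fd_char_def sum_distrib_left mult.assoc)
qed

text \<open>Infinite divisibility is used along a single direction: the multivariate root is
  projected onto \<open>\<theta>\<close>, and continuity in t selects the branch of the nth root of
  its characteristic function.\<close>

lemma real_root_of_fd_inf_div:
  assumes \<eta>: "fd_inf_div J \<eta>" and n: "0 < (n::nat)" and a: "continuous_on UNIV a" "a 0 = 0"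
    and char: "\<And>t. fd_char J \<eta> (\<lambda>j. t * \<theta> j) = exp (a t)"
  shows "\<exists>\<xi>. real_distribution \<xi> \<and> (\<forall>t. char \<xi> t = exp (a t / of_nat n))"
proof -
  from \<eta> n obtain \<zeta> where \<zeta>: "fd_prob J \<zeta>" and pow: "\<And>\<theta>. fd_char J \<eta> \<theta> = fd_char J \<zeta> \<theta> ^ n"
    unfolding fd_inf_div_def by blast
  define \<xi> where "\<xi> = distr \<zeta> borel (\<lambda>x. \<Sum>j\<in>J. \<theta> j * x j)"
  note \<xi> = real_law_of_fd_prob[OF \<zeta>, of \<theta>, folded \<xi>_def]
  interpret real_distribution \<xi> by (rule \<xi>(1))
  have "char \<xi> t = exp (a t / of_nat n)" for t
  proof (rule continuous_root_of_exp[OF _ _ a n])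
    show "continuous_on UNIV (char \<xi>)"
      by (intro continuous_at_imp_continuous_on ballI isCont_char)
    show "char \<xi> 0 = 1" by (rule char_zero)
    show "char \<xi> t ^ n = exp (a t)" for t unfolding \<xi>(2) pow[symmetric] char ..
  qed
  then show ?thesis using \<xi>(1) by blast
qed

context
  fixes \<rho> :: "real measure" and b :: real
  assumes jm: "jump_measure \<rho>"
begin

lemmas [measurable] = KK_measurable[OF jm] cexp_measurable[OF jm]

lemma modular_scale_le_1:
  assumes [measurable]: "f \<in> borel_measurable borel" and c: "\<bar>c\<bar> \<le> 1"
  shows "modular b \<rho> (\<lambda>s. c * f s) \<le> ennreal \<bar>c\<bar> * modular b \<rho> f"
proof -
  have "modular b \<rho> (\<lambda>s. c * f s) \<le> (\<integral>\<^sup>+s. ennreal \<bar>c\<bar> * ennreal (KK b \<rho> (f s)) \<partial>lborel)"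
    unfolding modular_def using KK_scale_le_1[OF jm c] KK_nonneg[OF jm]
    by (intro nn_integral_mono) (auto simp flip: ennreal_mult intro!: ennreal_leI)
  also have "\<dots> = ennreal \<bar>c\<bar> * modular b \<rho> f"
    unfolding modular_def by (rule nn_integral_cmult) auto
  finally show ?thesis .
qed

lemma modular_scale_tendsto_0:
  assumes h: "h \<in> borel_measurable borel" and fin: "modular b \<rho> h < \<infinity>" and c: "(c \<longlongrightarrow> 0) F"
  shows "((\<lambda>n. modular b \<rho> (\<lambda>s. c n * h s)) \<longlongrightarrow> 0) F"
proof (rule tendsto_sandwich[of "\<lambda>_. 0" _ F "\<lambda>n. ennreal \<bar>c n\<bar> * modular b \<rho> h"])
  obtain K where K: "modular b \<rho> h = ennreal K" "0 \<le> K" using fin by (cases "modular b \<rho> h") auto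
  have "((\<lambda>n. ennreal (\<bar>c n\<bar> * K)) \<longlongrightarrow> ennreal (\<bar>0\<bar> * K)) F"
    by (intro tendsto_intros tendsto_ennrealI c)
  then show "((\<lambda>n. ennreal \<bar>c n\<bar> * modular b \<rho> h) \<longlongrightarrow> 0) F" by (simp add: K ennreal_mult)
  have "\<forall>\<^sub>F n in F. \<bar>c n\<bar> < 1" using order_tendstoD(2)[OF tendsto_rabs[OF c], of 1] by simp
  then show "\<forall>\<^sub>F n in F. modular b \<rho> (\<lambda>s. c n * h s) \<le> ennreal \<bar>c n\<bar> * modular b \<rho> h"
    by eventually_elim (rule modular_scale_le_1[OF h], simp)
qed simp_all

lemma continuous_expo_scale:
  assumes h [measurable]: "h \<in> borel_measurable borel" and fin: "modular b \<rho> h < \<infinity>"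
  shows "continuous_on UNIV (\<lambda>t. expo b \<rho> (\<lambda>s. t * h s))"
  unfolding continuous_on_def
proof
  fix t :: real
  have "((\<lambda>u. u - t) \<longlongrightarrow> t - t) (at t)" by (intro tendsto_intros)
  then have "((\<lambda>u. u - t) \<longlongrightarrow> 0) (at t)" by simp
  from modular_scale_tendsto_0[OF h fin this]
  have "((\<lambda>u. modular b \<rho> (\<lambda>s. u * h s - t * h s)) \<longlongrightarrow> 0) (at t)"
    by (simp add: left_diff_distrib)
  then show "((\<lambda>t. expo b \<rho> (\<lambda>s. t * h s)) \<longlongrightarrow> expo b \<rho> (\<lambda>s. t * h s)) (at t within UNIV)"
    by (intro expo_tendsto[OF jm] modular_scale_finite[OF jm h fin]) auto
qed

lemma expo_indicator:
  assumes B: "B \<in> bdd_borel"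
  shows "expo b \<rho> (\<lambda>s. t * indicator B s) = measure lborel B *\<^sub>R cexp b \<rho> t"
proof -
  have "expo b \<rho> (\<lambda>s. t * indicator B s) = (CLINT s|lborel. indicator B s *\<^sub>R cexp b \<rho> t)"
    unfolding expo_def using cexp_0[OF jm, of b] by (intro Bochner_Integration.integral_cong) (auto simp: indicator_def)
  then show ?thesis using bdd_borel_sets[OF B] bdd_borel_finite[OF B] by simp
qed

lemma modular_indicator:
  assumes B: "B \<in> bdd_borel"
  shows "modular b \<rho> (\<lambda>s. t * indicator B s) = ennreal (KK b \<rho> t * measure lborel B)"
proof -
  have "modular b \<rho> (\<lambda>s. t * indicator B s) = (\<integral>\<^sup>+s. ennreal (KK b \<rho> t) * indicator B s \<partial>lborel)"
    unfolding modular_def using KK_0[OF jm, of b] by (intro nn_integral_cong) (auto simp: indicator_def)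
  also have "\<dots> = ennreal (KK b \<rho> t) * emeasure lborel B"
    using bdd_borel_sets[OF B] by (intro nn_integral_cmult_indicator) simp
  also have "emeasure lborel B = ennreal (measure lborel B)"
    using bdd_borel_finite[OF B] by (simp add: emeasure_eq_ennreal_measure)
  finally show ?thesis using KK_nonneg[OF jm] by (simp add: ennreal_mult)
qed

text \<open>Both error terms carry the volume as a factor, so after division by it the error depends
  only on the relative closeness \<open>\<delta>\<close>, on t and on the free
  \<open>e\<close>.\<close>

lemma expo_near_indicator:
  assumes B: "B \<in> bdd_borel" and V: "0 < measure lborel B" and h [measurable]: "h \<in> borel_measurable borel"
    and near: "modular b \<rho> (\<lambda>s. h s - indicator B s) \<le> ennreal (\<delta> * measure lborel B)"
    and d: "0 \<le> \<delta>" and e: "0 < e" "e \<le> 1"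
  shows "norm (expo b \<rho> (\<lambda>s. t * h s) - measure lborel B *\<^sub>R cexp b \<rho> t) \<le>
    (4 * e * KK b \<rho> t + 9 / e * (max 1 (t\<^sup>2) * \<delta>)) * measure lborel B"
proof -
  define V where "V = measure lborel B"
  have V0: "0 < V" using V by (simp add: V_def)
  have Bs [measurable]: "B \<in> sets borel" by (rule bdd_borel_sets[OF B])
  have 1: "modular b \<rho> (\<lambda>s. t * indicator B s) = ennreal (KK b \<rho> t * V)"
    unfolding V_def by (rule modular_indicator[OF B])
  have "modular b \<rho> (\<lambda>s. t * (h s - indicator B s)) \<le> ennreal (max 1 (t\<^sup>2)) * ennreal (\<delta> * V)"
  proof (rule order_trans)
    show "modular b \<rho> (\<lambda>s. t * (h s - indicator B s)) \<le> ennreal (max 1 (t\<^sup>2)) * modular b \<rho> (\<lambda>s. h s - indicator B s)"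
      by (rule modular_scale[OF jm]) measurable
    show "ennreal (max 1 (t\<^sup>2)) * modular b \<rho> (\<lambda>s. h s - indicator B s) \<le> ennreal (max 1 (t\<^sup>2)) * ennreal (\<delta> * V)"
      by (rule mult_left_mono) (use near in \<open>simp_all add: V_def\<close>)
  qed
  also have "\<dots> = ennreal (max 1 (t\<^sup>2) * (\<delta> * V))" by (rule ennreal_mult[symmetric]) (use d V0 in auto)
  finally have 2: "modular b \<rho> (\<lambda>s. t * h s - t * indicator B s) \<le> ennreal (max 1 (t\<^sup>2) * (\<delta> * V))"
    by (simp add: right_diff_distrib)
  then have 3: "enn2real (modular b \<rho> (\<lambda>s. t * h s - t * indicator B s)) \<le> max 1 (t\<^sup>2) * (\<delta> * V)"
    using d V0 by (intro enn2real_leI) auto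
  have "norm (expo b \<rho> (\<lambda>s. t * h s) - expo b \<rho> (\<lambda>s. t * indicator B s)) \<le>
      4 * e * enn2real (modular b \<rho> (\<lambda>s. t * indicator B s)) +
      9 / e * enn2real (modular b \<rho> (\<lambda>s. t * h s - t * indicator B s))"
  proof (rule norm_expo_diff[OF jm _ _ _ _ e])
    show "modular b \<rho> (\<lambda>s. t * indicator B s) < \<infinity>" unfolding 1 by simp
    show "modular b \<rho> (\<lambda>s. t * h s - t * indicator B s) < \<infinity>" using 2 by (rule order.strict_trans1) simp
  qed measurable
  also have "\<dots> \<le> 4 * e * (KK b \<rho> t * V) + 9 / e * (max 1 (t\<^sup>2) * (\<delta> * V))"
    unfolding 1 using e 3 KK_nonneg[OF jm, of b t] V0 by (intro add_mono mult_left_mono) auto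
  finally show ?thesis unfolding expo_indicator[OF B] V_def[symmetric] by (simp only: distrib_right mult.assoc)
qed

end

text \<open>Relative closeness to indicators is the property of a family of kernels that lets the
  finite-dimensional laws of the field determine the Levy measure.\<close>

definition rich :: "real \<Rightarrow> real measure \<Rightarrow> 'i set \<Rightarrow> ('i \<Rightarrow> 'd::euclidean_space \<Rightarrow> real) \<Rightarrow> bool" where
  "rich b \<rho> I f \<longleftrightarrow> (\<forall>e>0. \<exists>J \<theta> B. finite J \<and> J \<subseteq> I \<and> B \<in> bdd_borel \<and> 0 < measure lborel B \<and>
     modular b \<rho> (\<lambda>s. (\<Sum>j\<in>J. \<theta> j * f j s) - indicator B s) \<le> ennreal (e * measure lborel B))"

text \<open>For a combination \<open>h\<close> close to the indicator of a set of volume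
  \<open>V\<close>, the cofactor of the law of the same combination of the field has an exponent
  close to \<open>V\<close> times \<open>w\<close>. Its nth root has exponent about V w / n, so
  rescaling by n / V, and letting n / V tend to infinity, recovers \<open>w\<close> from
  characteristic functions as \<open>splits_of_char_limit\<close> demands.\<close>

lemma splits_of_rich:
  fixes f :: "'i \<Rightarrow> 'd::euclidean_space \<Rightarrow> real"
  assumes jm: "jump_measure \<rho>" and q: "1 < q"
    and f: "\<And>j. j \<in> I \<Longrightarrow> f j \<in> borel_measurable borel" and fin: "\<And>j. j \<in> I \<Longrightarrow> modular b \<rho> (f j) < \<infinity>"
    and rich: "rich b \<rho> I f"
    and U: "\<And>J. finite J \<Longrightarrow> J \<subseteq> I \<Longrightarrow>
      \<exists>\<nu> \<eta>. (\<forall>\<theta>. fd_char J \<nu> \<theta> = exp (expo b \<rho> (\<lambda>s. \<Sum>j\<in>J. \<theta> j * f j s))) \<and> fd_inf_div J \<eta> \<and> fd_factor J \<nu> q \<eta>"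
  shows "\<exists>\<rho>'. splits \<rho> q \<rho>'"
proof -
  define w where "w t = cexp b \<rho> t - cexp b \<rho> (t / q)" for t
  define D where "D t = 4 * KK b \<rho> t + 9 * max 1 (t\<^sup>2)" for t
  define P where "P k \<xi> r z \<longleftrightarrow> real_distribution \<xi> \<and> real (Suc k) \<le> r \<and> (\<forall>t. char \<xi> t = exp (z t)) \<and>
    (\<forall>t. norm (r *\<^sub>R z t - w t) \<le> (D t + D (t / q)) * (1 / sqrt (real (Suc k))))" for k \<xi> r and z :: "real \<Rightarrow> complex"
  have "\<exists>\<xi> r z. P k \<xi> r z" for k
  proof -
    define K where "K = real (Suc k)"
    have K: "1 \<le> K" by (simp add: K_def)
    then have "0 < 1 / K" by simp
    from rich[unfolded rich_def, rule_format, OF this] obtain J \<theta> B where J: "finite J" "J \<subseteq> I" and B: "B \<in> bdd_borel" and V: "0 < measure lborel B"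
      and near: "modular b \<rho> (\<lambda>s. (\<Sum>j\<in>J. \<theta> j * f j s) - indicator B s) \<le> ennreal (1 / K * measure lborel B)"
      by (elim exE conjE) (rule that)
    define h where "h s = (\<Sum>j\<in>J. \<theta> j * f j s)" for s
    have fJ: "f j \<in> borel_measurable borel" "modular b \<rho> (f j) < \<infinity>" if "j \<in> J" for j
      using f fin J that by blast+
    have h: "h \<in> borel_measurable borel" unfolding h_def using fJ(1) by measurable
    have hfin: "modular b \<rho> h < \<infinity>" unfolding h_def by (rule modular_sum_finite[OF jm J(1) fJ])
    define V where "V = measure lborel B"
    have V0: "0 < V" using \<open>0 < measure lborel B\<close> by (simp add: V_def)
    define a where "a t = expo b \<rho> (\<lambda>s. t * h s) - expo b \<rho> (\<lambda>s. t / q * h s)" for t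
    have a0: "a 0 = 0" by (simp add: a_def)
    \<comment> \<open>Continuity of the candidate exponent is what identifies the characteristic
      function of the root in \<open>real_root_of_fd_inf_div\<close>.\<close>
    have ac: "continuous_on UNIV a"
    proof -
      have c: "continuous_on UNIV (\<lambda>t. expo b \<rho> (\<lambda>s. t * h s))" by (rule continuous_expo_scale[OF jm h hfin])
      have "continuous_on UNIV (\<lambda>t. expo b \<rho> (\<lambda>s. (t / q) * h s))"
        by (rule continuous_on_compose2[OF c]) (use q in \<open>auto intro!: continuous_intros\<close>)
      then show ?thesis unfolding a_def by (intro continuous_on_diff c)
    qed
    from U[OF J] obtain \<nu> \<eta> where \<nu>: "\<And>\<theta>. fd_char J \<nu> \<theta> = exp (expo b \<rho> (\<lambda>s. \<Sum>j\<in>J. \<theta> j * f j s))"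
      and \<eta>: "fd_inf_div J \<eta>" "fd_factor J \<nu> q \<eta>" by blast
    have \<eta>c: "fd_char J \<eta> (\<lambda>j. t * \<theta> j) = exp (a t)" for t
    proof -
      have sums: "(\<Sum>j\<in>J. t * \<theta> j * f j s) = t * h s" "(\<Sum>j\<in>J. t * \<theta> j / q * f j s) = t / q * h s" for s t
        unfolding h_def sum_distrib_left by (simp_all add: mult.assoc)
      have "exp (expo b \<rho> (\<lambda>s. t * h s)) = exp (expo b \<rho> (\<lambda>s. t / q * h s)) * fd_char J \<eta> (\<lambda>j. t * \<theta> j)"
        using \<eta>(2)[unfolded fd_factor_def \<nu>, rule_format, of "\<lambda>j. t * \<theta> j"] unfolding sums .
      then show ?thesis unfolding a_def exp_diff by simp
    qed
    \<comment> \<open>Large relative to the volume: n / V is at least \<open>K\<close>, which makes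
      the exponents of the roots tend to 0.\<close>
    define n where "n = nat \<lceil>K * V\<rceil> + 1"
    have n: "0 < n" "K * V \<le> real n" unfolding n_def by linarith+
    from real_root_of_fd_inf_div[OF \<eta>(1) n(1) ac a0 \<eta>c] obtain \<xi> where \<xi>: "real_distribution \<xi>"
      and \<xi>c: "\<And>t. char \<xi> t = exp (a t / of_nat n)" by blast
    \<comment> \<open>Balances the two error terms, of sizes e and 1 / (e K), for relative closeness
      1 / K.\<close>
    define e where "e = 1 / sqrt K"
    have e: "0 < e" "e \<le> 1" using K by (simp_all add: e_def)
    have dist: "norm (expo b \<rho> (\<lambda>s. t * h s) - V *\<^sub>R cexp b \<rho> t) \<le> D t * e * V" for t
    proof -
      have "norm (expo b \<rho> (\<lambda>s. t * h s) - V *\<^sub>R cexp b \<rho> t) \<le>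
          (4 * e * KK b \<rho> t + 9 / e * (max 1 (t\<^sup>2) * (1 / K))) * V"
        unfolding V_def using K by (intro expo_near_indicator[OF jm B V h near[folded h_def] _ e]) simp
      also have "9 / e * (max 1 (t\<^sup>2) * (1 / K)) = 9 * max 1 (t\<^sup>2) * e"
      proof -
        have "1 / e * (1 / K) = e" using K real_sqrt_mult_self[of K] by (simp add: e_def field_simps)
        moreover have "9 / e * (max 1 (t\<^sup>2) * (1 / K)) = 9 * max 1 (t\<^sup>2) * (1 / e * (1 / K))"
          by (simp add: divide_inverse mult_ac)
        ultimately show ?thesis by simp
      qed
      finally show ?thesis by (simp add: D_def algebra_simps)
    qed
    have "norm ((real n / V) *\<^sub>R (a t / of_nat n) - w t) \<le> (D t + D (t / q)) * e" for t
    proof -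
      have "(real n / V) *\<^sub>R (a t / of_nat n) - w t = (1 / V) *\<^sub>R (a t - V *\<^sub>R w t)"
        using n(1) V0 by (simp add: scaleR_conv_of_real field_simps)
      also have "a t - V *\<^sub>R w t = (expo b \<rho> (\<lambda>s. t * h s) - V *\<^sub>R cexp b \<rho> t) -
          (expo b \<rho> (\<lambda>s. t / q * h s) - V *\<^sub>R cexp b \<rho> (t / q))"
        by (simp add: a_def w_def scaleR_diff_right)
      also have "norm ((1 / V) *\<^sub>R \<dots>) \<le> (1 / V) * (D t * e * V + D (t / q) * e * V)"
        unfolding norm_scaleR using V0
        by (intro mult_mono order_trans[OF norm_triangle_ineq4] add_mono dist) auto
      also have "\<dots> = (D t + D (t / q)) * e" using V0 by (simp add: field_simps)
      finally show ?thesis .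
    qed
    moreover have "K \<le> real n / V" using n(2) V0 by (simp add: field_simps)
    ultimately have "P k \<xi> (real n / V) (\<lambda>t. a t / of_nat n)"
      unfolding P_def using \<xi> \<xi>c unfolding e_def K_def by blast
    then show ?thesis by blast
  qed
  then obtain \<xi> r z where Pk: "\<And>k. P k (\<xi> k) (r k) (z k)" by metis
  have rd: "real_distribution (\<xi> k)" and r: "real (Suc k) \<le> r k" and z: "char (\<xi> k) t = exp (z k t)"
    and zw: "norm (r k *\<^sub>R z k t - w t) \<le> (D t + D (t / q)) * (1 / sqrt (real (Suc k)))" for k t
    using Pk[of k] unfolding P_def by blast+
  have rzw: "(\<lambda>k. r k *\<^sub>R z k t) \<longlonglongrightarrow> w t" for t
  proof (rule LIM_zero_cancel, rule Lim_null_comparison)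
    show "\<forall>\<^sub>F k in sequentially. norm (r k *\<^sub>R z k t - w t) \<le> (D t + D (t / q)) * (1 / sqrt (real (Suc k)))"
      using zw by simp
    have "(\<lambda>k. 1 / sqrt (real (Suc k))) \<longlonglongrightarrow> 0" by real_asymp
    then show "(\<lambda>k. (D t + D (t / q)) * (1 / sqrt (real (Suc k)))) \<longlonglongrightarrow> 0"
      by (rule tendsto_mult_right_zero)
  qed
  have r_inv: "(\<lambda>k. inverse (r k)) \<longlonglongrightarrow> 0"
  proof (rule Lim_null_comparison)
    show "\<forall>\<^sub>F k in sequentially. norm (inverse (r k)) \<le> inverse (real (Suc k))"
    proof (intro always_eventually allI)
      fix k
      have "inverse (r k) \<le> inverse (real (Suc k))" by (rule le_imp_inverse_le[OF r]) simp
      moreover have "0 \<le> inverse (r k)" using r[of k] by simp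
      ultimately show "norm (inverse (r k)) \<le> inverse (real (Suc k))" by simp
    qed
  qed (rule LIMSEQ_inverse_real_of_nat)
  have z0: "(\<lambda>k. z k t) \<longlonglongrightarrow> 0" for t
  proof -
    have "(\<lambda>k. inverse (r k) *\<^sub>R (r k *\<^sub>R z k t)) \<longlonglongrightarrow> 0 *\<^sub>R w t" by (intro tendsto_scaleR r_inv rzw)
    moreover have "inverse (r k) *\<^sub>R (r k *\<^sub>R z k t) = z k t" for k using r[of k] by simp
    ultimately show ?thesis by simp
  qed
  show ?thesis
  proof (rule splits_of_char_limit[OF jm q rd])
    show "0 \<le> r k" for k using r[of k] by simp
    show "(\<lambda>k. r k *\<^sub>R (char (\<xi> k) t - 1)) \<longlonglongrightarrow> cexp b \<rho> t - cexp b \<rho> (t / q)" for t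
      unfolding z by (rule tendsto_scaled_exp_minus_1[OF rzw[unfolded w_def] z0])
  qed
qed

text \<open>Exponentials have no zeros, so a cofactor supplied by \<open>urbanik\<close> must have
  the exponent given by \<open>\<rho>'\<close> and the same kernels. The modular of
  \<open>\<rho>'\<close> is no larger than that of \<open>\<rho>\<close>, whence the kernels stay
  rich and the induction applies to \<open>\<rho>'\<close>.\<close>

lemma decomp_class_of_urbanik:
  fixes f :: "'i \<Rightarrow> 'd::euclidean_space \<Rightarrow> real"
  assumes f: "\<And>j. j \<in> I \<Longrightarrow> f j \<in> borel_measurable borel"
    and "jump_measure \<rho>" "\<And>j. j \<in> I \<Longrightarrow> modular b \<rho> (f j) < \<infinity>" "rich b \<rho> I f"
    and "\<And>J. finite J \<Longrightarrow> J \<subseteq> I \<Longrightarrow>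
      \<exists>\<nu>. (\<forall>\<theta>. fd_char J \<nu> \<theta> = exp (expo b \<rho> (\<lambda>s. \<Sum>j\<in>J. \<theta> j * f j s))) \<and> urbanik m J \<nu>"
  shows "decomp_class m \<rho>"
  using assms(2-)
proof (induction m arbitrary: \<rho> b)
  case (0 \<rho> b)
  show ?case
    unfolding decomp_class.simps
  proof (intro allI impI)
    fix q :: real assume q: "1 < q"
    show "\<exists>\<rho>'. splits \<rho> q \<rho>'"
    proof (rule splits_of_rich[OF 0(1) q f 0(2,3)])
      fix J assume J: "finite J" "J \<subseteq> I"
      from 0(4)[OF J] obtain \<nu> where "\<forall>\<theta>. fd_char J \<nu> \<theta> = exp (expo b \<rho> (\<lambda>s. \<Sum>j\<in>J. \<theta> j * f j s))"
        "urbanik 0 J \<nu>" by blast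
      then show "\<exists>\<nu> \<eta>. (\<forall>\<theta>. fd_char J \<nu> \<theta> = exp (expo b \<rho> (\<lambda>s. \<Sum>j\<in>J. \<theta> j * f j s))) \<and>
          fd_inf_div J \<eta> \<and> fd_factor J \<nu> q \<eta>"
        using q unfolding urbanik.simps by blast
    qed
  qed
next
  case (Suc m \<rho> b)
  note jm = Suc.prems(1)
  have D0: "decomp_class 0 \<rho>"
    unfolding decomp_class.simps
  proof (intro allI impI)
    fix q :: real assume q: "1 < q"
    show "\<exists>\<rho>'. splits \<rho> q \<rho>'"
    proof (rule splits_of_rich[OF jm q f Suc.prems(2,3)])
      fix J assume J: "finite J" "J \<subseteq> I"
      from Suc.prems(4)[OF J] obtain \<nu> where "\<forall>\<theta>. fd_char J \<nu> \<theta> = exp (expo b \<rho> (\<lambda>s. \<Sum>j\<in>J. \<theta> j * f j s))"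
        "urbanik (Suc m) J \<nu>" by blast
      then show "\<exists>\<nu> \<eta>. (\<forall>\<theta>. fd_char J \<nu> \<theta> = exp (expo b \<rho> (\<lambda>s. \<Sum>j\<in>J. \<theta> j * f j s))) \<and>
          fd_inf_div J \<eta> \<and> fd_factor J \<nu> q \<eta>"
        using q unfolding urbanik.simps by blast
    qed
  qed
  have "\<exists>\<rho>'. decomp_class m \<rho>' \<and> splits \<rho> q \<rho>'" if q: "1 < q" for q
  proof -
    from D0 q obtain \<rho>' where sp: "splits \<rho> q \<rho>'" by auto
    have "decomp_class m \<rho>'"
    proof (rule Suc.IH[of \<rho>' "residual_gauss b q"])
      show "jump_measure \<rho>'" by (rule splits_jump[OF jm q sp])
      show "modular (residual_gauss b q) \<rho>' (f j) < \<infinity>" if "j \<in> I" for j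
        using splits_modular[OF jm q sp] Suc.prems(2)[OF that] by (rule order.strict_trans1)
      show "rich (residual_gauss b q) \<rho>' I f"
        unfolding rich_def
      proof (intro allI impI)
        fix e :: real assume "0 < e"
        from Suc.prems(3)[unfolded rich_def, rule_format, OF this] obtain J \<theta> B where J: "finite J" "J \<subseteq> I" "B \<in> bdd_borel" "0 < measure lborel B"
          and near: "modular b \<rho> (\<lambda>s. (\<Sum>j\<in>J. \<theta> j * f j s) - indicator B s) \<le> ennreal (e * measure lborel B)"
          by (elim exE conjE) (rule that)
        have "modular (residual_gauss b q) \<rho>' (\<lambda>s. (\<Sum>j\<in>J. \<theta> j * f j s) - indicator B s) \<le> ennreal (e * measure lborel B)"
          using splits_modular[OF jm q sp] near by (rule order_trans)
        then show "\<exists>J \<theta> B. finite J \<and> J \<subseteq> I \<and> B \<in> bdd_borel \<and> 0 < measure lborel B \<and>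
          modular (residual_gauss b q) \<rho>' (\<lambda>s. (\<Sum>j\<in>J. \<theta> j * f j s) - indicator B s) \<le> ennreal (e * measure lborel B)"
          using J by blast
      qed
      fix J assume J: "finite J" "J \<subseteq> I"
      have fJ: "f j \<in> borel_measurable borel" "modular b \<rho> (f j) < \<infinity>" if "j \<in> J" for j
        using f Suc.prems(2) J that by blast+
      from Suc.prems(4)[OF J] obtain \<nu> where \<nu>: "\<And>\<theta>. fd_char J \<nu> \<theta> = exp (expo b \<rho> (\<lambda>s. \<Sum>j\<in>J. \<theta> j * f j s))"
        and "urbanik (Suc m) J \<nu>" by blast
      then obtain \<eta> where \<eta>: "urbanik m J \<eta>" "fd_factor J \<nu> q \<eta>" using q unfolding urbanik.simps by blast
      have "fd_char J \<eta> \<theta> = exp (expo (residual_gauss b q) \<rho>' (\<lambda>s. \<Sum>j\<in>J. \<theta> j * f j s))" for \<theta>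
      proof -
        have m: "(\<lambda>s. \<Sum>j\<in>J. \<theta> j * f j s) \<in> borel_measurable borel" using fJ(1) by measurable
        have sE: "expo b \<rho> (\<lambda>s. \<Sum>j\<in>J. \<theta> j * f j s) = expo b \<rho> (\<lambda>s. (\<Sum>j\<in>J. \<theta> j * f j s) / q) +
            expo (residual_gauss b q) \<rho>' (\<lambda>s. \<Sum>j\<in>J. \<theta> j * f j s)"
          by (rule splits_expo[OF jm q sp m modular_sum_finite[OF jm J(1) fJ]])
        have sq: "(\<Sum>j\<in>J. \<theta> j / q * f j s) = (\<Sum>j\<in>J. \<theta> j * f j s) / q" for s
          by (simp add: sum_divide_distrib)
        have "exp (expo b \<rho> (\<lambda>s. (\<Sum>j\<in>J. \<theta> j * f j s) / q)) *
            exp (expo (residual_gauss b q) \<rho>' (\<lambda>s. \<Sum>j\<in>J. \<theta> j * f j s)) =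
            exp (expo b \<rho> (\<lambda>s. (\<Sum>j\<in>J. \<theta> j * f j s) / q)) * fd_char J \<eta> \<theta>"
          using \<eta>(2)[unfolded fd_factor_def \<nu>, rule_format, of \<theta>] unfolding sE sq exp_add .
        then show ?thesis by simp
      qed
      then show "\<exists>\<nu>. (\<forall>\<theta>. fd_char J \<nu> \<theta> = exp (expo (residual_gauss b q) \<rho>' (\<lambda>s. \<Sum>j\<in>J. \<theta> j * f j s))) \<and> urbanik m J \<nu>"
        using \<eta>(1) by blast
    qed
    then show ?thesis using sp by blast
  qed
  then show ?case using D0 unfolding decomp_class.simps by blast
qed

section \<open>Averaged translates of a kernel\<close>

lemma borel_measurable_shift_pair:
  fixes g :: "'d::euclidean_space \<Rightarrow> real"
  assumes s: "sets \<nu> = sets borel" and F: "F \<in> measurable borel borel" and g [measurable]: "g \<in> borel_measurable borel"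
  shows "(\<lambda>(u, s). g (F u - s)) \<in> borel_measurable (\<nu> \<Otimes>\<^sub>M borel)"
proof -
  have [measurable]: "F \<in> measurable \<nu> borel" unfolding measurable_cong_sets[OF s refl] by (rule F)
  show ?thesis by measurable
qed

text \<open>Convolution of \<open>\<nu>\<close> with the reflection of \<open>g\<close>. Where the
  integral does not exist it is 0 by convention; for finite \<open>\<nu>\<close> and integrable
  \<open>g\<close> this happens only on a null set, by \<open>AE_integrable_shift\<close>.\<close>

definition smear :: "'d::euclidean_space measure \<Rightarrow> ('d \<Rightarrow> real) \<Rightarrow> 'd \<Rightarrow> real" where
  "smear \<nu> g s = (LINT u|\<nu>. g (u - s))"

lemma lborel_reflect_pair:
  fixes g :: "'d::euclidean_space \<Rightarrow> real"
  assumes [measurable]: "g \<in> borel_measurable borel"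
  shows "(\<integral>\<^sup>+s. ennreal \<bar>g (u - s)\<bar> \<partial>lborel) = (\<integral>\<^sup>+s. ennreal \<bar>g s\<bar> \<partial>lborel)"
  by (rule lborel_reflect[of "\<lambda>s. ennreal \<bar>g s\<bar>"]) measurable

lemma AE_integrable_shift:
  fixes g :: "'d::euclidean_space \<Rightarrow> real"
  assumes \<nu>: "finite_measure \<nu>" and s: "sets \<nu> = sets borel" and g: "integrable lborel g"
  shows "AE s in lborel. integrable \<nu> (\<lambda>u. g (u - s))"
proof -
  interpret finite_measure \<nu> by fact
  interpret P: pair_sigma_finite lborel \<nu> ..
  have gm [measurable]: "g \<in> borel_measurable borel" using g by auto
  have m: "(\<lambda>(u, s). g (u - s)) \<in> borel_measurable (\<nu> \<Otimes>\<^sub>M lborel)"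
    by (intro measurable_pair_lborel borel_measurable_shift_pair s gm) simp
  have m': "(\<lambda>(s, u). g (u - s)) \<in> borel_measurable (lborel \<Otimes>\<^sub>M \<nu>)"
    using measurable_pair_swap[OF m] by (simp add: case_prod_beta')
  have m'': "(\<lambda>x. ennreal \<bar>g (snd x - fst x)\<bar>) \<in> borel_measurable (lborel \<Otimes>\<^sub>M \<nu>)"
    using m' by (simp add: case_prod_beta')
  have sec: "(\<lambda>u. g (u - s)) \<in> borel_measurable \<nu>" for s
    unfolding measurable_cong_sets[OF \<open>sets \<nu> = sets borel\<close> refl] by measurable
  have "(\<integral>\<^sup>+s. (\<integral>\<^sup>+u. ennreal \<bar>g (u - s)\<bar> \<partial>\<nu>) \<partial>lborel) = (\<integral>\<^sup>+u. (\<integral>\<^sup>+s. ennreal \<bar>g (u - s)\<bar> \<partial>lborel) \<partial>\<nu>)"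
    by (rule P.Fubini'[symmetric]) (use m'' in \<open>simp add: case_prod_beta'\<close>)
  also have "\<dots> = (\<integral>\<^sup>+s. ennreal \<bar>g s\<bar> \<partial>lborel) * emeasure \<nu> (space \<nu>)"
    unfolding lborel_reflect_pair[OF gm] by simp
  also have "\<dots> < \<infinity>"
  proof -
    have "(\<integral>\<^sup>+s. ennreal \<bar>g s\<bar> \<partial>lborel) < \<infinity>" using g by (simp add: integrable_iff_bounded)
    then show ?thesis by (simp add: ennreal_mult_less_top emeasure_eq_measure)
  qed
  finally have fin: "(\<integral>\<^sup>+s. (\<integral>\<^sup>+u. ennreal \<bar>g (u - s)\<bar> \<partial>\<nu>) \<partial>lborel) \<noteq> \<infinity>" by simp
  have "AE s in lborel. (\<integral>\<^sup>+u. ennreal \<bar>g (u - s)\<bar> \<partial>\<nu>) \<noteq> \<infinity>"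
  proof (rule nn_integral_PInf_AE[OF _ fin])
    show "(\<lambda>s. \<integral>\<^sup>+u. ennreal \<bar>g (u - s)\<bar> \<partial>\<nu>) \<in> borel_measurable lborel"
      using m'' by (intro borel_measurable_nn_integral) (simp add: case_prod_beta')
  qed
  then show ?thesis
  proof eventually_elim
    case (elim s)
    show ?case using elim sec by (auto simp: integrable_iff_bounded less_top)
  qed
qed

lemma integral_simple_compose:
  fixes f :: "'e \<Rightarrow> real" and F :: "'d::euclidean_space \<Rightarrow> 'e"
  assumes \<nu>: "finite_measure \<nu>" and s: "sets \<nu> = sets borel" and F: "simple_function borel F"
  shows "integrable \<nu> (\<lambda>u. f (F u))"
    and "(LINT u|\<nu>. f (F u)) = (\<Sum>y\<in>range F. measure \<nu> (F -` {y}) * f y)"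
proof -
  interpret finite_measure \<nu> by fact
  have fin: "finite (range F)" using simple_functionD(1)[OF F] by simp
  have sp: "space \<nu> = UNIV" using sets_eq_imp_space_eq[OF s] by simp
  have Fs: "F -` {y} \<in> sets \<nu>" for y using simple_functionD(2)[OF F, of "{y}"] s by simp
  have eq: "f (F u) = (\<Sum>y\<in>range F. f y * indicator (F -` {y}) u)" for u
  proof -
    have "(\<Sum>y\<in>range F. f y * indicator (F -` {y}) u) = (\<Sum>y\<in>{F u}. f y * indicator (F -` {y}) u)"
      by (rule sum.mono_neutral_right) (use fin in auto)
    then show ?thesis by simp
  qed
  have i: "integrable \<nu> (\<lambda>u. f y * indicator (F -` {y}) u)" for y
    using Fs by (intro integrable_mult_right integrable_real_indicator) (simp_all add: emeasure_eq_measure)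
  show "integrable \<nu> (\<lambda>u. f (F u))" unfolding eq by (intro Bochner_Integration.integrable_sum i)
  show "(LINT u|\<nu>. f (F u)) = (\<Sum>y\<in>range F. measure \<nu> (F -` {y}) * f y)"
    unfolding eq by (subst Bochner_Integration.integral_sum[OF i]) (simp add: Fs sp mult.commute)
qed

lemma smear_measurable:
  fixes g :: "'d::euclidean_space \<Rightarrow> real"
  assumes g: "g \<in> borel_measurable borel" and \<nu>: "finite_measure \<nu>" and sets_\<nu>: "sets \<nu> = sets borel"
  shows "smear \<nu> g \<in> borel_measurable borel"
proof -
  interpret finite_measure \<nu> by (rule \<nu>)
  have "(\<lambda>(u, s). g (u - s)) \<in> borel_measurable (\<nu> \<Otimes>\<^sub>M borel)"
    by (rule borel_measurable_shift_pair[OF sets_\<nu> _ g]) simp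
  from measurable_pair_swap[OF this]
  have "(\<lambda>(s, u). g (u - s)) \<in> borel_measurable (borel \<Otimes>\<^sub>M \<nu>)" by (simp add: case_prod_beta')
  then show ?thesis unfolding smear_def by (rule borel_measurable_lebesgue_integral)
qed

lemma simple_identity_sequence:
  "\<exists>F :: nat \<Rightarrow> 'd::euclidean_space \<Rightarrow> 'd. (\<forall>i. simple_function borel (F i)) \<and> (\<forall>u. (\<lambda>i. F i u) \<longlonglongrightarrow> u)"
proof -
  have "(\<lambda>u::'d. u) \<in> borel_measurable borel" by simp
  from borel_measurable_implies_sequence_metric[OF this, of 0] show ?thesis by auto
qed

context
  fixes \<rho> :: "real measure" and b :: real and g :: "'d::euclidean_space \<Rightarrow> real" and \<nu> :: "'d measure"
  assumes jm: "jump_measure \<rho>" and g: "g \<in> borel_measurable borel" and fin: "modular b \<rho> g < \<infinity>"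
    and \<nu>: "finite_measure \<nu>" and sets_\<nu>: "sets \<nu> = sets borel"
begin

lemma smear_modular_finite: "modular b \<rho> (smear \<nu> g) < \<infinity>"
proof -
  interpret finite_measure \<nu> by (rule \<nu>)
  have "modular b \<rho> (\<lambda>s. LINT u|\<nu>. g (u - s)) \<le>
      ennreal (max 1 (measure \<nu> (space \<nu>))) * (\<integral>\<^sup>+u. modular b \<rho> (\<lambda>s. g (u - s)) \<partial>\<nu>)"
    by (rule modular_mix[OF jm \<nu>]) (rule borel_measurable_shift_pair[OF sets_\<nu> _ g], simp)
  also have "\<dots> = ennreal (max 1 (measure \<nu> (space \<nu>))) * (modular b \<rho> g * emeasure \<nu> (space \<nu>))"
    unfolding modular_reflect[OF jm g] by simp
  also have "\<dots> < \<infinity>" using fin by (simp add: ennreal_mult_less_top emeasure_eq_measure)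
  finally show ?thesis unfolding smear_def[abs_def] .
qed

text \<open>Riemann sums: replacing u by the simple map \<open>F i u\<close> turns the average into
  a finite combination of translates. The error is a mixture of differences of translates, which
  tend to 0 in the modular by \<open>translation_continuous\<close> and are bounded by a constant,
  so \<open>modular_mix\<close> and dominated convergence finish.\<close>

lemma smear_approx:
  assumes int: "integrable lborel g"
    and F: "\<And>i. simple_function borel (F i)" and F_lim: "\<And>u. (\<lambda>i. F i u) \<longlonglongrightarrow> u"
  shows "(\<lambda>i. modular b \<rho> (\<lambda>s. (\<Sum>y\<in>range (F i). measure \<nu> (F i -` {y}) * g (y - s)) - smear \<nu> g s)) \<longlonglongrightarrow> 0"
proof -
  interpret finite_measure \<nu> by (rule \<nu>)
  note [measurable] = KK_measurable[OF jm]
  define T where "T = max 1 (measure \<nu> (space \<nu>))"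
  define H where "H i u s = g (F i u - s) - g (u - s)" for i u s
  have Fm: "F i \<in> measurable borel borel" for i using borel_measurable_simple_function[OF F] .
  have Hm: "case_prod (H i) \<in> borel_measurable (\<nu> \<Otimes>\<^sub>M borel)" for i
  proof -
    have "(\<lambda>x. (\<lambda>(u, s). g (F i u - s)) x - (\<lambda>(u, s). g (u - s)) x) \<in> borel_measurable (\<nu> \<Otimes>\<^sub>M borel)"
      by (intro borel_measurable_diff borel_measurable_shift_pair[OF sets_\<nu> _ g] Fm) simp
    then show ?thesis by (simp add: H_def case_prod_beta')
  qed
  have Mm: "(\<lambda>u. modular b \<rho> (H i u)) \<in> borel_measurable \<nu>" for i
  proof -
    have "case_prod (H i) \<in> borel_measurable (\<nu> \<Otimes>\<^sub>M lborel)" by (rule measurable_pair_lborel[OF Hm])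
    then have "(\<lambda>x. ennreal (KK b \<rho> (case_prod (H i) x))) \<in> borel_measurable (\<nu> \<Otimes>\<^sub>M lborel)" by measurable
    then show ?thesis unfolding modular_def
      by (intro lborel.borel_measurable_nn_integral) (simp add: case_prod_beta')
  qed
  have shift: "(\<lambda>s. g (u - s)) \<in> borel_measurable borel" for u using g by measurable
  have Mlim: "(\<lambda>i. modular b \<rho> (H i u)) \<longlonglongrightarrow> 0" for u
    unfolding H_def[abs_def] by (rule translation_continuous[OF jm g fin F_lim])
  have Mbound: "modular b \<rho> (H i u) \<le> 2 * (modular b \<rho> g + modular b \<rho> g)" for i u
  proof -
    have neg: "modular b \<rho> (\<lambda>s. - g (u - s)) = modular b \<rho> g"
      using modular_reflect[OF jm g, of b u] KK_minus[OF jm] by (simp add: modular_def)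
    have "modular b \<rho> (\<lambda>s. g (F i u - s) + (- g (u - s))) \<le>
        2 * (modular b \<rho> (\<lambda>s. g (F i u - s)) + modular b \<rho> (\<lambda>s. - g (u - s)))"
      by (rule modular_add[OF jm]) (use shift in measurable)
    then show ?thesis unfolding neg modular_reflect[OF jm g] by (simp add: H_def[abs_def])
  qed
  have "(\<lambda>i. \<integral>\<^sup>+u. modular b \<rho> (H i u) \<partial>\<nu>) \<longlonglongrightarrow> (\<integral>\<^sup>+u. 0 \<partial>\<nu>)"
  proof (rule nn_integral_dominated_convergence[where w = "\<lambda>_. 2 * (modular b \<rho> g + modular b \<rho> g)"])
    show "(\<integral>\<^sup>+u. 2 * (modular b \<rho> g + modular b \<rho> g) \<partial>\<nu>) < \<infinity>"
      using fin by (simp add: ennreal_mult_less_top emeasure_eq_measure)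
  qed (use Mm Mlim Mbound in auto)
  then have "(\<lambda>i. ennreal T * (\<integral>\<^sup>+u. modular b \<rho> (H i u) \<partial>\<nu>)) \<longlonglongrightarrow> ennreal T * (\<integral>\<^sup>+u. 0 \<partial>\<nu>)"
    by (rule ennreal_tendsto_cmult[rotated]) simp
  then have lim: "(\<lambda>i. ennreal T * (\<integral>\<^sup>+u. modular b \<rho> (H i u) \<partial>\<nu>)) \<longlonglongrightarrow> 0" by simp
  have "modular b \<rho> (\<lambda>s. (\<Sum>y\<in>range (F i). measure \<nu> (F i -` {y}) * g (y - s)) - smear \<nu> g s) \<le>
      ennreal T * (\<integral>\<^sup>+u. modular b \<rho> (H i u) \<partial>\<nu>)" for i
  proof -
    have "AE s in lborel. (\<Sum>y\<in>range (F i). measure \<nu> (F i -` {y}) * g (y - s)) - smear \<nu> g s = (LINT u|\<nu>. H i u s)"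
      using AE_integrable_shift[OF \<nu> sets_\<nu> int]
    proof eventually_elim
      case (elim s)
      show ?case unfolding H_def smear_def integral_simple_compose(2)[OF \<nu> sets_\<nu> F, of "\<lambda>y. g (y - s)", symmetric]
        by (rule Bochner_Integration.integral_diff[symmetric, OF integral_simple_compose(1)[OF \<nu> sets_\<nu> F] elim])
    qed
    then have "modular b \<rho> (\<lambda>s. (\<Sum>y\<in>range (F i). measure \<nu> (F i -` {y}) * g (y - s)) - smear \<nu> g s) =
        modular b \<rho> (\<lambda>s. LINT u|\<nu>. H i u s)"
      unfolding modular_def by (intro nn_integral_cong_AE) (auto elim!: eventually_mono)
    also have "\<dots> \<le> ennreal T * (\<integral>\<^sup>+u. modular b \<rho> (H i u) \<partial>\<nu>)"
      unfolding T_def by (rule modular_mix[OF jm \<nu> Hm])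
    finally show ?thesis .
  qed
  then show ?thesis
    by (intro tendsto_sandwich[OF _ _ tendsto_const lim]) (auto intro: always_eventually)
qed

end

section \<open>Balls, their translates, and averages of a kernel over large balls\<close>

lemma nn_integral_shift_lborel:
  fixes f :: "'d::euclidean_space \<Rightarrow> ennreal"
  assumes [measurable]: "f \<in> borel_measurable borel"
  shows "(\<integral>\<^sup>+s. f (c + s) \<partial>lborel) = (\<integral>\<^sup>+s. f s \<partial>lborel)"
  by (subst (2) lborel_distr_plus[of c, symmetric]) (simp add: nn_integral_distr)

lemma integral_shift_lborel:
  fixes f :: "'d::euclidean_space \<Rightarrow> real"
  assumes [measurable]: "f \<in> borel_measurable borel"
  shows "(LINT s|lborel. f (c + s)) = (LINT s|lborel. f s)"
  by (subst (2) lborel_distr_plus[of c, symmetric]) (simp add: integral_distr)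

text \<open>Bounds the volume of the symmetric difference of a ball of radius r and its translate by
  a vector of norm x. The annulus is small relative to the ball as r grows; the cap at twice the
  volume supplies domination when x is integrated out. The type argument carries the
  dimension.\<close>

definition cball_shift :: "'d::euclidean_space itself \<Rightarrow> real \<Rightarrow> real \<Rightarrow> real" where
  "cball_shift _ r x = min (2 * measure lborel (cball (0::'d) r))
    (measure lborel (cball (0::'d) (r + x)) - measure lborel (cball (0::'d) (max 0 (r - x))))"

lemma nn_integral_cball_shift:
  fixes w :: "'d::euclidean_space"
  assumes r: "0 < r"
  shows "(\<integral>\<^sup>+s. ennreal \<bar>indicator (cball 0 r) (w + s) - indicator (cball 0 r) s\<bar> \<partial>lborel) \<le>
    ennreal (cball_shift TYPE('d) r (norm w))"
proof -
  let ?B = "cball (0::'d) r"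
  define x where "x = norm w"
  have x: "0 \<le> x" by (simp add: x_def)
  have B [measurable]: "?B \<in> sets borel" by simp
  have em: "emeasure lborel (cball (0::'d) R) = ennreal (measure lborel (cball (0::'d) R))" for R
    by (rule emeasure_eq_ennreal_measure) (use emeasure_lborel_cball_finite[of "0::'d" R] in simp)
  have indm: "(\<lambda>s::'d. ennreal (indicator ?B s)) \<in> borel_measurable borel"
    by (intro measurable_compose[OF borel_measurable_indicator[OF B]]) simp
  have "(\<integral>\<^sup>+s. ennreal \<bar>indicator ?B (w + s) - indicator ?B s\<bar> \<partial>lborel) \<le>
      (\<integral>\<^sup>+s. ennreal (indicator ?B (w + s)) + ennreal (indicator ?B s) \<partial>lborel)"
    by (intro nn_integral_mono) (auto simp: indicator_def)
  also have "\<dots> = (\<integral>\<^sup>+s. ennreal (indicator ?B (w + s)) \<partial>lborel) + (\<integral>\<^sup>+s. ennreal (indicator ?B s) \<partial>lborel)"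
    by (rule nn_integral_add) (use indm in measurable)
  also have "(\<integral>\<^sup>+s. ennreal (indicator ?B (w + s)) \<partial>lborel) = (\<integral>\<^sup>+s. ennreal (indicator ?B s) \<partial>lborel)"
    by (rule nn_integral_shift_lborel[OF indm])
  also have "(\<integral>\<^sup>+s. ennreal (indicator ?B s) \<partial>lborel) = ennreal (measure lborel ?B)"
    by (simp add: ennreal_indicator em)
  finally have 1: "(\<integral>\<^sup>+s. ennreal \<bar>indicator ?B (w + s) - indicator ?B s\<bar> \<partial>lborel) \<le> ennreal (2 * measure lborel ?B)"
    by (simp add: ennreal_plus[symmetric] del: ennreal_plus)
  \<comment> \<open>Membership in the ball changes under the translation only at points whose norm
    differs from r by at most x.\<close>
  define A where "A = cball (0::'d) (r + x) - ball 0 (max 0 (r - x))"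
  have A: "A \<in> sets borel" by (simp add: A_def)
  have "(\<integral>\<^sup>+s. ennreal \<bar>indicator ?B (w + s) - indicator ?B s\<bar> \<partial>lborel) \<le> (\<integral>\<^sup>+s. indicator A s \<partial>lborel)"
  proof (rule nn_integral_mono)
    fix s :: 'd
    have t: "norm (w + s) \<le> x + norm s" "norm s \<le> x + norm (w + s)"
      using norm_triangle_ineq[of w s] norm_triangle_ineq4[of "w + s" w] by (simp_all add: x_def)
    show "ennreal \<bar>indicator ?B (w + s) - indicator ?B s\<bar> \<le> indicator A s"
    proof (cases "s \<in> A")
      case True
      then show ?thesis by (auto simp: indicator_def)
    next
      case False
      then have "norm s < max 0 (r - x) \<or> r + x < norm s" by (auto simp: A_def)
      then have "norm s < r - x \<or> r + x < norm s"
        using norm_ge_zero[of s] by (simp add: less_max_iff_disj)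
      then have "(w + s \<in> ?B) = (s \<in> ?B)" using t x by auto
      then show ?thesis by (simp add: indicator_def)
    qed
  qed
  also have "\<dots> = emeasure lborel A" using A by simp
  also have "\<dots> = emeasure lborel (cball (0::'d) (r + x)) - emeasure lborel (ball (0::'d) (max 0 (r - x)))"
    unfolding A_def using r x by (intro emeasure_Diff) (auto simp: emeasure_ball)
  also have "emeasure lborel (ball (0::'d) (max 0 (r - x))) = emeasure lborel (cball (0::'d) (max 0 (r - x)))"
    by (simp add: emeasure_ball emeasure_cball)
  finally have 2: "(\<integral>\<^sup>+s. ennreal \<bar>indicator ?B (w + s) - indicator ?B s\<bar> \<partial>lborel) \<le>
      ennreal (measure lborel (cball (0::'d) (r + x)) - measure lborel (cball (0::'d) (max 0 (r - x))))"
    unfolding em by (simp add: ennreal_minus)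
  show ?thesis unfolding cball_shift_def x_def[symmetric] using 1 2 by (simp add: min_def)
qed

lemma cball_shift_nonneg: "0 < r \<Longrightarrow> 0 \<le> x \<Longrightarrow> 0 \<le> cball_shift TYPE('d::euclidean_space) r x"
  unfolding cball_shift_def by (auto simp: content_cball intro!: mult_left_mono power_mono)

text \<open>With d the dimension, the annulus has relative volume (1 + x/r)^d - max(0, 1 - x/r)^d,
  which tends to 0: boundaries of large balls are negligible.\<close>

lemma cball_shift_ratio_tendsto:
  assumes x: "0 \<le> x"
  shows "(\<lambda>n. cball_shift TYPE('d::euclidean_space) (real (Suc n)) x / measure lborel (cball (0::'d) (real (Suc n)))) \<longlonglongrightarrow> 0"
proof -
  define \<omega> where "\<omega> = unit_ball_vol (real DIM('d))"
  have \<omega>: "0 < \<omega>" by (simp add: \<omega>_def)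
  let ?r = "\<lambda>n. real (Suc n)"
  have lim0: "(\<lambda>n. x / ?r n) \<longlonglongrightarrow> 0" by real_asymp
  have "(\<lambda>n. (1 + x / ?r n) ^ DIM('d) - (max 0 (1 - x / ?r n)) ^ DIM('d)) \<longlonglongrightarrow> (1 + 0) ^ DIM('d) - (max 0 (1 - 0)) ^ DIM('d)"
    by (intro tendsto_intros lim0)
  then have lim: "(\<lambda>n. (1 + x / ?r n) ^ DIM('d) - (max 0 (1 - x / ?r n)) ^ DIM('d)) \<longlonglongrightarrow> 0" by simp
  have "cball_shift TYPE('d) (?r n) x / measure lborel (cball (0::'d) (?r n)) \<le>
      (1 + x / ?r n) ^ DIM('d) - (max 0 (1 - x / ?r n)) ^ DIM('d)" for n
  proof -
    have r: "0 < ?r n" by simp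
    have e: "?r n + x = (1 + x / ?r n) * ?r n" "max 0 (?r n - x) = max 0 (1 - x / ?r n) * ?r n"
      using r by (simp_all only: max_mult_distrib_right distrib_right left_diff_distrib) simp_all
    have V: "measure lborel (cball (0::'d) (?r n)) = \<omega> * ?r n ^ DIM('d)" by (simp add: content_cball \<omega>_def)
    have V0: "0 < \<omega> * ?r n ^ DIM('d)" using \<omega> r by simp
    have "cball_shift TYPE('d) (?r n) x \<le> \<omega> * (?r n + x) ^ DIM('d) - \<omega> * max 0 (?r n - x) ^ DIM('d)"
      unfolding cball_shift_def using x by (simp add: content_cball \<omega>_def)
    also have "\<dots> = ((1 + x / ?r n) ^ DIM('d) - (max 0 (1 - x / ?r n)) ^ DIM('d)) * (\<omega> * ?r n ^ DIM('d))"
      unfolding e power_mult_distrib left_diff_distrib by (simp only: mult_ac)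
    finally show ?thesis unfolding V using V0 by (simp only: pos_divide_le_eq)
  qed
  then show ?thesis using cball_shift_nonneg[OF _ x, where 'd='d]
    by (intro tendsto_sandwich[OF _ _ tendsto_const lim]) (auto intro!: always_eventually)
qed

definition cball_measure :: "real \<Rightarrow> 'd::euclidean_space measure" where
  "cball_measure r = density lborel (\<lambda>u. ennreal (indicator (cball 0 r) u))"

lemma finite_cball_measure: "finite_measure (cball_measure r :: 'd::euclidean_space measure)"
proof
  have B: "cball (0::'d) r \<in> sets borel" by simp
  have "(\<lambda>u::'d. ennreal (indicator (cball 0 r) u)) \<in> borel_measurable lborel"
    using measurable_compose[OF borel_measurable_indicator[OF B] measurable_ennreal] by simp
  then have "emeasure (cball_measure r) (UNIV :: 'd set) = emeasure lborel (cball (0::'d) r)"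
    unfolding cball_measure_def by (subst emeasure_density) (simp_all add: ennreal_indicator)
  then show "emeasure (cball_measure r :: 'd measure) (space (cball_measure r)) \<noteq> \<infinity>"
    using emeasure_lborel_cball_finite[of "0::'d" r] by (simp add: cball_measure_def)
qed

lemma sets_cball_measure [simp]: "sets (cball_measure r) = sets borel"
  by (simp add: cball_measure_def)

context
  fixes \<rho> :: "real measure" and b :: real and g :: "'d::euclidean_space \<Rightarrow> real"
  assumes jm: "jump_measure \<rho>" and int: "integrable lborel g" and c0: "(LINT s|lborel. g s) \<noteq> 0"
begin

text \<open>The substitution w = u - s writes the deviation as the integral of g(w) times the change
  of the indicator of the ball under translation by w; Tonelli and
  \<open>nn_integral_cball_shift\<close> bound its L^1 norm.\<close>

lemma nn_integral_smear_cball: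
  assumes r: "0 < r"
  shows "(\<integral>\<^sup>+s. ennreal \<bar>smear (cball_measure r) g s - (LINT s|lborel. g s) * indicator (cball 0 r) s\<bar> \<partial>lborel) \<le>
      ennreal (LINT w|lborel. \<bar>g w\<bar> * cball_shift TYPE('d) r (norm w))" (is ?int)
    and "\<bar>smear (cball_measure r) g s - (LINT s|lborel. g s) * indicator (cball 0 r) s\<bar> \<le> 2 * (LINT w|lborel. \<bar>g w\<bar>)"
      (is ?bound)
    and "integrable lborel (\<lambda>w. \<bar>g w\<bar> * cball_shift TYPE('d) r (norm w))"
proof -
  have gm [measurable]: "g \<in> borel_measurable borel" using int by auto
  let ?B = "cball (0::'d) r"
  have Bm: "indicator ?B \<in> borel_measurable borel" by (rule borel_measurable_indicator) simp
  define D where "D w s = indicator ?B (s + w) - (indicator ?B s :: real)" for w s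
  have Dm: "(\<lambda>x. D (fst x) (snd x)) \<in> borel_measurable (borel \<Otimes>\<^sub>M borel)"
    unfolding D_def using Bm by measurable
  have Dm1: "(\<lambda>w. D w s) \<in> borel_measurable borel" for s unfolding D_def using Bm by measurable
  have D1: "\<bar>D w s\<bar> \<le> 1" for w s by (simp add: D_def indicator_def)
  have iB: "integrable lborel (\<lambda>w. g w * indicator ?B (s + w))" for s
  proof (rule Bochner_Integration.integrable_bound[OF int])
    show "(\<lambda>w. g w * indicator ?B (s + w)) \<in> borel_measurable lborel" using Bm by measurable
  qed (simp add: indicator_def)
  have eq: "smear (cball_measure r) g s - (LINT s|lborel. g s) * indicator ?B s = (LINT w|lborel. g w * D w s)" for s
  proof -
    have m: "(\<lambda>u. indicator ?B u *\<^sub>R g (u - s)) \<in> borel_measurable borel" using Bm by measurable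
    have "smear (cball_measure r) g s = (LINT u|lborel. indicator ?B u *\<^sub>R g (u - s))"
      unfolding smear_def cball_measure_def by (rule integral_density) (use Bm in measurable, auto)
    also have "\<dots> = (LINT w|lborel. indicator ?B (s + w) *\<^sub>R g (s + w - s))"
      by (rule integral_shift_lborel[OF m, symmetric])
    also have "\<dots> = (LINT w|lborel. g w * indicator ?B (s + w))" by (simp add: mult.commute)
    finally have "smear (cball_measure r) g s - (LINT s|lborel. g s) * indicator ?B s =
        (LINT w|lborel. g w * indicator ?B (s + w)) - (LINT w|lborel. g w * indicator ?B s)" by simp
    also have "\<dots> = (LINT w|lborel. g w * indicator ?B (s + w) - g w * indicator ?B s)"
      by (rule Bochner_Integration.integral_diff[symmetric, OF iB]) (use int in simp)
    finally show ?thesis by (simp add: D_def right_diff_distrib)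
  qed
  have iD: "integrable lborel (\<lambda>w. \<bar>g w\<bar> * \<bar>D w s\<bar>)" for s
  proof (rule Bochner_Integration.integrable_bound[OF int])
    show "(\<lambda>w. \<bar>g w\<bar> * \<bar>D w s\<bar>) \<in> borel_measurable lborel" using Dm1 by measurable
    show "AE w in lborel. norm (\<bar>g w\<bar> * \<bar>D w s\<bar>) \<le> norm (g w)"
      using D1 by (auto simp: abs_mult intro!: mult_left_le AE_I2)
  qed
  have iD': "integrable lborel (\<lambda>w. g w * D w s)" for s
    by (rule Bochner_Integration.integrable_bound[OF iD[of s]]) (use Dm1 in measurable, simp add: abs_mult)
  have le: "\<bar>smear (cball_measure r) g s - (LINT s|lborel. g s) * indicator ?B s\<bar> \<le> (LINT w|lborel. \<bar>g w\<bar> * \<bar>D w s\<bar>)" for s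
    unfolding eq using norm_integral_le[OF iD'[of s] iD[of s]] by (simp add: abs_mult)
  also have "(LINT w|lborel. \<bar>g w\<bar> * \<bar>D w s\<bar>) \<le> (LINT w|lborel. 2 * \<bar>g w\<bar>)"
  proof (rule integral_mono[OF iD])
    fix w
    have "\<bar>g w\<bar> * \<bar>D w s\<bar> \<le> \<bar>g w\<bar> * 1" by (rule mult_left_mono[OF D1]) simp
    then show "\<bar>g w\<bar> * \<bar>D w s\<bar> \<le> 2 * \<bar>g w\<bar>" by simp
  qed (use int in simp)
  finally show ?bound by simp
  have cs: "\<bar>cball_shift TYPE('d) r (norm w)\<bar> \<le> 2 * measure lborel ?B" for w :: 'd
    using cball_shift_nonneg[OF r, of "norm w", where 'd='d] by (simp add: cball_shift_def)
  have csm: "(\<lambda>w::'d. cball_shift TYPE('d) r (norm w)) \<in> borel_measurable borel"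
  proof -
    have "(\<lambda>w::'d. min (2 * measure lborel ?B) (unit_ball_vol (real DIM('d)) * (r + norm w) ^ DIM('d) -
        unit_ball_vol (real DIM('d)) * (max 0 (r - norm w)) ^ DIM('d))) \<in> borel_measurable borel" by measurable
    moreover have "cball_shift TYPE('d) r (norm w) = min (2 * measure lborel ?B) (unit_ball_vol (real DIM('d)) * (r + norm w) ^ DIM('d) -
        unit_ball_vol (real DIM('d)) * (max 0 (r - norm w)) ^ DIM('d))" for w :: 'd
      using r norm_ge_zero[of w] by (simp add: cball_shift_def content_cball add_nonneg_nonneg)
    ultimately show ?thesis by simp
  qed
  show ics: "integrable lborel (\<lambda>w. \<bar>g w\<bar> * cball_shift TYPE('d) r (norm w))"
  proof (rule Bochner_Integration.integrable_bound)
    show "integrable lborel (\<lambda>w. (2 * measure lborel ?B) * g w)" using int by simp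
    show "(\<lambda>w. \<bar>g w\<bar> * cball_shift TYPE('d) r (norm w)) \<in> borel_measurable lborel" using csm by measurable
    show "AE w in lborel. norm (\<bar>g w\<bar> * cball_shift TYPE('d) r (norm w)) \<le> norm ((2 * measure lborel ?B) * g w)"
    proof (rule AE_I2)
      fix w :: 'd
      have "\<bar>g w\<bar> * \<bar>cball_shift TYPE('d) r (norm w)\<bar> \<le> \<bar>g w\<bar> * (2 * measure lborel ?B)"
        by (rule mult_left_mono[OF cs]) simp
      then show "norm (\<bar>g w\<bar> * cball_shift TYPE('d) r (norm w)) \<le> norm ((2 * measure lborel ?B) * g w)"
        by (simp add: abs_mult mult.commute)
    qed
  qed
  have Gm: "(\<lambda>x. ennreal (\<bar>g (fst x)\<bar> * \<bar>D (fst x) (snd x)\<bar>)) \<in> borel_measurable (lborel \<Otimes>\<^sub>M lborel)"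
  proof -
    have "(\<lambda>x. ennreal (\<bar>g (fst x)\<bar> * \<bar>D (fst x) (snd x)\<bar>)) \<in> borel_measurable (borel \<Otimes>\<^sub>M borel)"
      using Dm by measurable
    moreover have "sets (lborel \<Otimes>\<^sub>M lborel) = sets (borel \<Otimes>\<^sub>M (borel :: 'd measure) :: ('d \<times> 'd) measure)"
      by (rule sets_pair_measure_cong) simp_all
    ultimately show ?thesis using measurable_cong_sets by blast
  qed
  have "(\<integral>\<^sup>+s. ennreal \<bar>smear (cball_measure r) g s - (LINT s|lborel. g s) * indicator ?B s\<bar> \<partial>lborel) \<le>
      (\<integral>\<^sup>+s. (\<integral>\<^sup>+w. ennreal (\<bar>g w\<bar> * \<bar>D w s\<bar>) \<partial>lborel) \<partial>lborel)"
  proof (rule nn_integral_mono)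
    fix s
    have "(\<integral>\<^sup>+w. ennreal (\<bar>g w\<bar> * \<bar>D w s\<bar>) \<partial>lborel) = ennreal (LINT w|lborel. \<bar>g w\<bar> * \<bar>D w s\<bar>)"
      by (rule nn_integral_eq_integral[OF iD]) simp
    then show "ennreal \<bar>smear (cball_measure r) g s - (LINT s|lborel. g s) * indicator ?B s\<bar> \<le>
        (\<integral>\<^sup>+w. ennreal (\<bar>g w\<bar> * \<bar>D w s\<bar>) \<partial>lborel)" using ennreal_leI[OF le[of s]] by simp
  qed
  also have "\<dots> = (\<integral>\<^sup>+w. (\<integral>\<^sup>+s. ennreal (\<bar>g w\<bar> * \<bar>D w s\<bar>) \<partial>lborel) \<partial>lborel)"
    by (rule lborel_pair.Fubini') (use Gm in \<open>simp add: case_prod_beta'\<close>)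
  also have "\<dots> \<le> (\<integral>\<^sup>+w. ennreal (\<bar>g w\<bar> * cball_shift TYPE('d) r (norm w)) \<partial>lborel)"
  proof (rule nn_integral_mono)
    fix w :: 'd
    have Dw: "(\<lambda>s. ennreal \<bar>D w s\<bar>) \<in> borel_measurable lborel" unfolding D_def using Bm by measurable
    have "(\<integral>\<^sup>+s. ennreal (\<bar>g w\<bar> * \<bar>D w s\<bar>) \<partial>lborel) = ennreal \<bar>g w\<bar> * (\<integral>\<^sup>+s. ennreal \<bar>D w s\<bar> \<partial>lborel)"
      unfolding ennreal_mult[OF abs_ge_zero abs_ge_zero] by (rule nn_integral_cmult[OF Dw])
    also have "\<dots> \<le> ennreal \<bar>g w\<bar> * ennreal (cball_shift TYPE('d) r (norm w))"
      using nn_integral_cball_shift[OF r, of w] by (intro mult_left_mono) (simp_all add: D_def add.commute)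
    also have "\<dots> = ennreal (\<bar>g w\<bar> * cball_shift TYPE('d) r (norm w))"
      using cball_shift_nonneg[OF r, of "norm w", where 'd='d] by (intro ennreal_mult[symmetric]) auto
    finally show "(\<integral>\<^sup>+s. ennreal (\<bar>g w\<bar> * \<bar>D w s\<bar>) \<partial>lborel) \<le> ennreal (\<bar>g w\<bar> * cball_shift TYPE('d) r (norm w))" .
  qed
  also have "\<dots> = ennreal (LINT w|lborel. \<bar>g w\<bar> * cball_shift TYPE('d) r (norm w))"
    using cball_shift_nonneg[OF r norm_ge_zero, where 'd='d] by (intro nn_integral_eq_integral[OF ics] AE_I2 mult_nonneg_nonneg abs_ge_zero)
  finally show ?int .
qed

text \<open>The deviation is uniformly bounded by 2m, and its L^1 norm is small relative to the
  volume. \<open>KK_scale_le_1\<close> combines the two: for |y| <= 2m, the value of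
  \<open>KK\<close> at y/c is at most |y|/(2m) times its value at 2m/c.\<close>

lemma cball_smear_near_indicator:
  assumes e: "0 < e"
  shows "\<exists>r>0. modular b \<rho> (\<lambda>s. smear (cball_measure r) g s / (LINT s|lborel. g s) - indicator (cball 0 r) s) \<le>
    ennreal (e * measure lborel (cball (0::'d) r))"
proof -
  have gm [measurable]: "g \<in> borel_measurable borel" using int by auto
  define c where "c = (LINT s|lborel. g s)"
  define m where "m = (LINT w|lborel. \<bar>g w\<bar>)"
  define V where "V n = measure lborel (cball (0::'d) (real (Suc n)))" for n
  define I where "I n = (LINT w|lborel. \<bar>g w\<bar> * cball_shift TYPE('d) (real (Suc n)) (norm w))" for n
  have c: "c \<noteq> 0" using c0 by (simp add: c_def)
  have V: "0 < V n" for n unfolding V_def by simp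
  have mc: "\<bar>c\<bar> \<le> m" unfolding c_def m_def by (rule integral_abs_bound)
  then have m: "0 < m" using c by linarith
  have "(\<lambda>n. LINT w|lborel. \<bar>g w\<bar> * (cball_shift TYPE('d) (real (Suc n)) (norm w) / V n)) \<longlonglongrightarrow> (LINT w|(lborel :: 'd measure). 0)"
  proof (rule integral_dominated_convergence[where w = "\<lambda>w. 2 * \<bar>g w\<bar>"])
    show "(\<lambda>w. \<bar>g w\<bar> * (cball_shift TYPE('d) (real (Suc n)) (norm w) / V n)) \<in> borel_measurable lborel" for n
      using borel_measurable_integrable[OF nn_integral_smear_cball(3)[of "real (Suc n)"]] by simp
    show "AE w in lborel. (\<lambda>n. \<bar>g w\<bar> * (cball_shift TYPE('d) (real (Suc n)) (norm w) / V n)) \<longlonglongrightarrow> 0"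
      unfolding V_def by (intro AE_I2 tendsto_mult_right_zero cball_shift_ratio_tendsto norm_ge_zero)
    show "AE w in lborel. norm (\<bar>g w\<bar> * (cball_shift TYPE('d) (real (Suc n)) (norm w) / V n)) \<le> 2 * \<bar>g w\<bar>" for n
    proof (rule AE_I2)
      fix w :: 'd
      have "0 \<le> cball_shift TYPE('d) (real (Suc n)) (norm w)" by (rule cball_shift_nonneg) auto
      moreover have "cball_shift TYPE('d) (real (Suc n)) (norm w) \<le> 2 * V n" by (simp add: cball_shift_def V_def)
      ultimately have "\<bar>cball_shift TYPE('d) (real (Suc n)) (norm w) / V n\<bar> \<le> 2"
        using V[of n] by (simp add: pos_divide_le_eq)
      then have "\<bar>g w\<bar> * \<bar>cball_shift TYPE('d) (real (Suc n)) (norm w) / V n\<bar> \<le> \<bar>g w\<bar> * 2" by (rule mult_left_mono) simp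
      then show "norm (\<bar>g w\<bar> * (cball_shift TYPE('d) (real (Suc n)) (norm w) / V n)) \<le> 2 * \<bar>g w\<bar>"
        by (simp add: abs_mult mult.commute)
    qed
  qed (use int in simp_all)
  then have "(\<lambda>n. I n / V n) \<longlonglongrightarrow> 0" by (simp add: I_def)
  then have lim: "(\<lambda>n. KK b \<rho> (2 * m / c) / (2 * m) * (I n / V n)) \<longlonglongrightarrow> 0" by (rule tendsto_mult_right_zero)
  from order_tendstoD(2)[OF this e] obtain n where n: "KK b \<rho> (2 * m / c) / (2 * m) * (I n / V n) < e"
    by (auto simp: eventually_sequentially)
  define r where "r = real (Suc n)"
  have r: "0 < r" by (simp add: r_def)
  let ?B = "cball (0::'d) r"
  define y where "y s = smear (cball_measure r) g s - c * indicator ?B s" for s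
  have y: "\<bar>y s\<bar> \<le> 2 * m" for s
    unfolding y_def c_def m_def by (rule nn_integral_smear_cball(2)[OF r])
  have ym: "y \<in> borel_measurable borel"
  proof -
    have [measurable]: "smear (cball_measure r) g \<in> borel_measurable borel"
      by (rule smear_measurable[OF gm finite_cball_measure]) simp_all
    have im: "indicator ?B \<in> borel_measurable borel" by (rule borel_measurable_indicator) simp
    show ?thesis unfolding y_def using im by measurable
  qed
  have "modular b \<rho> (\<lambda>s. smear (cball_measure r) g s / c - indicator ?B s) \<le>
      (\<integral>\<^sup>+s. ennreal (KK b \<rho> (2 * m / c) / (2 * m)) * ennreal \<bar>y s\<bar> \<partial>lborel)"
    unfolding modular_def
  proof (rule nn_integral_mono)
    fix s
    have "KK b \<rho> (smear (cball_measure r) g s / c - indicator ?B s) = KK b \<rho> (y s / (2 * m) * (2 * m / c))"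
    proof -
      have "smear (cball_measure r) g s / c - indicator ?B s = y s / c"
        using c by (simp add: y_def diff_divide_distrib)
      also have "\<dots> = y s / (2 * m) * (2 * m / c)" using m by simp
      finally show ?thesis by (simp only:)
    qed
    also have "\<dots> \<le> \<bar>y s / (2 * m)\<bar> * KK b \<rho> (2 * m / c)"
      by (rule KK_scale_le_1[OF jm]) (use y[of s] m in simp)
    also have "\<dots> = KK b \<rho> (2 * m / c) / (2 * m) * \<bar>y s\<bar>" using m by simp
    finally have "ennreal (KK b \<rho> (smear (cball_measure r) g s / c - indicator ?B s)) \<le>
        ennreal (KK b \<rho> (2 * m / c) / (2 * m) * \<bar>y s\<bar>)" by (rule ennreal_leI)
    also have "\<dots> = ennreal (KK b \<rho> (2 * m / c) / (2 * m)) * ennreal \<bar>y s\<bar>"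
      using m KK_nonneg[OF jm] by (intro ennreal_mult) auto
    finally show "ennreal (KK b \<rho> (smear (cball_measure r) g s / c - indicator ?B s)) \<le> \<dots>" .
  qed
  also have "\<dots> = ennreal (KK b \<rho> (2 * m / c) / (2 * m)) * (\<integral>\<^sup>+s. ennreal \<bar>y s\<bar> \<partial>lborel)"
    by (rule nn_integral_cmult) (use ym in measurable)
  also have "\<dots> \<le> ennreal (KK b \<rho> (2 * m / c) / (2 * m)) * ennreal (I n)"
    using nn_integral_smear_cball(1)[OF r] by (intro mult_left_mono) (simp_all add: y_def c_def I_def r_def)
  also have "\<dots> = ennreal (KK b \<rho> (2 * m / c) / (2 * m) * I n)"
  proof (rule ennreal_mult[symmetric])
    show "0 \<le> I n" unfolding I_def
      by (intro integral_nonneg_AE AE_I2 mult_nonneg_nonneg abs_ge_zero cball_shift_nonneg norm_ge_zero) simp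
    show "0 \<le> KK b \<rho> (2 * m / c) / (2 * m)" using m KK_nonneg[OF jm] by simp
  qed
  also have "\<dots> \<le> ennreal (e * V n)"
  proof (rule ennreal_leI)
    have "KK b \<rho> (2 * m / c) / (2 * m) * I n / V n < e" using n by simp
    then show "KK b \<rho> (2 * m / c) / (2 * m) * I n \<le> e * V n" using V[of n] by (simp only: pos_divide_less_eq less_imp_le)
  qed
  finally show ?thesis using r unfolding V_def c_def r_def by blast
qed

end

text \<open>Reduces richness to approximating averages of \<open>g\<close> over a ball by the
  kernels at hand. The ball is fixed beforehand, so any absolute precision \<open>\<delta>\<close>
  can be requested.\<close>

lemma rich_of_approx:
  fixes g :: "'d::euclidean_space \<Rightarrow> real" and f :: "'i \<Rightarrow> 'd \<Rightarrow> real"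
  assumes jm: "jump_measure \<rho>" and int: "integrable lborel g" and c0: "(LINT s|lborel. g s) \<noteq> 0"
    and f: "\<And>j. j \<in> I \<Longrightarrow> f j \<in> borel_measurable borel"
    and approx: "\<And>r \<delta>. 0 < r \<Longrightarrow> 0 < \<delta> \<Longrightarrow> \<exists>(Y :: 'y set) \<phi> \<beta>. finite Y \<and> \<phi> ` Y \<subseteq> I \<and>
      modular b \<rho> (\<lambda>s. (\<Sum>y\<in>Y. \<beta> y * f (\<phi> y) s) - smear (cball_measure r) g s) \<le> ennreal \<delta>"
  shows "rich b \<rho> I f"
  unfolding rich_def
proof (intro allI impI)
  fix e :: real assume e: "0 < e"
  define c where "c = (LINT s|lborel. g s)"
  have c: "c \<noteq> 0" using c0 by (simp add: c_def)
  have "0 < e / 4" using e by simp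
  from cball_smear_near_indicator[OF jm int c0 this] obtain r where r: "0 < r"
    and near: "modular b \<rho> (\<lambda>s. smear (cball_measure r) g s / c - indicator (cball 0 r) s) \<le>
      ennreal (e / 4 * measure lborel (cball (0::'d) r))" unfolding c_def by blast
  define V where "V = measure lborel (cball (0::'d) r)"
  have V: "0 < V" using r by (simp add: V_def)
  \<comment> \<open>Cost in the modular of multiplying by 1 / c. With precision e V / (4 M) both
    errors are at most e V / 4, and the factor 2 of \<open>modular_add\<close> brings their sum to e
    V.\<close>
  define M where "M = max 1 ((1 / c)\<^sup>2)"
  have M: "1 \<le> M" by (simp add: M_def)
  have "0 < e * V / (4 * M)" using e V M by simp
  from approx[OF r this] obtain Y \<phi> \<beta> where Y: "finite (Y :: 'y set)" "\<phi> ` Y \<subseteq> I"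
    and close: "modular b \<rho> (\<lambda>s. (\<Sum>y\<in>Y. \<beta> y * f (\<phi> y) s) - smear (cball_measure r) g s) \<le> ennreal (e * V / (4 * M))"
    by (elim exE conjE) (rule that)
  \<comment> \<open>\<open>\<phi>\<close> need not be injective, so the coefficient of an index
    collects its whole fibre.\<close>
  define \<theta> where "\<theta> j = (\<Sum>y | y \<in> Y \<and> \<phi> y = j. \<beta> y / c)" for j
  have comb: "(\<Sum>j\<in>\<phi> ` Y. \<theta> j * f j s) = (1 / c) * (\<Sum>y\<in>Y. \<beta> y * f (\<phi> y) s)" for s
  proof -
    have "(\<Sum>j\<in>\<phi> ` Y. \<theta> j * f j s) = (\<Sum>j\<in>\<phi> ` Y. (\<Sum>y | y \<in> Y \<and> \<phi> y = j. \<beta> y / c * f (\<phi> y) s))"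
      unfolding \<theta>_def sum_distrib_right by (intro sum.cong refl) simp
    also have "\<dots> = (\<Sum>y\<in>Y. \<beta> y / c * f (\<phi> y) s)" by (rule sum.image_gen[OF Y(1), symmetric])
    also have "\<dots> = (1 / c) * (\<Sum>y\<in>Y. \<beta> y * f (\<phi> y) s)" by (simp add: sum_distrib_left)
    finally show ?thesis .
  qed
  have gm: "g \<in> borel_measurable borel" using int by auto
  have hm: "smear (cball_measure r) g \<in> borel_measurable borel"
    by (rule smear_measurable[OF gm finite_cball_measure]) simp
  define p where "p s = (\<Sum>y\<in>Y. \<beta> y * f (\<phi> y) s) - smear (cball_measure r) g s" for s
  define q where "q s = smear (cball_measure r) g s / c - indicator (cball 0 r) s" for s
  have fm: "f (\<phi> y) \<in> borel_measurable borel" if "y \<in> Y" for y using f Y that by blast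
  have pm: "p \<in> borel_measurable borel" unfolding p_def using hm fm by measurable
  have im: "indicator (cball (0::'d) r) \<in> borel_measurable borel" by (rule borel_measurable_indicator) simp
  have qm: "q \<in> borel_measurable borel" unfolding q_def using hm im by measurable
  have "modular b \<rho> (\<lambda>s. (\<Sum>j\<in>\<phi> ` Y. \<theta> j * f j s) - indicator (cball 0 r) s) = modular b \<rho> (\<lambda>s. (1 / c) * p s + q s)"
    unfolding comb p_def q_def right_diff_distrib by simp
  also have "\<dots> \<le> 2 * (modular b \<rho> (\<lambda>s. (1 / c) * p s) + modular b \<rho> q)"
    by (rule modular_add[OF jm _ qm]) (use pm in measurable)
  also have "\<dots> \<le> 2 * (ennreal (e * V / 4) + ennreal (e * V / 4))"
  proof (intro mult_left_mono add_mono)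
    have "modular b \<rho> (\<lambda>s. (1 / c) * p s) \<le> ennreal M * modular b \<rho> p"
      unfolding M_def by (rule modular_scale[OF jm pm])
    also have "\<dots> \<le> ennreal M * ennreal (e * V / (4 * M))"
      by (rule mult_left_mono) (use close in \<open>simp_all add: p_def[abs_def]\<close>)
    also have "\<dots> = ennreal (M * (e * V / (4 * M)))" using M e V by (intro ennreal_mult[symmetric]) auto
    also have "M * (e * V / (4 * M)) = e * V / 4" using M by simp
    finally show "modular b \<rho> (\<lambda>s. (1 / c) * p s) \<le> ennreal (e * V / 4)" .
    show "modular b \<rho> q \<le> ennreal (e * V / 4)" using near by (simp add: q_def[abs_def] V_def)
  qed simp_all
  also have "\<dots> = ennreal (2 * (e * V / 4 + e * V / 4))"
    using e V by (simp add: ennreal_plus[symmetric] numeral_mult_ennreal del: ennreal_plus)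
  also have "2 * (e * V / 4 + e * V / 4) = e * V" by simp
  finally have "modular b \<rho> (\<lambda>s. (\<Sum>j\<in>\<phi> ` Y. \<theta> j * f j s) - indicator (cball 0 r) s) \<le>
      ennreal (e * measure lborel (cball (0::'d) r))" by (simp add: V_def)
  moreover have "cball (0::'d) r \<in> bdd_borel" by (simp add: bdd_borel_def)
  moreover have "finite (\<phi> ` Y)" using Y by simp
  moreover have "0 < measure lborel (cball (0::'d) r)" using V by (simp add: V_def)
  ultimately show "\<exists>J \<theta> B. finite J \<and> J \<subseteq> I \<and> B \<in> bdd_borel \<and> 0 < measure lborel B \<and>
      modular b \<rho> (\<lambda>s. (\<Sum>j\<in>J. \<theta> j * f j s) - indicator B s) \<le> ennreal (e * measure lborel B)"
    using Y(2) by blast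
qed

lemma rich_indicators:
  assumes jm: "jump_measure \<rho>"
  shows "rich b \<rho> bdd_borel (indicator :: 'd::euclidean_space set \<Rightarrow> 'd \<Rightarrow> real)"
  unfolding rich_def
proof (intro allI impI exI conjI)
  fix e :: real assume e: "0 < e"
  let ?B = "cball (0::'d) 1"
  show "finite {?B}" "{?B} \<subseteq> bdd_borel" "?B \<in> bdd_borel" "0 < measure lborel ?B"
    by (simp_all add: bdd_borel_def)
  show "modular b \<rho> (\<lambda>s. (\<Sum>j\<in>{?B}. 1 * indicator j s) - indicator ?B s) \<le> ennreal (e * measure lborel ?B)"
    by (simp add: modular_0[OF jm])
qed

lemma rich_translates:
  fixes g :: "'d::euclidean_space \<Rightarrow> real"
  assumes jm: "jump_measure \<rho>" and int: "integrable lborel g" and c0: "(LINT s|lborel. g s) \<noteq> 0"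
    and fin: "modular b \<rho> g < \<infinity>"
  shows "rich b \<rho> UNIV (\<lambda>u s. g (u - s))"
proof (rule rich_of_approx[OF jm int c0])
  have gm: "g \<in> borel_measurable borel" using int by auto
  show "(\<lambda>s. g (u - s)) \<in> borel_measurable borel" for u using gm by measurable
  fix r \<delta> :: real assume "0 < \<delta>"
  obtain F :: "nat \<Rightarrow> 'd \<Rightarrow> 'd" where F: "\<And>i. simple_function borel (F i)" and F_lim: "\<And>u. (\<lambda>i. F i u) \<longlonglongrightarrow> u"
    using simple_identity_sequence by blast
  let ?\<nu> = "cball_measure r :: 'd measure"
  have "(\<lambda>i. modular b \<rho> (\<lambda>s. (\<Sum>y\<in>range (F i). measure ?\<nu> (F i -` {y}) * g (y - s)) - smear ?\<nu> g s)) \<longlonglongrightarrow> 0"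
    by (rule smear_approx[OF jm gm fin finite_cball_measure _ int F F_lim]) simp
  from order_tendstoD(2)[OF this, of "ennreal \<delta>"] \<open>0 < \<delta>\<close> obtain i where
    "modular b \<rho> (\<lambda>s. (\<Sum>y\<in>range (F i). measure ?\<nu> (F i -` {y}) * g (y - s)) - smear ?\<nu> g s) < ennreal \<delta>"
    by (auto simp: eventually_sequentially)
  then show "\<exists>(Y :: 'd set) \<phi> \<beta>. finite Y \<and> \<phi> ` Y \<subseteq> UNIV \<and>
      modular b \<rho> (\<lambda>s. (\<Sum>y\<in>Y. \<beta> y * g (\<phi> y - s)) - smear ?\<nu> g s) \<le> ennreal \<delta>"
    using simple_functionD(1)[OF F[of i]]
    by (intro exI[of _ "range (F i)"] exI[of _ "\<lambda>y. y"] exI[of _ "\<lambda>y. measure ?\<nu> (F i -` {y})"]) simp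
qed

definition restr_measure :: "'d::euclidean_space measure \<Rightarrow> 'd set \<Rightarrow> 'd measure" where
  "restr_measure \<mu> A = density \<mu> (\<lambda>u. ennreal (indicator A u))"

lemma sets_restr_measure [simp]: "sets (restr_measure \<mu> A) = sets \<mu>"
  by (simp add: restr_measure_def)

lemma indicator_ennreal_measurable:
  assumes "A \<in> sets N" shows "(\<lambda>u. ennreal (indicator A u)) \<in> borel_measurable N"
  using measurable_compose[OF borel_measurable_indicator[OF assms] measurable_ennreal] .

lemma finite_restr_measure:
  assumes \<mu>: "finite_measure \<mu>" and A: "A \<in> sets \<mu>"
  shows "finite_measure (restr_measure \<mu> A)"
proof
  interpret finite_measure \<mu> by fact
  have "emeasure (restr_measure \<mu> A) (space \<mu>) = emeasure \<mu> A"
    unfolding restr_measure_def using indicator_ennreal_measurable[OF A] A sets.sets_into_space[OF A]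
    by (subst emeasure_density) (simp_all add: ennreal_indicator Int_absorb1 Int_absorb2 flip: indicator_inter_arith)
  then show "emeasure (restr_measure \<mu> A) (space (restr_measure \<mu> A)) \<noteq> \<infinity>"
    by (simp add: restr_measure_def emeasure_eq_measure)
qed

lemma integral_restr_measure:
  fixes f :: "'d::euclidean_space \<Rightarrow> real"
  assumes A: "A \<in> sets \<mu>" and f: "f \<in> borel_measurable \<mu>"
  shows "(LINT u|restr_measure \<mu> A. f u) = (LINT u:A|\<mu>. f u)"
  unfolding restr_measure_def set_lebesgue_integral_def
  by (rule integral_density[OF f borel_measurable_indicator[OF A]]) simp

text \<open>Lebesgue measure on a ball has a density \<open>p\<close> relative to
  \<open>\<mu>\<close> by Radon--Nikodym. A simple function approximating \<open>p\<close> is a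
  combination of indicators of level sets, so its smear is a combination of smears of restrictions
  of \<open>\<mu>\<close>; the error is a mixture over the measure whose density is the absolute
  deviation, and the mass of that measure tends to 0.\<close>

lemma rich_smears:
  fixes g :: "'d::euclidean_space \<Rightarrow> real"
  assumes jm: "jump_measure \<rho>" and int: "integrable lborel g" and c0: "(LINT s|lborel. g s) \<noteq> 0"
    and fin: "modular b \<rho> g < \<infinity>"
    and \<mu>: "finite_measure \<mu>" and sets_\<mu>: "sets \<mu> = sets borel"
    and null: "\<And>A. A \<in> sets borel \<Longrightarrow> emeasure \<mu> A = 0 \<Longrightarrow> emeasure lborel A = 0"
  shows "rich b \<rho> (sets borel) (\<lambda>A. smear (restr_measure \<mu> A) g)"
proof (rule rich_of_approx[OF jm int c0])
  interpret \<mu>: finite_measure \<mu> by fact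
  have gm: "g \<in> borel_measurable borel" using int by auto
  have on_\<mu>: "f \<in> borel_measurable \<mu>" if "f \<in> borel_measurable borel" for f :: "'d \<Rightarrow> 'z::topological_space"
    unfolding measurable_cong_sets[OF sets_\<mu> refl] by (rule that)
  have sp: "space \<mu> = UNIV" using sets_eq_imp_space_eq[OF sets_\<mu>] by simp
  have shift: "(\<lambda>u. g (u - s)) \<in> borel_measurable borel" "(\<lambda>s. g (u - s)) \<in> borel_measurable borel" for s u
    using gm by measurable
  show "smear (restr_measure \<mu> A) g \<in> borel_measurable borel" if "A \<in> sets borel" for A
    by (rule smear_measurable[OF gm finite_restr_measure[OF \<mu>]]) (use that sets_\<mu> in simp_all)
  fix r \<delta> :: real assume \<delta>: "0 < \<delta>"
  define \<nu> where "\<nu> = (cball_measure r :: 'd measure)"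
  have \<nu>: "finite_measure \<nu>" "sets \<nu> = sets borel"
    unfolding \<nu>_def by (rule finite_cball_measure, simp)
  interpret \<nu>: finite_measure \<nu> by (rule \<nu>)
  have B: "cball (0::'d) r \<in> sets borel" by simp
  have "absolutely_continuous \<mu> \<nu>"
    unfolding absolutely_continuous_def
  proof
    fix N assume "N \<in> null_sets \<mu>"
    then have N: "N \<in> sets borel" "emeasure \<mu> N = 0" using sets_\<mu> by (auto simp: null_sets_def)
    have "emeasure \<nu> N = (\<integral>\<^sup>+u. ennreal (indicator (cball (0::'d) r) u) * indicator N u \<partial>lborel)"
      unfolding \<nu>_def cball_measure_def using N
      by (intro emeasure_density indicator_ennreal_measurable) simp_all
    also have "\<dots> \<le> (\<integral>\<^sup>+u. indicator N u \<partial>lborel)"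
      by (intro nn_integral_mono) (simp add: indicator_def)
    also have "\<dots> = 0" using N null by simp
    finally have "N \<in> null_sets \<nu>" using N \<nu>(2) by (auto simp: null_sets_def)
    then show "N \<in> null_sets \<nu>" .
  qed
  from \<mu>.Radon_Nikodym[OF this] \<nu>(2) sets_\<mu> obtain f0 where f0: "f0 \<in> borel_measurable \<mu>" "density \<mu> f0 = \<nu>" by auto
  \<comment> \<open>The density is finite almost everywhere since the ball has finite volume, so a
    real version serves.\<close>
  define p where "p u = enn2real (f0 u)" for u
  have pm: "p \<in> borel_measurable borel"
    using f0(1) unfolding measurable_cong_sets[OF sets_\<mu> refl] p_def by measurable
  have p0: "0 \<le> p u" for u by (simp add: p_def)
  have f0_int: "(\<integral>\<^sup>+u. f0 u \<partial>\<mu>) = emeasure \<nu> (space \<nu>)"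
    unfolding f0(2)[symmetric] using f0(1) by (subst emeasure_density) (auto intro!: nn_integral_cong)
  have "AE u in \<mu>. f0 u \<noteq> \<infinity>"
    by (rule nn_integral_PInf_AE[OF f0(1)]) (simp add: f0_int \<nu>.emeasure_eq_measure)
  then have f0p: "AE u in \<mu>. f0 u = ennreal (p u)"
    by eventually_elim (simp add: p_def less_top)
  have \<nu>p: "\<nu> = density \<mu> (\<lambda>u. ennreal (p u))"
    unfolding f0(2)[symmetric] using f0(1) on_\<mu>[OF pm] f0p by (intro density_cong) auto
  have ip: "integrable \<mu> p"
  proof (rule integrableI_nonneg[OF on_\<mu>[OF pm]])
    have "(\<integral>\<^sup>+u. ennreal (p u) \<partial>\<mu>) = (\<integral>\<^sup>+u. f0 u \<partial>\<mu>)"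
      using f0p by (intro nn_integral_cong_AE) (auto elim!: eventually_mono)
    then show "(\<integral>\<^sup>+u. ennreal (p u) \<partial>\<mu>) < \<infinity>" by (simp add: f0_int \<nu>.emeasure_eq_measure)
  qed (simp add: p0)
  from borel_measurable_implies_sequence_metric[OF pm, of 0] obtain P where
    P: "\<And>i. simple_function borel (P i)" and P_lim: "\<And>u. (\<lambda>i. P i u) \<longlonglongrightarrow> p u"
    and P_le: "\<And>i u. \<bar>P i u\<bar> \<le> 2 * \<bar>p u\<bar>" by (auto simp: dist_norm)
  have Pm: "P i \<in> borel_measurable borel" for i by (rule borel_measurable_simple_function[OF P])
  define mass where "mass i = (LINT u|\<mu>. \<bar>P i u - p u\<bar>)" for i
  have iP: "integrable \<mu> (\<lambda>u. P i u - p u)" for i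
  proof (rule Bochner_Integration.integrable_bound)
    show "integrable \<mu> (\<lambda>u. 3 * p u)" using ip by simp
    show "(\<lambda>u. P i u - p u) \<in> borel_measurable \<mu>" using Pm pm by (intro on_\<mu>) measurable
    show "AE u in \<mu>. norm (P i u - p u) \<le> norm (3 * p u)"
    proof (rule AE_I2)
      fix u
      have "\<bar>P i u - p u\<bar> \<le> \<bar>P i u\<bar> + \<bar>p u\<bar>" by (rule abs_triangle_ineq4)
      then show "norm (P i u - p u) \<le> norm (3 * p u)" using P_le[of i u] by (simp add: abs_mult)
    qed
  qed
  have mass_lim: "mass \<longlonglongrightarrow> 0"
  proof -
    have "(\<lambda>i. LINT u|\<mu>. \<bar>P i u - p u\<bar>) \<longlonglongrightarrow> (LINT u|\<mu>. 0)"
    proof (rule integral_dominated_convergence[where w = "\<lambda>u. 3 * p u"])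
      show "AE u in \<mu>. (\<lambda>i. \<bar>P i u - p u\<bar>) \<longlonglongrightarrow> 0"
      proof (rule AE_I2)
        fix u
        have "(\<lambda>i. \<bar>P i u - p u\<bar>) \<longlonglongrightarrow> \<bar>p u - p u\<bar>" by (intro tendsto_intros P_lim)
        then show "(\<lambda>i. \<bar>P i u - p u\<bar>) \<longlonglongrightarrow> 0" by simp
      qed
      show "AE u in \<mu>. norm \<bar>P i u - p u\<bar> \<le> 3 * p u" for i
      proof (rule AE_I2)
        fix u
        have "\<bar>P i u - p u\<bar> \<le> \<bar>P i u\<bar> + \<bar>p u\<bar>" by (rule abs_triangle_ineq4)
        then show "norm \<bar>P i u - p u\<bar> \<le> 3 * p u" using P_le[of i u] p0[of u] by simp
      qed
      show "(\<lambda>u. \<bar>P i u - p u\<bar>) \<in> borel_measurable \<mu>" for i using Pm pm by (intro on_\<mu>) measurable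
    qed (use ip in simp_all)
    then show ?thesis by (simp add: mass_def[abs_def])
  qed
  have mass0: "0 \<le> mass i" for i unfolding mass_def by (rule integral_nonneg_AE) simp
  obtain K where K: "modular b \<rho> g = ennreal K" "0 \<le> K" using fin by (cases "modular b \<rho> g") auto
  have "(\<lambda>i. max 1 (mass i) * (K * mass i)) \<longlonglongrightarrow> max 1 0 * (K * 0)" by (intro tendsto_intros mass_lim)
  then have "(\<lambda>i. max 1 (mass i) * (K * mass i)) \<longlonglongrightarrow> 0" by simp
  from order_tendstoD(2)[OF this \<delta>] obtain i where i: "max 1 (mass i) * (K * mass i) < \<delta>"
    by (auto simp: eventually_sequentially)
  \<comment> \<open>Total variation of the signed measure with density \<open>P i - p\<close>. The
    sign goes into the kernel \<open>H\<close>, where it does not increase the modular, so that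
    \<open>modular_mix\<close> for nonnegative measures applies.\<close>
  define \<eta> where "\<eta> = density \<mu> (\<lambda>u. ennreal \<bar>P i u - p u\<bar>)"
  have \<eta>m: "(\<lambda>u. ennreal \<bar>P i u - p u\<bar>) \<in> borel_measurable \<mu>" using Pm pm by (intro on_\<mu>) measurable
  have \<eta>e: "emeasure \<eta> (space \<eta>) = ennreal (mass i)"
  proof -
    have "emeasure \<eta> (space \<eta>) = (\<integral>\<^sup>+u. ennreal \<bar>P i u - p u\<bar> \<partial>\<mu>)"
      unfolding \<eta>_def using \<eta>m by (subst emeasure_density) (auto intro!: nn_integral_cong)
    also have "\<dots> = ennreal (mass i)"
      unfolding mass_def using iP[of i] by (intro nn_integral_eq_integral integrable_abs) auto
    finally show ?thesis .
  qed
  have \<eta>: "finite_measure \<eta>" by (rule finite_measureI) (simp add: \<eta>e)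
  have \<eta>s: "sets \<eta> = sets borel" by (simp add: \<eta>_def sets_\<mu>)
  have \<eta>r: "measure \<eta> (space \<eta>) = mass i" using \<eta>e mass0 by (simp add: measure_def)
  define H where "H u s = sgn (P i u - p u) * g (u - s)" for u s
  have Hm: "case_prod H \<in> borel_measurable (\<eta> \<Otimes>\<^sub>M borel)"
  proof -
    have [measurable]: "(\<lambda>u. sgn (P i u - p u)) \<in> borel_measurable \<eta>"
      unfolding measurable_cong_sets[OF \<eta>s refl] using Pm pm by measurable
    have [measurable]: "(\<lambda>(u, s). g (u - s)) \<in> borel_measurable (\<eta> \<Otimes>\<^sub>M borel)"
      by (rule borel_measurable_shift_pair[OF \<eta>s _ gm]) simp
    have "(\<lambda>x. sgn (P i (fst x) - p (fst x)) * (\<lambda>(u, s). g (u - s)) x) \<in> borel_measurable (\<eta> \<Otimes>\<^sub>M borel)"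
      by measurable
    then show ?thesis by (simp add: H_def case_prod_beta')
  qed
  define Y where "Y = range (P i)"
  have Y: "finite Y" unfolding Y_def using simple_functionD(1)[OF P[of i]] by simp
  have Ys: "P i -` {y} \<in> sets borel" for y using simple_functionD(2)[OF P[of i], of "{y}"] by simp
  have step: "P i u = (\<Sum>y\<in>Y. y * indicator (P i -` {y}) u)" for u
  proof -
    have "(\<Sum>y\<in>Y. y * indicator (P i -` {y}) u) = (\<Sum>y\<in>{P i u}. y * indicator (P i -` {y}) u)"
      by (rule sum.mono_neutral_right) (use Y in \<open>auto simp: Y_def\<close>)
    then show ?thesis by simp
  qed
  have "AE s in lborel. (\<Sum>y\<in>Y. y * smear (restr_measure \<mu> (P i -` {y})) g s) - smear \<nu> g s = (LINT u|\<eta>. H u s)"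
    using AE_integrable_shift[OF \<nu> int] AE_integrable_shift[OF \<mu> sets_\<mu> int]
  proof eventually_elim
    case (elim s)
    have gs: "(\<lambda>u. g (u - s)) \<in> borel_measurable \<mu>" by (rule on_\<mu>[OF shift(1)])
    have i1: "integrable \<mu> (\<lambda>u. p u * g (u - s))"
      using elim(1) unfolding \<nu>p integrable_density[OF gs on_\<mu>[OF pm] AE_I2[OF p0]] by simp
    have e1: "smear \<nu> g s = (LINT u|\<mu>. p u * g (u - s))"
      unfolding smear_def \<nu>p integral_density[OF gs on_\<mu>[OF pm] AE_I2[OF p0]] by simp
    have iy: "integrable \<mu> (\<lambda>u. y * indicator (P i -` {y}) u * g (u - s))" for y
    proof (rule Bochner_Integration.integrable_bound)
      show "integrable \<mu> (\<lambda>u. y * g (u - s))" using elim(2) by simp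
      show "(\<lambda>u. y * indicator (P i -` {y}) u * g (u - s)) \<in> borel_measurable \<mu>"
        using Pm borel_measurable_indicator[OF Ys] shift by (intro on_\<mu>) measurable
    qed (simp add: indicator_def)
    have ey: "y * smear (restr_measure \<mu> (P i -` {y})) g s = (LINT u|\<mu>. y * indicator (P i -` {y}) u * g (u - s))" for y
    proof -
      have "smear (restr_measure \<mu> (P i -` {y})) g s = (LINT u|\<mu>. indicator (P i -` {y}) u *\<^sub>R g (u - s))"
        unfolding smear_def by (subst integral_restr_measure) (use Ys sets_\<mu> gs in \<open>simp_all add: set_lebesgue_integral_def\<close>)
      then show ?thesis by (simp add: mult.assoc)
    qed
    have "(\<Sum>y\<in>Y. y * smear (restr_measure \<mu> (P i -` {y})) g s) = (LINT u|\<mu>. (\<Sum>y\<in>Y. y * indicator (P i -` {y}) u * g (u - s)))"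
      unfolding ey by (rule Bochner_Integration.integral_sum[OF iy, symmetric])
    also have "\<dots> = (LINT u|\<mu>. P i u * g (u - s))" unfolding sum_distrib_right[symmetric] step[symmetric] ..
    finally have e2: "(\<Sum>y\<in>Y. y * smear (restr_measure \<mu> (P i -` {y})) g s) = (LINT u|\<mu>. P i u * g (u - s))" .
    have "integrable \<mu> (\<lambda>u. (\<Sum>y\<in>Y. y * indicator (P i -` {y}) u * g (u - s)))"
      by (rule Bochner_Integration.integrable_sum[OF iy])
    then have i2: "integrable \<mu> (\<lambda>u. P i u * g (u - s))" unfolding sum_distrib_right[symmetric] step[symmetric] .
    have "(LINT u|\<eta>. H u s) = (LINT u|\<mu>. \<bar>P i u - p u\<bar> *\<^sub>R H u s)"
      unfolding \<eta>_def
    proof (rule integral_density)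
      show "(\<lambda>u. H u s) \<in> borel_measurable \<mu>" unfolding H_def using Pm pm shift by (intro on_\<mu>) measurable
      show "(\<lambda>u. \<bar>P i u - p u\<bar>) \<in> borel_measurable \<mu>" using Pm pm by (intro on_\<mu>) measurable
    qed simp
    also have "\<dots> = (LINT u|\<mu>. P i u * g (u - s) - p u * g (u - s))"
    proof (rule Bochner_Integration.integral_cong[OF refl])
      fix u
      have "\<bar>P i u - p u\<bar> * sgn (P i u - p u) = P i u - p u" by (rule abs_mult_sgn)
      then show "\<bar>P i u - p u\<bar> *\<^sub>R H u s = P i u * g (u - s) - p u * g (u - s)"
        by (simp add: H_def left_diff_distrib mult.assoc[symmetric])
    qed
    also have "\<dots> = (LINT u|\<mu>. P i u * g (u - s)) - (LINT u|\<mu>. p u * g (u - s))"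
      by (rule Bochner_Integration.integral_diff[OF i2 i1])
    finally show ?case unfolding e1 e2 by simp
  qed
  then have "modular b \<rho> (\<lambda>s. (\<Sum>y\<in>Y. y * smear (restr_measure \<mu> (P i -` {y})) g s) - smear \<nu> g s) =
      modular b \<rho> (\<lambda>s. LINT u|\<eta>. H u s)"
    unfolding modular_def by (intro nn_integral_cong_AE) (auto elim!: eventually_mono)
  also have "\<dots> \<le> ennreal (max 1 (mass i)) * (\<integral>\<^sup>+u. modular b \<rho> (H u) \<partial>\<eta>)"
    using modular_mix[OF jm \<eta> Hm, of b] unfolding \<eta>r .
  also have "\<dots> \<le> ennreal (max 1 (mass i)) * (\<integral>\<^sup>+u. modular b \<rho> g \<partial>\<eta>)"
  proof (intro mult_left_mono nn_integral_mono)
    fix u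
    have "modular b \<rho> (H u) \<le> modular b \<rho> (\<lambda>s. g (u - s))"
      by (rule modular_mono[OF jm]) (simp add: H_def abs_mult abs_sgn_eq)
    then show "modular b \<rho> (H u) \<le> modular b \<rho> g" unfolding modular_reflect[OF jm gm] .
  qed simp
  also have "\<dots> = ennreal (max 1 (mass i)) * (ennreal K * ennreal (mass i))" by (simp add: \<eta>e K)
  also have "\<dots> = ennreal (max 1 (mass i) * (K * mass i))"
    using K mass0[of i] by (simp add: ennreal_mult)
  also have "\<dots> \<le> ennreal \<delta>" using i by (intro ennreal_leI) simp
  finally show "\<exists>(Y :: real set) \<phi> \<beta>. finite Y \<and> \<phi> ` Y \<subseteq> sets borel \<and>
      modular b \<rho> (\<lambda>s. (\<Sum>y\<in>Y. \<beta> y * smear (restr_measure \<mu> (\<phi> y)) g s) - smear (cball_measure r) g s) \<le> ennreal \<delta>"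
    using Y Ys unfolding \<nu>_def
    by (intro exI[of _ Y] exI[of _ "\<lambda>y. P i -` {y}"] exI[of _ "\<lambda>y. y"]) auto
qed

section \<open>The three fields\<close>

lemma modular_sum_tendsto_0:
  fixes f :: "nat \<Rightarrow> 'j \<Rightarrow> 'd::euclidean_space \<Rightarrow> real"
  assumes jm: "jump_measure \<rho>" and "finite J" and "\<And>n j. j \<in> J \<Longrightarrow> f n j \<in> borel_measurable borel"
    and "\<And>j. j \<in> J \<Longrightarrow> (\<lambda>n. modular b \<rho> (f n j)) \<longlonglongrightarrow> 0"
  shows "(\<lambda>n. modular b \<rho> (\<lambda>s. \<Sum>j\<in>J. \<theta> j * f n j s)) \<longlonglongrightarrow> 0"
  using assms(2-)
proof (induction J rule: finite_induct)
  case empty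
  then show ?case by (simp add: modular_0[OF jm])
next
  case (insert i J)
  have m: "f n j \<in> borel_measurable borel" if "j \<in> insert i J" for n j using insert.prems(1) that by blast
  have mi: "(\<lambda>s. \<theta> i * f n i s) \<in> borel_measurable borel" for n
    using m[of i n] by measurable
  have mJ: "(\<lambda>s. \<Sum>j\<in>J. \<theta> j * f n j s) \<in> borel_measurable borel" for n
    using m[of _ n] by measurable
  have "(\<lambda>n. ennreal (max 1 ((\<theta> i)\<^sup>2)) * modular b \<rho> (f n i)) \<longlonglongrightarrow> ennreal (max 1 ((\<theta> i)\<^sup>2)) * 0"
    by (rule ennreal_tendsto_cmult) (use insert.prems(2) in simp_all)
  then have "(\<lambda>n. ennreal (max 1 ((\<theta> i)\<^sup>2)) * modular b \<rho> (f n i)) \<longlonglongrightarrow> 0" by simp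
  moreover have "(\<lambda>n. modular b \<rho> (\<lambda>s. \<Sum>j\<in>J. \<theta> j * f n j s)) \<longlonglongrightarrow> 0"
    by (rule insert.IH) (use insert.prems in blast)+
  ultimately have "(\<lambda>n. ennreal (max 1 ((\<theta> i)\<^sup>2)) * modular b \<rho> (f n i) + modular b \<rho> (\<lambda>s. \<Sum>j\<in>J. \<theta> j * f n j s)) \<longlonglongrightarrow> 0 + 0"
    by (rule tendsto_add)
  then have "(\<lambda>n. 2 * (ennreal (max 1 ((\<theta> i)\<^sup>2)) * modular b \<rho> (f n i) + modular b \<rho> (\<lambda>s. \<Sum>j\<in>J. \<theta> j * f n j s))) \<longlonglongrightarrow> 2 * (0 + 0)"
    by (rule ennreal_tendsto_cmult[rotated]) simp
  then have lim: "(\<lambda>n. 2 * (ennreal (max 1 ((\<theta> i)\<^sup>2)) * modular b \<rho> (f n i) + modular b \<rho> (\<lambda>s. \<Sum>j\<in>J. \<theta> j * f n j s))) \<longlonglongrightarrow> 0" by simp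
  have "modular b \<rho> (\<lambda>s. \<Sum>j\<in>insert i J. \<theta> j * f n j s) \<le>
      2 * (ennreal (max 1 ((\<theta> i)\<^sup>2)) * modular b \<rho> (f n i) + modular b \<rho> (\<lambda>s. \<Sum>j\<in>J. \<theta> j * f n j s))" for n
  proof -
    have "modular b \<rho> (\<lambda>s. \<theta> i * f n i s + (\<Sum>j\<in>J. \<theta> j * f n j s)) \<le>
        2 * (modular b \<rho> (\<lambda>s. \<theta> i * f n i s) + modular b \<rho> (\<lambda>s. \<Sum>j\<in>J. \<theta> j * f n j s))"
      by (rule modular_add[OF jm mi mJ])
    also have "\<dots> \<le> 2 * (ennreal (max 1 ((\<theta> i)\<^sup>2)) * modular b \<rho> (f n i) + modular b \<rho> (\<lambda>s. \<Sum>j\<in>J. \<theta> j * f n j s))"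
      by (intro mult_left_mono add_right_mono modular_scale[OF jm m]) simp_all
    finally show ?thesis using insert.hyps by simp
  qed
  then show ?case by (intro tendsto_sandwich[OF _ _ tendsto_const lim]) (auto intro: always_eventually)
qed

locale moving_average = centered_levy_basis M L \<gamma> b \<rho>
  for M :: "'a measure" and L :: "'d::euclidean_space set \<Rightarrow> 'a \<Rightarrow> real" and \<gamma> b \<rho> +
  fixes g :: "'d \<Rightarrow> real" and X :: "'d \<Rightarrow> 'a \<Rightarrow> real"
  assumes g_int: "integrable lborel g" and g_fin: "modular b \<rho> g < \<infinity>"
    and X_joint: "(\<lambda>(u, \<omega>). X u \<omega>) \<in> borel_measurable (lborel \<Otimes>\<^sub>M M)"
    and X_levy: "\<And>u. levy_integral M L (\<lambda>s. g (u - s)) (X u)"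
begin

lemma g_measurable: "g \<in> borel_measurable borel"
  using g_int by auto

lemma g_shift: "(\<lambda>s. g (u - s)) \<in> borel_measurable borel"
  using g_measurable by measurable

lemma g_shift_fin: "modular b \<rho> (\<lambda>s. g (u - s)) < \<infinity>"
  unfolding modular_reflect[OF jm g_measurable] by (rule g_fin)

lemma X_measurable: "X u \<in> borel_measurable M"
  by (rule levy_integral_measurable[OF X_levy])

lemma X_fd_char:
  assumes "finite J"
  shows "(CLINT \<omega>|M. iexp (\<Sum>u\<in>J. \<theta> u * X u \<omega>)) = exp (expo b \<rho> (\<lambda>s. \<Sum>u\<in>J. \<theta> u * g (u - s)))"
  by (rule levy_integral_fd_char[OF assms X_levy g_shift g_shift_fin])

text \<open>The difference of two values is the integral of a difference of translates, of small
  modular by \<open>translation_continuous\<close>; \<open>moment_expo\<close> turns small modular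
  into small first moment. This L^1 continuity takes the place of path regularity of
  \<open>X\<close>.\<close>

lemma X_diff_tendsto:
  assumes v: "v \<longlonglongrightarrow> u"
  shows "(\<lambda>i. \<integral>\<^sup>+\<omega>. ennreal \<bar>X (v i) \<omega> - X u \<omega>\<bar> \<partial>M) \<longlonglongrightarrow> 0"
proof (rule order_tendstoI)
  fix a :: ennreal assume "0 < a"
  then have "\<exists>e>0. ennreal e \<le> a" by (cases a) (auto intro: exI[of _ 1])
  then obtain e where e: "0 < e" "ennreal e \<le> a" by blast
  define h where "h i s = g (v i - s) + (-1) * g (u - s)" for i s
  define Y where "Y i \<omega> = X (v i) \<omega> + (-1) * X u \<omega>" for i \<omega>
  have Yl: "levy_integral M L (h i) (Y i)" for i
    unfolding h_def[abs_def] Y_def[abs_def] by (rule levy_integral_add_scaled[OF X_levy X_levy])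
  have hm: "h i \<in> borel_measurable borel" for i unfolding h_def using g_shift by measurable
  have h_lim: "(\<lambda>i. modular b \<rho> (h i)) \<longlonglongrightarrow> 0"
    using translation_continuous[OF jm g_measurable g_fin v] by (simp add: h_def[abs_def])
  have h_fin: "modular b \<rho> (h i) < \<infinity>" for i
    unfolding h_def[abs_def]
    by (intro modular_add_finite[OF jm] modular_scale_finite[OF jm] g_shift g_shift_fin) (use g_shift in measurable)
  define \<kappa> where "\<kappa> i = enn2real (modular b \<rho> (h i))" for i
  have \<kappa>: "\<kappa> \<longlonglongrightarrow> 0" unfolding \<kappa>_def[abs_def] by (rule tendsto_enn2real) (use h_lim in simp_all)
  \<comment> \<open>The limiting bound 8 / T is then at most e / 2.\<close>
  define T where "T = max 1 (16 / e)"
  have T: "1 \<le> T" by (simp add: T_def)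
  have "16 / e \<le> T" by (simp add: T_def)
  then have "16 \<le> T * e" using e by (simp add: pos_divide_le_eq)
  then have Te: "4 * (2 / T) < e" using T e by (simp add: pos_divide_less_eq mult.commute)
  have "(\<lambda>i. 4 * (2 / T + (T + 6) * \<kappa> i + 8 * T\<^sup>2 * (\<kappa> i)\<^sup>2 * T)) \<longlonglongrightarrow> 4 * (2 / T + (T + 6) * 0 + 8 * T\<^sup>2 * 0\<^sup>2 * T)"
    by (intro tendsto_intros \<kappa>)
  then have "(\<lambda>i. 4 * (2 / T + (T + 6) * \<kappa> i + 8 * T\<^sup>2 * (\<kappa> i)\<^sup>2 * T)) \<longlonglongrightarrow> 4 * (2 / T)" by simp
  from order_tendstoD(2)[OF this Te]
  show "\<forall>\<^sub>F i in sequentially. (\<integral>\<^sup>+\<omega>. ennreal \<bar>X (v i) \<omega> - X u \<omega>\<bar> \<partial>M) < a"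
  proof eventually_elim
    case (elim i)
    have "(\<integral>\<^sup>+\<omega>. ennreal \<bar>Y i \<omega>\<bar> \<partial>M) \<le> ennreal (4 * (2 / T + (T + 6) * \<kappa> i + 8 * T\<^sup>2 * (\<kappa> i)\<^sup>2 * T))"
      unfolding \<kappa>_def
      by (rule moment_expo[OF jm prob_space_axioms levy_integral_measurable[OF Yl] hm h_fin T levy_integral_char[OF Yl hm h_fin]])
    also have "\<dots> < ennreal e" using elim e by (intro ennreal_lessI) auto
    finally show ?case using e(2) by (simp add: Y_def order.strict_trans2)
  qed
qed simp

text \<open>The modular of a translate does not depend on the translation, so
  \<open>moment_expo\<close> with T = 1 is uniform in u.\<close>

lemma X_L1_bound: "\<exists>C. \<forall>u. (\<integral>\<^sup>+\<omega>. ennreal \<bar>X u \<omega>\<bar> \<partial>M) \<le> ennreal C"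
proof (intro exI allI)
  fix u
  show "(\<integral>\<^sup>+\<omega>. ennreal \<bar>X u \<omega>\<bar> \<partial>M) \<le> ennreal (4 * (2 / 1 + (1 + 6) * enn2real (modular b \<rho> g) +
      8 * 1\<^sup>2 * (enn2real (modular b \<rho> g))\<^sup>2 * 1))"
    using moment_expo[OF jm prob_space_axioms X_measurable g_shift g_shift_fin order.refl
      levy_integral_char[OF X_levy g_shift g_shift_fin], of u]
    unfolding modular_reflect[OF jm g_measurable] .
qed

lemma X_integrable: "integrable M (X u)"
proof -
  obtain C where "(\<integral>\<^sup>+\<omega>. ennreal \<bar>X u \<omega>\<bar> \<partial>M) \<le> ennreal C" using X_L1_bound by blast
  then have "(\<integral>\<^sup>+\<omega>. ennreal \<bar>X u \<omega>\<bar> \<partial>M) < \<infinity>" by (rule order.strict_trans1) simp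
  then show ?thesis using X_measurable by (simp add: integrable_iff_bounded)
qed

context
  fixes \<nu> :: "'d measure"
  assumes \<nu>: "finite_measure \<nu>" and sets_\<nu>: "sets \<nu> = sets borel"
begin

interpretation \<nu>: finite_measure \<nu> by (rule \<nu>)
interpretation P: pair_sigma_finite \<nu> M ..

lemma X_pair:
  assumes F: "F \<in> measurable borel borel"
  shows "(\<lambda>(u, \<omega>). X (F u) \<omega>) \<in> borel_measurable (\<nu> \<Otimes>\<^sub>M M)"
proof -
  have [measurable]: "F \<in> measurable \<nu> lborel"
    unfolding measurable_cong_sets[OF sets_\<nu> sets_lborel] by (rule F)
  have "(\<lambda>x. (F (fst x), snd x)) \<in> measurable (\<nu> \<Otimes>\<^sub>M M) (lborel \<Otimes>\<^sub>M M)" by measurable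
  from measurable_compose[OF this X_joint] show ?thesis by (simp add: case_prod_beta')
qed

lemma X_pair_integrable: "integrable (\<nu> \<Otimes>\<^sub>M M) (\<lambda>(u, \<omega>). X u \<omega>)"
proof (rule integrableI_bounded)
  have m: "(\<lambda>(u, \<omega>). X u \<omega>) \<in> borel_measurable (\<nu> \<Otimes>\<^sub>M M)" by (rule X_pair) simp
  then show "(\<lambda>(u, \<omega>). X u \<omega>) \<in> borel_measurable (\<nu> \<Otimes>\<^sub>M M)" .
  obtain C where C: "\<And>u. (\<integral>\<^sup>+\<omega>. ennreal \<bar>X u \<omega>\<bar> \<partial>M) \<le> ennreal C" using X_L1_bound by blast
  have "(\<lambda>x. ennreal \<bar>X (fst x) (snd x)\<bar>) \<in> borel_measurable (\<nu> \<Otimes>\<^sub>M M)"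
    using m by (simp add: case_prod_beta')
  from nn_integral_fst[OF this]
  have "(\<integral>\<^sup>+x. ennreal (norm ((\<lambda>(u, \<omega>). X u \<omega>) x)) \<partial>(\<nu> \<Otimes>\<^sub>M M)) = (\<integral>\<^sup>+u. (\<integral>\<^sup>+\<omega>. ennreal \<bar>X u \<omega>\<bar> \<partial>M) \<partial>\<nu>)"
    by (simp add: case_prod_beta')
  also have "\<dots> \<le> (\<integral>\<^sup>+u. ennreal C \<partial>\<nu>)" by (intro nn_integral_mono C)
  also have "\<dots> < \<infinity>" by (simp add: ennreal_mult_less_top \<nu>.emeasure_eq_measure)
  finally show "(\<integral>\<^sup>+x. ennreal (norm ((\<lambda>(u, \<omega>). X u \<omega>) x)) \<partial>(\<nu> \<Otimes>\<^sub>M M)) < \<infinity>" .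
qed

lemma X_smear_integrable: "integrable M (\<lambda>\<omega>. LINT u|\<nu>. X u \<omega>)"
  by (rule P.integrable_snd[OF X_pair_integrable])

text \<open>The same Riemann sums as in \<open>smear_approx\<close>, now for the field itself: L^1
  continuity of \<open>X\<close> and its uniform moment bound make the double integral converge, and
  Fubini passes to the pathwise integrals, which exist for almost every \<omega>.\<close>

lemma X_smear_approx:
  assumes F: "\<And>i. simple_function borel (F i)" and F_lim: "\<And>u. (\<lambda>i. F i u) \<longlonglongrightarrow> u"
  shows "(\<lambda>i. LINT \<omega>|M. \<bar>(\<Sum>y\<in>range (F i). measure \<nu> (F i -` {y}) * X y \<omega>) - (LINT u|\<nu>. X u \<omega>)\<bar>) \<longlonglongrightarrow> 0"
proof -
  obtain C where C: "\<And>u. (\<integral>\<^sup>+\<omega>. ennreal \<bar>X u \<omega>\<bar> \<partial>M) \<le> ennreal C" using X_L1_bound by blast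
  have Fm: "F i \<in> measurable borel borel" for i using borel_measurable_simple_function[OF F] .
  define D where "D i x = ennreal \<bar>X (F i (fst x)) (snd x) - X (fst x) (snd x)\<bar>" for i x
  have Dm: "D i \<in> borel_measurable (\<nu> \<Otimes>\<^sub>M M)" for i
  proof -
    have "(\<lambda>x. X (F i (fst x)) (snd x)) \<in> borel_measurable (\<nu> \<Otimes>\<^sub>M M)" "(\<lambda>x. X (fst x) (snd x)) \<in> borel_measurable (\<nu> \<Otimes>\<^sub>M M)"
      using X_pair[OF Fm[of i]] X_pair[of "\<lambda>u. u"] by (simp_all add: case_prod_beta')
    then show ?thesis unfolding D_def[abs_def] by measurable
  qed
  have D_le: "(\<integral>\<^sup>+\<omega>. D i (u, \<omega>) \<partial>M) \<le> ennreal C + ennreal C" for i u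
  proof -
    have "(\<integral>\<^sup>+\<omega>. D i (u, \<omega>) \<partial>M) \<le> (\<integral>\<^sup>+\<omega>. ennreal \<bar>X (F i u) \<omega>\<bar> + ennreal \<bar>X u \<omega>\<bar> \<partial>M)"
    proof (rule nn_integral_mono)
      fix \<omega>
      have "D i (u, \<omega>) \<le> ennreal (\<bar>X (F i u) \<omega>\<bar> + \<bar>X u \<omega>\<bar>)"
        unfolding D_def fst_conv snd_conv by (intro ennreal_leI abs_triangle_ineq4)
      then show "D i (u, \<omega>) \<le> ennreal \<bar>X (F i u) \<omega>\<bar> + ennreal \<bar>X u \<omega>\<bar>" by simp
    qed
    also have "\<dots> = (\<integral>\<^sup>+\<omega>. ennreal \<bar>X (F i u) \<omega>\<bar> \<partial>M) + (\<integral>\<^sup>+\<omega>. ennreal \<bar>X u \<omega>\<bar> \<partial>M)"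
      by (intro nn_integral_add measurable_compose[OF X_measurable, where g = "\<lambda>y. ennreal \<bar>y\<bar>"]) simp_all
    finally show ?thesis using add_mono[OF C C] by (rule order_trans)
  qed
  have "(\<lambda>i. \<integral>\<^sup>+u. (\<integral>\<^sup>+\<omega>. D i (u, \<omega>) \<partial>M) \<partial>\<nu>) \<longlonglongrightarrow> (\<integral>\<^sup>+u. 0 \<partial>\<nu>)"
  proof (rule nn_integral_dominated_convergence[where w = "\<lambda>_. ennreal C + ennreal C"])
    show "(\<lambda>u. \<integral>\<^sup>+\<omega>. D i (u, \<omega>) \<partial>M) \<in> borel_measurable \<nu>" for i
      by (rule borel_measurable_nn_integral_fst[OF Dm])
    show "(\<integral>\<^sup>+u. ennreal C + ennreal C \<partial>\<nu>) < \<infinity>"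
      by (simp add: ennreal_mult_less_top \<nu>.emeasure_eq_measure)
    show "AE u in \<nu>. (\<lambda>i. \<integral>\<^sup>+\<omega>. D i (u, \<omega>) \<partial>M) \<longlonglongrightarrow> 0"
      unfolding D_def fst_conv snd_conv by (intro AE_I2 X_diff_tendsto F_lim)
  qed (use D_le in auto)
  then have lim: "(\<lambda>i. \<integral>\<^sup>+u. (\<integral>\<^sup>+\<omega>. D i (u, \<omega>) \<partial>M) \<partial>\<nu>) \<longlonglongrightarrow> 0" by simp
  define Z where "Z i \<omega> = \<bar>(\<Sum>y\<in>range (F i). measure \<nu> (F i -` {y}) * X y \<omega>) - (LINT u|\<nu>. X u \<omega>)\<bar>" for i \<omega>
  have Zi: "integrable M (Z i)" for i
    unfolding Z_def[abs_def]
    by (intro integrable_abs Bochner_Integration.integrable_diff Bochner_Integration.integrable_sum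
        integrable_mult_right X_integrable X_smear_integrable)
  have Z_le: "(\<integral>\<^sup>+\<omega>. ennreal (Z i \<omega>) \<partial>M) \<le> (\<integral>\<^sup>+u. (\<integral>\<^sup>+\<omega>. D i (u, \<omega>) \<partial>M) \<partial>\<nu>)" for i
  proof -
    have "AE \<omega> in M. integrable \<nu> (\<lambda>u. X u \<omega>)" by (rule P.AE_integrable_snd[OF X_pair_integrable])
    then have "AE \<omega> in M. ennreal (Z i \<omega>) \<le> (\<integral>\<^sup>+u. D i (u, \<omega>) \<partial>\<nu>)"
    proof eventually_elim
      case (elim \<omega>)
      note FX = integral_simple_compose[OF \<nu> sets_\<nu> F, of "\<lambda>y. X y \<omega>" i]
      have d: "integrable \<nu> (\<lambda>u. X (F i u) \<omega> - X u \<omega>)" by (rule Bochner_Integration.integrable_diff[OF FX(1) elim])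
      have "Z i \<omega> = norm (LINT u|\<nu>. X (F i u) \<omega> - X u \<omega>)"
        unfolding Z_def FX(2)[symmetric] Bochner_Integration.integral_diff[OF FX(1) elim] by simp
      then have "ennreal (Z i \<omega>) \<le> (\<integral>\<^sup>+u. ennreal (norm (X (F i u) \<omega> - X u \<omega>)) \<partial>\<nu>)"
        using integral_norm_bound_ennreal[OF d] by simp
      then show ?case by (simp add: D_def)
    qed
    then have "(\<integral>\<^sup>+\<omega>. ennreal (Z i \<omega>) \<partial>M) \<le> (\<integral>\<^sup>+\<omega>. (\<integral>\<^sup>+u. D i (u, \<omega>) \<partial>\<nu>) \<partial>M)" by (rule nn_integral_mono_AE)
    also have "\<dots> = (\<integral>\<^sup>+u. (\<integral>\<^sup>+\<omega>. D i (u, \<omega>) \<partial>M) \<partial>\<nu>)" by (rule P.Fubini[OF Dm])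
    finally show ?thesis .
  qed
  have "(\<lambda>i. \<integral>\<^sup>+\<omega>. ennreal (Z i \<omega>) \<partial>M) \<longlonglongrightarrow> 0"
    using Z_le by (intro tendsto_sandwich[OF _ _ tendsto_const lim]) (auto intro: always_eventually)
  then have "(\<lambda>i. enn2real (\<integral>\<^sup>+\<omega>. ennreal (Z i \<omega>) \<partial>M)) \<longlonglongrightarrow> 0" by (intro tendsto_enn2real) simp_all
  moreover have "enn2real (\<integral>\<^sup>+\<omega>. ennreal (Z i \<omega>) \<partial>M) = (LINT \<omega>|M. Z i \<omega>)" for i
    using Zi[of i] by (subst integral_eq_nn_integral) (auto simp: Z_def)
  ultimately show ?thesis by (simp add: Z_def)
qed

end

text \<open>A stochastic Fubini theorem at the level of characteristic functions: the pathwise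
  averages of \<open>X\<close> are L^1 limits of finite combinations, whose kernels converge to
  \<open>smear\<close> in the modular because the same simple maps \<open>F\<close> are used on both
  sides.\<close>

lemma smear_fd_char:
  assumes J: "finite J" and \<nu>: "\<And>j. j \<in> J \<Longrightarrow> finite_measure (\<nu> j)" and sets_\<nu>: "\<And>j. j \<in> J \<Longrightarrow> sets (\<nu> j) = sets borel"
  shows "(CLINT \<omega>|M. iexp (\<Sum>j\<in>J. \<theta> j * (LINT u|\<nu> j. X u \<omega>))) = exp (expo b \<rho> (\<lambda>s. \<Sum>j\<in>J. \<theta> j * smear (\<nu> j) g s))"
proof -
  obtain F :: "nat \<Rightarrow> 'd \<Rightarrow> 'd" where F: "\<And>i. simple_function borel (F i)" and F_lim: "\<And>u. (\<lambda>i. F i u) \<longlonglongrightarrow> u"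
    using simple_identity_sequence by blast
  define c where "c n j y = measure (\<nu> j) (F n -` {y})" for n j y
  define S where "S n j \<omega> = (\<Sum>y\<in>range (F n). c n j y * X y \<omega>)" for n j \<omega>
  define h where "h n j s = (\<Sum>y\<in>range (F n). c n j y * g (y - s))" for n j s
  have finF: "finite (range (F n))" for n using simple_functionD(1)[OF F[of n]] by simp
  have hm: "h n j \<in> borel_measurable borel" for n j unfolding h_def using g_shift by measurable
  have sm: "smear (\<nu> j) g \<in> borel_measurable borel" if "j \<in> J" for j
    by (rule smear_measurable[OF g_measurable \<nu>[OF that] sets_\<nu>[OF that]])
  have sfin: "modular b \<rho> (smear (\<nu> j) g) < \<infinity>" if "j \<in> J" for j
    by (rule smear_modular_finite[OF jm g_measurable g_fin \<nu>[OF that] sets_\<nu>[OF that]])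
  have "(\<lambda>n. CLINT \<omega>|M. iexp (\<Sum>j\<in>J. \<theta> j * S n j \<omega>)) \<longlonglongrightarrow> (CLINT \<omega>|M. iexp (\<Sum>j\<in>J. \<theta> j * (LINT u|\<nu> j. X u \<omega>)))"
  proof (rule fd_char_L1_limit[OF prob_space_axioms J])
    show "integrable M (S n j)" for n j
      unfolding S_def[abs_def] by (intro Bochner_Integration.integrable_sum integrable_mult_right X_integrable)
    show "integrable M (\<lambda>\<omega>. LINT u|\<nu> j. X u \<omega>)" if "j \<in> J" for j
      by (rule X_smear_integrable[OF \<nu>[OF that] sets_\<nu>[OF that]])
    show "(\<lambda>n. LINT \<omega>|M. \<bar>S n j \<omega> - (LINT u|\<nu> j. X u \<omega>)\<bar>) \<longlonglongrightarrow> 0" if "j \<in> J" for j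
      unfolding S_def c_def by (rule X_smear_approx[OF \<nu>[OF that] sets_\<nu>[OF that] F F_lim])
  qed
  moreover have "(CLINT \<omega>|M. iexp (\<Sum>j\<in>J. \<theta> j * S n j \<omega>)) = exp (expo b \<rho> (\<lambda>s. \<Sum>j\<in>J. \<theta> j * h n j s))" for n
  proof -
    have swap: "(\<Sum>j\<in>J. \<theta> j * (\<Sum>y\<in>range (F n). c n j y * w y)) = (\<Sum>y\<in>range (F n). (\<Sum>j\<in>J. \<theta> j * c n j y) * w y)" for w
      unfolding sum_distrib_left sum_distrib_right mult.assoc by (rule sum.swap)
    show ?thesis unfolding S_def h_def swap by (rule X_fd_char[OF finF])
  qed
  moreover have "(\<lambda>n. exp (expo b \<rho> (\<lambda>s. \<Sum>j\<in>J. \<theta> j * h n j s))) \<longlonglongrightarrow> exp (expo b \<rho> (\<lambda>s. \<Sum>j\<in>J. \<theta> j * smear (\<nu> j) g s))"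
  proof (rule tendsto_exp, rule expo_tendsto[OF jm])
    show "(\<lambda>s. \<Sum>j\<in>J. \<theta> j * smear (\<nu> j) g s) \<in> borel_measurable borel" using sm by measurable
    show "(\<lambda>s. \<Sum>j\<in>J. \<theta> j * h n j s) \<in> borel_measurable borel" for n using hm by measurable
    show "modular b \<rho> (\<lambda>s. \<Sum>j\<in>J. \<theta> j * smear (\<nu> j) g s) < \<infinity>" by (rule modular_sum_finite[OF jm J sm sfin])
    have "(\<lambda>n. modular b \<rho> (\<lambda>s. \<Sum>j\<in>J. \<theta> j * (h n j s - smear (\<nu> j) g s))) \<longlonglongrightarrow> 0"
    proof (rule modular_sum_tendsto_0[OF jm J])
      show "(\<lambda>s. h n j s - smear (\<nu> j) g s) \<in> borel_measurable borel" if "j \<in> J" for n j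
        using hm sm[OF that] by measurable
      show "(\<lambda>n. modular b \<rho> (\<lambda>s. h n j s - smear (\<nu> j) g s)) \<longlonglongrightarrow> 0" if "j \<in> J" for j
        unfolding h_def c_def by (rule smear_approx[OF jm g_measurable g_fin \<nu>[OF that] sets_\<nu>[OF that] g_int F F_lim])
    qed
    then show "(\<lambda>n. modular b \<rho> (\<lambda>s. (\<Sum>j\<in>J. \<theta> j * h n j s) - (\<Sum>j\<in>J. \<theta> j * smear (\<nu> j) g s))) \<longlonglongrightarrow> 0"
      by (simp add: right_diff_distrib sum_subtractf)
  qed
  ultimately show ?thesis using LIMSEQ_unique by force
qed

end

text \<open>The right-hand side mentions neither the field nor its kernels, so fields driven by the
  same \<open>\<rho>\<close> can be compared through it.\<close>

lemma field_in_urbanik_iff: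
  fixes f :: "'i \<Rightarrow> 'd::euclidean_space \<Rightarrow> real"
  assumes M: "prob_space M" and Y: "\<And>j. j \<in> I \<Longrightarrow> Y j \<in> borel_measurable M"
    and jm: "jump_measure \<rho>" and f: "\<And>j. j \<in> I \<Longrightarrow> f j \<in> borel_measurable borel"
    and fin: "\<And>j. j \<in> I \<Longrightarrow> modular b \<rho> (f j) < \<infinity>" and rich: "rich b \<rho> I f"
    and char: "\<And>J \<theta>. finite J \<Longrightarrow> J \<subseteq> I \<Longrightarrow>
      (CLINT \<omega>|M. iexp (\<Sum>j\<in>J. \<theta> j * Y j \<omega>)) = exp (expo b \<rho> (\<lambda>s. \<Sum>j\<in>J. \<theta> j * f j s))"
  shows "field_in_urbanik m M I Y \<longleftrightarrow> decomp_class m \<rho>"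
proof -
  define law where "law J = distr M (PiM J (\<lambda>_. borel)) (\<lambda>\<omega>. \<lambda>j\<in>J. Y j \<omega>)" for J
  have law: "fd_char J (law J) \<theta> = exp (expo b \<rho> (\<lambda>s. \<Sum>j\<in>J. \<theta> j * f j s))" if J: "finite J" "J \<subseteq> I" for J \<theta>
  proof -
    have "Y j \<in> borel_measurable M" if "j \<in> J" for j using Y J that by blast
    then have "fd_char J (law J) \<theta> = (CLINT \<omega>|M. iexp (\<Sum>j\<in>J. \<theta> j * Y j \<omega>))"
      unfolding law_def by (rule fd_char_distr[OF J(1)])
    then show ?thesis unfolding char[OF J] .
  qed
  show ?thesis
  proof
    assume U: "field_in_urbanik m M I Y"
    show "decomp_class m \<rho>"
    proof (rule decomp_class_of_urbanik[OF f jm fin rich])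
      fix J assume J: "finite J" "J \<subseteq> I"
      have "urbanik m J (law J)" using U J unfolding field_in_urbanik_def law_def by blast
      then show "\<exists>\<nu>. (\<forall>\<theta>. fd_char J \<nu> \<theta> = exp (expo b \<rho> (\<lambda>s. \<Sum>j\<in>J. \<theta> j * f j s))) \<and> urbanik m J \<nu>"
        using law[OF J] by blast
    qed
  next
    assume D: "decomp_class m \<rho>"
    show "field_in_urbanik m M I Y"
      unfolding field_in_urbanik_def law_def[symmetric]
    proof (intro allI impI)
      fix J assume "finite J \<and> J \<subseteq> I"
      then have J: "finite J" "J \<subseteq> I" by blast+
      have fJ: "f j \<in> borel_measurable borel" "modular b \<rho> (f j) < \<infinity>" "Y j \<in> borel_measurable M" if "j \<in> J" for j
        using f fin Y J that by blast+
      have p: "fd_prob J (law J)" unfolding law_def by (rule fd_prob_distr[OF M fJ(3)])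
      show "urbanik m J (law J)" by (rule urbanik_of_decomp_class[OF J(1) fJ(1) jm D fJ(2) p law[OF J]])
    qed
  qed
qed

theorem theorem5p4:
  fixes M :: "'a measure"
    and L :: "'d::euclidean_space set \<Rightarrow> 'a \<Rightarrow> real"
    and \<gamma> b :: real and \<rho> :: "real measure"
    and g :: "'d \<Rightarrow> real"
    and \<mu> :: "'d measure"
    and X :: "'d \<Rightarrow> 'a \<Rightarrow> real"
    and m :: nat
  assumes "prob_space M"
    and "homogeneous_levy_basis M L \<gamma> b \<rho>"
    and "centered M L"
    and "integrable lborel g"
    and "in_L_Phi1 \<gamma> b \<rho> g"
    and "\<forall>\<theta>. fourier g \<theta> \<noteq> 0"
    and "finite_measure \<mu>" and "sets \<mu> = sets borel"
    and "\<forall>A\<in>sets borel. emeasure \<mu> A = 0 \<longleftrightarrow> emeasure lborel A = 0"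
    and "(\<lambda>(u, \<omega>). X u \<omega>) \<in> borel_measurable (lborel \<Otimes>\<^sub>M M)"
    and "\<forall>u. levy_integral M L (\<lambda>s. g (u - s)) (X u)"
  shows "(field_in_urbanik m M (sets borel) (\<lambda>A \<omega>. LINT u:A|\<mu>. X u \<omega>)
            \<longleftrightarrow> field_in_urbanik m M UNIV X)
       \<and> (field_in_urbanik m M UNIV X \<longleftrightarrow> field_in_urbanik m M bdd_borel L)"
proof -
  note M = assms(1) and hlb = assms(2) and int = assms(4) and \<mu> = assms(7) and sets_\<mu> = assms(8)
  have gm: "g \<in> borel_measurable borel" using int by auto
  have "fourier g 0 = of_real (LINT s|lborel. g s)" by (simp add: fourier_def)
  then have c0: "(LINT s|lborel. g s) \<noteq> 0" using assms(6) by (metis of_real_0)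
  \<comment> \<open>A kernel vanishing almost everywhere would make \<open>in_L_Phi1\<close> silent
    about large jumps; a nonzero integral excludes this.\<close>
  have nz: "\<not> (AE s in lborel. g s = 0)"
  proof
    assume "AE s in lborel. g s = 0"
    then have "(LINT s|lborel. g s) = 0" by (rule integral_eq_zero_AE)
    then show False using c0 by simp
  qed
  have lm: "levy_measure \<rho>" using hlb by (simp add: homogeneous_levy_basis_def)
  note jm = jump_measure_and_modular_finite(1)[OF lm gm assms(5) nz]
    and g_fin = jump_measure_and_modular_finite(2)[OF lm gm assms(5) nz]
  interpret prob_space M by (rule M)
  interpret centered_levy_basis M L \<gamma> b \<rho>
    by unfold_locales (rule hlb, rule jm, rule lk_exponent_eq_cexp[OF jm M hlb assms(3)])
  interpret moving_average M L \<gamma> b \<rho> g X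
    by unfold_locales (rule int, rule g_fin, rule assms(10), use assms(11) in blast)
  have L: "field_in_urbanik m M bdd_borel L \<longleftrightarrow> decomp_class m \<rho>"
  proof (rule field_in_urbanik_iff[OF M _ jm _ _ rich_indicators[OF jm]])
    show "L A \<in> borel_measurable M" if "A \<in> bdd_borel" for A by (rule L_measurable[OF that])
    show "(indicator A :: 'd \<Rightarrow> real) \<in> borel_measurable borel" if "A \<in> bdd_borel" for A
      by (rule borel_measurable_indicator[OF bdd_borel_sets[OF that]])
    show "modular b \<rho> (indicator A) < \<infinity>" if "A \<in> bdd_borel" for A :: "'d set"
      by (rule modular_indicator_finite[OF that])
    show "(CLINT \<omega>|M. iexp (\<Sum>A\<in>J. \<theta> A * L A \<omega>)) = exp (expo b \<rho> (\<lambda>s. \<Sum>A\<in>J. \<theta> A * indicator A s))"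
      if "finite J" "J \<subseteq> bdd_borel" for J \<theta>
      using that by (intro L_fd_char) auto
  qed
  have X: "field_in_urbanik m M UNIV X \<longleftrightarrow> decomp_class m \<rho>"
    by (rule field_in_urbanik_iff[OF M X_measurable jm g_shift g_shift_fin rich_translates[OF jm int c0 g_fin] X_fd_char])
  have sA: "sets (restr_measure \<mu> A) = sets borel" for A using sets_\<mu> by simp
  have fA: "finite_measure (restr_measure \<mu> A)" if "A \<in> sets borel" for A
    by (rule finite_restr_measure[OF \<mu>]) (use that sets_\<mu> in simp)
  \<comment> \<open>Written against restricted measures, the averages are of the form treated by
    \<open>smear_fd_char\<close>.\<close>
  have "field_in_urbanik m M (sets borel) (\<lambda>A \<omega>. LINT u|restr_measure \<mu> A. X u \<omega>) \<longleftrightarrow> decomp_class m \<rho>"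
  proof (rule field_in_urbanik_iff[OF M _ jm])
    show "rich b \<rho> (sets borel) (\<lambda>A. smear (restr_measure \<mu> A) g)"
      by (rule rich_smears[OF jm int c0 g_fin \<mu> sets_\<mu>]) (use assms(9) in blast)
    show "(\<lambda>\<omega>. LINT u|restr_measure \<mu> A. X u \<omega>) \<in> borel_measurable M" if "A \<in> sets borel" for A
      by (rule borel_measurable_integrable[OF X_smear_integrable[OF fA[OF that] sA]])
    show "smear (restr_measure \<mu> A) g \<in> borel_measurable borel" if "A \<in> sets borel" for A
      by (rule smear_measurable[OF gm fA[OF that] sA])
    show "modular b \<rho> (smear (restr_measure \<mu> A) g) < \<infinity>" if "A \<in> sets borel" for A
      by (rule smear_modular_finite[OF jm gm g_fin fA[OF that] sA])
    show "(CLINT \<omega>|M. iexp (\<Sum>A\<in>J. \<theta> A * (LINT u|restr_measure \<mu> A. X u \<omega>))) =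
        exp (expo b \<rho> (\<lambda>s. \<Sum>A\<in>J. \<theta> A * smear (restr_measure \<mu> A) g s))"
      if "finite J" "J \<subseteq> sets borel" for J \<theta>
      using that fA sA by (intro smear_fd_char) auto
  qed
  \<comment> \<open>The two integrals agree for every \<omega> in the space, whether or not they
    exist, so both fields have the same finite-dimensional laws.\<close>
  moreover have "field_in_urbanik m M (sets borel) (\<lambda>A \<omega>. LINT u|restr_measure \<mu> A. X u \<omega>) \<longleftrightarrow>
      field_in_urbanik m M (sets borel) (\<lambda>A \<omega>. LINT u:A|\<mu>. X u \<omega>)"
  proof -
    have Xu: "(\<lambda>u. X u \<omega>) \<in> borel_measurable \<mu>" if "\<omega> \<in> space M" for \<omega>
    proof -
      have "(\<lambda>u. X u \<omega>) \<in> borel_measurable lborel"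
        using measurable_compose[OF measurable_Pair2'[OF that] assms(10)] by simp
      then show ?thesis unfolding measurable_cong_sets[OF sets_\<mu> refl] by simp
    qed
    have "distr M (PiM J (\<lambda>_. borel)) (\<lambda>\<omega>. \<lambda>A\<in>J. LINT u|restr_measure \<mu> A. X u \<omega>) =
        distr M (PiM J (\<lambda>_. borel)) (\<lambda>\<omega>. \<lambda>A\<in>J. LINT u:A|\<mu>. X u \<omega>)" if "J \<subseteq> sets borel" for J
    proof (rule distr_cong[OF refl refl], rule restrict_ext)
      fix \<omega> A assume "\<omega> \<in> space M" "A \<in> J"
      then show "(LINT u|restr_measure \<mu> A. X u \<omega>) = (LINT u:A|\<mu>. X u \<omega>)"
        using that sets_\<mu> Xu by (intro integral_restr_measure) auto
    qed
    then show ?thesis unfolding field_in_urbanik_def by auto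
  qed
  ultimately show ?thesis using L X by blast
qed

end
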